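(* Let $(X,m)$ be a measure space with $L^2(X,m)$ separable, and let $L$ be a selfadjoint operator on $L^2(X,m)$ with spectrum $\Sigma$. Let $\gamma:\mathbb{R}\to\mathbb{R}$ be continuous and bounded with $|\gamma|>0$ on $\Sigma$, and assume that the range of $\gamma(L)$ is contained in $L^\infty(X,m)$. Let $w:X\to[1,\infty)$ be a function with $w^{-1}\in L^2(X,m)$, and set $\mathcal{H}_+=\{f: f=w^{-1}g,\ g\in L^2(X,m)\}$, $\mathcal{H}_-=\{h \text{ measurable on } X: w^{-1}h\in L^2(X,m)\}$. Then there exists an expansion in generalized eigenfunctions (as defined in the context, with respect to $T=$ multiplication by $w$) such that for $\mu$-almost every $\lambda$ the basis elements $(\varphi_j(\lambda))_j$ are functions on $X$ satisfying $w^{-1}\varphi_j(\lambda)\in L^2(X,m)$ for all $j\in J$. Moreover, for every $f\in\mathcal{H}_+$: $$\langle\varphi_j(\lambda),f\rangle_d=\int_X\varphi_j(\lambda)(x)f(x)\,dm(x)$$ as an ordinary Lebesgue integral; $$f=\lim_{n\to\infty,E\to\infty}\sum_{j=1}^n\int_{M_j\cap[-E,E]}\langle\varphi_j(\lambda),f\rangle_d\,\varphi_j(\lambda)\,d\mu(\lambda);$$ and $$\int_\Sigma\sum_{j\in J}|\langle\varphi_j(\lambda),f\rangle_d|^2\,d\mu(\lambda)=\|f\|^2<\infty.$$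
   Context: For a selfadjoint $T\ge1$ on $\mathcal{H}=L^2(X,m)$ let $\mathcal{H}_+(T)=D(T)$ with inner product $\langle Tx,Ty\rangle$, $\mathcal{H}_-(T)$ the completion of $\mathcal{H}$ w.r.t. $\langle T^{-1}x,T^{-1}y\rangle$, and $\langle\cdot,\cdot\rangle_d:\mathcal{H}_-\times\mathcal{H}_+\to\mathbb{C}$ the extension of the inner product of $\mathcal{H}$ (for $T$ = multiplication by $w$ these are the spaces $\mathcal{H}_\pm$ above). A spectral measure $\mu$ of $L$ is a measure on $\mathbb{R}$ with $\mu(A)=0$ iff $1_A(L)=0$. An expansion in generalized eigenfunctions of $L$ (w.r.t. $T$) consists of a spectral measure $\mu$, a countable index set $J=\{1,\dots,N\}$ ($N=\infty$ allowed), measurable sets $M_1\supset M_2\supset\cdots$ in $\mathbb{R}$, a unitary $U=(U_j):\mathcal{H}\to\bigoplus_{j}L^2(M_j,\mu)$ with $U\Phi(L)=M_\Phi U$ for every measurable $\Phi$ ($M_\Phi$ multiplication by $\Phi$), and measurable maps $\varphi_j:M_j\to\mathcal{H}_-$ such that: (a) $U_jf(\lambda)=\langle\varphi_j(\lambda),f\rangle_d$ for $f\in\mathcal{H}_+$ and $\mu$-a.e. $\lambda\in M_j$; (b) for $g=(g_j)\in\bigoplus_jL^2(M_j,\mu)$, $U^{-1}g=\lim_{n,E\to\infty}\sum_{j=1}^n\int_{M_j\cap[-E,E]}g_j(\lambda)\varphi_j(\lambda)d\mu(\lambda)$ and for $f\in\mathcal{H}$, $f=\lim_{n,E\to\infty}\sum_{j=1}^n\int_{M_j\cap[-E,E]}(U_jf)(\lambda)\varphi_j(\lambda)d\mu(\lambda)$,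 limits in $\mathcal{H}$; (c) for $f\in D(L)\cap\mathcal{H}_+$ with $Lf\in\mathcal{H}_+$, $\langle\varphi_j(\lambda),Lf\rangle_d=\lambda\langle\varphi_j(\lambda),f\rangle_d$ for all $j$ and $\mu$-a.e. $\lambda$. Here $\varphi_j(\lambda)$ is set to $0$ for $\lambda\notin M_j$.
   Formalization: The formula for ⟨φ_j(λ),f⟩_d is stated with the complex conjugate of φ_j(λ)(x) under the integral, since without it the claim fails for complex eigenfunctions; measurability of φ_j into H_- and the integrals of g_jφ_j are understood weakly, against elements of H_+. *)

theory Defs
  imports "HOL-Analysis.Analysis"
begin

section \<open>The Hilbert space L^2(X,m), modelled by square integrable representatives\<close>

type_synonym 'a fn = "'a \<Rightarrow> complex"
type_synonym 'a op = "('a fn \<times> 'a fn) set"  \<comment> \<open>an operator = its graph\<close>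

definition L2 :: "'a measure \<Rightarrow> 'a fn set" where
  "L2 m = {f. f \<in> borel_measurable m \<and> integrable m (\<lambda>x. (cmod (f x))^2)}"

definition aeq :: "'a measure \<Rightarrow> 'a fn \<Rightarrow> 'a fn \<Rightarrow> bool" where
  "aeq m f g \<longleftrightarrow> (AE x in m. f x = g x)"

definition ip :: "'a measure \<Rightarrow> 'a fn \<Rightarrow> 'a fn \<Rightarrow> complex" where
  "ip m f g = (\<integral>x. cnj (f x) * g x \<partial>m)"

definition l2norm :: "'a measure \<Rightarrow> 'a fn \<Rightarrow> real" where
  "l2norm m f = sqrt (\<integral>x. (cmod (f x))^2 \<partial>m)"

definition dense_in_L2 :: "'a measure \<Rightarrow> 'a fn set \<Rightarrow> bool" where
  "dense_in_L2 m D \<longleftrightarrow> (\<forall>f\<in>L2 m. \<forall>e>0. \<exists>u\<in>D. l2norm m (\<lambda>x. f x - u x) < e)"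

definition separable_L2 :: "'a measure \<Rightarrow> bool" where
  "separable_L2 m \<longleftrightarrow> (\<exists>D. countable D \<and> D \<subseteq> L2 m \<and> dense_in_L2 m D)"

definition is_operator :: "'a measure \<Rightarrow> 'a op \<Rightarrow> bool" where
  "is_operator m A \<longleftrightarrow>
     A \<subseteq> L2 m \<times> L2 m \<and>
     (\<lambda>x. 0, \<lambda>x. 0) \<in> A \<and>
     (\<forall>f g f' g' (a::complex). (f,g) \<in> A \<longrightarrow> (f',g') \<in> A \<longrightarrow>
        (\<lambda>x. f x + a * f' x, \<lambda>x. g x + a * g' x) \<in> A) \<and>
     (\<forall>f g f' g'. (f,g) \<in> A \<longrightarrow> f' \<in> L2 m \<longrightarrow> g' \<in> L2 m \<longrightarrow> aeq m f f' \<longrightarrow> aeq m g g'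
        \<longrightarrow> (f',g') \<in> A) \<and>
     (\<forall>f g g'. (f,g) \<in> A \<longrightarrow> (f,g') \<in> A \<longrightarrow> aeq m g g')"

definition adjoint_op :: "'a measure \<Rightarrow> 'a op \<Rightarrow> 'a op" where
  "adjoint_op m A = {(f,g). f \<in> L2 m \<and> g \<in> L2 m \<and> (\<forall>(u,v)\<in>A. ip m f v = ip m g u)}"

definition selfadjoint :: "'a measure \<Rightarrow> 'a op \<Rightarrow> bool" where
  "selfadjoint m A \<longleftrightarrow> is_operator m A \<and> dense_in_L2 m (Domain A) \<and> A = adjoint_op m A"

definition op_zero :: "'a measure \<Rightarrow> 'a op \<Rightarrow> bool" where
  "op_zero m A \<longleftrightarrow> (\<forall>(f,g)\<in>A. aeq m g (\<lambda>x. 0))"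

definition bdd_invertible :: "'a measure \<Rightarrow> 'a op \<Rightarrow> bool" where
  "bdd_invertible m A \<longleftrightarrow> (\<forall>g\<in>L2 m. \<exists>f. (f,g) \<in> A) \<and>
     (\<exists>C. \<forall>f g. (f,g) \<in> A \<longrightarrow> l2norm m f \<le> C * l2norm m g)"

text \<open>spectrum of a selfadjoint operator (which is a subset of the reals)\<close>
definition spectrum_op :: "'a measure \<Rightarrow> 'a op \<Rightarrow> real set" where
  "spectrum_op m A =
     {t. \<not> bdd_invertible m {(f, \<lambda>x. g x - complex_of_real t * f x) | f g. (f,g) \<in> A}}"

section \<open>Borel functional calculus (via the multiplication operator form of the spectral theorem)\<close>

text \<open>(nu, V, h) is a spectral representation of A: V is a unitary from L^2(m) onto L^2(nu)
  which transforms A into multiplication by the real function h.  For separable L^2(m)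
  such a representation exists on (a measure on) nat x real.\<close>
definition spec_rep :: "'a measure \<Rightarrow> 'a op \<Rightarrow> (nat \<times> real) measure
     \<Rightarrow> ('a fn \<Rightarrow> (nat \<times> real) fn) \<Rightarrow> (nat \<times> real \<Rightarrow> real) \<Rightarrow> bool" where
  "spec_rep m A \<nu> V h \<longleftrightarrow>
     h \<in> borel_measurable \<nu> \<and>
     (\<forall>f\<in>L2 m. V f \<in> L2 \<nu>) \<and>
     (\<forall>f\<in>L2 m. \<forall>g\<in>L2 m. \<forall>a::complex.
        aeq \<nu> (V (\<lambda>x. f x + a * g x)) (\<lambda>y. V f y + a * V g y)) \<and>
     (\<forall>f\<in>L2 m. \<forall>g\<in>L2 m. aeq m f g \<longrightarrow> aeq \<nu> (V f) (V g)) \<and>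
     (\<forall>f\<in>L2 m. l2norm \<nu> (V f) = l2norm m f) \<and>
     (\<forall>k\<in>L2 \<nu>. \<exists>f\<in>L2 m. aeq \<nu> (V f) k) \<and>
     A = {(f,g). f \<in> L2 m \<and> g \<in> L2 m \<and> (\<lambda>y. complex_of_real (h y) * V f y) \<in> L2 \<nu> \<and>
                 aeq \<nu> (V g) (\<lambda>y. complex_of_real (h y) * V f y)}"

text \<open>Phi(A) for a Borel function Phi : real => complex (independent of the chosen representation)\<close>
definition fcalc :: "'a measure \<Rightarrow> 'a op \<Rightarrow> (real \<Rightarrow> complex) \<Rightarrow> 'a op" where
  "fcalc m A \<Phi> =
     (let r = (SOME r. spec_rep m A (fst r) (fst (snd r)) (snd (snd r)));
          \<nu> = fst r; V = fst (snd r); h = snd (snd r)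
      in {(f,g). f \<in> L2 m \<and> g \<in> L2 m \<and> (\<lambda>y. \<Phi> (h y) * V f y) \<in> L2 \<nu> \<and>
                 aeq \<nu> (V g) (\<lambda>y. \<Phi> (h y) * V f y)})"

definition Hplus :: "'a measure \<Rightarrow> ('a \<Rightarrow> real) \<Rightarrow> 'a fn set" where
  "Hplus m w = {f. \<exists>g\<in>L2 m. f = (\<lambda>x. g x / complex_of_real (w x))}"

definition Hminus :: "'a measure \<Rightarrow> ('a \<Rightarrow> real) \<Rightarrow> 'a fn set" where
  "Hminus m w = {h. h \<in> borel_measurable m \<and> (\<lambda>x. h x / complex_of_real (w x)) \<in> L2 m}"

text \<open>The dual pairing H_- x H_+ -> C: continuous extension of the inner product of H
  (H is dense in H_- w.r.t. the norm of w^{-1} h in L^2).\<close>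
definition dpair :: "'a measure \<Rightarrow> ('a \<Rightarrow> real) \<Rightarrow> 'a fn \<Rightarrow> 'a fn \<Rightarrow> complex" where
  "dpair m w h f = (THE c. \<forall>hs. (\<forall>n. hs n \<in> L2 m) \<and>
       (\<lambda>n. l2norm m (\<lambda>x. (hs n x - h x) / complex_of_real (w x))) \<longlonglongrightarrow> 0
       \<longrightarrow> (\<lambda>n. ip m (hs n) f) \<longlonglongrightarrow> c)"

definition Jset :: "enat \<Rightarrow> nat set" where
  "Jset N = {j. 1 \<le> j \<and> enat j \<le> N}"

definition dsnorm2 :: "real measure \<Rightarrow> nat set \<Rightarrow> (nat \<Rightarrow> real set) \<Rightarrow> (nat \<Rightarrow> real \<Rightarrow> complex)
     \<Rightarrow> ennreal" where
  "dsnorm2 \<mu> J M g =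
     (\<Sum>j. if j \<in> J then (\<integral>\<^sup>+t. indicator (M j) t * ennreal ((cmod (g j t))^2) \<partial>\<mu>) else 0)"

definition in_dsum :: "real measure \<Rightarrow> nat set \<Rightarrow> (nat \<Rightarrow> real set) \<Rightarrow> (nat \<Rightarrow> real \<Rightarrow> complex)
     \<Rightarrow> bool" where
  "in_dsum \<mu> J M g \<longleftrightarrow> (\<forall>j\<in>J. g j \<in> borel_measurable \<mu>) \<and> dsnorm2 \<mu> J M g < \<infinity>"

text \<open>h is the (weakly defined, H_- valued) integral
  sum_{j in J, j <= n} int_{M_j cap [-E,E]} g_j(t) phi_j(t) dmu(t)\<close>
definition wsum :: "'a measure \<Rightarrow> ('a \<Rightarrow> real) \<Rightarrow> real measure \<Rightarrow> nat set \<Rightarrow> (nat \<Rightarrow> real set)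
     \<Rightarrow> (nat \<Rightarrow> real \<Rightarrow> 'a fn) \<Rightarrow> (nat \<Rightarrow> real \<Rightarrow> complex) \<Rightarrow> nat \<Rightarrow> real \<Rightarrow> 'a fn \<Rightarrow> bool" where
  "wsum m w \<mu> J M \<phi> g n E h \<longleftrightarrow> h \<in> Hminus m w \<and>
     (\<forall>u\<in>Hplus m w.
        (\<forall>j\<in>J. j \<le> n \<longrightarrow> integrable \<mu>
            (\<lambda>t. (indicator (M j \<inter> {-E..E}) t :: complex) * (cnj (g j t) * dpair m w (\<phi> j t) u))) \<and>
        dpair m w h u = (\<Sum>j\<in>{j\<in>J. j \<le> n}.
            \<integral>t. (indicator (M j \<inter> {-E..E}) t :: complex) * (cnj (g j t) * dpair m w (\<phi> j t) u) \<partial>\<mu>))"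

definition exp_limit :: "'a measure \<Rightarrow> ('a \<Rightarrow> real) \<Rightarrow> real measure \<Rightarrow> nat set \<Rightarrow> (nat \<Rightarrow> real set)
     \<Rightarrow> (nat \<Rightarrow> real \<Rightarrow> 'a fn) \<Rightarrow> (nat \<Rightarrow> real \<Rightarrow> complex) \<Rightarrow> 'a fn \<Rightarrow> bool" where
  "exp_limit m w \<mu> J M \<phi> g f \<longleftrightarrow>
     (\<forall>n E. \<exists>h. wsum m w \<mu> J M \<phi> g n E h) \<and>
     (\<forall>e>0. \<exists>n0 E0. \<forall>n\<ge>n0. \<forall>E\<ge>E0. \<forall>h. wsum m w \<mu> J M \<phi> g n E h \<longrightarrow>
          h \<in> L2 m \<and> l2norm m (\<lambda>x. h x - f x) < e)"

definition spectral_measure :: "'a measure \<Rightarrow> 'a op \<Rightarrow> real measure \<Rightarrow> bool" where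
  "spectral_measure m L \<mu> \<longleftrightarrow> sets \<mu> = sets borel \<and>
     (\<forall>A\<in>sets borel. emeasure \<mu> A = 0 \<longleftrightarrow> op_zero m (fcalc m L (indicator A)))"

definition gen_eig_expansion :: "'a measure \<Rightarrow> 'a op \<Rightarrow> ('a \<Rightarrow> real) \<Rightarrow> real measure \<Rightarrow> enat
     \<Rightarrow> (nat \<Rightarrow> real set) \<Rightarrow> (nat \<Rightarrow> 'a fn \<Rightarrow> real \<Rightarrow> complex) \<Rightarrow> (nat \<Rightarrow> real \<Rightarrow> 'a fn) \<Rightarrow> bool" where
  "gen_eig_expansion m L w \<mu> N M U \<phi> \<longleftrightarrow>
     spectral_measure m L \<mu> \<and>
     \<comment> \<open>measurable decreasing sets M_1 \<supseteq> M_2 \<supseteq> ...\<close>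
     (\<forall>j\<in>Jset N. M j \<in> sets borel) \<and>
     (\<forall>j. j \<in> Jset N \<longrightarrow> Suc j \<in> Jset N \<longrightarrow> M (Suc j) \<subseteq> M j) \<and>
     \<comment> \<open>U is unitary from H onto the direct sum of the L^2(M_j, mu)\<close>
     (\<forall>f\<in>L2 m. in_dsum \<mu> (Jset N) M (\<lambda>j. U j f)) \<and>
     (\<forall>f\<in>L2 m. \<forall>g\<in>L2 m. \<forall>a::complex. \<forall>j\<in>Jset N.
        AE t in \<mu>. t \<in> M j \<longrightarrow> U j (\<lambda>x. f x + a * g x) t = U j f t + a * U j g t) \<and>
     (\<forall>f\<in>L2 m. \<forall>g\<in>L2 m. aeq m f g \<longrightarrow> (\<forall>j\<in>Jset N. AE t in \<mu>. t \<in> M j \<longrightarrow> U j f t = U j g t)) \<and>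
     (\<forall>f\<in>L2 m. dsnorm2 \<mu> (Jset N) M (\<lambda>j. U j f) = ennreal ((l2norm m f)^2)) \<and>
     (\<forall>g. in_dsum \<mu> (Jset N) M g \<longrightarrow>
        (\<exists>f\<in>L2 m. \<forall>j\<in>Jset N. AE t in \<mu>. t \<in> M j \<longrightarrow> U j f t = g j t)) \<and>
     \<comment> \<open>U Phi(L) = M_Phi U for every measurable Phi\<close>
     (\<forall>\<Phi>::real \<Rightarrow> complex. \<Phi> \<in> borel_measurable borel \<longrightarrow>
        (\<forall>f\<in>L2 m.
           (f \<in> Domain (fcalc m L \<Phi>) \<longleftrightarrow> dsnorm2 \<mu> (Jset N) M (\<lambda>j t. \<Phi> t * U j f t) < \<infinity>) \<and>
           (\<forall>g. (f,g) \<in> fcalc m L \<Phi> \<longrightarrow>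
              (\<forall>j\<in>Jset N. AE t in \<mu>. t \<in> M j \<longrightarrow> U j g t = \<Phi> t * U j f t)))) \<and>
     \<comment> \<open>phi_j : M_j -> H_- measurable, phi_j(t) = 0 outside M_j\<close>
     (\<forall>j\<in>Jset N. \<forall>t. t \<in> M j \<longrightarrow> \<phi> j t \<in> Hminus m w) \<and>
     (\<forall>j\<in>Jset N. \<forall>t. t \<notin> M j \<longrightarrow> \<phi> j t = (\<lambda>x. 0)) \<and>
     (\<forall>j\<in>Jset N. \<forall>u\<in>Hplus m w. (\<lambda>t. dpair m w (\<phi> j t) u) \<in> borel_measurable \<mu>) \<and>
     \<comment> \<open>(a)\<close>
     (\<forall>f\<in>Hplus m w. \<forall>j\<in>Jset N. AE t in \<mu>. t \<in> M j \<longrightarrow> U j f t = dpair m w (\<phi> j t) f) \<and>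
     \<comment> \<open>(b)\<close>
     (\<forall>g f. in_dsum \<mu> (Jset N) M g \<longrightarrow> f \<in> L2 m \<longrightarrow>
        (\<forall>j\<in>Jset N. AE t in \<mu>. t \<in> M j \<longrightarrow> U j f t = g j t) \<longrightarrow>
        exp_limit m w \<mu> (Jset N) M \<phi> g f) \<and>
     (\<forall>f\<in>L2 m. exp_limit m w \<mu> (Jset N) M \<phi> (\<lambda>j. U j f) f) \<and>
     \<comment> \<open>(c)\<close>
     (\<forall>f g. (f,g) \<in> L \<longrightarrow> f \<in> Hplus m w \<longrightarrow> g \<in> Hplus m w \<longrightarrow>
        (\<forall>j\<in>Jset N. AE t in \<mu>. dpair m w (\<phi> j t) g = complex_of_real t * dpair m w (\<phi> j t) f))"

end

theory Submission
  imports Defs "HOL-Probability.Probability"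
begin

text \<open>
  The Cayley transform \<open>W\<close> of \<open>L\<close> is unitary, so by Herglotz's theorem each vector \<open>g\<close> has a spectral measure
  on the circle (a weak limit of the Fejer means of \<open>n \<mapsto> \<langle>g, W\<^sup>n g\<rangle>\<close>), which does not charge the point \<open>1\<close>
  because \<open>W - 1\<close> has dense range.  An orthogonal decomposition into cyclic subspaces turns \<open>L\<close> into multiplication by \<open>t\<close>
  on a sum of spaces \<open>L\<^sup>2(d\<^sub>i \<mu>)\<close>; enumerating, for each \<open>t\<close>, the indices with \<open>d\<^sub>i(t) > 0\<close> in increasing order
  yields decreasing sets \<open>M\<^sub>1 \<supseteq> M\<^sub>2 \<supseteq> \<dots>\<close> at once, without a maximality argument.  Any two spectral representations
  give the same functional calculus, since measures on the line are determined by their Cayley moments.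

  The operator \<open>K = \<gamma>(L)\<close> maps \<open>L\<^sup>2\<close> boundedly into \<open>L\<^sup>\<infinity>\<close> by uniform boundedness, so \<open>w\<^sup>-\<^sup>1 K\<close> is Hilbert-Schmidt, and so is its
  adjoint \<open>K w\<^sup>-\<^sup>1\<close>.  For an orthonormal basis \<open>e\<^sub>n\<close> this says that \<open>\<Sum>\<^sub>n |\<gamma>(t)|\<^sup>2 |U\<^sub>j(w\<^sup>-\<^sup>1 e\<^sub>n)(t)|\<^sup>2\<close> is integrable, hence finite
  for almost every \<open>t\<close>; as \<open>\<gamma>\<close> does not vanish on the spectrum, \<open>\<phi>\<^sub>j(t) = w \<Sum>\<^sub>n cnj (U\<^sub>j(w\<^sup>-\<^sup>1 e\<^sub>n)(t)) e\<^sub>n\<close> defines the generalized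
  eigenfunctions.
\<close>

section \<open>The semi-inner product space of square integrable functions\<close>

text \<open>Vectors are square integrable functions rather than classes, so identities between
  operators hold only up to \<open>aeq\<close>, and subspaces are sets of functions closed under
  linear combination. The calculus \<open>fcalc\<close> refers to a representation picked by
  \<open>SOME\<close>; a concrete diagonalization says nothing about it until all representations
  are known to agree, and this is why uniqueness from moments is proved separately. The point 1 of
  the circle must carry no mass because it is the image of t = infinity. L itself has no smoothing
  property, only \<gamma>(L) has; summability is obtained for the transforms multiplied by \<gamma>,
  and \<gamma> is divided out at each fixed t afterwards, so it may come arbitrarily close to 0 on
  the spectrum. A bound on K f holds outside a null set that depends on f. The square function of
  the orthonormal basis is therefore controlled through countably many coefficient vectors, dense
  among all of them, before it is integrated against the square of 1/w.\<close>

lemma measurable_cnj [measurable (raw)]: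
  "f \<in> borel_measurable m \<Longrightarrow> (\<lambda>x. cnj (f x)) \<in> borel_measurable m"
  by (rule borel_measurable_continuous_on[where f=cnj]) (auto intro!: continuous_intros)

lemma L2_measurable [measurable_dest]: "f \<in> L2 m \<Longrightarrow> f \<in> borel_measurable m"
  by (simp add: L2_def)

lemma L2_integrable: "f \<in> L2 m \<Longrightarrow> integrable m (\<lambda>x. (cmod (f x))\<^sup>2)"
  by (simp add: L2_def)

lemma L2_bound:
  assumes "f \<in> L2 m" "g \<in> borel_measurable m" "AE x in m. cmod (g x) \<le> C * cmod (f x)"
  shows "g \<in> L2 m"
proof -
  have "integrable m (\<lambda>x. (C * cmod (f x))\<^sup>2)"
    using L2_integrable[OF assms(1)] by (simp add: power_mult_distrib)
  then have "integrable m (\<lambda>x. (cmod (g x))\<^sup>2)"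
  proof (rule Bochner_Integration.integrable_bound)
    show "AE x in m. norm ((cmod (g x))\<^sup>2) \<le> norm ((C * cmod (f x))\<^sup>2)"
      using assms(3) by eventually_elim (simp add: power_mono)
  qed (use assms(2) in measurable)
  with assms(2) show ?thesis by (simp add: L2_def)
qed

lemma L2_cong_AE:
  assumes "f \<in> L2 m" "g \<in> borel_measurable m" "aeq m f g"
  shows "g \<in> L2 m"
  by (rule L2_bound[OF assms(1,2), of 1]) (use assms(3) in \<open>auto simp: aeq_def\<close>)

lemma sq_add_le: "(cmod (a + b))\<^sup>2 \<le> 2 * (cmod a)\<^sup>2 + 2 * (cmod b)\<^sup>2"
proof -
  have "(cmod (a + b))\<^sup>2 \<le> (cmod a + cmod b)\<^sup>2"
    by (intro power_mono norm_triangle_ineq) auto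
  also have "\<dots> \<le> 2 * (cmod a)\<^sup>2 + 2 * (cmod b)\<^sup>2"
    using zero_le_power2[of "cmod a - cmod b"] by (simp add: power2_eq_square algebra_simps)
  finally show ?thesis .
qed

lemma L2_zero [simp]: "(\<lambda>x. 0) \<in> L2 m"
  by (simp add: L2_def)

lemma L2_lin [intro]:
  assumes [measurable]: "f \<in> L2 m" "g \<in> L2 m"
  shows "(\<lambda>x. f x + a * g x) \<in> L2 m"
proof -
  have "integrable m (\<lambda>x. 2 * (cmod (f x))\<^sup>2 + 2 * ((cmod a)\<^sup>2 * (cmod (g x))\<^sup>2))"
    using L2_integrable[OF assms(1)] L2_integrable[OF assms(2)] by simp
  then have "integrable m (\<lambda>x. (cmod (f x + a * g x))\<^sup>2)"
  proof (rule Bochner_Integration.integrable_bound)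
    show "AE x in m. norm ((cmod (f x + a * g x))\<^sup>2)
        \<le> norm (2 * (cmod (f x))\<^sup>2 + 2 * ((cmod a)\<^sup>2 * (cmod (g x))\<^sup>2))"
      using sq_add_le by (intro AE_I2) (auto simp: norm_mult power_mult_distrib, metis norm_mult power_mult_distrib)
  qed measurable
  then show ?thesis unfolding L2_def by simp
qed

lemma L2_add [intro]: "f \<in> L2 m \<Longrightarrow> g \<in> L2 m \<Longrightarrow> (\<lambda>x. f x + g x) \<in> L2 m"
  using L2_lin[of f m g 1] by simp

lemma L2_diff [intro]: "f \<in> L2 m \<Longrightarrow> g \<in> L2 m \<Longrightarrow> (\<lambda>x. f x - g x) \<in> L2 m"
  using L2_lin[of f m g "-1"] by simp

lemma L2_scale [intro]: "f \<in> L2 m \<Longrightarrow> (\<lambda>x. a * f x) \<in> L2 m"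
  using L2_lin[of "\<lambda>x. 0" m f a] by simp

lemma L2_sum [intro]:
  assumes "\<And>i. i \<in> I \<Longrightarrow> f i \<in> L2 m"
  shows "(\<lambda>x. \<Sum>i\<in>I. f i x) \<in> L2 m"
  using assms by (induction I rule: infinite_finite_induct) auto

lemma L2_prod_integrable:
  assumes [measurable]: "f \<in> L2 m" "g \<in> L2 m"
  shows "integrable m (\<lambda>x. cnj (f x) * g x)"
proof (rule Bochner_Integration.integrable_bound)
  show "integrable m (\<lambda>x. (cmod (f x))\<^sup>2 + (cmod (g x))\<^sup>2)"
    using L2_integrable[OF assms(1)] L2_integrable[OF assms(2)] by simp
  have "a * b \<le> a\<^sup>2 + b\<^sup>2" if "0 \<le> a" "0 \<le> b" for a b :: real
    using sum_squares_bound[of a b] that mult_nonneg_nonneg[OF that] by linarith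
  then show "AE x in m. norm (cnj (f x) * g x) \<le> norm ((cmod (f x))\<^sup>2 + (cmod (g x))\<^sup>2)"
    by (auto simp: norm_mult)
qed measurable

lemma ip_add_right:
  "f \<in> L2 m \<Longrightarrow> g \<in> L2 m \<Longrightarrow> h \<in> L2 m \<Longrightarrow> ip m f (\<lambda>x. g x + h x) = ip m f g + ip m f h"
  unfolding ip_def by (simp add: distrib_left L2_prod_integrable)

lemma ip_scale_right: "ip m f (\<lambda>x. a * g x) = a * ip m f g"
proof -
  have "ip m f (\<lambda>x. a * g x) = (\<integral>x. a * (cnj (f x) * g x) \<partial>m)"
    unfolding ip_def by (intro Bochner_Integration.integral_cong) auto
  then show ?thesis by (simp add: ip_def)
qed

lemma ip_cnj: "cnj (ip m f g) = ip m g f"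
  unfolding ip_def by (subst Bochner_Integration.integral_cnj[symmetric]) (simp add: mult.commute)

lemma ip_diff_right:
  "f \<in> L2 m \<Longrightarrow> g \<in> L2 m \<Longrightarrow> h \<in> L2 m \<Longrightarrow> ip m f (\<lambda>x. g x - h x) = ip m f g - ip m f h"
  unfolding ip_def by (simp add: right_diff_distrib L2_prod_integrable)

lemma ip_lin_right:
  "f \<in> L2 m \<Longrightarrow> g \<in> L2 m \<Longrightarrow> h \<in> L2 m \<Longrightarrow> ip m f (\<lambda>x. g x + a * h x) = ip m f g + a * ip m f h"
  by (subst ip_add_right) (auto simp: ip_scale_right)

lemma ip_lin_left:
  "f \<in> L2 m \<Longrightarrow> g \<in> L2 m \<Longrightarrow> h \<in> L2 m \<Longrightarrow> ip m (\<lambda>x. g x + a * h x) f = ip m g f + cnj a * ip m h f"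
  by (subst (1 2 3) ip_cnj[symmetric]) (simp add: ip_lin_right)

lemma ip_diff_left:
  "f \<in> L2 m \<Longrightarrow> g \<in> L2 m \<Longrightarrow> h \<in> L2 m \<Longrightarrow> ip m (\<lambda>x. g x - h x) f = ip m g f - ip m h f"
  using ip_lin_left[of f m g h "-1"] by simp

lemma ip_scale_left: "ip m (\<lambda>x. a * g x) f = cnj a * ip m g f"
  by (subst (1 2) ip_cnj[symmetric]) (simp add: ip_scale_right)

lemma ip_zero [simp]: "ip m f (\<lambda>x. 0) = 0" "ip m (\<lambda>x. 0) f = 0"
  by (simp_all add: ip_def)

lemma ip_sum_right:
  assumes "f \<in> L2 m" "\<And>i. i \<in> I \<Longrightarrow> g i \<in> L2 m"
  shows "ip m f (\<lambda>x. \<Sum>i\<in>I. g i x) = (\<Sum>i\<in>I. ip m f (g i))"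
  using assms(2)
  by (induction I rule: infinite_finite_induct) (simp_all add: assms(1) ip_add_right L2_sum)

lemma ip_sum_left:
  assumes "f \<in> L2 m" "\<And>i. i \<in> I \<Longrightarrow> g i \<in> L2 m"
  shows "ip m (\<lambda>x. \<Sum>i\<in>I. g i x) f = (\<Sum>i\<in>I. ip m (g i) f)"
  by (subst (1 2) ip_cnj[symmetric]) (simp add: ip_sum_right assms)

lemma ip_cong:
  assumes "aeq m f f'" "aeq m g g'" "f \<in> borel_measurable m" "f' \<in> borel_measurable m"
    "g \<in> borel_measurable m" "g' \<in> borel_measurable m"
  shows "ip m f g = ip m f' g'"
proof -
  note [measurable] = assms(3-)
  show ?thesis unfolding ip_def
  proof (rule integral_cong_AE)
    show "AE x in m. cnj (f x) * g x = cnj (f' x) * g' x"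
      using assms(1,2)[unfolded aeq_def] by eventually_elim simp
  qed measurable
qed

lemma l2norm_nonneg [simp]: "0 \<le> l2norm m f"
  by (simp add: l2norm_def)

lemma l2norm_sq: "(l2norm m f)\<^sup>2 = (\<integral>x. (cmod (f x))\<^sup>2 \<partial>m)"
  by (simp add: l2norm_def)

lemma ip_self: "ip m f f = complex_of_real ((l2norm m f)\<^sup>2)"
  unfolding ip_def l2norm_sq integral_complex_of_real[symmetric] complex_norm_square
  by (simp add: mult.commute)

lemma l2norm_sq_Re: "(l2norm m f)\<^sup>2 = Re (ip m f f)"
  by (simp add: ip_self)

lemma l2norm_cong:
  assumes "aeq m f g" "f \<in> borel_measurable m" "g \<in> borel_measurable m"
  shows "l2norm m f = l2norm m g"
  unfolding l2norm_def using assms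
  by (intro arg_cong[where f=sqrt] integral_cong_AE) (auto simp: aeq_def elim: eventually_mono)

lemma nn_integral_L2: "f \<in> L2 m \<Longrightarrow> (\<integral>\<^sup>+x. ennreal ((cmod (f x))\<^sup>2) \<partial>m) = ennreal ((l2norm m f)\<^sup>2)"
  unfolding l2norm_sq by (rule nn_integral_eq_integral) (auto simp: L2_integrable)

lemma L2_nn_integral_iff:
  "f \<in> borel_measurable m \<Longrightarrow> f \<in> L2 m \<longleftrightarrow> (\<integral>\<^sup>+x. ennreal ((cmod (f x))\<^sup>2) \<partial>m) < \<infinity>"
  by (auto simp: L2_def integrable_iff_bounded)

lemma l2norm_eq_0_iff:
  assumes "f \<in> L2 m" shows "l2norm m f = 0 \<longleftrightarrow> aeq m f (\<lambda>x. 0)"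
  unfolding l2norm_def aeq_def
  using integral_nonneg_eq_0_iff_AE[OF L2_integrable[OF assms]] by simp

lemma ip_self_eq_0: "f \<in> L2 m \<Longrightarrow> ip m f f = 0 \<Longrightarrow> aeq m f (\<lambda>x. 0)"
  by (simp add: ip_self l2norm_eq_0_iff)

text \<open>One expansion with a free complex coefficient serves for Cauchy-Schwarz, the triangle
  inequality, the parallelogram law, Bessel's inequality and polarization.\<close>

lemma l2norm_lin_sq:
  assumes "f \<in> L2 m" "g \<in> L2 m"
  shows "(l2norm m (\<lambda>x. f x + a * g x))\<^sup>2 = (l2norm m f)\<^sup>2 + 2 * Re (a * ip m f g) + (cmod a)\<^sup>2 * (l2norm m g)\<^sup>2"
proof -
  have "ip m (\<lambda>x. f x + a * g x) (\<lambda>x. f x + a * g x)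
      = ip m f f + a * ip m f g + cnj (a * ip m f g) + (a * cnj a) * ip m g g"
    using assms by (simp add: ip_lin_left ip_lin_right L2_lin ip_cnj algebra_simps)
  moreover have "a * cnj a = complex_of_real ((cmod a)\<^sup>2)" by (rule complex_norm_square[symmetric])
  ultimately have "Re (ip m (\<lambda>x. f x + a * g x) (\<lambda>x. f x + a * g x))
      = (l2norm m f)\<^sup>2 + 2 * Re (a * ip m f g) + (cmod a)\<^sup>2 * (l2norm m g)\<^sup>2"
    by (simp add: ip_self[of m f] ip_self[of m g])
  then show ?thesis by (simp only: l2norm_sq_Re[symmetric])
qed

lemma l2norm_scale: "l2norm m (\<lambda>x. a * f x) = cmod a * l2norm m f"
proof (rule power2_eq_imp_eq)
  show "(l2norm m (\<lambda>x. a * f x))\<^sup>2 = (cmod a * l2norm m f)\<^sup>2"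
    unfolding l2norm_sq power_mult_distrib by (simp add: norm_mult power_mult_distrib)
qed auto

lemma Cauchy_Schwarz_L2:
  assumes "f \<in> L2 m" "g \<in> L2 m"
  shows "cmod (ip m f g) \<le> l2norm m f * l2norm m g"
proof (cases "l2norm m g = 0")
  case True
  then have "aeq m g (\<lambda>x. 0)" using assms(2) by (simp add: l2norm_eq_0_iff)
  then have "ip m f g = ip m f (\<lambda>x. 0)" using assms by (intro ip_cong) (auto simp: aeq_def L2_measurable)
  then show ?thesis by simp
next
  case False
  let ?n = "(l2norm m g)\<^sup>2"
  \<comment> \<open>The coefficient for which \<open>f + a * g\<close> has minimal norm;
    nonnegativity of that norm is then the inequality.\<close>
  define a where "a = - cnj (ip m f g) / complex_of_real ?n"
  have "a * ip m f g = - complex_of_real ((cmod (ip m f g))\<^sup>2 / ?n)"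
    unfolding a_def of_real_divide complex_norm_square[of "ip m f g"] by (simp add: mult.commute)
  then have 1: "Re (a * ip m f g) = - ((cmod (ip m f g))\<^sup>2 / ?n)" by simp
  have 2: "(cmod a)\<^sup>2 * ?n = (cmod (ip m f g))\<^sup>2 / ?n"
    unfolding a_def norm_divide norm_minus_cancel norm_of_real complex_mod_cnj using False
    by (simp add: power_divide power2_eq_square)
  have "0 \<le> (l2norm m f)\<^sup>2 - (cmod (ip m f g))\<^sup>2 / ?n"
    using l2norm_lin_sq[OF assms, of a] 1 2 zero_le_power2[of "l2norm m (\<lambda>x. f x + a * g x)"] by linarith
  then have "(cmod (ip m f g))\<^sup>2 \<le> (l2norm m f * l2norm m g)\<^sup>2"
    using False by (simp add: field_simps power_mult_distrib)
  then show ?thesis by (rule power2_le_imp_le) simp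
qed

lemma l2norm_triangle:
  assumes "f \<in> L2 m" "g \<in> L2 m"
  shows "l2norm m (\<lambda>x. f x + g x) \<le> l2norm m f + l2norm m g"
proof (rule power2_le_imp_le)
  have "(l2norm m (\<lambda>x. f x + g x))\<^sup>2 = (l2norm m f)\<^sup>2 + 2 * Re (ip m f g) + (l2norm m g)\<^sup>2"
    using l2norm_lin_sq[OF assms, of 1] by simp
  also have "Re (ip m f g) \<le> l2norm m f * l2norm m g"
    using Cauchy_Schwarz_L2[OF assms] complex_Re_le_cmod[of "ip m f g"] by linarith
  finally show "(l2norm m (\<lambda>x. f x + g x))\<^sup>2 \<le> (l2norm m f + l2norm m g)\<^sup>2"
    by (simp add: power2_eq_square algebra_simps)
qed simp

lemma l2norm_minus_commute: "l2norm m (\<lambda>x. f x - g x) = l2norm m (\<lambda>x. g x - f x)"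
  by (simp add: l2norm_def norm_minus_commute)

lemma l2norm_triangle_sub:
  assumes "f \<in> L2 m" "g \<in> L2 m" "h \<in> L2 m"
  shows "l2norm m (\<lambda>x. f x - h x) \<le> l2norm m (\<lambda>x. f x - g x) + l2norm m (\<lambda>x. g x - h x)"
  using l2norm_triangle[OF L2_diff[OF assms(1,2)] L2_diff[OF assms(2,3)]] by simp

lemma l2norm_triangle_rev:
  assumes "f \<in> L2 m" "g \<in> L2 m"
  shows "\<bar>l2norm m f - l2norm m g\<bar> \<le> l2norm m (\<lambda>x. f x - g x)"
  using l2norm_triangle[OF assms(2) L2_diff[OF assms]] l2norm_triangle[OF assms(1) L2_diff[OF assms(2,1)]]
  by (simp add: l2norm_minus_commute[of m f g])

section \<open>Convergence in mean and completeness\<close>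

definition l2lim :: "'a measure \<Rightarrow> (nat \<Rightarrow> 'a fn) \<Rightarrow> 'a fn \<Rightarrow> bool" where
  "l2lim m F f \<longleftrightarrow> (\<lambda>n. l2norm m (\<lambda>x. F n x - f x)) \<longlonglongrightarrow> 0"

lemma l2lim_ip:
  assumes "\<And>n. F n \<in> L2 m" "f \<in> L2 m" "g \<in> L2 m" "l2lim m F f"
  shows "(\<lambda>n. ip m g (F n)) \<longlonglongrightarrow> ip m g f" "(\<lambda>n. ip m (F n) g) \<longlonglongrightarrow> ip m f g"
proof -
  have "(\<lambda>n. ip m g (F n) - ip m g f) \<longlonglongrightarrow> 0"
  proof (rule Lim_null_comparison)
    show "(\<lambda>n. l2norm m g * l2norm m (\<lambda>x. F n x - f x)) \<longlonglongrightarrow> 0"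
      using assms(4) unfolding l2lim_def by (rule tendsto_mult_right_zero)
    show "\<forall>\<^sub>F n in sequentially. norm (ip m g (F n) - ip m g f) \<le> l2norm m g * l2norm m (\<lambda>x. F n x - f x)"
      using Cauchy_Schwarz_L2[OF assms(3) L2_diff[OF assms(1,2)]] assms
      by (simp add: ip_diff_right)
  qed
  then show 1: "(\<lambda>n. ip m g (F n)) \<longlonglongrightarrow> ip m g f" by (simp add: LIM_zero_iff)
  from tendsto_cnj[OF this] show "(\<lambda>n. ip m (F n) g) \<longlonglongrightarrow> ip m f g" by (simp add: ip_cnj)
qed

lemma l2lim_norm:
  assumes "\<And>n. F n \<in> L2 m" "f \<in> L2 m" "l2lim m F f"
  shows "(\<lambda>n. l2norm m (F n)) \<longlonglongrightarrow> l2norm m f"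
proof -
  have "(\<lambda>n. l2norm m (F n) - l2norm m f) \<longlonglongrightarrow> 0"
    by (rule Lim_null_comparison[OF _ assms(3)[unfolded l2lim_def]])
       (simp add: l2norm_triangle_rev assms)
  then show ?thesis by (simp add: LIM_zero_iff)
qed

text \<open>The squared distances tend to 0 in mean of order one, so the subsequence theorem for
  that mode of convergence applies to them.\<close>

lemma l2lim_AE_subseq:
  assumes "\<And>n. F n \<in> L2 m" "f \<in> L2 m" "l2lim m F f"
  shows "\<exists>r. strict_mono r \<and> (AE x in m. (\<lambda>n. F (r n) x) \<longlonglongrightarrow> f x)"
proof -
  let ?u = "\<lambda>n x. (cmod (F n x - f x))\<^sup>2"
  have 0: "(\<lambda>n. (l2norm m (\<lambda>x. F n x - f x))\<^sup>2) \<longlonglongrightarrow> 0\<^sup>2"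
    using assms(3) unfolding l2lim_def by (rule tendsto_power)
  have "\<exists>r. strict_mono r \<and> (AE x in m. (\<lambda>n. ?u (r n) x) \<longlonglongrightarrow> 0)"
  proof (rule tendsto_L1_AE_subseq)
    show "integrable m (?u n)" for n using assms by (intro L2_integrable L2_diff)
    show "(\<lambda>n. \<integral>x. norm (?u n x) \<partial>m) \<longlonglongrightarrow> 0" using 0 by (simp add: l2norm_sq)
  qed
  then obtain r where r: "strict_mono r" "AE x in m. (\<lambda>n. ?u (r n) x) \<longlonglongrightarrow> 0" by blast
  from r(2) have "AE x in m. (\<lambda>n. F (r n) x) \<longlonglongrightarrow> f x"
  proof eventually_elim
    case (elim x)
    from tendsto_real_sqrt[OF elim] have "(\<lambda>n. cmod (F (r n) x - f x)) \<longlonglongrightarrow> 0" by simp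
    then show ?case by (simp add: tendsto_norm_zero_iff LIM_zero_iff)
  qed
  with r(1) show ?thesis by blast
qed

lemma ennreal_le_suminf: "(a k :: ennreal) \<le> (\<Sum>k. a k)"
proof -
  have "sum a {k} \<le> suminf a" by (rule sum_le_suminf[OF summableI]) simp_all
  then show ?thesis by simp
qed

text \<open>A rapidly Cauchy subsequence converges almost everywhere, and Fatou's lemma turns its
  pointwise limit into the limit in mean of the whole sequence.\<close>

lemma L2_complete:
  assumes F: "\<And>n. F n \<in> L2 m"
    and Cauchy: "\<And>e. e > 0 \<Longrightarrow> \<exists>N. \<forall>i\<ge>N. \<forall>j\<ge>N. l2norm m (\<lambda>x. F i x - F j x) < e"
  shows "\<exists>f\<in>L2 m. l2lim m F f"
proof -
  have [measurable]: "\<And>n. F n \<in> borel_measurable m" by (rule L2_measurable[OF F])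
  have "\<forall>k. \<exists>N. \<forall>i\<ge>N. \<forall>j\<ge>N. l2norm m (\<lambda>x. F i x - F j x) < (1/4)^k"
  proof
    fix k :: nat
    have "(0::real) < (1/4)^k" by simp
    from Cauchy[OF this] show "\<exists>N. \<forall>i\<ge>N. \<forall>j\<ge>N. l2norm m (\<lambda>x. F i x - F j x) < (1/4)^k" .
  qed
  from choice[OF this] obtain N :: "nat \<Rightarrow> nat"
    where "\<forall>k. \<forall>i\<ge>N k. \<forall>j\<ge>N k. l2norm m (\<lambda>x. F i x - F j x) < (1/4)^k" ..
  then have N: "l2norm m (\<lambda>x. F i x - F j x) < (1/4)^k" if "i \<ge> N k" "j \<ge> N k" for i j k
    using that by simp
  \<comment> \<open>The maximum over all thresholds up to k makes \<open>r k\<close> admissible for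
    every l up to k, and the summand k makes it tend to infinity.\<close>
  define r where "r k = Max (N ` {..k}) + k" for k
  have rN: "r k \<ge> N l" if "l \<le> k" for k l
  proof -
    have "N l \<le> Max (N ` {..k})" using that by (intro Max_ge) auto
    then show ?thesis unfolding r_def by linarith
  qed
  have rk: "r k \<ge> k" for k by (simp add: r_def)
  define d where "d k x = F (r (Suc k)) x - F (r k) x" for k x
  have d: "d k \<in> L2 m" for k unfolding d_def by (intro L2_diff F)
  note [measurable] = L2_measurable[OF d]
  have dn: "(l2norm m (d k))\<^sup>2 \<le> (1/16)^k" for k
  proof -
    have "l2norm m (d k) \<le> (1/4)^k" unfolding d_def using N[of k "r (Suc k)" "r k"] rN by simp
    then have "(l2norm m (d k))\<^sup>2 \<le> ((1/4)^k)\<^sup>2" by (rule power_mono) simp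
    also have "((1/4)^k)\<^sup>2 = (1/16::real)^k"
      by (simp only: power2_eq_square power_mult_distrib[symmetric]) simp
    finally show ?thesis .
  qed
  \<comment> \<open>The squared norms of \<open>d k\<close> decay like \<open>(1/16)^k\<close>, so
    the weight \<open>4^k\<close> still leaves a convergent sum; finiteness at a point then bounds
    \<open>d k x\<close> by a constant times \<open>(1/2)^k\<close>.\<close>
  have "(\<integral>\<^sup>+x. (\<Sum>k. ennreal (4^k * (cmod (d k x))\<^sup>2)) \<partial>m) = (\<Sum>k. \<integral>\<^sup>+x. ennreal (4^k * (cmod (d k x))\<^sup>2) \<partial>m)"
    by (rule nn_integral_suminf) measurable
  also have "\<dots> = (\<Sum>k. ennreal (4^k * (l2norm m (d k))\<^sup>2))"
  proof (intro suminf_cong)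
    fix k
    show "(\<integral>\<^sup>+x. ennreal (4^k * (cmod (d k x))\<^sup>2) \<partial>m) = ennreal (4^k * (l2norm m (d k))\<^sup>2)"
      by (simp add: ennreal_mult nn_integral_cmult nn_integral_L2[OF d])
  qed
  also have "\<dots> \<le> (\<Sum>k. ennreal ((1/4)^k))"
  proof (intro suminf_le ennreal_leI)
    fix k :: nat
    have "4^k * (l2norm m (d k))\<^sup>2 \<le> 4^k * (1/16)^k" using dn by (intro mult_left_mono) auto
    also have "\<dots> = (1/4::real)^k" by (simp only: power_mult_distrib[symmetric]) simp
    finally show "4^k * (l2norm m (d k))\<^sup>2 \<le> (1/4)^k" .
  qed auto
  also have "\<dots> < \<infinity>"
    by (subst suminf_ennreal2) (auto intro!: summable_geometric)
  finally have fin: "(\<integral>\<^sup>+x. (\<Sum>k. ennreal (4^k * (cmod (d k x))\<^sup>2)) \<partial>m) \<noteq> \<infinity>" by simp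
  have "AE x in m. (\<Sum>k. ennreal (4^k * (cmod (d k x))\<^sup>2)) \<noteq> \<infinity>"
    by (rule nn_integral_PInf_AE[OF _ fin]) measurable
  then have conv: "AE x in m. convergent (\<lambda>k. F (r k) x)"
  proof eventually_elim
    case (elim x)
    define C where "C = enn2real (\<Sum>k. ennreal (4^k * (cmod (d k x))\<^sup>2))"
    have C0: "C \<ge> 0" unfolding C_def by (rule enn2real_nonneg)
    have le: "4^k * (cmod (d k x))\<^sup>2 \<le> C" for k
    proof -
      have "ennreal (4^k * (cmod (d k x))\<^sup>2) \<le> (\<Sum>k. ennreal (4^k * (cmod (d k x))\<^sup>2))"
        by (rule ennreal_le_suminf)
      also have "\<dots> = ennreal C" unfolding C_def using elim by (subst ennreal_enn2real) (auto simp: less_top)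
      finally show ?thesis by (subst (asm) ennreal_le_iff) (rule C0)
    qed
    have "cmod (d k x) \<le> sqrt C * (1/2)^k" for k
    proof (rule power2_le_imp_le)
      have "((1/2::real)^k)\<^sup>2 = 1 / 4^k"
        by (simp only: power2_eq_square power_mult_distrib[symmetric]) (simp add: power_one_over)
      then have "(sqrt C * (1/2)^k)\<^sup>2 = C / 4^k"
        using C0 by (simp only: power_mult_distrib real_sqrt_pow2) simp
      then show "(cmod (d k x))\<^sup>2 \<le> (sqrt C * (1/2)^k)\<^sup>2"
        using le[of k] by (simp only: pos_le_divide_eq zero_less_power zero_less_numeral mult.commute)
    qed (intro mult_nonneg_nonneg real_sqrt_ge_zero C0, simp)
    moreover have "summable (\<lambda>k. sqrt C * (1/2)^k)"
      by (intro summable_mult summable_geometric) simp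
    ultimately have "summable (\<lambda>k. d k x)"
      by (intro summable_comparison_test[of "\<lambda>k. d k x" "\<lambda>k. sqrt C * (1/2)^k"]) blast+
    then have "convergent (\<lambda>n. \<Sum>k<n. d k x)" by (simp add: summable_iff_convergent)
    moreover have "(\<Sum>k<n. d k x) = F (r n) x - F (r 0) x" for n
      unfolding d_def by (rule sum_lessThan_telescope)
    ultimately have "convergent (\<lambda>n. F (r n) x - F (r 0) x)" by simp
    then show ?case by (simp add: convergent_diff_const_right_iff)
  qed
  define f where "f x = lim (\<lambda>k. F (r k) x)" for x
  have [measurable]: "f \<in> borel_measurable m" unfolding f_def by measurable
  have lim: "AE x in m. (\<lambda>k. F (r k) x) \<longlonglongrightarrow> f x"
    using conv by eventually_elim (simp add: f_def convergent_LIMSEQ_iff)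
  \<comment> \<open>Fatou's lemma along the subsequence with n fixed: from index l on, its members
    stay within \<open>(1/4)^l\<close> of \<open>F n\<close>.\<close>
  have bound: "(\<integral>\<^sup>+x. ennreal ((cmod (f x - F n x))\<^sup>2) \<partial>m) \<le> ennreal (((1/4)^l)\<^sup>2)" if n: "n \<ge> N l" for n l
  proof -
    have "(\<integral>\<^sup>+x. ennreal ((cmod (f x - F n x))\<^sup>2) \<partial>m)
        = (\<integral>\<^sup>+x. liminf (\<lambda>k. ennreal ((cmod (F (r k) x - F n x))\<^sup>2)) \<partial>m)"
    proof (rule nn_integral_cong_AE)
      show "AE x in m. ennreal ((cmod (f x - F n x))\<^sup>2) = liminf (\<lambda>k. ennreal ((cmod (F (r k) x - F n x))\<^sup>2))"
        using lim
      proof eventually_elim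
        case (elim x)
        have "(\<lambda>k. ennreal ((cmod (F (r k) x - F n x))\<^sup>2)) \<longlonglongrightarrow> ennreal ((cmod (f x - F n x))\<^sup>2)"
          by (intro tendsto_ennrealI tendsto_intros elim)
        from lim_imp_Liminf[OF _ this] show ?case by simp
      qed
    qed
    also have "\<dots> \<le> liminf (\<lambda>k. \<integral>\<^sup>+x. ennreal ((cmod (F (r k) x - F n x))\<^sup>2) \<partial>m)"
      by (rule nn_integral_liminf) measurable
    also have "\<dots> = liminf (\<lambda>k. ennreal ((l2norm m (\<lambda>x. F (r k) x - F n x))\<^sup>2))"
      by (simp add: nn_integral_L2 L2_diff F)
    also have "\<dots> \<le> limsup (\<lambda>k. ennreal ((l2norm m (\<lambda>x. F (r k) x - F n x))\<^sup>2))"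
      by (rule Liminf_le_Limsup) simp
    also have "\<dots> \<le> ennreal (((1/4)^l)\<^sup>2)"
    proof (rule Limsup_bounded, rule eventually_sequentiallyI)
      fix k assume "l \<le> k"
      then show "ennreal ((l2norm m (\<lambda>x. F (r k) x - F n x))\<^sup>2) \<le> ennreal (((1/4)^l)\<^sup>2)"
        using N[of l "r k" n] rN[of l k] n by (intro ennreal_leI power_mono) auto
    qed
    finally show ?thesis .
  qed
  have D: "(\<lambda>x. f x - F n x) \<in> L2 m" if "n \<ge> N l" for n l
    using bound[OF that] by (subst L2_nn_integral_iff) (auto intro: le_less_trans)
  have f: "f \<in> L2 m" using L2_add[OF D[OF order_refl[of "N 0"]] F[of "N 0"]] by simp
  have "l2norm m (\<lambda>x. F n x - f x) \<le> (1/4)^l" if "n \<ge> N l" for n l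
  proof -
    have "ennreal ((l2norm m (\<lambda>x. f x - F n x))\<^sup>2) \<le> ennreal (((1/4)^l)\<^sup>2)"
      using bound[OF that] nn_integral_L2[OF D[OF that]] by simp
    then have "(l2norm m (\<lambda>x. f x - F n x))\<^sup>2 \<le> ((1/4)^l)\<^sup>2" by (subst (asm) ennreal_le_iff) auto
    then show ?thesis by (subst l2norm_minus_commute) (rule power2_le_imp_le, auto)
  qed
  moreover have "\<exists>l. (1/4::real)^l < e" if "e > 0" for e :: real
    using that by (rule real_arch_pow_inv) simp
  ultimately have "l2lim m F f"
    unfolding l2lim_def by (intro LIMSEQ_I) (auto, metis le_less_trans)
  with f show ?thesis by blast
qed

section \<open>Projections, unitary extension and orthonormal systems\<close>

lemma l2norm_parallelogram:
  assumes "u \<in> L2 m" "v \<in> L2 m"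
  shows "(l2norm m (\<lambda>x. u x - v x))\<^sup>2 + (l2norm m (\<lambda>x. u x + v x))\<^sup>2 = 2 * (l2norm m u)\<^sup>2 + 2 * (l2norm m v)\<^sup>2"
  using l2norm_lin_sq[OF assms, of 1] l2norm_lin_sq[OF assms, of "-1"] by simp

text \<open>S is not assumed closed, so the projection lies only in its closure, which is recorded
  by a sequence from S. A minimizing sequence is Cauchy by the parallelogram law, and its limit
  satisfies the orthogonality condition by varying the approximants inside S.\<close>

lemma projection_L2:
  assumes S: "S \<subseteq> L2 m" "(\<lambda>x. 0) \<in> S"
    and lin: "\<And>s t a. s \<in> S \<Longrightarrow> t \<in> S \<Longrightarrow> (\<lambda>x. s x + a * t x) \<in> S"
    and f: "f \<in> L2 m"
  shows "\<exists>p F. p \<in> L2 m \<and> (\<forall>n. F n \<in> S) \<and> l2lim m F p \<and> (\<forall>s\<in>S. ip m s (\<lambda>x. f x - p x) = 0)"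
proof -
  define Q where "Q s = (l2norm m (\<lambda>x. f x - s x))\<^sup>2" for s
  define d where "d = (INF s\<in>S. Q s)"
  have bdd: "bdd_below (Q ` S)" by (rule bdd_belowI[of _ 0]) (auto simp: Q_def)
  have d_le: "d \<le> Q s" if "s \<in> S" for s
    unfolding d_def by (rule cINF_lower[OF bdd that])
  have ex: "\<exists>s\<in>S. Q s < d + 1 / real (Suc n)" for n
  proof -
    have "Inf (Q ` S) < d + 1 / real (Suc n)" by (simp add: d_def)
    with cInf_lessD[of "Q ` S"] S(2) show ?thesis by fastforce
  qed
  then obtain F where F: "\<And>n. F n \<in> S" "\<And>n. Q (F n) < d + 1 / real (Suc n)" by metis
  have FL: "F n \<in> L2 m" for n using F S by auto
  \<comment> \<open>The midpoint of \<open>F i\<close> and \<open>F j\<close> lies in S, so its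
    distance from f cannot fall below the infimum; the parallelogram law then leaves little room for
    the difference.\<close>
  have diff: "(l2norm m (\<lambda>x. F i x - F j x))\<^sup>2 \<le> 4 / real (Suc N)" if ij: "i \<ge> N" "j \<ge> N" for i j N
  proof -
    have half: "(\<lambda>x. (1/2) * F i x + (1/2) * F j x) \<in> S"
      using lin[OF lin[OF S(2) F(1)[of i], of "1/2"] F(1)[of j], of "1/2"] by simp
    have "(l2norm m (\<lambda>x. f x - F j x - (f x - F i x)))\<^sup>2 + (l2norm m (\<lambda>x. f x - F j x + (f x - F i x)))\<^sup>2
       = 2 * Q (F j) + 2 * Q (F i)"
      unfolding Q_def by (rule l2norm_parallelogram) (intro L2_diff f FL)+
    moreover have "(\<lambda>x. f x - F j x - (f x - F i x)) = (\<lambda>x. F i x - F j x)" by auto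
    moreover have "(\<lambda>x. f x - F j x + (f x - F i x)) = (\<lambda>x. 2 * (f x - ((1/2) * F i x + (1/2) * F j x)))"
      by (auto simp: algebra_simps)
    ultimately have "(l2norm m (\<lambda>x. F i x - F j x))\<^sup>2 + 4 * Q (\<lambda>x. (1/2) * F i x + (1/2) * F j x) = 2 * Q (F j) + 2 * Q (F i)"
      by (simp only: l2norm_scale power_mult_distrib Q_def) simp
    moreover have "1 / real (Suc i) \<le> 1 / real (Suc N)" "1 / real (Suc j) \<le> 1 / real (Suc N)"
      using ij by (auto simp: field_simps)
    ultimately show ?thesis using d_le[OF half] F(2)[of i] F(2)[of j] by simp
  qed
  have "\<exists>p\<in>L2 m. l2lim m F p"
  proof (rule L2_complete[OF FL])
    fix e :: real assume e: "e > 0"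
    obtain N where "4 / e\<^sup>2 < real N" using reals_Archimedean2 by blast
    then have "4 / e\<^sup>2 < real (Suc N)" by simp
    then have N: "4 / real (Suc N) < e\<^sup>2" using e by (simp add: field_simps)
    have "l2norm m (\<lambda>x. F i x - F j x) < e" if "i \<ge> N" "j \<ge> N" for i j
      using diff[OF that] N e by (intro power2_less_imp_less[of _ e]) auto
    then show "\<exists>N. \<forall>i\<ge>N. \<forall>j\<ge>N. l2norm m (\<lambda>x. F i x - F j x) < e" by blast
  qed
  then obtain p where p: "p \<in> L2 m" "l2lim m F p" by blast
  have "ip m s (\<lambda>x. f x - p x) = 0" if s: "s \<in> S" for s
  proof -
    have sL: "s \<in> L2 m" using s S by auto
    \<comment> \<open>The step length for a variation along s: the quadratic term is then at most
      \<open>\<epsilon> * (cmod (z n))\<^sup>2\<close>, half of what the linear term gains. The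
      summand 1 covers the case of a null s.\<close>
    define \<epsilon> where "\<epsilon> = 1 / ((l2norm m s)\<^sup>2 + 1)"
    have \<epsilon>: "\<epsilon> > 0" "\<epsilon> * (l2norm m s)\<^sup>2 \<le> 1" by (auto simp: \<epsilon>_def field_simps add_pos_nonneg)
    define z where "z n = ip m (\<lambda>x. f x - F n x) s" for n
    have z: "\<epsilon> * (cmod (z n))\<^sup>2 \<le> 1 / real (Suc n)" for n
    proof -
      define a where "a = - complex_of_real \<epsilon> * cnj (z n)"
      have "(\<lambda>x. F n x + (- a) * s x) \<in> S" by (rule lin[OF F(1) s])
      from d_le[OF this] have "d \<le> (l2norm m (\<lambda>x. (f x - F n x) + a * s x))\<^sup>2"
        unfolding Q_def by (simp add: algebra_simps)
      also have "\<dots> = Q (F n) + 2 * Re (a * z n) + (cmod a)\<^sup>2 * (l2norm m s)\<^sup>2"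
        unfolding Q_def z_def by (rule l2norm_lin_sq) (intro L2_diff f FL sL)+
      also have "a * z n = - complex_of_real (\<epsilon> * (cmod (z n))\<^sup>2)"
        unfolding a_def of_real_mult complex_norm_square by (simp add: mult.commute mult.left_commute)
      also have "(cmod a)\<^sup>2 * (l2norm m s)\<^sup>2 = (\<epsilon> * (l2norm m s)\<^sup>2) * (\<epsilon> * (cmod (z n))\<^sup>2)"
        using \<epsilon> by (simp add: a_def norm_mult power2_eq_square)
      also have "\<dots> \<le> 1 * (\<epsilon> * (cmod (z n))\<^sup>2)" using \<epsilon> by (intro mult_right_mono) auto
      finally show ?thesis using F(2)[of n] by simp
    qed
    have lim: "z \<longlonglongrightarrow> ip m (\<lambda>x. f x - p x) s"
    proof -
      have "(\<lambda>n. ip m f s - ip m (F n) s) \<longlonglongrightarrow> ip m f s - ip m p s"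
        by (intro tendsto_intros l2lim_ip(2) FL p sL)
      then show ?thesis unfolding z_def by (simp add: ip_diff_left f FL sL p)
    qed
    have "(\<lambda>n. \<epsilon> * (cmod (z n))\<^sup>2) \<longlonglongrightarrow> \<epsilon> * (cmod (ip m (\<lambda>x. f x - p x) s))\<^sup>2"
      by (intro tendsto_intros lim)
    then have "\<epsilon> * (cmod (ip m (\<lambda>x. f x - p x) s))\<^sup>2 \<le> 0"
      by (rule LIMSEQ_le[OF _ LIMSEQ_inverse_real_of_nat]) (use z in \<open>auto simp: divide_inverse\<close>)
    then have "ip m (\<lambda>x. f x - p x) s = 0" using \<epsilon>(1) by (simp add: mult_le_0_iff)
    then show ?thesis by (subst ip_cnj[symmetric]) simp
  qed
  with p F(1) show ?thesis by blast
qed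

section \<open>Total sets and uniform boundedness\<close>

definition total_L2 :: "'a measure \<Rightarrow> 'a fn set \<Rightarrow> bool" where
  "total_L2 m G \<longleftrightarrow> (\<forall>f\<in>L2 m. (\<forall>g\<in>G. ip m g f = 0) \<longrightarrow> aeq m f (\<lambda>x. 0))"

text \<open>The remainder of the projection onto S is orthogonal to S, hence null, so the
  approximants of the projection already approximate f.\<close>

lemma total_imp_approx:
  assumes S: "S \<subseteq> L2 m" "(\<lambda>x. 0) \<in> S"
    and lin: "\<And>s t a. s \<in> S \<Longrightarrow> t \<in> S \<Longrightarrow> (\<lambda>x. s x + a * t x) \<in> S"
    and tot: "total_L2 m S" and f: "f \<in> L2 m"
  shows "\<exists>F. (\<forall>n. F n \<in> S) \<and> l2lim m F f"
proof -
  obtain p F where p: "p \<in> L2 m" "\<forall>n. F n \<in> S" "l2lim m F p" "\<forall>s\<in>S. ip m s (\<lambda>x. f x - p x) = 0"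
    using projection_L2[OF S lin f] by blast
  have "aeq m (\<lambda>x. f x - p x) (\<lambda>x. 0)" using tot p f unfolding total_L2_def by blast
  then have "l2norm m (\<lambda>x. F n x - f x) = l2norm m (\<lambda>x. F n x - p x)" for n
    using p(2) S f p(1) by (intro l2norm_cong L2_measurable L2_diff) (auto simp: aeq_def)
  with p show ?thesis unfolding l2lim_def by auto
qed

text \<open>If f is orthogonal to u, then the square of its norm is the inner product of
  \<open>f - u\<close> with f, which Cauchy-Schwarz makes small when u is close to f.\<close>

lemma dense_imp_total:
  assumes D: "D \<subseteq> L2 m" "dense_in_L2 m D"
  shows "total_L2 m D"
  unfolding total_L2_def
proof (intro ballI impI)
  fix f assume f: "f \<in> L2 m" and orth: "\<forall>g\<in>D. ip m g f = 0"
  have le: "(l2norm m f)\<^sup>2 \<le> e * l2norm m f" if e: "e > 0" for e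
  proof -
    obtain u where u: "u \<in> D" "l2norm m (\<lambda>x. f x - u x) < e"
      using D(2) f e unfolding dense_in_L2_def by blast
    then have uL: "u \<in> L2 m" using D by auto
    have "ip m (\<lambda>x. f x - u x) f = complex_of_real ((l2norm m f)\<^sup>2)"
      using u orth by (simp add: ip_diff_left f uL ip_self)
    then have "(l2norm m f)\<^sup>2 \<le> l2norm m (\<lambda>x. f x - u x) * l2norm m f"
      using Cauchy_Schwarz_L2[OF L2_diff[OF f uL] f] by (simp add: norm_power)
    also have "\<dots> \<le> e * l2norm m f" using u by (intro mult_right_mono) auto
    finally show ?thesis .
  qed
  have "l2norm m f = 0"
  proof (rule ccontr)
    assume "l2norm m f \<noteq> 0"
    then have "l2norm m f > 0" using l2norm_nonneg[of m f] by linarith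
    then show False using le[of "l2norm m f / 2"] by (simp add: power2_eq_square)
  qed
  then show "aeq m f (\<lambda>x. 0)" by (simp add: l2norm_eq_0_iff f)
qed

text \<open>Sokal's gliding hump: corrections of length \<open>3\<^sup>-\<^sup>n\<close> along \<open>s\<^sub>n\<close>, with signs such that later ones cannot cancel them.\<close>
lemma uniform_bounded_L2:
  assumes S: "S \<subseteq> L2 m" and bd: "\<And>f. f \<in> L2 m \<Longrightarrow> \<exists>C. \<forall>s\<in>S. cmod (ip m s f) \<le> C"
  shows "\<exists>C. \<forall>s\<in>S. l2norm m s \<le> C"
proof (rule ccontr)
  assume neg: "\<not> ?thesis"
  have "\<forall>n. \<exists>s\<in>S. l2norm m s > 4^n" using neg by (meson not_le)
  then obtain s where s: "\<And>n. s n \<in> S" "\<And>n. l2norm m (s n) > 4^n" by metis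
  have sL: "s n \<in> L2 m" for n using s S by auto
  have spos: "l2norm m (s n) > 0" for n using s(2)[of n] by (rule less_trans[rotated]) simp
  define c where "c n = complex_of_real ((1/3)^n / l2norm m (s n))" for n
  have "\<exists>x. \<forall>n. x n \<in> L2 m \<and> (l2norm m (\<lambda>y. x (Suc n) y - x n y) \<le> (1/3)^n \<and>
      cmod (ip m (s n) (x (Suc n))) \<ge> (1/3)^n * l2norm m (s n))"
  proof (rule dependent_nat_choice)
    fix x n assume x: "x \<in> L2 m"
    have cs: "cmod (c n * ip m (s n) (s n)) = (1/3)^n * l2norm m (s n)"
      using spos[of n] unfolding c_def ip_self norm_mult norm_of_real by (simp add: power2_eq_square)
    let ?a = "ip m (s n) x" and ?b = "c n * ip m (s n) (s n)"
    \<comment> \<open>The two sums differ by twice \<open>?b\<close>, so they cannot both be shorter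
      than \<open>?b\<close>; this decides the sign of the correction.\<close>
    have "cmod ?b \<le> cmod (?a + ?b) \<or> cmod ?b \<le> cmod (?a + - ?b)"
    proof (rule ccontr)
      assume "\<not> ?thesis"
      moreover have "cmod (2 * ?b) \<le> cmod (?a + ?b) + cmod (?a + - ?b)"
        using norm_triangle_ineq4[of "?a + ?b" "?a + - ?b"] by (simp add: algebra_simps)
      ultimately show False by (simp add: norm_mult)
    qed
    then obtain \<sigma> :: complex where \<sigma>: "\<sigma> = 1 \<or> \<sigma> = -1" "cmod ?b \<le> cmod (?a + \<sigma> * ?b)"
      by (metis mult_1 mult_minus1)
    let ?y = "\<lambda>t. x t + (\<sigma> * c n) * s n t"
    have "ip m (s n) ?y = ?a + \<sigma> * ?b" by (simp add: ip_lin_right x sL)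
    moreover have "l2norm m (\<lambda>t. ?y t - x t) = (1/3)^n"
    proof -
      have "(\<lambda>t. ?y t - x t) = (\<lambda>t. (\<sigma> * c n) * s n t)" by auto
      moreover have "cmod \<sigma> = 1" using \<sigma>(1) by auto
      moreover have "cmod (c n) = (1/3)^n / l2norm m (s n)" unfolding c_def norm_of_real by simp
      ultimately show ?thesis using spos[of n] by (simp only: l2norm_scale norm_mult) simp
    qed
    ultimately have "?y \<in> L2 m \<and> l2norm m (\<lambda>t. ?y t - x t) \<le> (1/3)^n \<and> cmod (ip m (s n) ?y) \<ge> (1/3)^n * l2norm m (s n)"
      using \<sigma>(2) cs x sL by (auto intro: L2_lin)
    then show "\<exists>y. y \<in> L2 m \<and> l2norm m (\<lambda>t. y t - x t) \<le> (1/3)^n \<and> cmod (ip m (s n) y) \<ge> (1/3)^n * l2norm m (s n)"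
      by (rule exI[of _ ?y])
  qed (rule exI[of _ "\<lambda>x. 0"], simp)
  then obtain x where x: "\<And>n. x n \<in> L2 m" "\<And>n. l2norm m (\<lambda>y. x (Suc n) y - x n y) \<le> (1/3)^n"
      "\<And>n. cmod (ip m (s n) (x (Suc n))) \<ge> (1/3)^n * l2norm m (s n)" by blast
  \<comment> \<open>The corrections between the indices i and j add up to a geometric sum with ratio
    1/3, which is where the factor 3/2 comes from.\<close>
  have dist: "l2norm m (\<lambda>y. x j y - x i y) \<le> 3/2 * ((1/3)^i - (1/3)^j)" if "i \<le> j" for i j
    using that
  proof (induction j rule: dec_induct)
    case base show ?case by (simp add: l2norm_def)
  next
    case (step j)
    have "l2norm m (\<lambda>y. x (Suc j) y - x i y) \<le> l2norm m (\<lambda>y. x (Suc j) y - x j y) + l2norm m (\<lambda>y. x j y - x i y)"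
      by (rule l2norm_triangle_sub) (rule x)+
    also have "\<dots> \<le> (1/3)^j + 3/2 * ((1/3)^i - (1/3)^j)" using x(2)[of j] step by linarith
    also have "\<dots> = 3/2 * ((1/3)^i - (1/3)^(Suc j))" by (simp add: algebra_simps)
    finally show ?case .
  qed
  have dist': "l2norm m (\<lambda>y. x j y - x i y) \<le> 3/2 * (1/3)^i" if "i \<le> j" for i j
    using dist[OF that] by (rule order_trans) (simp add: right_diff_distrib)
  have "\<exists>z\<in>L2 m. l2lim m x z"
  proof (rule L2_complete[OF x(1)])
    fix e :: real assume e: "e > 0"
    have "\<exists>N. (1/3::real)^N < e / 3" using e by (intro real_arch_pow_inv) auto
    then obtain N where N: "(1/3::real)^N < e/3" ..
    have "l2norm m (\<lambda>y. x i y - x j y) < e" if "i \<ge> N" "j \<ge> N" for i j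
    proof -
      have "l2norm m (\<lambda>y. x i y - x j y) \<le> l2norm m (\<lambda>y. x i y - x N y) + l2norm m (\<lambda>y. x N y - x j y)"
        by (rule l2norm_triangle_sub) (rule x)+
      also have "\<dots> \<le> 3/2 * (1/3)^N + 3/2 * (1/3)^N"
        using dist'[OF that(1)] dist'[OF that(2)] l2norm_minus_commute[of m "x N" "x j"] by linarith
      also have "\<dots> < e" using N by linarith
      finally show ?thesis .
    qed
    then show "\<exists>N. \<forall>i\<ge>N. \<forall>j\<ge>N. l2norm m (\<lambda>y. x i y - x j y) < e" by blast
  qed
  then obtain z where z: "z \<in> L2 m" "l2lim m x z" by blast
  have zx: "l2norm m (\<lambda>y. z y - x i y) \<le> 3/2 * (1/3)^i" for i
  proof (rule LIMSEQ_le_const2)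
    show "(\<lambda>j. l2norm m (\<lambda>y. x j y - x i y)) \<longlonglongrightarrow> l2norm m (\<lambda>y. z y - x i y)"
      by (rule l2lim_norm) (use z x in \<open>auto simp: l2lim_def\<close>)
    show "\<exists>N. \<forall>n\<ge>N. l2norm m (\<lambda>y. x n y - x i y) \<le> 3 / 2 * (1 / 3) ^ i"
      using dist'[of i] by blast
  qed
  obtain C where C: "\<And>t. t \<in> S \<Longrightarrow> cmod (ip m t z) \<le> C" using bd[OF z(1)] by blast
  \<comment> \<open>All corrections after step n together have length at most half of
    \<open>(1/3)^n\<close>, so half of the value produced at step n survives in z; the growth of the
    norms beyond \<open>4^n\<close> then contradicts the bound C.\<close>
  have "(4/3)^n / 2 \<le> C" for n
  proof -
    let ?L = "l2norm m (s n)" and ?q = "(1/3::real)^n"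
    have "cmod (ip m (s n) (x (Suc n))) \<le> cmod (ip m (s n) z) + cmod (ip m (s n) (\<lambda>y. z y - x (Suc n) y))"
      using norm_triangle_ineq4[of "ip m (s n) z" "ip m (s n) (\<lambda>y. z y - x (Suc n) y)"]
      by (simp add: ip_diff_right z x sL)
    moreover have "cmod (ip m (s n) (\<lambda>y. z y - x (Suc n) y)) \<le> ?L * (?q / 2)"
      using Cauchy_Schwarz_L2[OF sL[of n] L2_diff[OF z(1) x(1)[of "Suc n"]]]
        mult_left_mono[OF zx[of "Suc n"] l2norm_nonneg[of m "s n"]] by simp
    ultimately have "?q * ?L / 2 \<le> C" using x(3)[of n] C[OF s(1)[of n]] by (simp add: algebra_simps)
    moreover have "?q * 4^n \<le> ?q * ?L" using s(2)[of n] by (intro mult_left_mono) auto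
    moreover have "?q * 4^n = (4/3)^n" by (simp add: power_divide)
    ultimately show ?thesis by linarith
  qed
  moreover obtain n where "(4/3::real)^n > 2 * C" using real_arch_pow[of "4/3" "2*C"] by auto
  ultimately show False by (metis linorder_not_le mult.commute pos_divide_le_eq zero_less_numeral)
qed

text \<open>The span of the pairs \<open>(a i, b i)\<close> as a relation: the vectors
  \<open>a i\<close> may be linearly dependent, so a map on their span would have to be shown well
  defined first, whereas equal Gram matrices make the relation isometric directly.\<close>

inductive_set pspan :: "('i \<Rightarrow> 'a fn) \<Rightarrow> ('i \<Rightarrow> 'b fn) \<Rightarrow> ('a fn \<times> 'b fn) set"
  for a b where
  zero: "(\<lambda>x. 0, \<lambda>y. 0) \<in> pspan a b"
| step: "(s, t) \<in> pspan a b \<Longrightarrow> (\<lambda>x. s x + c * a i x, \<lambda>y. t y + c * b i y) \<in> pspan a b"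

lemma pspan_lin:
  assumes "(s', t') \<in> pspan a b" "(s, t) \<in> pspan a b"
  shows "(\<lambda>x. s x + c * s' x, \<lambda>y. t y + c * t' y) \<in> pspan a b"
  using assms(1)
proof induction
  case zero then show ?case using assms(2) by simp
next
  case (step s' t' d i)
  from pspan.step[OF step.IH, of "c * d" i] show ?case by (simp add: algebra_simps)
qed

lemma pspan_L2:
  assumes "\<And>i. a i \<in> L2 m" "\<And>i. b i \<in> L2 \<nu>" "(s, t) \<in> pspan a b"
  shows "s \<in> L2 m \<and> t \<in> L2 \<nu>"
  using assms(3) by induction (auto intro!: L2_lin assms(1,2))

lemma pspan_base: "(a i, b i) \<in> pspan a b"
  using pspan.step[OF pspan.zero, of 1 a i b] by simp

text \<open>Sesquilinearity spreads the equality of the Gram matrices to the spans, one argument at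
  a time.\<close>

lemma pspan_ip:
  assumes L: "\<And>i. a i \<in> L2 m" "\<And>i. b i \<in> L2 \<nu>"
    and gram: "\<And>i j. ip m (a i) (a j) = ip \<nu> (b i) (b j)"
    and st: "(s, t) \<in> pspan a b" and st': "(s', t') \<in> pspan a b"
  shows "ip m s s' = ip \<nu> t t'"
proof -
  have 1: "ip m (a i) s' = ip \<nu> (b i) t'" for i
    using st'
  proof induction
    case (step s t c j)
    then show ?case using pspan_L2[of a m b \<nu>, OF L step.hyps] by (simp add: ip_lin_right L gram)
  qed simp
  note L' = pspan_L2[of a m b \<nu>, OF L st']
  show ?thesis using st
  proof induction
    case (step s t c j)
    then show ?case using pspan_L2[of a m b \<nu>, OF L step.hyps] L' by (simp add: ip_lin_left L 1)
  qed simp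
qed

text \<open>Approximate f by span elements and take partners of these in the relation
  \<open>pspan\<close>. The partners form a Cauchy sequence by isometry, and their limit is the
  image.\<close>

lemma unitary_ext_ex:
  assumes L: "\<And>i. a i \<in> L2 m" "\<And>i. b i \<in> L2 \<nu>"
    and gram: "\<And>i j. ip m (a i) (a j) = ip \<nu> (b i) (b j)"
    and tot: "total_L2 m (range a)" and f: "f \<in> L2 m"
  shows "\<exists>k\<in>L2 \<nu>. (\<forall>i. ip \<nu> (b i) k = ip m (a i) f) \<and> l2norm \<nu> k = l2norm m f"
proof -
  define S where "S = Domain (pspan a b)"
  have S: "S \<subseteq> L2 m" using pspan_L2[of a m b \<nu>, OF L] by (auto simp: S_def)
  have a_S: "a i \<in> S" for i using pspan_base[of a i b] by (auto simp: S_def)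
  have totS: "total_L2 m S" using tot a_S unfolding total_L2_def by blast
  have zS: "(\<lambda>x. 0) \<in> S" using pspan.zero[of a b] by (auto simp: S_def)
  have linS: "(\<lambda>x. s x + c * s' x) \<in> S" if "s \<in> S" "s' \<in> S" for s s' c
    using that pspan_lin[of _ _ a b] unfolding S_def by blast
  obtain F where F: "\<forall>n. F n \<in> S" "l2lim m F f"
    using total_imp_approx[OF S zS linS totS f] by blast
  then have "\<forall>n. \<exists>t. (F n, t) \<in> pspan a b" unfolding S_def by blast
  then obtain T where T: "\<And>n. (F n, T n) \<in> pspan a b" by metis
  have FL: "F n \<in> L2 m" "T n \<in> L2 \<nu>" for n using pspan_L2[of a m b \<nu>, OF L T] by auto
  have norm: "l2norm \<nu> t = l2norm m s" if "(s, t) \<in> pspan a b" for s t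
  proof -
    have "ip m s s = ip \<nu> t t" by (rule pspan_ip[of a m b \<nu>, OF L gram that that])
    then have "(l2norm \<nu> t)\<^sup>2 = (l2norm m s)\<^sup>2" unfolding l2norm_sq_Re by simp
    then show ?thesis by (rule power2_eq_imp_eq) auto
  qed
  have normd: "l2norm \<nu> (\<lambda>x. T i x - T j x) = l2norm m (\<lambda>x. F i x - F j x)" for i j
    using norm[OF pspan_lin[OF T T, of i "-1" j]] by (simp add: l2norm_minus_commute)
  have "\<exists>k\<in>L2 \<nu>. l2lim \<nu> T k"
  proof (rule L2_complete[OF FL(2)])
    fix e :: real assume "e > 0"
    then have "\<forall>\<^sub>F n in sequentially. l2norm m (\<lambda>x. F n x - f x) < e / 2"
      using F(2) unfolding l2lim_def by (intro order_tendstoD) auto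
    then obtain N where N: "\<And>n. n \<ge> N \<Longrightarrow> l2norm m (\<lambda>x. F n x - f x) < e / 2"
      unfolding eventually_sequentially by blast
    have "l2norm m (\<lambda>x. F i x - F j x) < e" if "i \<ge> N" "j \<ge> N" for i j
      using l2norm_triangle_sub[OF FL(1) f FL(1), of i j] N[OF that(1)] N[OF that(2)]
        l2norm_minus_commute[of m f "F j"] by linarith
    then show "\<exists>N. \<forall>i\<ge>N. \<forall>j\<ge>N. l2norm \<nu> (\<lambda>x. T i x - T j x) < e"
      unfolding normd by blast
  qed
  then obtain k where k: "k \<in> L2 \<nu>" "l2lim \<nu> T k" by blast
  have "ip \<nu> (b i) k = ip m (a i) f" for i
  proof (rule LIMSEQ_unique)
    show "(\<lambda>n. ip \<nu> (b i) (T n)) \<longlonglongrightarrow> ip \<nu> (b i) k" by (rule l2lim_ip(1)) (use FL k L in auto)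
    have "ip \<nu> (b i) (T n) = ip m (a i) (F n)" for n
      using pspan_ip[of a m b \<nu>, OF L gram pspan_base T] by simp
    then show "(\<lambda>n. ip \<nu> (b i) (T n)) \<longlonglongrightarrow> ip m (a i) f"
      using l2lim_ip(1)[OF FL(1) f L(1) F(2)] by simp
  qed
  moreover have "l2norm \<nu> k = l2norm m f"
  proof (rule LIMSEQ_unique)
    show "(\<lambda>n. l2norm \<nu> (T n)) \<longlonglongrightarrow> l2norm \<nu> k" by (rule l2lim_norm) (use FL k in auto)
    show "(\<lambda>n. l2norm \<nu> (T n)) \<longlonglongrightarrow> l2norm m f"
      using l2lim_norm[OF FL(1) f F(2)] norm[OF T] by simp
  qed
  ultimately show ?thesis using k by blast
qed

text \<open>The conditions on \<open>V\<close> in \<^const>\<open>spec_rep\<close> that do not involve the operator.\<close>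
definition unitary_L2 :: "'a measure \<Rightarrow> 'b measure \<Rightarrow> ('a fn \<Rightarrow> 'b fn) \<Rightarrow> bool" where
  "unitary_L2 m \<nu> V \<longleftrightarrow>
     (\<forall>f\<in>L2 m. V f \<in> L2 \<nu>) \<and>
     (\<forall>f\<in>L2 m. \<forall>g\<in>L2 m. \<forall>a::complex.
        aeq \<nu> (V (\<lambda>x. f x + a * g x)) (\<lambda>y. V f y + a * V g y)) \<and>
     (\<forall>f\<in>L2 m. \<forall>g\<in>L2 m. aeq m f g \<longrightarrow> aeq \<nu> (V f) (V g)) \<and>
     (\<forall>f\<in>L2 m. l2norm \<nu> (V f) = l2norm m f) \<and>
     (\<forall>k\<in>L2 \<nu>. \<exists>f\<in>L2 m. aeq \<nu> (V f) k)"

lemma total_eqI: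
  assumes "total_L2 m (range a)" "\<And>i. a i \<in> L2 m" "f \<in> L2 m" "g \<in> L2 m" "\<And>i. ip m (a i) f = ip m (a i) g"
  shows "aeq m f g"
proof -
  have "aeq m (\<lambda>x. f x - g x) (\<lambda>x. 0)"
    using assms unfolding total_L2_def by (auto simp: ip_diff_right L2_diff)
  then show ?thesis by (simp add: aeq_def)
qed

text \<open>The values \<open>V f\<close> are chosen separately for each f; linearity and
  compatibility with null sets follow because the inner products with the total family b determine
  an element almost everywhere. Surjectivity is the same existence lemma with a and b
  exchanged.\<close>

lemma unitary_ext:
  assumes L: "\<And>i. a i \<in> L2 m" "\<And>i. b i \<in> L2 \<nu>"
    and gram: "\<And>i j. ip m (a i) (a j) = ip \<nu> (b i) (b j)"
    and tot: "total_L2 m (range a)" "total_L2 \<nu> (range b)"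
  shows "\<exists>V. unitary_L2 m \<nu> V \<and> (\<forall>f\<in>L2 m. \<forall>i. ip \<nu> (b i) (V f) = ip m (a i) f)"
proof -
  have "\<forall>f. \<exists>k. f \<in> L2 m \<longrightarrow> k \<in> L2 \<nu> \<and> (\<forall>i. ip \<nu> (b i) k = ip m (a i) f) \<and> l2norm \<nu> k = l2norm m f"
    using unitary_ext_ex[OF L gram tot(1)] by blast
  then obtain V where V: "\<And>f. f \<in> L2 m \<Longrightarrow> V f \<in> L2 \<nu>" "\<And>f i. f \<in> L2 m \<Longrightarrow> ip \<nu> (b i) (V f) = ip m (a i) f"
    "\<And>f. f \<in> L2 m \<Longrightarrow> l2norm \<nu> (V f) = l2norm m f" by metis
  have "unitary_L2 m \<nu> V" unfolding unitary_L2_def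
  proof (intro conjI ballI allI impI)
    fix f g c assume fg: "f \<in> L2 m" "g \<in> L2 m"
    show "aeq \<nu> (V (\<lambda>x. f x + c * g x)) (\<lambda>y. V f y + c * V g y)"
      by (rule total_eqI[OF tot(2) L(2)]) (simp_all add: V fg L2_lin ip_lin_right L)
    assume "aeq m f g"
    then show "aeq \<nu> (V f) (V g)"
      by (intro total_eqI[OF tot(2) L(2)])
         (auto simp: V fg intro!: ip_cong L2_measurable[OF L(1)] fg[THEN L2_measurable], simp add: aeq_def)
  next
    fix k assume k: "k \<in> L2 \<nu>"
    from unitary_ext_ex[OF L(2,1) gram[symmetric] tot(2) k]
    obtain f where f: "f \<in> L2 m" "\<And>i. ip m (a i) f = ip \<nu> (b i) k" by blast
    have "aeq \<nu> (V f) k" by (rule total_eqI[OF tot(2) L(2)]) (simp_all add: V f k)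
    with f show "\<exists>f\<in>L2 m. aeq \<nu> (V f) k" by blast
  qed (simp_all add: V)
  with V show ?thesis by blast
qed

text \<open>Polarization: comparing the norms of \<open>f + c * g\<close> and of its image for c = 1
  and c = \<i> yields the real and the imaginary part.\<close>

lemma unitary_ip:
  fixes m :: "'a measure" and \<nu> :: "'b measure"
  assumes V: "unitary_L2 m \<nu> V" and f: "f \<in> L2 m" and g: "g \<in> L2 m"
  shows "ip \<nu> (V f) (V g) = ip m f g"
proof -
  have VL: "V h \<in> L2 \<nu>" "l2norm \<nu> (V h) = l2norm m h" if "h \<in> L2 m" for h
    using V that by (auto simp: unitary_L2_def)
  have *: "2 * Re (c * ip \<nu> (V f) (V g)) = 2 * Re (c * ip m f g)" for c
  proof -
    have "aeq \<nu> (V (\<lambda>x. f x + c * g x)) (\<lambda>y. V f y + c * V g y)"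
      using V f g by (auto simp: unitary_L2_def)
    then have "l2norm \<nu> (\<lambda>y. V f y + c * V g y) = l2norm \<nu> (V (\<lambda>x. f x + c * g x))"
      by (intro l2norm_cong[symmetric] L2_measurable VL L2_lin f g)
    also have "\<dots> = l2norm m (\<lambda>x. f x + c * g x)" by (rule VL) (intro L2_lin f g)
    finally show ?thesis
      using l2norm_lin_sq[OF f g, of c] l2norm_lin_sq[OF VL(1)[OF f] VL(1)[OF g], of c] VL(2)[OF f] VL(2)[OF g]
      by simp
  qed
  from *[of 1] *[of \<i>] show ?thesis by (simp add: complex_eq_iff)
qed

text \<open>Gram-Schmidt with whole orbits in place of single vectors, \<open>T k f\<close> running
  through the orbit of f. The hypothesis \<open>inv\<close> says that a vector orthogonal to an
  orbit has its own orbit orthogonal to it. Powers of the Cayley transform give cyclic subspaces,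
  the one-element index type gives an orthogonal basis.\<close>

lemma orth_decomp:
  fixes T :: "'k \<Rightarrow> 'a fn \<Rightarrow> 'a fn"
  assumes sep: "separable_L2 m"
    and TL: "\<And>k f. f \<in> L2 m \<Longrightarrow> T k f \<in> L2 m"
    and inv: "\<And>k l f g. f \<in> L2 m \<Longrightarrow> g \<in> L2 m \<Longrightarrow> (\<And>n. ip m (T n f) g = 0) \<Longrightarrow> ip m (T k f) (T l g) = 0"
    and id: "\<And>f. T k0 f = f"
  shows "\<exists>g::nat \<Rightarrow> 'a fn. (\<forall>i. g i \<in> L2 m) \<and> (\<forall>i j k l. i \<noteq> j \<longrightarrow> ip m (T k (g i)) (T l (g j)) = 0) \<and>
     total_L2 m (range (\<lambda>(i, k). T k (g i)))"
proof -
  obtain D where D: "countable D" "D \<subseteq> L2 m" "dense_in_L2 m D" using sep unfolding separable_L2_def by blast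
  from D(3)[unfolded dense_in_L2_def, rule_format, OF L2_zero zero_less_one]
  have "D \<noteq> {}" by fast
  define d where "d = from_nat_into D"
  have dr: "range d = D" unfolding d_def by (rule range_from_nat_into) fact+
  then have dL: "d n \<in> L2 m" for n using D(2) by auto
  \<comment> \<open>\<open>P g k r\<close> says that r is the projection of \<open>d k\<close> onto
    the complement of the orbits of the earlier generators; the last clause makes the remainder
    orthogonal to that complement.\<close>
  define P where "P g k r \<longleftrightarrow> r \<in> L2 m \<and> (\<forall>i<k. \<forall>n. ip m (T n (g i)) r = 0) \<and>
     (\<forall>u\<in>L2 m. (\<forall>i<k. \<forall>n. ip m (T n (g i)) u = 0) \<longrightarrow> ip m u (\<lambda>x. d k x - r x) = 0)"
    for g :: "nat \<Rightarrow> 'a fn" and k r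
  have "\<exists>g. \<forall>k. P g k (g k)"
  proof (rule dependent_wellorder_choice)
    show "P f x r = P g x r" if "\<And>y. y < x \<Longrightarrow> f y = g y" for r f g x
      using that unfolding P_def by simp
    fix k g assume IH: "\<And>j. j < k \<Longrightarrow> P g j (g j)"
    then have gL: "g j \<in> L2 m" if "j < k" for j using that by (auto simp: P_def)
    define S where "S = {u\<in>L2 m. \<forall>i<k. \<forall>n. ip m (T n (g i)) u = 0}"
    have "\<exists>p F. p \<in> L2 m \<and> (\<forall>n. F n \<in> S) \<and> l2lim m F p \<and> (\<forall>s\<in>S. ip m s (\<lambda>x. d k x - p x) = 0)"
      by (rule projection_L2) (auto simp: S_def dL TL gL ip_lin_right)
    then obtain p F where p: "p \<in> L2 m" "\<And>n. F n \<in> S" "l2lim m F p" "\<And>s. s \<in> S \<Longrightarrow> ip m s (\<lambda>x. d k x - p x) = 0" by blast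
    have "ip m (T n (g i)) p = 0" if "i < k" for i n
    proof (rule LIMSEQ_unique)
      show "(\<lambda>j. ip m (T n (g i)) (F j)) \<longlonglongrightarrow> ip m (T n (g i)) p"
        by (rule l2lim_ip) (use p that gL TL in \<open>auto simp: S_def\<close>)
      show "(\<lambda>j. ip m (T n (g i)) (F j)) \<longlonglongrightarrow> 0" using p(2) that by (simp add: S_def)
    qed
    with p have "P g k p" unfolding P_def S_def by blast
    then show "\<exists>r. P g k r" by blast
  qed
  then obtain g where g: "\<And>k. P g k (g k)" by blast
  have gL: "g k \<in> L2 m" for k using g by (auto simp: P_def)
  have less: "ip m (T k (g i)) (T l (g j)) = 0" if "i < j" for i j k l
    by (rule inv) (use g[of j] that in \<open>auto simp: P_def gL\<close>)
  have "ip m (T k (g i)) (T l (g j)) = 0" if "i \<noteq> j" for i j k l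
  proof (cases "i < j")
    case False
    then have "ip m (T l (g j)) (T k (g i)) = 0" using that by (intro less) auto
    then show ?thesis by (subst ip_cnj[symmetric]) simp
  qed (rule less)
  moreover have "total_L2 m (range (\<lambda>(i, k). T k (g i)))"
    unfolding total_L2_def
  proof (intro ballI impI)
    fix f assume f: "f \<in> L2 m" and orth: "\<forall>h\<in>range (\<lambda>(i, k). T k (g i)). ip m h f = 0"
    have o: "ip m (T k (g i)) f = 0" for i k
      by (rule orth[rule_format], rule range_eqI[of _ _ "(i, k)"]) simp
    \<comment> \<open>Being orthogonal to all orbits, f is orthogonal both to \<open>g k\<close>
      and, as an admissible u in \<open>P\<close>, to the remainder
      \<open>d k - g k\<close>.\<close>
    have "ip m (d k) f = 0" for k
    proof -
      have "ip m f (\<lambda>x. d k x - g k x) = 0" using g[of k] f o by (auto simp: P_def)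
      moreover have "ip m (g k) f = 0" using o[of k0 k] by (simp add: id)
      then have "cnj (ip m (g k) f) = 0" by simp
      ultimately have "ip m f (d k) = 0" by (simp add: ip_diff_right f dL gL ip_cnj)
      then show ?thesis by (subst ip_cnj[symmetric]) simp
    qed
    then have "\<forall>g\<in>D. ip m g f = 0" using dr by auto
    then show "aeq m f (\<lambda>x. 0)" using dense_imp_total[OF D(2,3)] f unfolding total_L2_def by blast
  qed
  ultimately show ?thesis using gL by (intro exI[of _ g] conjI allI) blast+
qed

text \<open>Zero vectors are allowed, so that the index set can always be all of \<open>nat\<close>.\<close>
definition onb :: "'a measure \<Rightarrow> (nat \<Rightarrow> 'a fn) \<Rightarrow> bool" where
  "onb m e \<longleftrightarrow> (\<forall>n. e n \<in> L2 m) \<and> (\<forall>i j. i \<noteq> j \<longrightarrow> ip m (e i) (e j) = 0) \<and>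
     (\<forall>n. l2norm m (e n) = 0 \<or> l2norm m (e n) = 1) \<and> total_L2 m (range e)"

lemma onb_exists:
  fixes m :: "'a measure"
  assumes "separable_L2 m" shows "\<exists>e. onb m e"
proof -
  have "\<exists>g::nat \<Rightarrow> 'a fn. (\<forall>i. g i \<in> L2 m) \<and> (\<forall>i j (k::unit) (l::unit). i \<noteq> j \<longrightarrow> ip m (g i) (g j) = 0) \<and>
     total_L2 m (range (\<lambda>(i, k::unit). g i))"
    by (rule orth_decomp[OF assms, of "\<lambda>(k::unit) f. f"]) auto
  then obtain g :: "nat \<Rightarrow> 'a fn" where g: "\<And>i. g i \<in> L2 m" "\<And>i j. i \<noteq> j \<Longrightarrow> ip m (g i) (g j) = 0"
    "total_L2 m (range (\<lambda>(i, k::unit). g i))" by blast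
  \<comment> \<open>Division by zero yields 0, so a null vector \<open>g n\<close> becomes the zero
    vector, which \<open>onb\<close> permits.\<close>
  define c where "c n = complex_of_real (1 / l2norm m (g n))" for n
  define e where "e n = (\<lambda>x. c n * g n x)" for n
  have eL: "e n \<in> L2 m" for n unfolding e_def by (intro L2_scale g)
  have "total_L2 m (range e)" unfolding total_L2_def
  proof (intro ballI impI)
    fix f assume f: "f \<in> L2 m" and o: "\<forall>h\<in>range e. ip m h f = 0"
    have "ip m (g n) f = 0" for n
    proof (cases "l2norm m (g n) = 0")
      case True
      then have "cmod (ip m (g n) f) \<le> 0" using Cauchy_Schwarz_L2[OF g(1)[of n] f] by simp
      then show ?thesis by simp
    next
      case False
      have "ip m (e n) f = 0" using o by blast
      then have "cnj (c n) * ip m (g n) f = 0" unfolding e_def ip_scale_left .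
      then show ?thesis using False by (simp add: c_def)
    qed
    then show "aeq m f (\<lambda>x. 0)" using g(3) f unfolding total_L2_def by auto
  qed
  moreover have "l2norm m (e n) = 0 \<or> l2norm m (e n) = 1" for n
    unfolding e_def l2norm_scale c_def norm_of_real by auto
  ultimately show ?thesis using eL g(2)
    by (intro exI[of _ e]) (auto simp: onb_def e_def ip_scale_left ip_scale_right)
qed

lemma onb_sum_norm:
  assumes e: "onb m e" and A: "finite A"
  shows "(l2norm m (\<lambda>x. \<Sum>n\<in>A. c n * e n x))\<^sup>2 = (\<Sum>n\<in>A. (cmod (c n))\<^sup>2 * (l2norm m (e n))\<^sup>2)"
  using A
proof (induction A rule: finite_induct)
  case empty then show ?case by (simp add: l2norm_def)
next
  case (insert n A)
  have eL: "e n \<in> L2 m" for n using e by (simp add: onb_def)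
  have sL: "(\<lambda>x. \<Sum>n\<in>A. c n * e n x) \<in> L2 m" by (intro L2_sum L2_scale eL)
  have "ip m (\<lambda>x. \<Sum>n\<in>A. c n * e n x) (e n) = (\<Sum>i\<in>A. ip m (\<lambda>x. c i * e i x) (e n))"
    by (rule ip_sum_left) (auto intro: eL)
  also have "\<dots> = 0" using insert e by (intro sum.neutral ballI) (simp add: ip_scale_left onb_def, metis)
  finally have 0: "ip m (\<lambda>x. \<Sum>n\<in>A. c n * e n x) (e n) = 0" .
  have "(\<lambda>x. \<Sum>n\<in>insert n A. c n * e n x) = (\<lambda>x. (\<Sum>n\<in>A. c n * e n x) + c n * e n x)"
    using insert by (auto simp: add.commute)
  then show ?case using insert by (simp add: l2norm_lin_sq[OF sL eL] 0)
qed

lemma riesz_fischer: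
  assumes e: "onb m e" and c: "summable (\<lambda>n. (cmod (c n))\<^sup>2)"
  shows "\<exists>f\<in>L2 m. l2lim m (\<lambda>N x. \<Sum>n<N. c n * e n x) f"
proof (rule L2_complete)
  have eL: "e n \<in> L2 m" for n using e by (simp add: onb_def)
  show "(\<lambda>x. \<Sum>n<N. c n * e n x) \<in> L2 m" for N by (intro L2_sum L2_scale eL)
  fix r :: real assume r: "r > 0"
  then obtain N where N: "\<And>p q. p \<ge> N \<Longrightarrow> norm (\<Sum>n\<in>{p..<q}. (cmod (c n))\<^sup>2) < r\<^sup>2"
    using c unfolding summable_Cauchy by (meson zero_less_power)
  have *: "l2norm m (\<lambda>x. (\<Sum>n<j. c n * e n x) - (\<Sum>n<i. c n * e n x)) < r" if "N \<le> i" "i \<le> j" for i j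
  proof (rule power2_less_imp_less)
    have "{..<j} = {..<i} \<union> {i..<j}" "{..<i} \<inter> {i..<j} = {}" using that by auto
    then have eq: "(\<lambda>x. (\<Sum>n<j. c n * e n x) - (\<Sum>n<i. c n * e n x)) = (\<lambda>x. \<Sum>n\<in>{i..<j}. c n * e n x)"
      by (simp add: sum.union_disjoint)
    have "(l2norm m (\<lambda>x. \<Sum>n\<in>{i..<j}. c n * e n x))\<^sup>2 \<le> (\<Sum>n\<in>{i..<j}. (cmod (c n))\<^sup>2)"
    proof (subst onb_sum_norm[OF e finite_atLeastLessThan], rule sum_mono)
      fix n
      have "l2norm m (e n) = 0 \<or> l2norm m (e n) = 1" using e by (simp add: onb_def)
      then show "(cmod (c n))\<^sup>2 * (l2norm m (e n))\<^sup>2 \<le> (cmod (c n))\<^sup>2" by auto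
    qed
    also have "\<dots> < r\<^sup>2" using N[OF that(1), of j] by simp
    finally show "(l2norm m (\<lambda>x. (\<Sum>n<j. c n * e n x) - (\<Sum>n<i. c n * e n x)))\<^sup>2 < r\<^sup>2" unfolding eq .
  qed (use r in simp)
  have "l2norm m (\<lambda>x. (\<Sum>n<i. c n * e n x) - (\<Sum>n<j. c n * e n x)) < r" if "N \<le> i" "N \<le> j" for i j
    using *[of i j] *[of j i] that by (cases "i \<le> j") (auto simp: l2norm_minus_commute[of m "\<lambda>x. \<Sum>n<i. c n * e n x"])
  then show "\<exists>N. \<forall>i\<ge>N. \<forall>j\<ge>N. l2norm m (\<lambda>x. (\<Sum>n<i. c n * e n x) - (\<Sum>n<j. c n * e n x)) < r" by blast
qed

lemma riesz_fischer_ip: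
  assumes e: "onb m e" and f: "f \<in> L2 m" "l2lim m (\<lambda>N x. \<Sum>n<N. c n * e n x) f" and g: "g \<in> L2 m"
  shows "(\<lambda>n. cnj (c n) * ip m (e n) g) sums ip m f g"
proof -
  have eL: "e n \<in> L2 m" for n using e by (simp add: onb_def)
  have "(\<lambda>N. ip m (\<lambda>x. \<Sum>n<N. c n * e n x) g) \<longlonglongrightarrow> ip m f g"
    by (rule l2lim_ip(2)[OF _ f(1) g f(2)]) (intro L2_sum L2_scale eL)
  moreover have "ip m (\<lambda>x. \<Sum>n<N. c n * e n x) g = (\<Sum>n<N. cnj (c n) * ip m (e n) g)" for N
    by (subst ip_sum_left[OF g]) (auto intro: eL simp: ip_scale_left)
  ultimately show ?thesis by (simp add: sums_def)
qed

text \<open>Bessel's inequality makes the coefficients square summable, so the partial sums have a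
  limit; it has the same coefficients as f and hence equals f by totality. Parseval's identity is
  the limit of the norms of the partial sums.\<close>

lemma onb_expand:
  assumes e: "onb m e" and f: "f \<in> L2 m"
  shows "(\<lambda>n. (cmod (ip m (e n) f))\<^sup>2) sums (l2norm m f)\<^sup>2"
    and "l2lim m (\<lambda>N x. \<Sum>n<N. ip m (e n) f * e n x) f"
proof -
  have eL: "e n \<in> L2 m" for n using e by (simp add: onb_def)
  define c where "c n = ip m (e n) f" for n
  define s where "s N = (\<lambda>x. \<Sum>n<N. c n * e n x)" for N
  have sL: "s N \<in> L2 m" for N unfolding s_def by (intro L2_sum L2_scale eL)
  have n01: "l2norm m (e n) = 0 \<or> l2norm m (e n) = 1" for n using e by (simp add: onb_def)
  have c0: "c n = 0" if "l2norm m (e n) = 0" for n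
    using Cauchy_Schwarz_L2[OF eL[of n] f] that by (simp add: c_def)
  have cn: "(cmod (c n))\<^sup>2 * (l2norm m (e n))\<^sup>2 = (cmod (c n))\<^sup>2" for n
    using n01[of n] c0[of n] by auto
  have sn: "(l2norm m (s N))\<^sup>2 = (\<Sum>n<N. (cmod (c n))\<^sup>2)" for N
    unfolding s_def by (simp add: onb_sum_norm[OF e] cn)
  have sf: "ip m f (s N) = complex_of_real (\<Sum>n<N. (cmod (c n))\<^sup>2)" for N
  proof -
    have "ip m f (s N) = (\<Sum>n<N. c n * ip m f (e n))"
      unfolding s_def by (subst ip_sum_right[OF f]) (auto intro: eL simp: ip_scale_right)
    also have "\<dots> = (\<Sum>n<N. complex_of_real ((cmod (c n))\<^sup>2))"
      by (intro sum.cong refl, subst complex_norm_square) (simp add: c_def ip_cnj)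
    finally show ?thesis by simp
  qed
  have bessel: "(\<Sum>n<N. (cmod (c n))\<^sup>2) \<le> (l2norm m f)\<^sup>2" for N
    using l2norm_lin_sq[OF f sL[of N], of "-1"] sf[of N] sn[of N] zero_le_power2[of "l2norm m (\<lambda>x. f x + - 1 * s N x)"] by simp
  have summ: "summable (\<lambda>n. (cmod (c n))\<^sup>2)"
    by (rule summableI_nonneg_bounded[OF _ bessel]) simp
  obtain p where p: "p \<in> L2 m" "l2lim m s p"
    using riesz_fischer[OF e summ] unfolding s_def by blast
  have "aeq m p f"
  proof (rule total_eqI)
    show "total_L2 m (range e)" using e by (simp add: onb_def)
    fix k
    have "(\<lambda>N. ip m (e k) (s N)) \<longlonglongrightarrow> ip m (e k) p" by (rule l2lim_ip(1)) (use sL p eL in auto)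
    moreover have "ip m (e k) (s N) = c k" if "N > k" for N
    proof -
      have "ip m (e k) (s N) = (\<Sum>n<N. c n * ip m (e k) (e n))"
        unfolding s_def by (subst ip_sum_right[OF eL]) (auto intro: eL simp: ip_scale_right)
      also have "\<dots> = (\<Sum>n<N. if n = k then c k * ip m (e k) (e k) else 0)"
        using e by (intro sum.cong) (auto simp: onb_def)
      also have "\<dots> = c k * ip m (e k) (e k)" using that by simp
      also have "\<dots> = c k" using n01[of k] c0[of k] by (auto simp: ip_self)
      finally show ?thesis .
    qed
    then have "(\<lambda>N. ip m (e k) (s N)) \<longlonglongrightarrow> c k"
      by (intro tendsto_eventually eventually_sequentiallyI[of "Suc k"]) auto
    ultimately show "ip m (e k) p = ip m (e k) f" unfolding c_def by (rule LIMSEQ_unique)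
  qed (rule eL p f)+
  then have "l2norm m (\<lambda>x. s N x - p x) = l2norm m (\<lambda>x. s N x - f x)" for N
    using sL p f by (intro l2norm_cong L2_measurable L2_diff) (auto simp: aeq_def)
  then have lim: "l2lim m s f" using p(2) by (simp add: l2lim_def)
  then show "l2lim m (\<lambda>N x. \<Sum>n<N. ip m (e n) f * e n x) f" unfolding s_def c_def .
  have "(\<lambda>N. (l2norm m (s N))\<^sup>2) \<longlonglongrightarrow> (l2norm m f)\<^sup>2" by (intro tendsto_power l2lim_norm sL f lim)
  then show "(\<lambda>n. (cmod (ip m (e n) f))\<^sup>2) sums (l2norm m f)\<^sup>2" by (simp add: sn sums_def c_def)
qed

section \<open>The Cayley transform of a selfadjoint operator\<close>

lemma sa_is_operator: "selfadjoint m L \<Longrightarrow> is_operator m L"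
  unfolding selfadjoint_def by (rule conjunct1)

lemma sa_L2: assumes "selfadjoint m L" "(u, v) \<in> L" shows "u \<in> L2 m \<and> v \<in> L2 m"
  using sa_is_operator[OF assms(1), unfolded is_operator_def, THEN conjunct1] assms(2) by auto

lemma sa_zero: "selfadjoint m L \<Longrightarrow> (\<lambda>x. 0, \<lambda>x. 0) \<in> L"
  by (drule sa_is_operator) (simp only: is_operator_def)

lemma sa_lin:
  assumes "selfadjoint m L" "(u, v) \<in> L" "(u', v') \<in> L"
  shows "(\<lambda>x. u x + c * u' x, \<lambda>x. v x + c * v' x) \<in> L"
  using sa_is_operator[OF assms(1), unfolded is_operator_def, THEN conjunct2, THEN conjunct2, THEN conjunct1,
      rule_format, OF assms(2,3)] .

lemma sa_cong:
  assumes "selfadjoint m L" "(u, v) \<in> L" "u' \<in> L2 m" "v' \<in> L2 m" "aeq m u u'" "aeq m v v'"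
  shows "(u', v') \<in> L"
  using sa_is_operator[OF assms(1), unfolded is_operator_def, THEN conjunct2, THEN conjunct2, THEN conjunct2,
      THEN conjunct1, rule_format, OF assms(2-)] .

lemma sa_sym:
  assumes sa: "selfadjoint m L" and "(u, v) \<in> L" "(u', v') \<in> L"
  shows "ip m u v' = ip m v u'"
proof -
  have "(u, v) \<in> adjoint_op m L" using sa assms(2) unfolding selfadjoint_def by simp
  then show ?thesis using assms(3) unfolding adjoint_op_def by blast
qed

lemma sa_closedI:
  assumes sa: "selfadjoint m L" and "u \<in> L2 m" "v \<in> L2 m" "\<And>u' v'. (u', v') \<in> L \<Longrightarrow> ip m u v' = ip m v u'"
  shows "(u, v) \<in> L"
proof -
  have "(u, v) \<in> adjoint_op m L" using assms unfolding adjoint_op_def by blast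
  then show ?thesis using sa unfolding selfadjoint_def by simp
qed

text \<open>The sign is kept variable so that one set of lemmas covers both the Cayley transform and
  its inverse.\<close>

definition imag_unit :: "complex \<Rightarrow> bool" where
  "imag_unit a \<longleftrightarrow> a = \<i> \<or> a = - \<i>"

lemma imag_unit_simps:
  assumes "imag_unit a" shows "cnj a = - a" "Re a = 0" "cmod a = 1" "a * a = -1" "imag_unit (- a)" "a \<noteq> 0"
  using assms by (auto simp: imag_unit_def)

text \<open>The inner product of v with u is real by symmetry and a is imaginary, so the mixed term
  has no real part.\<close>

lemma sa_norm:
  assumes sa: "selfadjoint m L" and uv: "(u, v) \<in> L" and a: "imag_unit a"
  shows "(l2norm m (\<lambda>x. v x + a * u x))\<^sup>2 = (l2norm m v)\<^sup>2 + (l2norm m u)\<^sup>2"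
proof -
  have L: "u \<in> L2 m" "v \<in> L2 m" using sa_L2[OF sa uv] by auto
  have "cnj (ip m v u) = ip m v u" using sa_sym[OF sa uv uv] by (simp add: ip_cnj)
  then have "Im (ip m v u) = 0" by (simp add: complex_eq_iff)
  then have "Re (a * ip m v u) = 0" using imag_unit_simps[OF a] by simp
  then show ?thesis using l2norm_lin_sq[OF L(2,1), of a] imag_unit_simps[OF a] by simp
qed

text \<open>The basic criterion of selfadjointness. The range of L - a is dense because a vector
  orthogonal to it would be an eigenvector of L with a nonreal eigenvalue; it is closed because
  \<open>sa_norm\<close> makes both u and v converge along with \<open>v - a * u\<close>, and an
  adjoint has a closed graph.\<close>

lemma sa_range:
  assumes sa: "selfadjoint m L" and a: "imag_unit a" and f: "f \<in> L2 m"
  shows "\<exists>u v. (u, v) \<in> L \<and> aeq m f (\<lambda>x. v x - a * u x)"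
proof -
  have a': "imag_unit (- a)" by (rule imag_unit_simps(5)[OF a])
  define S where "S = {(\<lambda>x. v x - a * u x) | u v. (u, v) \<in> L}"
  have SL: "S \<subseteq> L2 m"
  proof
    fix s assume "s \<in> S"
    then obtain u v where uv: "(u, v) \<in> L" and s: "s = (\<lambda>x. v x - a * u x)" by (auto simp: S_def)
    show "s \<in> L2 m" unfolding s using sa_L2[OF sa uv] by (intro L2_diff L2_scale) auto
  qed
  have S0: "(\<lambda>x. 0) \<in> S" unfolding S_def using sa_zero[OF sa] by (intro CollectI exI[of _ "\<lambda>x. 0"]) simp
  have lin: "(\<lambda>x. s x + c * t x) \<in> S" if "s \<in> S" "t \<in> S" for s t c
  proof -
    obtain u v u' v' where uv: "(u, v) \<in> L" "(u', v') \<in> L"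
      and s: "s = (\<lambda>x. v x - a * u x)" "t = (\<lambda>x. v' x - a * u' x)" using \<open>s \<in> S\<close> \<open>t \<in> S\<close> by (auto simp: S_def)
    have eq: "(\<lambda>x. s x + c * t x) = (\<lambda>x. (v x + c * v' x) - a * (u x + c * u' x))"
      unfolding s by (simp add: algebra_simps)
    show ?thesis unfolding S_def
      by (rule CollectI, rule exI[of _ "\<lambda>x. u x + c * u' x"], rule exI[of _ "\<lambda>x. v x + c * v' x"],
          rule conjI[OF eq sa_lin[OF sa uv]])
  qed
  obtain p F where p: "p \<in> L2 m" "\<And>n. F n \<in> S" "l2lim m F p" "\<And>s. s \<in> S \<Longrightarrow> ip m s (\<lambda>x. f x - p x) = 0"
    using projection_L2[OF SL S0 lin f] by blast
  define q where "q = (\<lambda>x. f x - p x)"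
  have qL: "q \<in> L2 m" unfolding q_def by (intro L2_diff f p)
  have qaL: "(\<lambda>x. (- a) * q x) \<in> L2 m" by (intro L2_scale qL)
  \<comment> \<open>Orthogonality to the range means that q lies in the domain of the adjoint, with
    eigenvalue \<open>cnj a = - a\<close>.\<close>
  have "(q, \<lambda>x. (- a) * q x) \<in> L"
  proof (rule sa_closedI[OF sa qL qaL])
    fix u v assume uv: "(u, v) \<in> L"
    then have "(\<lambda>x. v x - a * u x) \<in> S" by (auto simp: S_def)
    then have "ip m (\<lambda>x. v x + (- a) * u x) q = 0" using p(4) by (simp add: q_def)
    then have "ip m v q - cnj a * ip m u q = 0" using sa_L2[OF sa uv] qL by (simp only: ip_lin_left complex_cnj_minus) simp
    then have "cnj (ip m v q) = cnj (cnj a * ip m u q)" by simp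
    then show "ip m q v = ip m (\<lambda>x. (- a) * q x) u"
      by (simp only: ip_cnj complex_cnj_mult complex_cnj_cnj ip_scale_left complex_cnj_minus imag_unit_simps(1)[OF a] minus_minus)
  qed
  \<comment> \<open>Symmetry of L at the eigenvector q identifies the eigenvalue with its conjugate,
    up to the factor \<open>ip m q q\<close>.\<close>
  from sa_sym[OF sa this this] have "(- a) * ip m q q = cnj (- a) * ip m q q"
    by (simp only: ip_scale_right ip_scale_left)
  then have "a * ip m q q = 0" using imag_unit_simps(1)[OF a] by simp
  then have "aeq m q (\<lambda>x. 0)" using imag_unit_simps(6)[OF a] by (intro ip_self_eq_0 qL) simp
  then have fp: "aeq m f p" by (simp add: aeq_def q_def)
  have "\<forall>n. \<exists>u v. (u, v) \<in> L \<and> F n = (\<lambda>x. v x - a * u x)" using p(2) unfolding S_def by blast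
  then obtain u v where uv: "\<And>n. (u n, v n) \<in> L" "\<And>n. F n = (\<lambda>x. v n x - a * u n x)" by metis
  have L: "u n \<in> L2 m" "v n \<in> L2 m" for n using sa_L2[OF sa uv(1)] by auto
  have FL: "F n \<in> L2 m" for n using p(2) SL by blast
  \<comment> \<open>\<open>sa_norm\<close> applied to differences with the opposite sign of a: the
    sequences u and v are Cauchy as soon as F is.\<close>
  have nrm: "(l2norm m (\<lambda>x. v i x - v j x))\<^sup>2 + (l2norm m (\<lambda>x. u i x - u j x))\<^sup>2 = (l2norm m (\<lambda>x. F i x - F j x))\<^sup>2" for i j
  proof -
    have "(\<lambda>x. u i x + (-1) * u j x, \<lambda>x. v i x + (-1) * v j x) \<in> L" by (rule sa_lin[OF sa uv(1) uv(1)])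
    from sa_norm[OF sa this a'] show ?thesis by (simp add: uv(2) algebra_simps)
  qed
  have cau: "\<exists>N. \<forall>i\<ge>N. \<forall>j\<ge>N. l2norm m (\<lambda>x. F i x - F j x) < e" if "e > 0" for e
  proof -
    have "\<forall>\<^sub>F n in sequentially. l2norm m (\<lambda>x. F n x - p x) < e / 2"
      using p(3) that unfolding l2lim_def by (intro order_tendstoD) auto
    then obtain N where N: "\<And>n. n \<ge> N \<Longrightarrow> l2norm m (\<lambda>x. F n x - p x) < e / 2"
      unfolding eventually_sequentially by blast
    have "l2norm m (\<lambda>x. F i x - F j x) < e" if "i \<ge> N" "j \<ge> N" for i j
      using l2norm_triangle_sub[OF FL p(1) FL, of i j] N[OF that(1)] N[OF that(2)]
        l2norm_minus_commute[of m p "F j"] by linarith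
    then show ?thesis by blast
  qed
  have le1: "l2norm m (\<lambda>x. v i x - v j x) \<le> l2norm m (\<lambda>x. F i x - F j x)"
    and le2: "l2norm m (\<lambda>x. u i x - u j x) \<le> l2norm m (\<lambda>x. F i x - F j x)" for i j
    using nrm[of i j] zero_le_power2[of "l2norm m (\<lambda>x. u i x - u j x)"] zero_le_power2[of "l2norm m (\<lambda>x. v i x - v j x)"]
    by (intro power2_le_imp_le[OF _ l2norm_nonneg], linarith)+
  obtain v0 where v0: "v0 \<in> L2 m" "l2lim m v v0"
    using L2_complete[of v m] L(2) cau le1 by (meson le_less_trans)
  obtain u0 where u0: "u0 \<in> L2 m" "l2lim m u u0"
    using L2_complete[of u m] L(1) cau le2 by (meson le_less_trans)
  have "(u0, v0) \<in> L"
  proof (rule sa_closedI[OF sa u0(1) v0(1)])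
    fix u' v' assume uv': "(u', v') \<in> L"
    then have L': "u' \<in> L2 m" "v' \<in> L2 m" using sa_L2[OF sa] by auto
    have "(\<lambda>n. ip m (u n) v') \<longlonglongrightarrow> ip m u0 v'" by (rule l2lim_ip(2)[OF L(1) u0(1) L'(2) u0(2)])
    moreover have "(\<lambda>n. ip m (v n) u') \<longlonglongrightarrow> ip m v0 u'" by (rule l2lim_ip(2)[OF L(2) v0(1) L'(1) v0(2)])
    moreover have "ip m (u n) v' = ip m (v n) u'" for n by (rule sa_sym[OF sa uv(1) uv'])
    ultimately show "ip m u0 v' = ip m v0 u'" by (simp add: LIMSEQ_unique)
  qed
  moreover have "aeq m f (\<lambda>x. v0 x - a * u0 x)"
  proof -
    have vL: "(\<lambda>x. v0 x - a * u0 x) \<in> L2 m" by (intro L2_diff L2_scale v0 u0)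
    have "(\<lambda>n. l2norm m (\<lambda>x. F n x - (v0 x - a * u0 x))) \<longlonglongrightarrow> 0"
    proof (rule Lim_null_comparison)
      show "(\<lambda>n. l2norm m (\<lambda>x. v n x - v0 x) + l2norm m (\<lambda>x. u n x - u0 x)) \<longlonglongrightarrow> 0"
        using tendsto_add[OF v0(2)[unfolded l2lim_def] u0(2)[unfolded l2lim_def]] by simp
      have "l2norm m (\<lambda>x. F n x - (v0 x - a * u0 x)) \<le> l2norm m (\<lambda>x. v n x - v0 x) + l2norm m (\<lambda>x. u n x - u0 x)" for n
      proof -
        have "(\<lambda>x. F n x - (v0 x - a * u0 x)) = (\<lambda>x. (v n x - v0 x) + (- a) * (u n x - u0 x))"
          by (auto simp: uv(2) algebra_simps)
        moreover have "l2norm m (\<lambda>x. (v n x - v0 x) + (- a) * (u n x - u0 x))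
          \<le> l2norm m (\<lambda>x. v n x - v0 x) + l2norm m (\<lambda>x. (- a) * (u n x - u0 x))"
          by (rule l2norm_triangle) (intro L2_diff L2_scale L v0 u0)+
        moreover have "l2norm m (\<lambda>x. (- a) * (u n x - u0 x)) = l2norm m (\<lambda>x. u n x - u0 x)"
          by (simp only: l2norm_scale norm_minus_cancel imag_unit_simps(3)[OF a] mult_1)
        ultimately show ?thesis by simp
      qed
      then show "\<forall>\<^sub>F n in sequentially. norm (l2norm m (\<lambda>x. F n x - (v0 x - a * u0 x))) \<le> l2norm m (\<lambda>x. v n x - v0 x) + l2norm m (\<lambda>x. u n x - u0 x)"
        by simp
    qed
    then have "(\<lambda>n. l2norm m (\<lambda>x. F n x - (v0 x - a * u0 x)) + l2norm m (\<lambda>x. F n x - p x)) \<longlonglongrightarrow> 0 + 0"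
      using p(3) unfolding l2lim_def by (rule tendsto_add)
    moreover have "l2norm m (\<lambda>x. p x - (v0 x - a * u0 x)) \<le> l2norm m (\<lambda>x. F n x - (v0 x - a * u0 x)) + l2norm m (\<lambda>x. F n x - p x)" for n
      using l2norm_triangle_sub[OF p(1) FL vL, of n] l2norm_minus_commute[of m p "F n"] by linarith
    ultimately have "l2norm m (\<lambda>x. p x - (v0 x - a * u0 x)) \<le> 0 + 0"
      by (intro LIMSEQ_le_const) auto
    then have "l2norm m (\<lambda>x. p x - (v0 x - a * u0 x)) = 0"
      using l2norm_nonneg[of m "\<lambda>x. p x - (v0 x - a * u0 x)"] by linarith
    then have "aeq m (\<lambda>x. p x - (v0 x - a * u0 x)) (\<lambda>x. 0)"
      by (subst (asm) l2norm_eq_0_iff) (intro L2_diff p vL)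
    with fp show ?thesis unfolding aeq_def by eventually_elim simp
  qed
  ultimately show ?thesis by blast
qed

text \<open>L is a relation between representatives, so a pair solving \<open>f = v - a * u\<close>
  is chosen; different choices agree only almost everywhere, which is why every law below is stated
  with \<open>aeq\<close> or through inner products.\<close>

definition cayley :: "'a measure \<Rightarrow> 'a op \<Rightarrow> complex \<Rightarrow> 'a fn \<Rightarrow> 'a fn" where
  "cayley m L a f = (let p = (SOME p. p \<in> L \<and> aeq m f (\<lambda>x. snd p x - a * fst p x)) in (\<lambda>x. snd p x + a * fst p x))"

lemma cayley_ex:
  assumes sa: "selfadjoint m L" and a: "imag_unit a" and f: "f \<in> L2 m"
  shows "\<exists>u v. (u, v) \<in> L \<and> aeq m f (\<lambda>x. v x - a * u x) \<and> cayley m L a f = (\<lambda>x. v x + a * u x)"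
proof -
  have "\<exists>p. p \<in> L \<and> aeq m f (\<lambda>x. snd p x - a * fst p x)" using sa_range[OF assms] by force
  from someI_ex[OF this] show ?thesis
    unfolding cayley_def Let_def
    by (intro exI[of _ "fst (SOME p. p \<in> L \<and> aeq m f (\<lambda>x. snd p x - a * fst p x))"]
         exI[of _ "snd (SOME p. p \<in> L \<and> aeq m f (\<lambda>x. snd p x - a * fst p x))"]) simp
qed

lemma sa_unique:
  assumes sa: "selfadjoint m L" and a: "imag_unit a" and uv: "(u, v) \<in> L" "(u', v') \<in> L"
    and eq: "aeq m (\<lambda>x. v x - a * u x) (\<lambda>x. v' x - a * u' x)"
  shows "aeq m u u'" "aeq m v v'"
proof -
  have a': "imag_unit (- a)" by (rule imag_unit_simps(5)[OF a])
  note L = sa_L2[OF sa uv(1)] sa_L2[OF sa uv(2)]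
  have d: "(\<lambda>x. u x + (-1) * u' x, \<lambda>x. v x + (-1) * v' x) \<in> L" by (rule sa_lin[OF sa uv])
  note dL = sa_L2[OF sa d]
  have "aeq m (\<lambda>x. (v x + (-1) * v' x) + (- a) * (u x + (-1) * u' x)) (\<lambda>x. 0)"
    using eq unfolding aeq_def by eventually_elim (simp add: algebra_simps)
  moreover have "(\<lambda>x. (v x + (-1) * v' x) + (- a) * (u x + (-1) * u' x)) \<in> L2 m" using L by (intro L2_lin) auto
  ultimately have "l2norm m (\<lambda>x. (v x + (-1) * v' x) + (- a) * (u x + (-1) * u' x)) = 0"
    by (subst l2norm_eq_0_iff)
  then have "(l2norm m (\<lambda>x. v x + (-1) * v' x))\<^sup>2 + (l2norm m (\<lambda>x. u x + (-1) * u' x))\<^sup>2 = 0"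
    using sa_norm[OF sa d a'] by simp
  then have "l2norm m (\<lambda>x. v x + (-1) * v' x) = 0" "l2norm m (\<lambda>x. u x + (-1) * u' x) = 0"
    by (simp_all only: sum_power2_eq_zero_iff)
  then have "aeq m (\<lambda>x. v x + (-1) * v' x) (\<lambda>x. 0)" "aeq m (\<lambda>x. u x + (-1) * u' x) (\<lambda>x. 0)"
    using dL l2norm_eq_0_iff by blast+
  then show "aeq m u u'" "aeq m v v'" by (auto simp: aeq_def)
qed

lemma cayley_eq:
  assumes sa: "selfadjoint m L" and a: "imag_unit a" and f: "f \<in> L2 m" and uv: "(u, v) \<in> L"
    and eq: "aeq m f (\<lambda>x. v x - a * u x)"
  shows "aeq m (cayley m L a f) (\<lambda>x. v x + a * u x)"
proof -
  obtain u' v' where uv': "(u', v') \<in> L" "aeq m f (\<lambda>x. v' x - a * u' x)" "cayley m L a f = (\<lambda>x. v' x + a * u' x)"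
    using cayley_ex[OF sa a f] by blast
  have "aeq m (\<lambda>x. v' x - a * u' x) (\<lambda>x. v x - a * u x)"
    using eq uv'(2) unfolding aeq_def by eventually_elim simp
  from sa_unique[OF sa a uv'(1) uv this] show ?thesis
    unfolding uv'(3) aeq_def by eventually_elim simp
qed

lemma cayley_L2:
  assumes sa: "selfadjoint m L" and a: "imag_unit a" and f: "f \<in> L2 m"
  shows "cayley m L a f \<in> L2 m"
proof -
  obtain u v where uv: "(u, v) \<in> L" "cayley m L a f = (\<lambda>x. v x + a * u x)" using cayley_ex[OF assms] by blast
  then show ?thesis using sa_L2[OF sa uv(1)] by (auto intro: L2_lin)
qed

text \<open>Before and after the transform the inner product equals
  \<open>ip m v v' + ip m u u'\<close>: the mixed terms cancel by symmetry of L, and the change of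
  sign of a does not affect the rest.\<close>

lemma cayley_isometry:
  assumes sa: "selfadjoint m L" and a: "imag_unit a" and f: "f \<in> L2 m" and g: "g \<in> L2 m"
  shows "ip m (cayley m L a f) (cayley m L a g) = ip m f g"
proof -
  obtain u v where uv: "(u, v) \<in> L" "aeq m f (\<lambda>x. v x - a * u x)" "cayley m L a f = (\<lambda>x. v x + a * u x)"
    using cayley_ex[OF sa a f] by blast
  obtain u' v' where uv': "(u', v') \<in> L" "aeq m g (\<lambda>x. v' x - a * u' x)" "cayley m L a g = (\<lambda>x. v' x + a * u' x)"
    using cayley_ex[OF sa a g] by blast
  note L = sa_L2[OF sa uv(1)] sa_L2[OF sa uv'(1)]
  have "ip m f g = ip m (\<lambda>x. v x + (- a) * u x) (\<lambda>x. v' x + (- a) * u' x)"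
    using uv(2) uv'(2) L f g by (intro ip_cong L2_measurable L2_lin) auto
  also have "\<dots> = ip m v v' + ip m u u'"
    using L sa_sym[OF sa uv(1) uv'(1)] imag_unit_simps[OF a]
    by (simp only: ip_lin_left ip_lin_right L2_lin) (simp add: algebra_simps flip: mult.assoc)
  also have "\<dots> = ip m (\<lambda>x. v x + a * u x) (\<lambda>x. v' x + a * u' x)"
    using L sa_sym[OF sa uv(1) uv'(1)] imag_unit_simps[OF a]
    by (simp only: ip_lin_left ip_lin_right L2_lin) (simp add: algebra_simps flip: mult.assoc)
  finally show ?thesis using uv uv' by simp
qed

lemma cayley_inverse:
  assumes sa: "selfadjoint m L" and a: "imag_unit a" and f: "f \<in> L2 m"
  shows "aeq m (cayley m L (- a) (cayley m L a f)) f"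
proof -
  have a': "imag_unit (- a)" by (rule imag_unit_simps(5)[OF a])
  obtain u v where uv: "(u, v) \<in> L" "aeq m f (\<lambda>x. v x - a * u x)" "cayley m L a f = (\<lambda>x. v x + a * u x)"
    using cayley_ex[OF sa a f] by blast
  have "aeq m (cayley m L (- a) (cayley m L a f)) (\<lambda>x. v x + (- a) * u x)"
    by (rule cayley_eq[OF sa a' cayley_L2[OF sa a f] uv(1)]) (simp add: uv(3) aeq_def)
  with uv(2) show ?thesis unfolding aeq_def by eventually_elim simp
qed

text \<open>Two-sided powers are needed so that the orbit of a vector is invariant under the adjoint
  as well; only then does the complement of a cyclic subspace consist of whole orbits.\<close>

definition cpow :: "'a measure \<Rightarrow> 'a op \<Rightarrow> int \<Rightarrow> 'a fn \<Rightarrow> 'a fn" where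
  "cpow m L n f = (if n \<ge> 0 then (cayley m L \<i> ^^ nat n) f else (cayley m L (- \<i>) ^^ nat (- n)) f)"

lemma cpow_0 [simp]: "cpow m L 0 f = f"
  by (simp add: cpow_def)

context
  fixes m :: "'a measure" and L :: "'a op"
  assumes sa: "selfadjoint m L"
begin

lemma imag_unit_i: "imag_unit \<i>" "imag_unit (- \<i>)"
  by (auto simp: imag_unit_def)

lemma cpow_L2: "f \<in> L2 m \<Longrightarrow> cpow m L n f \<in> L2 m"
proof -
  assume f: "f \<in> L2 m"
  have "(cayley m L a ^^ k) f \<in> L2 m" if "imag_unit a" for a k
    using that f by (induction k) (auto intro: cayley_L2[OF sa])
  then show ?thesis using imag_unit_i by (simp add: cpow_def)
qed

text \<open>For negative n the transform cancels one factor of its inverse, and this cancellation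
  holds only up to a null set.\<close>

lemma cpow_Suc:
  assumes f: "f \<in> L2 m"
  shows "aeq m (cayley m L \<i> (cpow m L n f)) (cpow m L (n + 1) f)"
proof (cases "n \<ge> 0")
  case True
  then have "nat (n + 1) = Suc (nat n)" by simp
  then show ?thesis using True by (simp add: cpow_def aeq_def)
next
  case False
  then obtain k where k: "nat (- n) = Suc k" "nat (- (n + 1)) = k" by (cases "nat (- n)") auto
  have eq: "cpow m L (n + 1) f = (cayley m L (- \<i>) ^^ k) f"
    using False k by (cases "n + 1 = 0") (auto simp: cpow_def)
  have "cpow m L n f = cayley m L (- \<i>) (cpow m L (n + 1) f)"
    unfolding eq using False k by (simp add: cpow_def)
  then show ?thesis using cayley_inverse[OF sa imag_unit_i(2) cpow_L2[OF f, of "n + 1"]] by simp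
qed

lemma cpow_shift1:
  assumes "f \<in> L2 m" "g \<in> L2 m"
  shows "ip m (cpow m L (n + 1) f) (cpow m L (k + 1) g) = ip m (cpow m L n f) (cpow m L k g)"
proof -
  have "ip m (cpow m L (n + 1) f) (cpow m L (k + 1) g)
     = ip m (cayley m L \<i> (cpow m L n f)) (cayley m L \<i> (cpow m L k g))"
    using cpow_Suc[OF assms(1), of n] cpow_Suc[OF assms(2), of k]
    by (intro ip_cong[symmetric] L2_measurable cayley_L2[OF sa imag_unit_i(1)] cpow_L2 assms)
  then show ?thesis using cayley_isometry[OF sa imag_unit_i(1) cpow_L2[OF assms(1)] cpow_L2[OF assms(2)]] by simp
qed

lemma cpow_shift:
  assumes "f \<in> L2 m" "g \<in> L2 m"
  shows "ip m (cpow m L (n + int j) f) (cpow m L (k + int j) g) = ip m (cpow m L n f) (cpow m L k g)"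
proof (induction j)
  case (Suc j)
  then show ?case using cpow_shift1[OF assms, of "n + int j" "k + int j"] by (simp add: ac_simps)
qed simp

lemma cpow_ip:
  assumes "f \<in> L2 m" "g \<in> L2 m"
  shows "ip m (cpow m L n f) (cpow m L k g) = ip m f (cpow m L (k - n) g)"
  using cpow_shift[OF assms, of 0 "nat n" "k - n"] cpow_shift[OF assms, of n "nat (- n)" k]
  by (cases "n \<ge> 0") simp_all

lemma cpow_adjoint:
  assumes "f \<in> L2 m" "g \<in> L2 m"
  shows "ip m f (cpow m L n g) = ip m (cpow m L (- n) f) g"
  using cpow_ip[OF assms, of "- n" 0] by simp

end

text \<open>The power on g can be moved to f, so orthogonality of g to the two-sided orbit of f
  passes to the whole orbit of g.\<close>

lemma cayley_decomp:
  fixes m :: "'a measure"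
  assumes "separable_L2 m" and sa: "selfadjoint m L"
  shows "\<exists>g::nat \<Rightarrow> 'a fn. (\<forall>i. g i \<in> L2 m) \<and>
     (\<forall>i j k l. i \<noteq> j \<longrightarrow> ip m (cpow m L k (g i)) (cpow m L l (g j)) = 0) \<and>
     total_L2 m (range (\<lambda>(i, k). cpow m L k (g i)))"
proof (rule orth_decomp[OF assms(1), of "cpow m L" 0])
  fix k l f g assume f: "f \<in> L2 m" and g: "g \<in> L2 m" and z: "\<And>n. ip m (cpow m L n f) g = 0"
  have "ip m (cpow m L k f) (cpow m L l g) = ip m (cpow m L (- (l - k)) f) g"
    using cpow_ip[OF sa f g, of k l] cpow_adjoint[OF sa f g, of "l - k"] by simp
  then show "ip m (cpow m L k f) (cpow m L l g) = 0" using z by simp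
qed (auto intro: cpow_L2[OF sa])

section \<open>Measures are determined by their Cayley moments\<close>

text \<open>The line is mapped injectively into the unit circle; the point 1 is not attained and
  corresponds to t = infinity.\<close>

definition cay :: "real \<Rightarrow> complex" where
  "cay t = (complex_of_real t + \<i>) / (complex_of_real t - \<i>)"

lemma cay_denom: "complex_of_real t - \<i> \<noteq> 0" "complex_of_real t + \<i> \<noteq> 0"
  by (auto simp: complex_eq_iff)

lemma norm_cay [simp]: "cmod (cay t) = 1"
proof -
  have "cmod (complex_of_real t + \<i>) = cmod (complex_of_real t - \<i>)"
    by (simp add: cmod_def)
  then show ?thesis using cay_denom[of t] by (simp add: cay_def norm_divide)
qed

lemma cay_nonzero [simp]: "cay t \<noteq> 0"
  using norm_cay[of t] by (metis norm_zero zero_neq_one)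

lemma cay_cnj: "cnj (cay t) * cay t = 1" "cay t * cnj (cay t) = 1"
  using complex_norm_square[of "cay t"] by (simp_all add: mult.commute)

lemma inverse_cay: "inverse (cay t) = cnj (cay t)"
  using cay_cnj[of t] by (metis cay_nonzero inverse_unique)

lemma cay_inverse: "\<i> * (cay t + 1) / (cay t - 1) = complex_of_real t"
  using cay_denom[of t] by (simp add: cay_def divide_simps)

lemma inj_cay: "inj cay"
  by (rule injI) (metis cay_inverse of_real_eq_iff)

lemma continuous_on_cay [continuous_intros]: "continuous_on A f \<Longrightarrow> continuous_on A (\<lambda>x. cay (f x))"
  unfolding cay_def by (intro continuous_intros ballI cay_denom(1))

lemma measurable_cay [measurable]: "cay \<in> borel_measurable borel"
  by (intro borel_measurable_continuous_onI continuous_intros)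

lemma cay_sphere: "cay t \<in> sphere 0 1"
  by simp

lemma integrable_on_circle:
  assumes "finite_measure \<mu>" "sets \<mu> = sets borel" "continuous_on (sphere 0 1) r"
  shows "integrable \<mu> (\<lambda>t. (r (cay t) :: 'b :: {banach, second_countable_topology}))"
proof -
  interpret finite_measure \<mu> by fact
  note [measurable_cong] = assms(2)
  have "compact (r ` sphere 0 1)" by (intro compact_continuous_image assms compact_sphere)
  from compact_imp_bounded[OF this] obtain B where "\<forall>x\<in>r ` sphere 0 1. norm x \<le> B"
    unfolding bounded_iff ..
  then have B: "norm (r z) \<le> B" if "z \<in> sphere 0 1" for z using that by blast
  have "continuous_on UNIV (\<lambda>t. r (cay t))"
    by (rule continuous_on_compose2[OF assms(3) continuous_on_cay[OF continuous_on_id]]) auto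
  then have "(\<lambda>t. r (cay t)) \<in> borel_measurable borel" by (rule borel_measurable_continuous_onI)
  then have "(\<lambda>t. r (cay t)) \<in> borel_measurable \<mu>" using assms(2) by (simp cong: measurable_cong_sets)
  then show ?thesis by (intro integrable_const_bound[of _ B] AE_I2 B cay_sphere)
qed

context
  fixes \<mu>1 \<mu>2 :: "real measure"
  assumes fin: "finite_measure \<mu>1" "finite_measure \<mu>2"
    and sets: "sets \<mu>1 = sets borel" "sets \<mu>2 = sets borel"
    and mom: "\<And>n::nat. (\<integral>t. cay t ^ n \<partial>\<mu>1) = (\<integral>t. cay t ^ n \<partial>\<mu>2)"
begin

text \<open>Quantifying over all monomial factors makes the class stable under multiplication by \<open>z\<close> and \<open>cnj z\<close>,
  hence by real polynomials, which are dense by Stone-Weierstrass.\<close>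
definition moment_class :: "(complex \<Rightarrow> complex) set" where
  "moment_class = {r. continuous_on (sphere 0 1) r \<and>
     (\<forall>n k. (\<integral>t. cay t ^ n * cnj (cay t) ^ k * r (cay t) \<partial>\<mu>1) = (\<integral>t. cay t ^ n * cnj (cay t) ^ k * r (cay t) \<partial>\<mu>2))}"

lemma moment_class_integrable:
  assumes "r \<in> moment_class"
  shows "integrable \<mu>1 (\<lambda>t. cay t ^ n * cnj (cay t) ^ k * r (cay t))"
    "integrable \<mu>2 (\<lambda>t. cay t ^ n * cnj (cay t) ^ k * r (cay t))"
  using assms
  by (auto intro!: integrable_on_circle[of _ "\<lambda>z. z ^ n * cnj z ^ k * r z"] fin sets continuous_intros simp: moment_class_def)

text \<open>On the circle z times its conjugate is 1, so a mixed monomial reduces to a power of z or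
  to the conjugate of one, whose integral is the conjugate moment. Thus equality of the nonnegative
  moments suffices to start the class.\<close>

lemma moment_class_1: "(\<lambda>_. 1) \<in> moment_class"
  unfolding moment_class_def
proof (intro CollectI conjI allI)
  fix n k :: nat
  have *: "(\<integral>t. cay t ^ n * cnj (cay t) ^ k * 1 \<partial>\<mu>) =
     (if k \<le> n then (\<integral>t. cay t ^ (n - k) \<partial>\<mu>) else cnj (\<integral>t. cay t ^ (k - n) \<partial>\<mu>))" for \<mu>
  proof (cases "k \<le> n")
    case True
    have "cay t ^ n * cnj (cay t) ^ k * 1 = cay t ^ (n - k)" for t
    proof -
      have "cay t ^ n = cay t ^ (n - k) * cay t ^ k" using True by (simp flip: power_add)
      then have "cay t ^ n * cnj (cay t) ^ k = cay t ^ (n - k) * (cay t * cnj (cay t)) ^ k"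
        by (simp only: power_mult_distrib mult.assoc)
      then show ?thesis by (simp add: cay_cnj)
    qed
    then show ?thesis using True by simp
  next
    case False
    have "cay t ^ n * cnj (cay t) ^ k * 1 = cnj (cay t ^ (k - n))" for t
    proof -
      have "cnj (cay t) ^ k = cnj (cay t) ^ n * cnj (cay t) ^ (k - n)" using False by (simp flip: power_add)
      then have "cay t ^ n * cnj (cay t) ^ k = (cay t * cnj (cay t)) ^ n * cnj (cay t) ^ (k - n)"
        by (simp only: power_mult_distrib mult.assoc)
      then show ?thesis by (simp add: cay_cnj)
    qed
    then show ?thesis using False by (simp only: Bochner_Integration.integral_cnj if_False)
  qed
  show "(\<integral>t. cay t ^ n * cnj (cay t) ^ k * 1 \<partial>\<mu>1) = (\<integral>t. cay t ^ n * cnj (cay t) ^ k * 1 \<partial>\<mu>2)"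
    unfolding * using mom by simp
qed simp

lemma moment_class_add:
  assumes "r \<in> moment_class" "s \<in> moment_class" shows "(\<lambda>z. r z + s z) \<in> moment_class"
proof -
  have "(\<integral>t. cay t ^ n * cnj (cay t) ^ k * (r (cay t) + s (cay t)) \<partial>\<mu>1)
      = (\<integral>t. cay t ^ n * cnj (cay t) ^ k * (r (cay t) + s (cay t)) \<partial>\<mu>2)" for n k
    unfolding distrib_left
    using assms moment_class_integrable[OF assms(1), of n k] moment_class_integrable[OF assms(2), of n k]
    by (simp add: moment_class_def)
  then show ?thesis using assms by (auto simp: moment_class_def intro: continuous_intros)
qed

lemma moment_class_scale:
  assumes "r \<in> moment_class" shows "(\<lambda>z. c * r z) \<in> moment_class"
proof -
  have "(\<integral>t. cay t ^ n * cnj (cay t) ^ k * (c * r (cay t)) \<partial>\<mu>)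
      = c * (\<integral>t. cay t ^ n * cnj (cay t) ^ k * r (cay t) \<partial>\<mu>)" for n k \<mu>
    by (subst integral_mult_right_zero[symmetric]) (intro Bochner_Integration.integral_cong, auto)
  then show ?thesis using assms by (auto simp: moment_class_def intro: continuous_intros)
qed

lemma moment_class_z:
  assumes "r \<in> moment_class" shows "(\<lambda>z. z * r z) \<in> moment_class"
proof -
  have "(\<integral>t. cay t ^ n * cnj (cay t) ^ k * (cay t * r (cay t)) \<partial>\<mu>)
      = (\<integral>t. cay t ^ Suc n * cnj (cay t) ^ k * r (cay t) \<partial>\<mu>)" for n k \<mu>
    by (intro Bochner_Integration.integral_cong) auto
  then show ?thesis using assms by (auto simp: moment_class_def intro: continuous_intros simp del: power_Suc)
qed

lemma moment_class_cnj:
  assumes "r \<in> moment_class" shows "(\<lambda>z. cnj z * r z) \<in> moment_class"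
proof -
  have "(\<integral>t. cay t ^ n * cnj (cay t) ^ k * (cnj (cay t) * r (cay t)) \<partial>\<mu>)
      = (\<integral>t. cay t ^ n * cnj (cay t) ^ Suc k * r (cay t) \<partial>\<mu>)" for n k \<mu>
    by (intro Bochner_Integration.integral_cong) auto
  then show ?thesis using assms by (auto simp: moment_class_def intro: continuous_intros simp del: power_Suc)
qed

text \<open>The induction keeps r arbitrary, so that in the product case one hypothesis is applied
  to the function produced by the other.\<close>

lemma moment_class_poly:
  assumes "real_polynomial_function p" "r \<in> moment_class"
  shows "(\<lambda>z. complex_of_real (p z) * r z) \<in> moment_class"
  using assms
proof (induction p arbitrary: r)
  case (linear f)
  note r = \<open>r \<in> moment_class\<close>
  interpret bounded_linear f by fact
  \<comment> \<open>A real linear form on the plane is a combination of z and its conjugate; A and B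
    are the coefficients.\<close>
  define A where "A = (complex_of_real (f 1) - \<i> * complex_of_real (f \<i>)) / 2"
  define B where "B = (complex_of_real (f 1) + \<i> * complex_of_real (f \<i>)) / 2"
  have fz: "complex_of_real (f z) = A * z + B * cnj z" for z
  proof -
    have "z = Re z *\<^sub>R 1 + Im z *\<^sub>R \<i>" by (simp add: complex_eq_iff)
    then have "f z = f (Re z *\<^sub>R 1 + Im z *\<^sub>R \<i>)" by simp
    also have "\<dots> = Re z * f 1 + Im z * f \<i>" by (simp only: add scaleR real_scaleR_def)
    finally show ?thesis by (simp add: A_def B_def complex_eq_iff field_simps)
  qed
  have "(\<lambda>z. A * (z * r z) + B * (cnj z * r z)) \<in> moment_class"
    by (intro moment_class_add moment_class_scale moment_class_z moment_class_cnj r)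
  then show ?case by (simp add: fz algebra_simps)
next
  case (const c) then show ?case by (rule moment_class_scale)
next
  case (add f g)
  from moment_class_add[OF add.IH(1)[OF add.prems] add.IH(2)[OF add.prems]] show ?case by (simp add: algebra_simps)
next
  case (mult f g)
  from mult.IH(1)[OF mult.IH(2)[OF mult.prems]] show ?case by (simp add: mult.assoc)
qed

text \<open>A uniform approximation within e changes each of the two integrals by at most e times
  the total mass, and for polynomials they agree.\<close>

lemma circle_integral_eq:
  fixes f :: "complex \<Rightarrow> real"
  assumes f: "continuous_on (sphere 0 1) f"
  shows "(\<integral>t. f (cay t) \<partial>\<mu>1) = (\<integral>t. f (cay t) \<partial>\<mu>2)"
proof -
  interpret M1: finite_measure \<mu>1 by (rule fin)
  interpret M2: finite_measure \<mu>2 by (rule fin)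
  let ?K = "measure \<mu>1 (space \<mu>1) + measure \<mu>2 (space \<mu>2)"
  have le: "\<bar>(\<integral>t. f (cay t) \<partial>\<mu>1) - (\<integral>t. f (cay t) \<partial>\<mu>2)\<bar> \<le> e * ?K" if e: "e > 0" for e
  proof -
    obtain p where p: "polynomial_function p" "\<And>z. z \<in> sphere 0 1 \<Longrightarrow> norm (f z - p z) < e"
      using Stone_Weierstrass_polynomial_function[OF compact_sphere f e] by blast
    have rp: "real_polynomial_function p" using p(1) by (simp add: real_polynomial_function_eq)
    have cp: "continuous_on (sphere 0 1) p" by (rule continuous_on_polymonial_function[OF p(1)])
    have "(\<lambda>z. complex_of_real (p z) * 1) \<in> moment_class" by (rule moment_class_poly[OF rp moment_class_1])
    then have "(\<integral>t. cay t ^ 0 * cnj (cay t) ^ 0 * (complex_of_real (p (cay t)) * 1) \<partial>\<mu>1)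
        = (\<integral>t. cay t ^ 0 * cnj (cay t) ^ 0 * (complex_of_real (p (cay t)) * 1) \<partial>\<mu>2)"
      unfolding moment_class_def by blast
    then have eq: "(\<integral>t. p (cay t) \<partial>\<mu>1) = (\<integral>t. p (cay t) \<partial>\<mu>2)" by simp
    have b: "\<bar>(\<integral>t. f (cay t) \<partial>\<mu>) - (\<integral>t. p (cay t) \<partial>\<mu>)\<bar> \<le> e * measure \<mu> (space \<mu>)"
      if "finite_measure \<mu>" "sets \<mu> = sets borel" for \<mu>
    proof -
      interpret finite_measure \<mu> by fact
      have "(\<integral>t. f (cay t) \<partial>\<mu>) - (\<integral>t. p (cay t) \<partial>\<mu>) = (\<integral>t. f (cay t) - p (cay t) \<partial>\<mu>)"
        by (intro Bochner_Integration.integral_diff[symmetric] integrable_on_circle that f cp)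
      moreover have "norm (\<integral>t. f (cay t) - p (cay t) \<partial>\<mu>) \<le> (\<integral>t. e \<partial>\<mu>)"
      proof (rule Bochner_Integration.integral_norm_bound_integral)
        show "integrable \<mu> (\<lambda>t. f (cay t) - p (cay t))"
          by (intro Bochner_Integration.integrable_diff integrable_on_circle that f cp)
        show "norm (f (cay t) - p (cay t)) \<le> e" for t using p(2)[OF cay_sphere[of t]] by simp
      qed simp
      ultimately show ?thesis by (simp add: mult.commute)
    qed
    show ?thesis using b[OF fin(1) sets(1)] b[OF fin(2) sets(2)] eq by (simp add: distrib_left)
  qed
  define d where "d = \<bar>(\<integral>t. f (cay t) \<partial>\<mu>1) - (\<integral>t. f (cay t) \<partial>\<mu>2)\<bar>"
  define K where "K = ?K"
  have K: "K \<ge> 0" by (simp add: K_def)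
  have "d \<le> 0"
  proof (rule ccontr)
    assume "\<not> d \<le> 0"
    then have d: "d > 0" by simp
    then have "d / (2 * (K + 1)) > 0" using K d by simp
    from le[OF this] have "d \<le> d / (2 * (K + 1)) * K" unfolding d_def K_def .
    moreover have "d / (2 * (K + 1)) * K \<le> d / 2" using K d by (simp add: divide_simps)
    ultimately show False using d by linarith
  qed
  then show ?thesis by (simp add: d_def)
qed

lemma cayley_moments_measure_atLeastAtMost: "measure \<mu>1 {a..b} = measure \<mu>2 {a..b}"
proof -
  define K where "K = cay ` {a..b}"
  have Kc: "compact K" unfolding K_def by (intro compact_continuous_image continuous_intros) auto
  \<comment> \<open>Continuous functions on the circle that decrease to the indicator of the compact
    arc K; injectivity of \<open>cay\<close> turns this into the indicator of the interval on the
    line.\<close>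
  define f where "f k z = max 0 (1 - real k * infdist z K)" for k :: nat and z
  have fc: "continuous_on A (f k)" for k A unfolding f_def by (intro continuous_intros)
  show ?thesis
  proof (cases "a \<le> b")
    case False then show ?thesis by simp
  next
    case True
    then have Kne: "K \<noteq> {}" by (auto simp: K_def)
    have lim: "(\<lambda>k. f k (cay t)) \<longlonglongrightarrow> indicator {a..b} t" for t
    proof (cases "t \<in> {a..b}")
      case True
      then have "infdist (cay t) K = 0" by (simp add: K_def)
      then show ?thesis using True by (simp add: f_def)
    next
      case False
      then have "cay t \<notin> K" by (simp only: K_def inj_image_mem_iff[OF inj_cay] not_False_eq_True)
      then have d: "infdist (cay t) K > 0"
        using Kc Kne by (intro infdist_pos_not_in_closed compact_imp_closed)
      obtain k0 where k0: "1 / infdist (cay t) K < real k0" using reals_Archimedean2 by blast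
      have "f k (cay t) = 0" if "k \<ge> k0" for k
      proof -
        have "1 / infdist (cay t) K < real k" using k0 that by linarith
        then have "1 < real k * infdist (cay t) K" using d by (simp add: divide_simps)
        then show ?thesis by (simp add: f_def)
      qed
      then have "(\<lambda>k. f k (cay t)) \<longlonglongrightarrow> 0"
        by (intro tendsto_eventually eventually_sequentiallyI[of k0])
      then show ?thesis using False by simp
    qed
    have L: "(\<lambda>k. \<integral>t. f k (cay t) \<partial>\<mu>) \<longlonglongrightarrow> measure \<mu> {a..b}"
      if \<mu>: "finite_measure \<mu>" "sets \<mu> = sets borel" for \<mu>
    proof -
      interpret finite_measure \<mu> by fact
      have "(\<lambda>k. \<integral>t. f k (cay t) \<partial>\<mu>) \<longlonglongrightarrow> (\<integral>t. indicator {a..b} t \<partial>\<mu>)"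
      proof (rule integral_dominated_convergence[where w="\<lambda>_. 1"])
        show "(\<lambda>t. indicator {a..b} t :: real) \<in> borel_measurable \<mu>" using \<mu>(2) by measurable
        show "(\<lambda>t. f k (cay t)) \<in> borel_measurable \<mu>" for k
          using integrable_on_circle[OF \<mu> fc] by (rule borel_measurable_integrable)
      qed (use lim in \<open>auto simp: f_def infdist_nonneg\<close>)
      then show ?thesis using \<mu>(2) sets_eq_imp_space_eq[OF \<mu>(2)] by simp
    qed
    have "(\<integral>t. f k (cay t) \<partial>\<mu>1) = (\<integral>t. f k (cay t) \<partial>\<mu>2)" for k
      by (rule circle_integral_eq[OF fc])
    then show ?thesis using L[OF fin(1) sets(1)] L[OF fin(2) sets(2)] by (simp add: LIMSEQ_unique)
  qed
qed

text \<open>Compact intervals exhaust each half-line, so the distribution functions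
  coincide.\<close>

lemma cayley_moments_unique: "\<mu>1 = \<mu>2"
proof (rule cdf_unique')
  show "finite_borel_measure \<mu>1" "finite_borel_measure \<mu>2"
    by (auto simp: finite_borel_measure_def finite_borel_measure_axioms_def fin sets)
  have "measure \<mu>1 {..x} = measure \<mu>2 {..x}" for x
  proof (rule LIMSEQ_unique)
    have un: "(\<Union>n. {- real n..x}) = {..x}"
    proof (intro subset_antisym subsetI)
      fix y assume "y \<in> {..x}"
      moreover obtain n where "- y < real n" using reals_Archimedean2 by blast
      ultimately show "y \<in> (\<Union>n. {- real n..x})" by (auto intro!: exI[of _ n])
    qed auto
    have *: "(\<lambda>n. measure \<mu> {- real n..x}) \<longlonglongrightarrow> measure \<mu> {..x}"
      if \<mu>: "finite_measure \<mu>" "sets \<mu> = sets borel" for \<mu>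
    proof -
      interpret finite_measure \<mu> by fact
      have "(\<lambda>n. measure \<mu> {- real n..x}) \<longlonglongrightarrow> measure \<mu> (\<Union>n. {- real n..x})"
        by (rule finite_Lim_measure_incseq) (auto simp: \<mu> incseq_def)
      then show ?thesis unfolding un .
    qed
    show "(\<lambda>n. measure \<mu>1 {- real n..x}) \<longlonglongrightarrow> measure \<mu>1 {..x}" by (rule *[OF fin(1) sets(1)])
    show "(\<lambda>n. measure \<mu>1 {- real n..x}) \<longlonglongrightarrow> measure \<mu>2 {..x}"
      unfolding cayley_moments_measure_atLeastAtMost by (rule *[OF fin(2) sets(2)])
  qed
  then show "cdf \<mu>1 = cdf \<mu>2" by (auto simp: cdf_def)
qed

end

text \<open>The positive and the negative part of k are densities of finite measures with the same
  Cayley moments. These measures coincide, so both parts agree almost everywhere and their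
  difference k vanishes.\<close>

lemma cayley_density_zero_real:
  fixes k :: "real \<Rightarrow> real"
  assumes sets: "sets \<mu> = sets borel" and k: "integrable \<mu> k"
    and mom: "\<And>n::nat. (\<integral>t. cay t ^ n * complex_of_real (k t) \<partial>\<mu>) = 0"
  shows "AE t in \<mu>. k t = 0"
proof -
  have [measurable]: "k \<in> borel_measurable \<mu>" using k by simp
  have cm: "cay \<in> borel_measurable \<mu>" using sets by (simp cong: measurable_cong_sets)
  note [measurable] = cm
  define p where "p t = max 0 (k t)" for t
  define q where "q t = max 0 (- k t)" for t
  have [measurable]: "p \<in> borel_measurable \<mu>" "q \<in> borel_measurable \<mu>" unfolding p_def q_def by measurable
  have int: "integrable \<mu> p" "integrable \<mu> q" unfolding p_def q_def using k by auto
  have nn: "(\<integral>\<^sup>+t. ennreal (r t) \<partial>\<mu>) \<noteq> \<infinity>" if "integrable \<mu> r" "\<And>t. 0 \<le> r t" for r :: "real \<Rightarrow> real"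
    using that by (simp add: nn_integral_eq_integral)
  have pq: "0 \<le> p t" "0 \<le> q t" "k t = p t - q t" for t by (auto simp: p_def q_def)
  have "density \<mu> (\<lambda>t. ennreal (p t)) = density \<mu> (\<lambda>t. ennreal (q t))"
  proof (rule cayley_moments_unique)
    have *: "finite_measure (density \<mu> (\<lambda>t. ennreal (r t)))" if "integrable \<mu> r" "\<And>t. 0 \<le> r t" for r :: "real \<Rightarrow> real"
      by (rule finite_measureI) (use nn[OF that] that in \<open>simp add: emeasure_density borel_measurable_integrable cong: nn_integral_cong\<close>)
    show "finite_measure (density \<mu> (\<lambda>t. ennreal (p t)))" "finite_measure (density \<mu> (\<lambda>t. ennreal (q t)))"
      by (intro * int pq)+
    fix n :: nat
    have ii: "integrable \<mu> (\<lambda>t. cay t ^ n * complex_of_real (r t))" if "integrable \<mu> r" for r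
      by (rule Bochner_Integration.integrable_bound[OF that])
         (use borel_measurable_integrable[OF that] in \<open>auto simp: norm_mult norm_power\<close>)
    have d: "(\<integral>t. cay t ^ n \<partial>density \<mu> (\<lambda>t. ennreal (r t))) = (\<integral>t. cay t ^ n * complex_of_real (r t) \<partial>\<mu>)"
      if "integrable \<mu> r" "\<And>t. 0 \<le> r t" for r :: "real \<Rightarrow> real"
      using that borel_measurable_integrable[OF that(1)]
      by (subst integral_density) (auto simp: scaleR_conv_of_real mult.commute)
    have "(\<integral>t. cay t ^ n * complex_of_real (p t) \<partial>\<mu>) - (\<integral>t. cay t ^ n * complex_of_real (q t) \<partial>\<mu>)
       = (\<integral>t. cay t ^ n * complex_of_real (p t) - cay t ^ n * complex_of_real (q t) \<partial>\<mu>)"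
      by (intro Bochner_Integration.integral_diff[symmetric] ii int)
    also have "\<dots> = (\<integral>t. cay t ^ n * complex_of_real (k t) \<partial>\<mu>)"
      by (intro Bochner_Integration.integral_cong) (auto simp: pq(3) right_diff_distrib)
    finally show "(\<integral>t. cay t ^ n \<partial>density \<mu> (\<lambda>t. ennreal (p t))) = (\<integral>t. cay t ^ n \<partial>density \<mu> (\<lambda>t. ennreal (q t)))"
      using mom[of n] by (simp add: d int pq)
  qed (simp_all add: sets)
  then have "AE t in \<mu>. ennreal (p t) = ennreal (q t)"
    by (subst finite_density_unique[symmetric]) (use nn[OF int(1) pq(1)] in auto)
  then show ?thesis by eventually_elim (use pq in \<open>simp add: ennreal_inj\<close>)
qed

text \<open>The negative moments of k are the conjugates of the positive moments of its complex
  conjugate. Vanishing for all integers therefore reaches the real and the imaginary part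
  separately.\<close>

lemma cayley_density_zero:
  fixes k :: "real \<Rightarrow> complex"
  assumes sets: "sets \<mu> = sets borel" and k: "integrable \<mu> k"
    and mom: "\<And>n::int. (\<integral>t. cay t powi n * k t \<partial>\<mu>) = 0"
  shows "AE t in \<mu>. k t = 0"
proof -
  have cm: "cay \<in> borel_measurable \<mu>" using sets by (simp cong: measurable_cong_sets)
  note [measurable] = cm borel_measurable_integrable[OF k]
  have ii: "integrable \<mu> (\<lambda>t. cay t ^ n * r t)" if "integrable \<mu> r" for n :: nat and r
    by (rule Bochner_Integration.integrable_bound[OF that])
       (use borel_measurable_integrable[OF that] in \<open>auto simp: norm_mult norm_power\<close>)
  have m1: "(\<integral>t. cay t ^ n * k t \<partial>\<mu>) = 0" for n :: nat using mom[of "int n"] by simp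
  have m2: "(\<integral>t. cay t ^ n * cnj (k t) \<partial>\<mu>) = 0" for n :: nat
  proof -
    have "cay t ^ n * cnj (k t) = cnj (cay t powi (- int n) * k t)" for t
      by (simp add: power_int_minus flip: inverse_cay power_inverse)
    then have "(\<integral>t. cay t ^ n * cnj (k t) \<partial>\<mu>) = cnj (\<integral>t. cay t powi (- int n) * k t \<partial>\<mu>)"
      by (simp only: Bochner_Integration.integral_cnj)
    then show ?thesis using mom[of "- int n"] by simp
  qed
  have kc: "integrable \<mu> (\<lambda>t. cnj (k t))" using k by simp
  have "(\<integral>t. cay t ^ n * complex_of_real (Re (k t)) \<partial>\<mu>) = 0" for n :: nat
  proof -
    have "cay t ^ n * complex_of_real (Re (k t)) = (1/2) * (cay t ^ n * k t + cay t ^ n * cnj (k t))" for t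
      using complex_add_cnj[of "k t"] by (simp add: distrib_left[symmetric])
    then have "(\<integral>t. cay t ^ n * complex_of_real (Re (k t)) \<partial>\<mu>) = (1/2) * (\<integral>t. cay t ^ n * k t + cay t ^ n * cnj (k t) \<partial>\<mu>)"
      by (simp only: integral_mult_right_zero)
    then show ?thesis using ii[OF k, of n] ii[OF kc, of n] m1[of n] m2[of n] by simp
  qed
  then have 1: "AE t in \<mu>. Re (k t) = 0" by (intro cayley_density_zero_real sets integrable_Re k)
  have "(\<integral>t. cay t ^ n * complex_of_real (Im (k t)) \<partial>\<mu>) = 0" for n :: nat
  proof -
    have "cay t ^ n * complex_of_real (Im (k t)) = (- \<i> / 2) * (cay t ^ n * k t - cay t ^ n * cnj (k t))" for t
    proof -
      have "complex_of_real (Im (k t)) = (- \<i> / 2) * (k t - cnj (k t))" by (simp add: complex_eq_iff)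
      then show ?thesis by (simp only: mult.left_commute right_diff_distrib)
    qed
    then have "(\<integral>t. cay t ^ n * complex_of_real (Im (k t)) \<partial>\<mu>) = (- \<i> / 2) * (\<integral>t. cay t ^ n * k t - cay t ^ n * cnj (k t) \<partial>\<mu>)"
      by (simp only: integral_mult_right_zero)
    then show ?thesis using ii[OF k, of n] ii[OF kc, of n] m1[of n] m2[of n] by simp
  qed
  then have 2: "AE t in \<mu>. Im (k t) = 0" by (intro cayley_density_zero_real sets integrable_Im k)
  from 1 2 show ?thesis by eventually_elim (simp add: complex_eq_iff)
qed

section \<open>Spectral measures of vectors\<close>

lemma circle_fourier:
  "integrable lborel (\<lambda>\<theta>. indicator {0..2*pi} \<theta> *\<^sub>R cis (of_int p * \<theta>))"
  "(\<integral>\<theta>. indicator {0..2*pi} \<theta> *\<^sub>R cis (of_int p * \<theta>) \<partial>lborel) = (if p = 0 then complex_of_real (2 * pi) else 0)"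
proof -
  show "integrable lborel (\<lambda>\<theta>. indicator {0..2*pi} \<theta> *\<^sub>R cis (of_int p * \<theta>))"
    by (intro borel_integrable_compact continuous_intros compact_Icc)
  show "(\<integral>\<theta>. indicator {0..2*pi} \<theta> *\<^sub>R cis (of_int p * \<theta>) \<partial>lborel) = (if p = 0 then complex_of_real (2 * pi) else 0)"
  proof (cases "p = 0")
    case True
    then show ?thesis by (simp add: scaleR_conv_of_real)
  next
    case False
    define F where "F \<theta> = cis (of_int p * \<theta>) / (\<i> * of_int p)" for \<theta> :: real
    have "(\<integral>\<theta>. indicator {0..2*pi} \<theta> *\<^sub>R cis (of_int p * \<theta>) \<partial>lborel) = F (2 * pi) - F 0"
    proof (rule integral_FTC_atLeastAtMost)
      fix x :: real
      show "(F has_vector_derivative cis (of_int p * x)) (at x within {0..2*pi})"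
        unfolding F_def has_vector_derivative_def using False
        by (auto intro!: derivative_eq_intros simp: scaleR_conv_of_real field_simps)
    qed (auto intro!: continuous_intros)
    also have "cis (of_int p * (2 * pi)) = 1"
      using cis_multiple_2pi[of "of_int p"] by (simp add: mult_ac)
    then have "F (2 * pi) - F 0 = 0" by (simp add: F_def)
    finally show ?thesis using False by simp
  qed
qed

text \<open>Positivity is built in, since each approximating density is a squared norm. All of them
  live on one bounded interval, so they are tight; along a weakly convergent subsequence the moments
  pass to the limit because \<open>cis\<close> is bounded and continuous.\<close>

theorem herglotz:
  fixes h :: "nat \<Rightarrow> 'a fn"
  assumes hL: "\<And>k. h k \<in> L2 m"
    and shift: "\<And>j k. ip m (h (Suc j)) (h (Suc k)) = ip m (h j) (h k)"
    and unit: "l2norm m (h 0) = 1"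
  shows "\<exists>M. real_distribution M \<and> (\<forall>n::nat. (\<integral>\<theta>. cis (real n * \<theta>) \<partial>M) = ip m (h 0) (h n))"
proof -
  define G where "G j k = ip m (h j) (h k)" for j k
  have Gshift: "G (j + d) (k + d) = G j k" for j k d
    by (induction d) (auto simp: G_def shift)
  have G00: "G 0 0 = 1" by (simp add: G_def ip_self unit)
  text \<open>Fejer means of the formal Fourier series with coefficients \<open>G 0 n\<close>\<close>
  define \<sigma> where "\<sigma> N \<theta> = (l2norm m (\<lambda>x. \<Sum>k<N. cis (- (real k * \<theta>)) * h k x))\<^sup>2 / (2 * pi * real N)" for N \<theta>
  have \<sigma>_nonneg: "0 \<le> \<sigma> N \<theta>" for N \<theta> by (simp add: \<sigma>_def)
  have \<sigma>_expand: "complex_of_real (\<sigma> N \<theta>) = (\<Sum>j<N. \<Sum>k<N. G j k / complex_of_real (2 * pi * real N) * cis (of_int (int j - int k) * \<theta>))" for N \<theta>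
  proof -
    let ?s = "\<lambda>x. \<Sum>k<N. cis (- (real k * \<theta>)) * h k x"
    have "complex_of_real ((l2norm m ?s)\<^sup>2) = ip m ?s ?s" by (simp add: ip_self)
    also have "\<dots> = (\<Sum>j<N. ip m (\<lambda>x. cis (- (real j * \<theta>)) * h j x) ?s)"
      by (rule ip_sum_left) (auto intro!: hL)
    also have "\<dots> = (\<Sum>j<N. \<Sum>k<N. ip m (\<lambda>x. cis (- (real j * \<theta>)) * h j x) (\<lambda>x. cis (- (real k * \<theta>)) * h k x))"
      by (intro sum.cong refl ip_sum_right) (auto intro!: hL)
    also have "\<dots> = (\<Sum>j<N. \<Sum>k<N. cis (of_int (int j - int k) * \<theta>) * G j k)"
    proof (intro sum.cong refl)
      fix j k
      have "ip m (\<lambda>x. cis (- (real j * \<theta>)) * h j x) (\<lambda>x. cis (- (real k * \<theta>)) * h k x)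
          = (cis (real j * \<theta>) * cis (- (real k * \<theta>))) * G j k"
        by (simp add: ip_scale_left ip_scale_right G_def cis_cnj)
      then show "ip m (\<lambda>x. cis (- (real j * \<theta>)) * h j x) (\<lambda>x. cis (- (real k * \<theta>)) * h k x)
          = cis (of_int (int j - int k) * \<theta>) * G j k"
        unfolding cis_mult by (simp add: left_diff_distrib)
    qed
    finally show ?thesis unfolding \<sigma>_def of_real_divide
      by (simp add: sum_divide_distrib mult.commute)
  qed
  have \<sigma>_cont: "continuous_on UNIV (\<sigma> N)" for N
  proof -
    have "\<sigma> N = (\<lambda>\<theta>. Re (\<Sum>j<N. \<Sum>k<N. G j k / complex_of_real (2 * pi * real N) * cis (of_int (int j - int k) * \<theta>)))"
      by (rule ext, subst \<sigma>_expand[symmetric]) simp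
    then show ?thesis by (simp only:) (intro continuous_intros)
  qed
  have [measurable]: "\<sigma> N \<in> borel_measurable borel" for N
    by (rule borel_measurable_continuous_onI[OF \<sigma>_cont])
  define \<rho> where "\<rho> N \<theta> = indicator {0..2*pi} \<theta> * \<sigma> N \<theta>" for N \<theta>
  have [measurable]: "\<rho> N \<in> borel_measurable borel" for N unfolding \<rho>_def by measurable
  have \<rho>_nonneg: "0 \<le> \<rho> N \<theta>" for N \<theta> by (simp add: \<rho>_def \<sigma>_nonneg)
  have \<rho>_int: "(\<integral>\<theta>. \<rho> N \<theta> *\<^sub>R cis (real n * \<theta>) \<partial>lborel) = complex_of_real (real (N - n) / real N) * G 0 n"
    and \<rho>_integrable: "integrable lborel (\<lambda>\<theta>. \<rho> N \<theta> *\<^sub>R cis (real n * \<theta>))" for N n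
  proof -
    let ?e = "\<lambda>p \<theta>. indicator {0..2*pi} \<theta> *\<^sub>R cis (of_int p * \<theta>)"
    let ?c = "\<lambda>j k. G j k / complex_of_real (2 * pi * real N)"
    have eq: "\<rho> N \<theta> *\<^sub>R cis (real n * \<theta>) = (\<Sum>j<N. \<Sum>k<N. ?c j k * ?e (int n + int j - int k) \<theta>)" for \<theta>
    proof -
      have "cis (of_int (int j - int k) * \<theta>) * cis (real n * \<theta>) = cis (of_int (int n + int j - int k) * \<theta>)" for j k
        by (simp add: cis_mult algebra_simps)
      then have "complex_of_real (\<sigma> N \<theta>) * cis (real n * \<theta>) = (\<Sum>j<N. \<Sum>k<N. ?c j k * cis (of_int (int n + int j - int k) * \<theta>))"
        unfolding \<sigma>_expand sum_distrib_right by (simp only: mult.assoc)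
      then show ?thesis unfolding \<rho>_def by (cases "\<theta> \<in> {0..2*pi}") (simp_all add: scaleR_conv_of_real)
    qed
    show "integrable lborel (\<lambda>\<theta>. \<rho> N \<theta> *\<^sub>R cis (real n * \<theta>))"
      unfolding eq by (intro Bochner_Integration.integrable_sum integrable_mult_right circle_fourier)
    have "(\<integral>\<theta>. \<rho> N \<theta> *\<^sub>R cis (real n * \<theta>) \<partial>lborel) = (\<Sum>j<N. \<Sum>k<N. ?c j k * (\<integral>\<theta>. ?e (int n + int j - int k) \<theta> \<partial>lborel))"
      unfolding eq
      by (subst Bochner_Integration.integral_sum, intro Bochner_Integration.integrable_sum integrable_mult_right circle_fourier,
          intro sum.cong refl, subst Bochner_Integration.integral_sum, intro integrable_mult_right circle_fourier)
         (intro sum.cong refl integral_mult_right_zero)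
    also have "\<dots> = (\<Sum>j<N. \<Sum>k<N. if k = n + j then G 0 n / complex_of_real (real N) else 0)"
    proof (intro sum.cong refl)
      fix j k
      have "G j (n + j) = G 0 n" using Gshift[of 0 j n] by simp
      then show "?c j k * (\<integral>\<theta>. ?e (int n + int j - int k) \<theta> \<partial>lborel) = (if k = n + j then G 0 n / complex_of_real (real N) else 0)"
        unfolding circle_fourier by auto
    qed
    \<comment> \<open>Exactly N - n indices j satisfy n + j < N, which is the triangular Fejer
      weight; truncated subtraction also covers n above N.\<close>
    also have "\<dots> = (\<Sum>j<N. if j < N - n then G 0 n / complex_of_real (real N) else 0)"
      by (intro sum.cong refl) auto
    also have "\<dots> = (\<Sum>j\<in>{j. j < N \<and> j < N - n}. G 0 n / complex_of_real (real N))"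
      by (subst sum.If_cases) (auto simp: lessThan_def Collect_conj_eq)
    also have "{j. j < N \<and> j < N - n} = {..<N - n}" by auto
    finally show "(\<integral>\<theta>. \<rho> N \<theta> *\<^sub>R cis (real n * \<theta>) \<partial>lborel) = complex_of_real (real (N - n) / real N) * G 0 n"
      by simp
  qed
  \<comment> \<open>The shift to \<open>Suc N\<close> avoids dividing by zero, so every one of these
    measures has total mass 1.\<close>
  define D where "D N = density lborel (\<lambda>\<theta>. ennreal (\<rho> (Suc N) \<theta>))" for N
  have \<rho>_int1: "integrable lborel (\<rho> N)" for N using \<rho>_integrable[of N 0] integrable_Re by fastforce
  have \<rho>_1: "(\<integral>\<theta>. \<rho> (Suc N) \<theta> \<partial>lborel) = 1" for N
  proof -
    have "complex_of_real (\<integral>\<theta>. \<rho> (Suc N) \<theta> \<partial>lborel) = (\<integral>\<theta>. \<rho> (Suc N) \<theta> *\<^sub>R cis (real 0 * \<theta>) \<partial>lborel)"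
      by (simp add: scaleR_conv_of_real)
    also have "\<dots> = 1" unfolding \<rho>_int by (simp add: G00)
    finally show ?thesis by (simp only: of_real_eq_1_iff)
  qed
  have em: "emeasure (D N) A = 1" if "{0..2*pi} \<subseteq> A" "A \<in> sets borel" for N A
  proof -
    have "emeasure (D N) A = (\<integral>\<^sup>+\<theta>. ennreal (\<rho> (Suc N) \<theta>) * indicator A \<theta> \<partial>lborel)"
      unfolding D_def using that by (subst emeasure_density) auto
    also have "\<dots> = (\<integral>\<^sup>+\<theta>. ennreal (\<rho> (Suc N) \<theta>) \<partial>lborel)"
      using that by (intro nn_integral_cong) (auto simp: \<rho>_def indicator_def)
    also have "\<dots> = ennreal (\<integral>\<theta>. \<rho> (Suc N) \<theta> \<partial>lborel)"
      by (rule nn_integral_eq_integral[OF \<rho>_int1]) (simp add: \<rho>_nonneg)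
    finally show ?thesis by (simp add: \<rho>_1)
  qed
  have rd: "real_distribution (D N)" for N
  proof -
    have "prob_space (D N)" by (rule prob_spaceI) (use em[of UNIV N] in \<open>simp add: D_def\<close>)
    then show ?thesis by (simp add: real_distribution_def real_distribution_axioms_def D_def)
  qed
  have "tight D" unfolding tight_def
  proof (intro conjI allI impI rd)
    fix \<epsilon> :: real assume "\<epsilon> > 0"
    \<comment> \<open>The interval contains \<open>{0..2*pi}\<close> because pi is less than
      4.\<close>
    have "measure (D n) {-1<..8} = 1" for n
      unfolding measure_def using pi_less_4 by (subst em) auto
    then show "\<exists>a b::real. a < b \<and> (\<forall>n. measure (D n) {a<..b} > 1 - \<epsilon>)"
      using \<open>\<epsilon> > 0\<close> by (intro exI[of _ "-1"] exI[of _ 8]) auto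
  qed
  from tight_imp_convergent_subsubsequence[OF this strict_mono_id]
  obtain r M where r: "strict_mono r" and M: "real_distribution M" "weak_conv_m (\<lambda>k. D (r k)) M"
    by (auto simp: o_def)
  have "(\<integral>\<theta>. cis (real n * \<theta>) \<partial>M) = ip m (h 0) (h n)" for n
  proof (rule LIMSEQ_unique)
    show "(\<lambda>k. \<integral>\<theta>. cis (real n * \<theta>) \<partial>D (r k)) \<longlonglongrightarrow> (\<integral>\<theta>. cis (real n * \<theta>) \<partial>M)"
    proof (rule weak_conv_imp_integral_bdd_continuous_conv[OF rd M, where B=1])
      have "continuous_on UNIV (\<lambda>\<theta>. cis (real n * \<theta>))" by (intro continuous_intros)
      then show "isCont (\<lambda>\<theta>. cis (real n * \<theta>)) x" for x by (simp add: continuous_on_eq_continuous_at)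
    qed simp
    have cD: "(\<integral>\<theta>. cis (real n * \<theta>) \<partial>D k) = complex_of_real (real (Suc k - n) / real (Suc k)) * G 0 n" for k
    proof -
      have "(\<lambda>\<theta>. cis (real n * \<theta>)) \<in> borel_measurable borel"
        by (intro borel_measurable_continuous_onI continuous_intros)
      then show ?thesis
        unfolding \<rho>_int[symmetric] D_def by (subst integral_density) (auto simp: \<rho>_nonneg)
    qed
    have "(\<lambda>k. 1 - real n / real (Suc k)) \<longlonglongrightarrow> 1 - real n * 0"
      unfolding divide_inverse by (intro tendsto_intros LIMSEQ_inverse_real_of_nat)
    moreover have "\<forall>\<^sub>F k in sequentially. 1 - real n / real (Suc k) = real (Suc k - n) / real (Suc k)"
      by (rule eventually_sequentiallyI[of n]) (auto simp: field_simps of_nat_diff)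
    ultimately have "(\<lambda>k. real (Suc k - n) / real (Suc k)) \<longlonglongrightarrow> 1"
      by (simp add: filterlim_cong[OF refl refl])
    then have "(\<lambda>k. real (Suc (r k) - n) / real (Suc (r k))) \<longlonglongrightarrow> 1"
      using LIMSEQ_subseq_LIMSEQ[OF _ r] by (auto simp: o_def)
    then have "(\<lambda>k. complex_of_real (real (Suc (r k) - n) / real (Suc (r k))) * G 0 n) \<longlonglongrightarrow> complex_of_real 1 * G 0 n"
      by (intro tendsto_intros)
    then show "(\<lambda>k. \<integral>\<theta>. cis (real n * \<theta>) \<partial>D (r k)) \<longlonglongrightarrow> ip m (h 0) (h n)"
      unfolding cD by (simp add: G_def)
  qed
  with M show ?thesis by blast
qed

text \<open>The mean ergodic theorem on the circle: averaging powers isolates the point 1, since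
  elsewhere the geometric sums stay bounded. It is used to read off the mass of that point from the
  moments.\<close>

lemma average_powers_limit:
  fixes z :: complex
  assumes "cmod z = 1"
  shows "(\<lambda>N. (\<Sum>k<N. z ^ Suc k) / of_nat N) \<longlonglongrightarrow> (if z = 1 then 1 else 0)"
proof (cases "z = 1")
  case True
  have "\<forall>\<^sub>F N in sequentially. (\<Sum>k<N. z ^ Suc k) / of_nat N = (1::complex)"
    by (rule eventually_sequentiallyI[of 1]) (simp add: True)
  then show ?thesis using True by (simp add: tendsto_eventually)
next
  case False
  have "(\<lambda>N. (\<Sum>k<N. z ^ Suc k) / of_nat N) \<longlonglongrightarrow> 0"
  proof (rule Lim_null_comparison)
    show "(\<lambda>N. (2 / cmod (1 - z)) * inverse (real N)) \<longlonglongrightarrow> 0"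
      by (rule tendsto_mult_right_zero[OF lim_inverse_n])
    have "norm ((\<Sum>k<N. z ^ Suc k) / of_nat N) \<le> (2 / cmod (1 - z)) * inverse (real N)" for N
    proof -
      have "(\<Sum>k<N. z ^ Suc k) = z * ((1 - z ^ N) / (1 - z))"
        using False by (simp add: sum_distrib_left[symmetric] sum_gp_strict)
      then have "cmod (\<Sum>k<N. z ^ Suc k) = cmod (1 - z ^ N) / cmod (1 - z)"
        by (simp add: norm_mult norm_divide assms)
      also have "\<dots> \<le> 2 / cmod (1 - z)"
        using norm_triangle_ineq4[of 1 "z ^ N"] by (intro divide_right_mono) (auto simp: norm_power assms)
      finally have "cmod (\<Sum>k<N. z ^ Suc k) * inverse (real N) \<le> 2 / cmod (1 - z) * inverse (real N)"
        by (rule mult_right_mono) simp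
      then show ?thesis by (simp only: norm_divide norm_of_nat divide_inverse[of _ "real N"])
    qed
    then show "\<forall>\<^sub>F N in sequentially. norm ((\<Sum>k<N. z ^ Suc k) / of_nat N) \<le> (2 / cmod (1 - z)) * inverse (real N)"
      by simp
  qed
  then show ?thesis using False by simp
qed

text \<open>Let W be the transform. For u in the domain of L, \<open>2 * \<i> * u\<close> is W f - f
  with \<open>f = v - \<i> * u\<close>, so the sums with u in place of g telescope and stay bounded.
  The error \<open>g - u\<close> is small by density of the domain and contributes at most e per
  term.\<close>

lemma cpow_sum_bound:
  assumes sa: "selfadjoint m L" and g: "g \<in> L2 m" and e: "e > 0"
  shows "\<exists>C. \<forall>N. cmod (\<Sum>k<N. ip m g (cpow m L (int (Suc k)) g)) \<le> real N * e + C"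
proof -
  let ?s = "l2norm m g"
  have cn: "l2norm m (cpow m L n g) = ?s" for n
  proof (rule power2_eq_imp_eq)
    show "(l2norm m (cpow m L n g))\<^sup>2 = ?s\<^sup>2"
      unfolding l2norm_sq_Re using cpow_ip[OF sa g g, of n n] by simp
  qed auto
  have "dense_in_L2 m (Domain L)" using sa by (simp add: selfadjoint_def)
  then have "\<exists>u\<in>Domain L. l2norm m (\<lambda>x. g x - u x) < e / (?s + 1)"
    using g e by (simp add: dense_in_L2_def add_nonneg_pos)
  then obtain u v where uv: "(u, v) \<in> L" and ug: "l2norm m (\<lambda>x. g x - u x) < e / (?s + 1)" by blast
  have L: "u \<in> L2 m" "v \<in> L2 m" using sa_L2[OF sa uv] by auto
  define f where "f = (\<lambda>x. v x - \<i> * u x)"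
  define b where "b k = ip m f (cpow m L (int k) g)" for k
  have fL: "f \<in> L2 m" unfolding f_def by (intro L2_diff L2_scale L)
  have fpL: "(\<lambda>x. v x + \<i> * u x) \<in> L2 m" by (intro L2_lin L)
  have XL: "cpow m L n g \<in> L2 m" for n by (rule cpow_L2[OF sa g])
  have Wf: "aeq m (cpow m L 1 f) (\<lambda>x. v x + \<i> * u x)"
    using cayley_eq[OF sa imag_unit_i(1)[OF sa] fL uv] by (simp add: cpow_def f_def aeq_def)
  have imag_unit_i_eq: "2 * \<i> * ip m (\<lambda>x. u x) X = - (ip m (\<lambda>x. v x + \<i> * u x) X - ip m f X)" if "X \<in> L2 m" for X
  proof -
    have "f = (\<lambda>x. v x + (- \<i>) * u x)" by (simp add: f_def)
    then show ?thesis using that L by (simp only: ip_lin_left) simp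
  qed
  have uk: "2 * \<i> * ip m u (cpow m L (int (Suc k)) g) = b (Suc k) - b k" for k
  proof -
    have "ip m (\<lambda>x. v x + \<i> * u x) (cpow m L (int (Suc k)) g) = ip m (cpow m L 1 f) (cpow m L (int (Suc k)) g)"
      using Wf by (intro ip_cong L2_measurable fpL XL cpow_L2[OF sa fL]) (auto simp: aeq_def)
    also have "\<dots> = b k" unfolding b_def using cpow_shift1[OF sa fL g, of 0 "int k"] by (simp add: add.commute)
    finally show ?thesis using imag_unit_i_eq[OF XL[of "int (Suc k)"]] by (simp add: b_def)
  qed
  have "2 * \<i> * (\<Sum>k<N. ip m u (cpow m L (int (Suc k)) g)) = b N - b 0" for N
    unfolding sum_distrib_left uk by (rule sum_lessThan_telescope)
  then have "cmod (2 * \<i> * (\<Sum>k<N. ip m u (cpow m L (int (Suc k)) g))) = cmod (b N - b 0)" for N by simp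
  then have 1: "2 * cmod (\<Sum>k<N. ip m u (cpow m L (int (Suc k)) g)) = cmod (b N - b 0)" for N
    by (simp add: norm_mult)
  have bb: "cmod (b k) \<le> l2norm m f * ?s" for k
    unfolding b_def using Cauchy_Schwarz_L2[OF fL XL] by (simp add: cn)
  have 2: "cmod (\<Sum>k<N. ip m u (cpow m L (int (Suc k)) g)) \<le> l2norm m f * ?s" for N
    using 1[of N] bb[of N] bb[of 0] norm_triangle_ineq4[of "b N" "b 0"] by linarith
  have 3: "cmod (\<Sum>k<N. ip m (\<lambda>x. g x - u x) (cpow m L (int (Suc k)) g)) \<le> real N * e" for N
  proof -
    have "cmod (ip m (\<lambda>x. g x - u x) (cpow m L (int (Suc k)) g)) \<le> e" for k
    proof -
      have "cmod (ip m (\<lambda>x. g x - u x) (cpow m L (int (Suc k)) g)) \<le> l2norm m (\<lambda>x. g x - u x) * ?s"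
        using Cauchy_Schwarz_L2[OF L2_diff[OF g L(1)] XL] by (simp only: cn)
      also have "\<dots> \<le> e / (?s + 1) * (?s + 1)" using ug e by (intro mult_mono) (auto intro!: divide_nonneg_nonneg add_nonneg_nonneg)
      also have "\<dots> = e"
      proof -
        have "?s + 1 \<noteq> 0" using l2norm_nonneg[of m g] by linarith
        then show ?thesis by simp
      qed
      finally show ?thesis .
    qed
    then have "(\<Sum>k<N. cmod (ip m (\<lambda>x. g x - u x) (cpow m L (int (Suc k)) g))) \<le> (\<Sum>k<N. e)"
      by (intro sum_mono)
    then show ?thesis using norm_sum[of "\<lambda>k. ip m (\<lambda>x. g x - u x) (cpow m L (int (Suc k)) g)" "{..<N}"] by simp
  qed
  have "(\<Sum>k<N. ip m g (cpow m L (int (Suc k)) g)) = (\<Sum>k<N. ip m (\<lambda>x. g x - u x) (cpow m L (int (Suc k)) g))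
      + (\<Sum>k<N. ip m u (cpow m L (int (Suc k)) g))" for N
    unfolding sum.distrib[symmetric] by (intro sum.cong refl) (simp add: ip_diff_left XL g L del: of_nat_Suc)
  then have "cmod (\<Sum>k<N. ip m g (cpow m L (int (Suc k)) g)) \<le> real N * e + l2norm m f * ?s" for N
    using 2[of N] 3[of N] norm_triangle_ineq[of "\<Sum>k<N. ip m (\<lambda>x. g x - u x) (cpow m L (int (Suc k)) g)"
      "\<Sum>k<N. ip m u (cpow m L (int (Suc k)) g)"] by simp
  then show ?thesis by blast
qed

text \<open>For z of modulus 1 the quotient equals its own conjugate, so taking the real part loses
  nothing.\<close>

lemma cay_inverse_cis:
  fixes z :: complex
  assumes z: "cmod z = 1" "z \<noteq> 1"
  shows "cay (Re (\<i> * (z + 1) / (z - 1))) = z"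
proof -
  define w where "w = \<i> * (z + 1) / (z - 1)"
  have zz: "z * cnj z = 1" using complex_norm_square[of z] z by simp
  have z1: "z - 1 \<noteq> 0" using z by simp
  have c1: "cnj z - 1 \<noteq> 0" using z by (metis complex_cnj_one complex_cnj_cnj eq_iff_diff_eq_0)
  have "cnj w = - \<i> * (cnj z + 1) / (cnj z - 1)" by (simp add: w_def)
  moreover have "- \<i> * (cnj z + 1) / (cnj z - 1) = w"
  proof -
    have "(- \<i> * (cnj z + 1)) * (z - 1) = (\<i> * (z + 1)) * (cnj z - 1)"
      using zz by (simp add: algebra_simps)
    then show ?thesis unfolding w_def by (subst frac_eq_eq[OF c1 z1])
  qed
  ultimately have "cnj w = w" by simp
  then have Rw: "complex_of_real (Re w) = w" by (simp add: complex_eq_iff)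
  have "w + \<i> = 2 * \<i> * z / (z - 1)" "w - \<i> = 2 * \<i> / (z - 1)"
    unfolding w_def using z1 by (simp_all add: field_simps)
  then have "cay (Re w) = z" unfolding cay_def Rw using z1 by simp
  then show ?thesis by (simp add: w_def)
qed

text \<open>After normalization Herglotz's theorem applies to the orbit of g. The averages of the
  moments converge to the mass of the angles with \<open>cis \<theta> = 1\<close>, and
  \<open>cpow_sum_bound\<close> makes this mass arbitrarily small; then the inverse Cayley transform
  carries the measure to the line.\<close>

theorem cayley_measure:
  assumes sa: "selfadjoint m L" and g: "g \<in> L2 m"
  shows "\<exists>\<mu>. finite_measure \<mu> \<and> sets \<mu> = sets borel \<and>
     (\<forall>n::nat. (\<integral>t. cay t ^ n \<partial>\<mu>) = ip m g (cpow m L (int n) g))"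
proof (cases "l2norm m g = 0")
  case True
  have "ip m g (cpow m L n g) = 0" for n
    using Cauchy_Schwarz_L2[OF g cpow_L2[OF sa g], of n] True by simp
  moreover have "finite_measure (null_measure (borel :: real measure))" by (rule finite_measureI) simp
  ultimately show ?thesis by (intro exI[of _ "null_measure borel"]) simp
next
  case False
  define s where "s = l2norm m g"
  have s: "s > 0" using False l2norm_nonneg[of m g] unfolding s_def by linarith
  define h where "h k = (\<lambda>x. complex_of_real (1 / s) * cpow m L (int k) g x)" for k
  define c where "c n = ip m g (cpow m L (int n) g)" for n
  have XL: "cpow m L n g \<in> L2 m" for n by (rule cpow_L2[OF sa g])
  have hh: "ip m (h j) (h k) = ip m (cpow m L (int j) g) (cpow m L (int k) g) / complex_of_real (s\<^sup>2)" for j k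
    unfolding h_def ip_scale_left ip_scale_right by (simp add: power2_eq_square)
  have "\<exists>M. real_distribution M \<and> (\<forall>n::nat. (\<integral>\<theta>. cis (real n * \<theta>) \<partial>M) = ip m (h 0) (h n))"
  proof (rule herglotz)
    show "h k \<in> L2 m" for k unfolding h_def by (intro L2_scale XL)
    show "ip m (h (Suc j)) (h (Suc k)) = ip m (h j) (h k)" for j k
      unfolding hh using cpow_shift1[OF sa g g, of "int j" "int k"] by (simp add: add.commute)
    show "l2norm m (h 0) = 1"
      unfolding h_def l2norm_scale norm_of_real using s by (simp add: s_def)
  qed
  then obtain M where M: "real_distribution M" and "\<And>n::nat. (\<integral>\<theta>. cis (real n * \<theta>) \<partial>M) = ip m (h 0) (h n)"
    by blast
  then have mom: "(\<integral>\<theta>. cis (real n * \<theta>) \<partial>M) = c n / complex_of_real (s\<^sup>2)" for n :: nat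
    by (simp add: hh c_def)
  interpret M: real_distribution M by fact
  have [measurable]: "cis \<in> borel_measurable borel" by (intro borel_measurable_continuous_onI continuous_intros)
  define Z where "Z = {\<theta>. cis \<theta> = 1}"
  have "closed Z" unfolding Z_def by (intro closed_Collect_eq continuous_intros)
  then have Zs[measurable]: "Z \<in> sets borel" by simp
  let ?A = "\<lambda>N \<theta>. (\<Sum>k<N. cis \<theta> ^ Suc k) / of_nat N"
  have lim: "(\<lambda>N. \<integral>\<theta>. ?A N \<theta> \<partial>M) \<longlonglongrightarrow> (\<integral>\<theta>. indicator Z \<theta> \<partial>M)"
  proof (rule integral_dominated_convergence[where w="\<lambda>_. 1"])
    show "AE \<theta> in M. (\<lambda>N. ?A N \<theta>) \<longlonglongrightarrow> indicator Z \<theta>"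
    proof (rule AE_I2)
      fix \<theta> show "(\<lambda>N. ?A N \<theta>) \<longlonglongrightarrow> indicator Z \<theta>"
      proof -
        have "indicator Z \<theta> = (if cis \<theta> = 1 then 1 else 0 :: complex)" by (simp add: Z_def)
        then show ?thesis using average_powers_limit[OF norm_cis[of \<theta>]] by (simp only:)
      qed
    qed
    show "AE \<theta> in M. norm (?A N \<theta>) \<le> 1" for N
    proof (rule AE_I2)
      fix \<theta>
      have "cmod (\<Sum>k<N. cis \<theta> ^ Suc k) \<le> (\<Sum>k<N. 1)"
        by (rule order_trans[OF norm_sum]) (simp add: norm_power norm_mult)
      then show "norm (?A N \<theta>) \<le> 1" by (cases "N = 0") (simp_all add: norm_divide divide_le_eq_1 del: power_Suc)
    qed
  qed auto
  have Aint: "(\<integral>\<theta>. ?A N \<theta> \<partial>M) = (\<Sum>k<N. c (Suc k)) / (of_nat N * complex_of_real (s\<^sup>2))" for N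
  proof -
    have ii: "integrable M (\<lambda>\<theta>. cis \<theta> ^ k)" for k :: nat
      by (rule M.integrable_const_bound[of _ 1]) (auto simp: norm_power)
    have "(\<integral>\<theta>. ?A N \<theta> \<partial>M) = (\<Sum>k<N. \<integral>\<theta>. cis \<theta> ^ Suc k \<partial>M) / of_nat N"
      by (simp only: integral_divide_zero Bochner_Integration.integral_sum[OF ii])
    also have "(\<Sum>k<N. \<integral>\<theta>. cis \<theta> ^ Suc k \<partial>M) = (\<Sum>k<N. c (Suc k) / complex_of_real (s\<^sup>2))"
    proof (rule sum.cong[OF refl])
      fix k show "(\<integral>\<theta>. cis \<theta> ^ Suc k \<partial>M) = c (Suc k) / complex_of_real (s\<^sup>2)"
        using mom[of "Suc k"] unfolding Complex.DeMoivre .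
    qed
    finally show ?thesis by (simp add: sum_divide_distrib[symmetric] mult.commute)
  qed
  have iZ: "(\<integral>\<theta>. indicator Z \<theta> \<partial>M) = complex_of_real (measure M Z)"
  proof -
    have "(\<lambda>\<theta>. indicator Z \<theta> :: complex) = (\<lambda>\<theta>. complex_of_real (indicator Z \<theta>))"
      by (auto simp: indicator_def)
    then show ?thesis by simp
  qed
  have small: "measure M Z \<le> e / s\<^sup>2" if e: "e > 0" for e
  proof -
    obtain C where C: "\<And>N. cmod (\<Sum>k<N. c (Suc k)) \<le> real N * e + C"
      using cpow_sum_bound[OF sa g e] unfolding c_def by blast
    have "cmod (\<integral>\<theta>. indicator Z \<theta> \<partial>M) \<le> e / s\<^sup>2 + (C / s\<^sup>2) * 0"
    proof (rule LIMSEQ_le)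
      show "(\<lambda>N. cmod (\<integral>\<theta>. ?A N \<theta> \<partial>M)) \<longlonglongrightarrow> cmod (\<integral>\<theta>. indicator Z \<theta> \<partial>M)"
        by (intro tendsto_norm lim)
      show "(\<lambda>N. e / s\<^sup>2 + (C / s\<^sup>2) * inverse (real N)) \<longlonglongrightarrow> e / s\<^sup>2 + (C / s\<^sup>2) * 0"
        by (intro tendsto_intros lim_inverse_n)
      have "cmod (\<integral>\<theta>. ?A N \<theta> \<partial>M) \<le> e / s\<^sup>2 + (C / s\<^sup>2) * inverse (real N)" if "N \<ge> 1" for N
      proof -
        have "cmod (\<integral>\<theta>. ?A N \<theta> \<partial>M) = cmod (\<Sum>k<N. c (Suc k)) / (real N * s\<^sup>2)"
          unfolding Aint norm_divide norm_mult norm_of_nat norm_of_real by simp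
        also have "\<dots> \<le> (real N * e + C) / (real N * s\<^sup>2)"
          using s by (intro divide_right_mono C) simp
        also have "\<dots> = e / s\<^sup>2 + (C / s\<^sup>2) * inverse (real N)"
          using that s by (simp add: field_simps)
        finally show ?thesis .
      qed
      then show "\<exists>N0. \<forall>N\<ge>N0. cmod (\<integral>\<theta>. ?A N \<theta> \<partial>M) \<le> e / s\<^sup>2 + (C / s\<^sup>2) * inverse (real N)"
        by blast
    qed
    then show ?thesis unfolding iZ by simp
  qed
  have "measure M Z = 0"
  proof (rule ccontr)
    assume "measure M Z \<noteq> 0"
    then have p: "measure M Z > 0" using measure_nonneg[of M Z] by linarith
    then have "measure M Z \<le> (measure M Z * s\<^sup>2 / 2) / s\<^sup>2" using s by (intro small) simp
    then show False using p s by simp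
  qed
  then have ae: "AE \<theta> in M. cis \<theta> \<noteq> 1"
    by (subst AE_iff_measurable[of Z]) (auto simp: Z_def M.emeasure_eq_measure)
  \<comment> \<open>Where \<open>cis \<theta> = 1\<close> the division by zero makes this 0, but
    such angles form a null set.\<close>
  define T where "T \<theta> = Re (\<i> * (cis \<theta> + 1) / (cis \<theta> - 1))" for \<theta>
  have [measurable]: "T \<in> borel_measurable borel" unfolding T_def by measurable
  define \<mu> where "\<mu> = density (distr M borel T) (\<lambda>_. ennreal (s\<^sup>2))"
  have "finite_measure \<mu>"
  proof (rule finite_measureI)
    have "emeasure \<mu> (space \<mu>) = ennreal (s\<^sup>2) * emeasure (distr M borel T) (space (distr M borel T))"
      unfolding \<mu>_def by (simp add: emeasure_density nn_integral_cmult)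
    also have "\<dots> \<noteq> \<infinity>"
      using M.finite_emeasure_space M.prob_space_distr[of T borel, THEN prob_space.emeasure_space_1] by (simp add: ennreal_mult_eq_top_iff)
    finally show "emeasure \<mu> (space \<mu>) \<noteq> \<infinity>" .
  qed
  moreover have "sets \<mu> = sets borel" by (simp add: \<mu>_def)
  moreover have "(\<integral>t. cay t ^ n \<partial>\<mu>) = c n" for n :: nat
  proof -
    have "(\<integral>t. cay t ^ n \<partial>\<mu>) = (\<integral>t. s\<^sup>2 *\<^sub>R cay t ^ n \<partial>distr M borel T)"
      unfolding \<mu>_def by (subst integral_density) auto
    also have "\<dots> = (\<integral>\<theta>. s\<^sup>2 *\<^sub>R cay (T \<theta>) ^ n \<partial>M)" by (subst integral_distr) auto
    also have "\<dots> = (\<integral>\<theta>. s\<^sup>2 *\<^sub>R cis (real n * \<theta>) \<partial>M)"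
    proof (rule integral_cong_AE)
      show "AE \<theta> in M. s\<^sup>2 *\<^sub>R cay (T \<theta>) ^ n = s\<^sup>2 *\<^sub>R cis (real n * \<theta>)"
        using ae by eventually_elim (simp add: T_def cay_inverse_cis Complex.DeMoivre)
    qed auto
    also have "\<dots> = complex_of_real (s\<^sup>2) * (\<integral>\<theta>. cis (real n * \<theta>) \<partial>M)" by (simp add: scaleR_conv_of_real)
    also have "\<dots> = c n" unfolding mom using s by simp
    finally show ?thesis .
  qed
  ultimately show ?thesis unfolding c_def by blast
qed

section \<open>Multiplicity spaces\<close>

lemma dominating_measure:
  fixes N :: "nat \<Rightarrow> 'a measure"
  assumes fin: "\<And>i. finite_measure (N i)" and sets: "\<And>i. sets (N i) = sets B"
  shows "\<exists>\<mu>. finite_measure \<mu> \<and> sets \<mu> = sets B \<and> (\<forall>A\<in>sets B. emeasure \<mu> A = 0 \<longleftrightarrow> (\<forall>i. emeasure (N i) A = 0))"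
proof -
  have sp: "space (N i) = space B" for i using sets_eq_imp_space_eq[OF sets] .
  \<comment> \<open>The weights make the total mass summable and stay positive, so the null sets of
    the weighted sum are exactly the common null sets of all \<open>N i\<close>.\<close>
  define w where "w i = ennreal ((1/2)^i / (1 + measure (N i) (space B)))" for i
  have w0: "w i \<noteq> 0" for i
    using measure_nonneg[of "N i" "space B"] unfolding w_def by (simp add: ennreal_eq_0_iff not_le add_pos_nonneg)
  define F where "F A = (\<integral>\<^sup>+i. w i * emeasure (N i) A \<partial>count_space UNIV)" for A
  define \<mu> where "\<mu> = measure_of (space B) (sets B) F"
  have ca: "countably_additive (sets B) F"
  proof (rule countably_additiveI)
    fix A :: "nat \<Rightarrow> 'a set" assume A: "range A \<subseteq> sets B" "disjoint_family A" "(\<Union>i. A i) \<in> sets B"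
    have "(\<Sum>n. F (A n)) = (\<integral>\<^sup>+i. (\<Sum>n. w i * emeasure (N i) (A n)) \<partial>count_space UNIV)"
      unfolding F_def by (rule nn_integral_suminf[symmetric]) simp
    also have "\<dots> = F (\<Union>i. A i)"
      unfolding F_def
    proof (intro nn_integral_cong)
      fix i
      have "(\<Sum>n. emeasure (N i) (A n)) = emeasure (N i) (\<Union>n. A n)"
        by (rule suminf_emeasure) (use A sets in auto)
      then show "(\<Sum>n. w i * emeasure (N i) (A n)) = w i * emeasure (N i) (\<Union>n. A n)" by simp
    qed
    finally show "(\<Sum>n. F (A n)) = F (\<Union>i. A i)" .
  qed
  have em: "emeasure \<mu> A = F A" if "A \<in> sets B" for A
    unfolding \<mu>_def
    by (rule emeasure_measure_of_sigma[OF sets.sigma_algebra_axioms _ ca that]) (simp add: positive_def F_def)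
  have sm: "sets \<mu> = sets B" "space \<mu> = space B" by (simp_all add: \<mu>_def)
  have "finite_measure \<mu>"
  proof (rule finite_measureI)
    have "F (space B) \<le> (\<integral>\<^sup>+i. ennreal ((1/2)^i) \<partial>count_space UNIV)"
      unfolding F_def
    proof (intro nn_integral_mono)
      fix i
      interpret finite_measure "N i" by (rule fin)
      have "w i * emeasure (N i) (space B) = ennreal ((1/2)^i / (1 + measure (N i) (space B)) * measure (N i) (space B))"
        unfolding w_def emeasure_eq_measure by (subst ennreal_mult) auto
      also have "\<dots> \<le> ennreal ((1/2)^i)"
      proof (rule ennreal_leI)
        have "measure (N i) (space B) / (1 + measure (N i) (space B)) \<le> 1"
          by (simp add: divide_le_eq_1 add_pos_nonneg)
        then have "(1/2)^i * (measure (N i) (space B) / (1 + measure (N i) (space B))) \<le> (1/2)^i * 1"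
          by (intro mult_left_mono) auto
        then show "(1/2)^i / (1 + measure (N i) (space B)) * measure (N i) (space B) \<le> (1/2)^i" by simp
      qed
      finally show "w i * emeasure (N i) (space B) \<le> ennreal ((1/2)^i)" .
    qed
    also have "\<dots> = (\<Sum>i. ennreal ((1/2)^i))" by (rule nn_integral_count_space_nat)
    also have "\<dots> < \<infinity>" by (subst suminf_ennreal2) (auto intro!: summable_geometric)
    finally show "emeasure \<mu> (space \<mu>) \<noteq> \<infinity>" using em[of "space B"] by (simp add: sm)
  qed
  moreover have "emeasure \<mu> A = 0 \<longleftrightarrow> (\<forall>i. emeasure (N i) A = 0)" if "A \<in> sets B" for A
    unfolding em[OF that] F_def by (subst nn_integral_0_iff_AE) (auto simp: w0 AE_count_space)
  ultimately show ?thesis using sm by blast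
qed

lemma RN_density_real:
  assumes fin: "finite_measure \<mu>" "finite_measure N" and sets: "sets N = sets \<mu>"
    and ac: "\<And>A. A \<in> sets \<mu> \<Longrightarrow> emeasure \<mu> A = 0 \<Longrightarrow> emeasure N A = 0"
  shows "\<exists>d. d \<in> borel_measurable \<mu> \<and> (\<forall>t. 0 \<le> d t) \<and> N = density \<mu> (\<lambda>t. ennreal (d t))"
proof -
  interpret finite_measure \<mu> by fact
  interpret N: finite_measure N by fact
  have "absolutely_continuous \<mu> N" unfolding absolutely_continuous_def using ac sets by (auto simp: null_sets_def)
  from Radon_Nikodym[OF this sets] obtain f where [measurable]: "f \<in> borel_measurable \<mu>" and f: "density \<mu> f = N" by blast
  have "(\<integral>\<^sup>+t. f t \<partial>\<mu>) = emeasure N (space N)"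
    unfolding f[symmetric] by (subst emeasure_density) (auto intro!: nn_integral_cong)
  then have "(\<integral>\<^sup>+t. f t \<partial>\<mu>) \<noteq> \<infinity>" using N.finite_emeasure_space by simp
  then have "AE t in \<mu>. f t \<noteq> \<infinity>" by (intro nn_integral_PInf_AE) auto
  then have "AE t in \<mu>. f t = ennreal (enn2real (f t))" by eventually_elim (simp add: less_top)
  then have "density \<mu> f = density \<mu> (\<lambda>t. ennreal (enn2real (f t)))" by (intro density_cong) auto
  then show ?thesis using f by (intro exI[of _ "\<lambda>t. enn2real (f t)"]) auto
qed

text \<open>\<open>rk d i t\<close> is the position (counted from 1) of \<open>i\<close> in the increasing enumeration of \<open>{i. d i t > 0}\<close>,
  provided \<open>d i t > 0\<close>; hence \<open>Mset d j\<close> is the set where the multiplicity is at least \<open>j\<close>.\<close>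
definition rk :: "(nat \<Rightarrow> real \<Rightarrow> real) \<Rightarrow> nat \<Rightarrow> real \<Rightarrow> nat" where
  "rk d i t = (\<Sum>l\<le>i. if d l t > 0 then 1 else 0)"

definition Mset :: "(nat \<Rightarrow> real \<Rightarrow> real) \<Rightarrow> nat \<Rightarrow> real set" where
  "Mset d j = {t. \<exists>i. d i t > 0 \<and> rk d i t = j}"

text \<open>The direct sum of the spaces over \<open>M j\<close> becomes the square integrable
  functions on one measure space of pairs, the disjoint union of the sets \<open>M j\<close>; this
  is the form in which \<open>spec_rep\<close> expects a representation.\<close>

definition slotm :: "real measure \<Rightarrow> (nat \<Rightarrow> real set) \<Rightarrow> (nat \<times> real) measure" where
  "slotm \<mu> M = density (count_space UNIV \<Otimes>\<^sub>M \<mu>) (\<lambda>(j, t). indicator (M j) t)"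

lemma rk_Suc: "rk d (Suc i) t = rk d i t + (if d (Suc i) t > 0 then 1 else 0)"
  by (simp add: rk_def)

lemma rk_mono: "i \<le> j \<Longrightarrow> rk d i t \<le> rk d j t"
  unfolding rk_def by (rule sum_mono2) auto

lemma rk_less: "i < j \<Longrightarrow> d j t > 0 \<Longrightarrow> rk d i t < rk d j t"
proof -
  assume ij: "i < j" and d: "d j t > 0"
  then obtain k where k: "j = Suc k" "i \<le> k" by (cases j) auto
  then show ?thesis using d rk_mono[OF k(2), of d t] by (simp add: rk_Suc)
qed

lemma rk_inj: "d i t > 0 \<Longrightarrow> d j t > 0 \<Longrightarrow> rk d i t = rk d j t \<Longrightarrow> i = j"
  using rk_less[of i j d t] rk_less[of j i d t] by (metis less_irrefl nat_neq_iff)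

lemma rk_pos: "d i t > 0 \<Longrightarrow> rk d i t \<ge> 1"
  by (cases i) (simp_all add: rk_Suc, simp add: rk_def)

lemma rk_attained: "rk d i t \<ge> 1 \<Longrightarrow> \<exists>l\<le>i. d l t > 0 \<and> rk d l t = rk d i t"
proof (induction i)
  case 0 then show ?case by (cases "d 0 t > 0") (auto simp: rk_def)
next
  case (Suc i)
  then show ?case
  proof (cases "d (Suc i) t > 0")
    case False
    then have "rk d (Suc i) t = rk d i t" by (simp add: rk_Suc)
    with Suc show ?thesis by (metis le_SucI)
  qed auto
qed

lemma Mset_0: "Mset d 0 = {}"
  using rk_pos by (fastforce simp: Mset_def)

text \<open>If the index i has rank j + 1, the count just before i is j, and a positive count is
  attained at an earlier index. The bound on j matters, because \<open>Mset d 0\<close> is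
  empty.\<close>

lemma Mset_antimono: "j \<ge> 1 \<Longrightarrow> Mset d (Suc j) \<subseteq> Mset d j"
proof
  fix t assume j: "j \<ge> 1" and "t \<in> Mset d (Suc j)"
  then obtain i where i: "d i t > 0" "rk d i t = Suc j" by (auto simp: Mset_def)
  have "i \<noteq> 0"
  proof
    assume "i = 0"
    with i j show False by (simp add: rk_def)
  qed
  then obtain k where k: "i = Suc k" by (cases i) auto
  then have "rk d k t = j" using i by (simp add: rk_Suc)
  with rk_attained[of d k t] j show "t \<in> Mset d j" by (auto simp: Mset_def)
qed

lemma Mset_1: "d i t > 0 \<Longrightarrow> t \<in> Mset d 1"
proof -
  assume "d i t > 0"
  then obtain l where l: "d l t > 0" "\<And>k. k < l \<Longrightarrow> \<not> d k t > 0"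
    using LeastI[of "\<lambda>i. d i t > 0"] not_less_Least[of _ "\<lambda>i. d i t > 0"] by blast
  have "rk d l t = (\<Sum>k\<le>l. if k = l then 1 else 0)"
    unfolding rk_def using l by (intro sum.cong) (auto simp: le_less)
  then show ?thesis using l by (auto simp: Mset_def)
qed

lemma slotm_sets: "sets \<mu> = sets borel \<Longrightarrow> sets (slotm \<mu> M) = sets (count_space UNIV \<Otimes>\<^sub>M borel)"
  unfolding slotm_def sets_density by (rule sets_pair_measure_cong[OF refl])

lemma slotm_measurable_iff:
  assumes "sets \<mu> = sets borel"
  shows "F \<in> borel_measurable (slotm \<mu> M) \<longleftrightarrow> (\<forall>j. (\<lambda>t. F (j, t)) \<in> borel_measurable borel)"
proof
  assume F: "F \<in> borel_measurable (slotm \<mu> M)"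
  then have F': "F \<in> borel_measurable (count_space UNIV \<Otimes>\<^sub>M borel)"
    using measurable_cong_sets[OF slotm_sets[OF assms] refl] by blast
  show "\<forall>j. (\<lambda>t. F (j, t)) \<in> borel_measurable borel"
    using measurable_compose[OF measurable_Pair1' F'] by simp
next
  assume "\<forall>j. (\<lambda>t. F (j, t)) \<in> borel_measurable borel"
  then have "F \<in> borel_measurable (count_space UNIV \<Otimes>\<^sub>M borel)"
    by (intro measurable_pair_measure_countable1) auto
  then show "F \<in> borel_measurable (slotm \<mu> M)"
    using measurable_cong_sets[OF slotm_sets[OF assms] refl] by blast
qed

section \<open>Integration on the slot space\<close>

locale slots =
  fixes \<mu> :: "real measure" and M :: "nat \<Rightarrow> real set"
  assumes fin: "finite_measure \<mu>" and sets_\<mu>: "sets \<mu> = sets borel" and M[measurable]: "\<And>j. M j \<in> sets borel"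
begin

abbreviation "\<nu> \<equiv> slotm \<mu> M"

lemmas [measurable_cong] = sets_\<mu>

sublocale finite_measure \<mu> by (rule fin)

sublocale P: pair_sigma_finite "count_space (UNIV :: nat set)" \<mu>
  by (intro pair_sigma_finite.intro sigma_finite_measure_count_space_countable) (auto simp: sigma_finite_measure_axioms)

lemma space_\<mu>: "space \<mu> = UNIV"
  using sets_eq_imp_space_eq[OF sets_\<mu>] by simp

lemma M_ind: "(\<lambda>(j, t). indicator (M j) t :: real) \<in> borel_measurable (count_space UNIV \<Otimes>\<^sub>M \<mu>)"
  by (rule measurable_pair_measure_countable1) (auto simp: sets_\<mu>)

lemma meas_slot: "F \<in> borel_measurable \<nu> \<Longrightarrow> F \<in> borel_measurable (count_space UNIV \<Otimes>\<^sub>M \<mu>)"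
  by (simp add: slotm_def)

lemma M_ind_ennreal: "(\<lambda>(j, t). indicator (M j) t :: ennreal) \<in> borel_measurable (count_space UNIV \<Otimes>\<^sub>M \<mu>)"
  by (rule measurable_pair_measure_countable1) (auto simp: sets_\<mu>)

lemma slot_nn_integral:
  assumes F: "F \<in> borel_measurable \<nu>"
  shows "(\<integral>\<^sup>+y. F y \<partial>\<nu>) = (\<Sum>j. \<integral>\<^sup>+t. indicator (M j) t * F (j, t) \<partial>\<mu>)"
proof -
  have [measurable]: "F \<in> borel_measurable (count_space UNIV \<Otimes>\<^sub>M \<mu>)" by (rule meas_slot[OF F])
  note [measurable] = M_ind_ennreal
  have "(\<integral>\<^sup>+y. F y \<partial>\<nu>) = (\<integral>\<^sup>+y. (case y of (j, t) \<Rightarrow> indicator (M j) t) * F y \<partial>(count_space UNIV \<Otimes>\<^sub>M \<mu>))"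
    unfolding slotm_def by (rule nn_integral_density) measurable
  also have "\<dots> = (\<integral>\<^sup>+j. \<integral>\<^sup>+t. indicator (M j) t * F (j, t) \<partial>\<mu> \<partial>count_space UNIV)"
    by (subst nn_integral_fst[symmetric]) auto
  finally show ?thesis by (simp add: nn_integral_count_space_nat)
qed

lemma slot_AE: "(AE y in \<nu>. P y) \<longleftrightarrow> (\<forall>j. AE t in \<mu>. t \<in> M j \<longrightarrow> P (j, t))"
proof
  assume "AE y in \<nu>. P y"
  then have "AE y in count_space UNIV \<Otimes>\<^sub>M \<mu>. 0 < ((case y of (j, t) \<Rightarrow> indicator (M j) t) :: ennreal) \<longrightarrow> P y"
    unfolding slotm_def by (subst (asm) AE_density[OF M_ind_ennreal])
  from P.AE_pair[OF this] have "AE j in count_space UNIV. AE t in \<mu>. 0 < (indicator (M j) t :: ennreal) \<longrightarrow> P (j, t)"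
    by simp
  then have "\<forall>j. AE t in \<mu>. 0 < (indicator (M j) t :: ennreal) \<longrightarrow> P (j, t)" by (simp add: AE_count_space)
  then show "\<forall>j. AE t in \<mu>. t \<in> M j \<longrightarrow> P (j, t)" by (auto elim!: eventually_mono simp: indicator_def split: if_splits)
next
  assume "\<forall>j. AE t in \<mu>. t \<in> M j \<longrightarrow> P (j, t)"
  then have "\<forall>j. \<exists>Z. Z \<in> null_sets \<mu> \<and> {t. \<not> (t \<in> M j \<longrightarrow> P (j, t))} \<subseteq> Z"
    by (auto simp: eventually_ae_filter space_\<mu>)
  then obtain Z where Z: "\<And>j. Z j \<in> null_sets \<mu>" "\<And>j t. t \<in> M j \<Longrightarrow> \<not> P (j, t) \<Longrightarrow> t \<in> Z j" by (metis (no_types, lifting) mem_Collect_eq subsetD)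
  have "{j} \<times> Z j \<in> null_sets (count_space UNIV \<Otimes>\<^sub>M \<mu>)" for j
    using Z(1)[of j] by (auto simp: null_sets_def emeasure_pair_measure_Times intro!: pair_measureI)
  then have N: "(\<Union>j. {j} \<times> Z j) \<in> null_sets (count_space UNIV \<Otimes>\<^sub>M \<mu>)" by (rule null_sets_UN)
  have "AE y in count_space UNIV \<Otimes>\<^sub>M \<mu>. 0 < ((case y of (j, t) \<Rightarrow> indicator (M j) t) :: ennreal) \<longrightarrow> P y"
    using AE_not_in[OF N]
  proof eventually_elim
    case (elim y)
    then show ?case using Z(2)[of "snd y" "fst y"] by (cases y) (auto simp: indicator_def)
  qed
  then show "AE y in \<nu>. P y" unfolding slotm_def by (subst AE_density[OF M_ind_ennreal])
qed

end

locale densities =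
  fixes \<mu> :: "real measure" and d :: "nat \<Rightarrow> real \<Rightarrow> real"
  assumes fin_\<mu>: "finite_measure \<mu>" and sets_\<mu>': "sets \<mu> = sets borel"
    and d_meas: "\<And>i. d i \<in> borel_measurable borel"
begin

lemma rk_meas [measurable]: "Measurable.pred borel (\<lambda>t. rk d i t = j)"
proof -
  have r: "real (rk d i t) = (\<Sum>l\<le>i. if d l t > 0 then 1 else 0)" for t
    unfolding rk_def by (simp only: of_nat_sum if_distrib[of real] of_nat_1 of_nat_0)
  have P: "{t \<in> space borel. d l t > 0} \<in> sets borel" for l
    by (rule borel_measurable_less[OF borel_measurable_const d_meas])
  have a: "(\<lambda>t. real (rk d i t)) \<in> borel_measurable borel"
    unfolding r by (intro borel_measurable_sum measurable_If borel_measurable_const P)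
  have "(\<lambda>t. real (rk d i t)) -` {real j} \<inter> space borel \<in> sets borel"
    by (rule measurable_sets[OF a]) simp
  then show ?thesis by (simp add: pred_def vimage_def)
qed

lemma Mset_sets: "Mset d j \<in> sets borel"
proof -
  note [measurable] = d_meas
  show ?thesis unfolding Mset_def by measurable
qed

sublocale slots \<mu> "Mset d"
  by (rule slots.intro[OF fin_\<mu> sets_\<mu>' Mset_sets])

text \<open>For each t the function is nonzero in at most one slot, the one with number
  \<open>rk d i t\<close>; integrating over the slots first removes the sum.\<close>

lemma slot_integral:
  fixes F :: "nat \<times> real \<Rightarrow> complex"
  assumes F: "integrable \<nu> F" and supp: "\<And>j t. F (j, t) \<noteq> 0 \<Longrightarrow> d i t > 0 \<and> rk d i t = j"
  shows "(\<integral>y. F y \<partial>\<nu>) = (\<integral>t. (if d i t > 0 then F (rk d i t, t) else 0) \<partial>\<mu>)"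
    and "integrable \<mu> (\<lambda>t. if d i t > 0 then F (rk d i t, t) else 0)"
proof -
  have Fm: "F \<in> borel_measurable (count_space UNIV \<Otimes>\<^sub>M \<mu>)"
    by (rule meas_slot) (rule borel_measurable_integrable[OF F])
  have eq: "(\<lambda>y. ((case y of (j, t) \<Rightarrow> indicator (Mset d j) t) :: real) *\<^sub>R F y) = (\<lambda>(j, t). F (j, t))"
  proof (rule ext)
    fix y :: "nat \<times> real"
    obtain j t where y: "y = (j, t)" by (cases y)
    show "((case y of (j, t) \<Rightarrow> indicator (Mset d j) t) :: real) *\<^sub>R F y = (\<lambda>(j, t). F (j, t)) y"
    proof (cases "F y = 0")
      case False
      then have "t \<in> Mset d j" using supp[of j t] y by (auto simp: Mset_def)
      then show ?thesis by (simp add: y)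
    qed (simp add: y)
  qed
  have conv: "slotm \<mu> (Mset d) = density (count_space UNIV \<Otimes>\<^sub>M \<mu>) (\<lambda>y. ennreal (case y of (j, t) \<Rightarrow> indicator (Mset d j) t))"
    unfolding slotm_def by (intro arg_cong2[where f=density] refl ext) (auto simp: indicator_def split: prod.splits)
  have int: "integrable (count_space UNIV \<Otimes>\<^sub>M \<mu>) (\<lambda>(j, t). F (j, t))"
    using F unfolding conv
    by (subst (asm) integrable_density) (auto simp: eq Fm M_ind split: prod.splits)
  have inner: "(\<integral>j. F (j, t) \<partial>count_space UNIV) = (if d i t > 0 then F (rk d i t, t) else 0)" for t
  proof -
    have sub: "{j \<in> UNIV. F (j, t) \<noteq> 0} \<subseteq> (if d i t > 0 then {rk d i t} else {})" using supp by auto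
    then have "finite {j \<in> UNIV. F (j, t) \<noteq> 0}" by (rule finite_subset) auto
    then have "(\<integral>j. F (j, t) \<partial>count_space UNIV) = (\<Sum>j | j \<in> UNIV \<and> F (j, t) \<noteq> 0. F (j, t))"
      by (rule lebesgue_integral_count_space_finite_support)
    also have "\<dots> = (\<Sum>j\<in>(if d i t > 0 then {rk d i t} else {}). F (j, t))"
      by (rule sum.mono_neutral_left) (use sub in auto)
    finally show ?thesis by auto
  qed
  have "(\<integral>y. F y \<partial>\<nu>) = (\<integral>y. ((case y of (j, t) \<Rightarrow> indicator (Mset d j) t) :: real) *\<^sub>R F y \<partial>(count_space UNIV \<Otimes>\<^sub>M \<mu>))"
    unfolding conv by (rule integral_density[OF Fm]) (auto simp: M_ind split: prod.splits)
  also have "\<dots> = (\<integral>t. \<integral>j. F (j, t) \<partial>count_space UNIV \<partial>\<mu>)"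
    unfolding eq by (rule P.integral_snd[OF int, symmetric])
  finally show "(\<integral>y. F y \<partial>\<nu>) = (\<integral>t. (if d i t > 0 then F (rk d i t, t) else 0) \<partial>\<mu>)"
    unfolding inner .
  show "integrable \<mu> (\<lambda>t. if d i t > 0 then F (rk d i t, t) else 0)"
    using P.integrable_snd[OF int] unfolding inner .
qed

lemma slot_nn_integral_single:
  assumes F: "F \<in> borel_measurable \<nu>" and supp: "\<And>j t. F (j, t) \<noteq> 0 \<Longrightarrow> d i t > 0 \<and> rk d i t = j"
  shows "(\<integral>\<^sup>+y. F y \<partial>\<nu>) = (\<integral>\<^sup>+t. (if d i t > 0 then F (rk d i t, t) else 0) \<partial>\<mu>)"
proof -
  have [measurable]: "F \<in> borel_measurable (count_space UNIV \<Otimes>\<^sub>M \<mu>)" by (rule meas_slot[OF F])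
  have eq: "(case y of (j, t) \<Rightarrow> indicator (Mset d j) t) * F y = F y" for y
  proof (cases "F y = 0")
    case False
    then have "snd y \<in> Mset d (fst y)" using supp[of "fst y" "snd y"] by (auto simp: Mset_def)
    then show ?thesis by (cases y) simp
  qed simp
  have inner: "(\<integral>\<^sup>+j. F (j, t) \<partial>count_space UNIV) = (if d i t > 0 then F (rk d i t, t) else 0)" for t
  proof -
    have "(\<integral>\<^sup>+j. F (j, t) \<partial>count_space UNIV) = (\<Sum>j\<in>(if d i t > 0 then {rk d i t} else {}). F (j, t))"
      by (rule nn_integral_count_space') (use supp[of _ t] in \<open>auto split: if_splits\<close>)
    then show ?thesis by auto
  qed
  have "(\<integral>\<^sup>+y. F y \<partial>\<nu>) = (\<integral>\<^sup>+y. (case y of (j, t) \<Rightarrow> indicator (Mset d j) t) * F y \<partial>(count_space UNIV \<Otimes>\<^sub>M \<mu>))"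
    unfolding slotm_def by (rule nn_integral_density[OF M_ind_ennreal]) measurable
  also have "\<dots> = (\<integral>\<^sup>+t. \<integral>\<^sup>+j. F (j, t) \<partial>count_space UNIV \<partial>\<mu>)"
    unfolding eq by (rule P.nn_integral_snd[symmetric]) measurable
  finally show ?thesis unfolding inner .
qed

text \<open>The intended image of \<open>cpow m L n (g i)\<close>: the square root turns the density
  of the spectral measure of the i-th generator into an inner product over \<mu>, and the entry sits
  in the slot given by the rank, so that different generators never share a slot at the same
  t.\<close>

definition slot_vec :: "nat \<Rightarrow> int \<Rightarrow> nat \<times> real \<Rightarrow> complex" where
  "slot_vec i n = (\<lambda>(j, t). if d i t > 0 \<and> rk d i t = j then cay t powi n * complex_of_real (sqrt (d i t)) else 0)"

lemma cay_powi_norm [simp]: "cmod (cay t powi n) = 1"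
  by (simp add: norm_power_int)

lemma measurable_cay_powi [measurable]: "(\<lambda>t. cay t powi n) \<in> borel_measurable borel"
  unfolding power_int_def by (cases "n \<ge> 0") auto

lemma slot_vec_measurable: "slot_vec i n \<in> borel_measurable \<nu>"
proof -
  note [measurable] = d_meas
  show ?thesis unfolding slotm_measurable_iff[OF sets_\<mu>] slot_vec_def by auto
qed

lemma slot_vec_supp: "slot_vec i n (j, t) \<noteq> 0 \<Longrightarrow> d i t > 0 \<and> rk d i t = j"
  by (auto simp: slot_vec_def split: if_splits)

lemma slot_vec_rk: "d i t > 0 \<Longrightarrow> slot_vec i n (rk d i t, t) = cay t powi n * complex_of_real (sqrt (d i t))"
  by (simp add: slot_vec_def)

lemma slot_vec_L2:
  assumes "integrable \<mu> (d i)"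
  shows "slot_vec i n \<in> L2 \<nu>"
proof -
  note [measurable] = slot_vec_measurable
  have "(\<integral>\<^sup>+y. ennreal ((cmod (slot_vec i n y))\<^sup>2) \<partial>\<nu>)
      = (\<integral>\<^sup>+t. (if d i t > 0 then ennreal ((cmod (slot_vec i n (rk d i t, t)))\<^sup>2) else 0) \<partial>\<mu>)"
    by (rule slot_nn_integral_single) (measurable, use slot_vec_supp in fastforce)
  also have "\<dots> \<le> (\<integral>\<^sup>+t. ennreal (norm (d i t)) \<partial>\<mu>)"
    by (rule nn_integral_mono) (simp add: slot_vec_rk norm_mult)
  also have "\<dots> < \<infinity>" using assms by (simp add: integrable_iff_bounded)
  finally show ?thesis by (subst L2_nn_integral_iff) (simp_all add: slot_vec_measurable)
qed

lemma slot_vec_ip: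
  assumes "integrable \<mu> (d i)" "k \<in> L2 \<nu>"
  shows "ip \<nu> (slot_vec i n) k = (\<integral>t. (if d i t > 0 then cnj (slot_vec i n (rk d i t, t)) * k (rk d i t, t) else 0) \<partial>\<mu>)"
    and "integrable \<mu> (\<lambda>t. if d i t > 0 then cnj (slot_vec i n (rk d i t, t)) * k (rk d i t, t) else 0)"
proof -
  have int: "integrable \<nu> (\<lambda>y. cnj (slot_vec i n y) * k y)"
    by (rule L2_prod_integrable[OF slot_vec_L2[OF assms(1)] assms(2)])
  have s: "d i t > 0 \<and> rk d i t = j" if "cnj (slot_vec i n (j, t)) * k (j, t) \<noteq> 0" for j t
    using that slot_vec_supp[of i n j t] by auto
  show "ip \<nu> (slot_vec i n) k = (\<integral>t. (if d i t > 0 then cnj (slot_vec i n (rk d i t, t)) * k (rk d i t, t) else 0) \<partial>\<mu>)"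
    unfolding ip_def by (rule slot_integral(1)[OF int s])
  show "integrable \<mu> (\<lambda>t. if d i t > 0 then cnj (slot_vec i n (rk d i t, t)) * k (rk d i t, t) else 0)"
    by (rule slot_integral(2)[OF int s])
qed

lemma cnj_cay_powi: "cnj (cay t) powi n = cay t powi (- n)"
  unfolding inverse_cay[symmetric] power_int_inverse power_int_minus ..

text \<open>For fixed i, orthogonality to all the vectors says that every Cayley moment of
  \<open>q i\<close> vanishes, hence \<open>q i\<close> does. Each t in \<open>Mset d j\<close>
  belongs to some i of rank j with positive density, so k vanishes there.\<close>

lemma slot_vec_total:
  assumes dint: "\<And>i. integrable \<mu> (d i)"
  shows "total_L2 \<nu> (range (\<lambda>(i, n). slot_vec i n))"
  unfolding total_L2_def
proof (intro ballI impI)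
  fix k assume k: "k \<in> L2 \<nu>" and orth: "\<forall>g\<in>range (\<lambda>(i, n). slot_vec i n). ip \<nu> g k = 0"
  have o: "ip \<nu> (slot_vec i n) k = 0" for i n
    by (rule orth[rule_format], rule range_eqI[of _ _ "(i, n)"]) simp
  define q where "q i t = (if d i t > 0 then complex_of_real (sqrt (d i t)) * k (rk d i t, t) else 0)" for i t
  have eq: "(if d i t > 0 then cnj (slot_vec i n (rk d i t, t)) * k (rk d i t, t) else 0) = cay t powi (- n) * q i t" for i n t
    by (simp add: q_def slot_vec_rk cnj_cay_powi)
  have qi: "integrable \<mu> (q i)" for i
    using slot_vec_ip(2)[OF dint[of i] k, of 0] unfolding eq by simp
  have "AE t in \<mu>. q i t = 0" for i
  proof (rule cayley_density_zero[OF sets_\<mu> qi])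
    fix n show "(\<integral>t. cay t powi n * q i t \<partial>\<mu>) = 0"
      using slot_vec_ip(1)[OF dint[of i] k, of "- n"] o[of i "- n"] unfolding eq by simp
  qed
  then have "AE t in \<mu>. \<forall>i. q i t = 0" by (simp add: AE_all_countable)
  then have "AE t in \<mu>. t \<in> Mset d j \<longrightarrow> k (j, t) = 0" for j
  proof eventually_elim
    case (elim t)
    show ?case
    proof
      assume "t \<in> Mset d j"
      then obtain i where i: "d i t > 0" "rk d i t = j" by (auto simp: Mset_def)
      have "q i t = 0" using elim by (rule spec)
      then show "k (j, t) = 0" using i by (simp add: q_def)
    qed
  qed
  then show "aeq \<nu> k (\<lambda>x. 0)" unfolding aeq_def slot_AE by simp
qed

text \<open>Different indices with positive density at t have different ranks, which gives
  orthogonality. For equal indices the two square roots multiply to the density, and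
  \<open>max 0\<close> accounts for the points where it is not positive.\<close>

lemma slot_vec_gram:
  assumes dint: "\<And>i. integrable \<mu> (d i)"
  shows "ip \<nu> (slot_vec i n) (slot_vec i' n') =
    (if i = i' then (\<integral>t. cay t powi (n' - n) * complex_of_real (max 0 (d i t)) \<partial>\<mu>) else 0)"
proof (cases "i = i'")
  case True
  have *: "(if d i t > 0 then cnj (slot_vec i n (rk d i t, t)) * slot_vec i n' (rk d i t, t) else 0)
      = cay t powi (n' - n) * complex_of_real (max 0 (d i t))" for t
  proof (cases "d i t > 0")
    case True
    then have "complex_of_real (sqrt (d i t)) * complex_of_real (sqrt (d i t)) = complex_of_real (d i t)"
      by (simp flip: of_real_mult)
    moreover have "cay t powi (n' - n) = cay t powi (- n) * cay t powi n'"
      by (simp add: power_int_add[symmetric])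
    ultimately show ?thesis using True by (simp add: slot_vec_rk cnj_cay_powi mult_ac)
  qed simp
  show ?thesis
    by (simp only: slot_vec_ip(1)[OF dint slot_vec_L2[OF dint]] True[symmetric] * if_True refl)
next
  case False
  have "slot_vec i' n' (rk d i t, t) = 0" if "d i t > 0" for t
    using rk_inj[of d i t i'] that False by (auto simp: slot_vec_def)
  then have "ip \<nu> (slot_vec i n) (slot_vec i' n') = (\<integral>t. 0 \<partial>\<mu>)"
    unfolding slot_vec_ip(1)[OF dint slot_vec_L2[OF dint]]
    by (intro Bochner_Integration.integral_cong) auto
  then show ?thesis using False by simp
qed

end

section \<open>The spectral theorem and the functional calculus\<close>

lemma unitary_L2D:
  assumes "unitary_L2 m \<nu> V"
  shows "f \<in> L2 m \<Longrightarrow> V f \<in> L2 \<nu>"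
    and "f \<in> L2 m \<Longrightarrow> g \<in> L2 m \<Longrightarrow> aeq \<nu> (V (\<lambda>x. f x + a * g x)) (\<lambda>y. V f y + a * V g y)"
    and "f \<in> L2 m \<Longrightarrow> g \<in> L2 m \<Longrightarrow> aeq m f g \<Longrightarrow> aeq \<nu> (V f) (V g)"
    and "f \<in> L2 m \<Longrightarrow> l2norm \<nu> (V f) = l2norm m f"
    and "k \<in> L2 \<nu> \<Longrightarrow> \<exists>f\<in>L2 m. aeq \<nu> (V f) k"
  using assms by (simp_all add: unitary_L2_def)

lemma unitary_inj:
  assumes V: "unitary_L2 m \<nu> V" and f: "f \<in> L2 m" and g: "g \<in> L2 m" and eq: "aeq \<nu> (V f) (V g)"
  shows "aeq m f g"
proof -
  have d: "(\<lambda>x. f x + (- 1) * g x) \<in> L2 m" using f g by (rule L2_lin)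
  have "aeq \<nu> (V (\<lambda>x. f x + (- 1) * g x)) (\<lambda>y. 0)"
    using unitary_L2D(2)[OF V f g, of "- 1"] eq unfolding aeq_def by eventually_elim simp
  then have "l2norm \<nu> (V (\<lambda>x. f x + (- 1) * g x)) = 0"
    by (subst l2norm_eq_0_iff[OF unitary_L2D(1)[OF V d]])
  then have "aeq m (\<lambda>x. f x + (- 1) * g x) (\<lambda>x. 0)"
    using unitary_L2D(4)[OF V d] l2norm_eq_0_iff[OF d] by simp
  then show ?thesis unfolding aeq_def by eventually_elim simp
qed

lemma spec_rep_iff:
  "spec_rep m A \<nu> V h \<longleftrightarrow> h \<in> borel_measurable \<nu> \<and> unitary_L2 m \<nu> V \<and>
     A = {(f,g). f \<in> L2 m \<and> g \<in> L2 m \<and> (\<lambda>y. complex_of_real (h y) * V f y) \<in> L2 \<nu> \<and>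
                 aeq \<nu> (V g) (\<lambda>y. complex_of_real (h y) * V f y)}"
  by (simp only: spec_rep_def unitary_L2_def conj_assoc)

text \<open>Clearing denominators; this translates pointwise between multiplication by
  \<open>cay t\<close> for the transform and multiplication by t for L.\<close>

lemma cay_eq_iff:
  "b + \<i> * a = cay t * (b - \<i> * a) \<longleftrightarrow> b = complex_of_real t * a"
proof -
  have "b + \<i> * a = cay t * (b - \<i> * a) \<longleftrightarrow>
      (complex_of_real t - \<i>) * (b + \<i> * a) = (complex_of_real t + \<i>) * (b - \<i> * a)"
    unfolding cay_def using cay_denom(1)[of t] by (auto simp: field_simps)
  also have "\<dots> \<longleftrightarrow> 2 * \<i> * b = 2 * \<i> * (complex_of_real t * a)"
    by (auto simp: algebra_simps)
  finally show ?thesis by simp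
qed

text \<open>The orbits of the generators and the slot vectors have the same Gram matrix, both being
  given by the moments of the same measures, so there is a unitary V between them. It carries the
  Cayley transform to multiplication by \<open>cay\<close>, and undoing the transform recovers
  L.\<close>

theorem spectral_theorem:
  fixes m :: "'a measure"
  assumes sep: "separable_L2 m" and sa: "selfadjoint m L"
  shows "\<exists>\<mu> d V. densities \<mu> d \<and> (AE t in \<mu>. t \<in> Mset d 1) \<and> spec_rep m L (slotm \<mu> (Mset d)) V snd"
proof -
  obtain g :: "nat \<Rightarrow> 'a fn" where gL: "\<And>i. g i \<in> L2 m"
    and gorth: "\<And>i j k l. i \<noteq> j \<Longrightarrow> ip m (cpow m L k (g i)) (cpow m L l (g j)) = 0"
    and gtot: "total_L2 m (range (\<lambda>(i, k). cpow m L k (g i)))"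
    using cayley_decomp[OF sep sa] by blast
  have "\<forall>i. \<exists>N. finite_measure N \<and> sets N = sets borel \<and>
     (\<forall>n::nat. (\<integral>t. cay t ^ n \<partial>N) = ip m (g i) (cpow m L (int n) (g i)))"
    using cayley_measure[OF sa gL] by blast
  from choice[OF this] obtain N where N: "\<And>i. finite_measure (N i)" "\<And>i. sets (N i) = sets borel"
    "\<And>i n. (\<integral>t. cay t ^ n \<partial>N i) = ip m (g i) (cpow m L (int n) (g i))" by blast
  obtain \<mu> where \<mu>: "finite_measure \<mu>" "sets \<mu> = sets borel"
    "\<And>A. A \<in> sets borel \<Longrightarrow> emeasure \<mu> A = 0 \<longleftrightarrow> (\<forall>i. emeasure (N i) A = 0)"
    using dominating_measure[of N borel] N by blast
  have "\<forall>i. \<exists>d. d \<in> borel_measurable \<mu> \<and> (\<forall>t. 0 \<le> d t) \<and> N i = density \<mu> (\<lambda>t. ennreal (d t))"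
    using RN_density_real[OF \<mu>(1) N(1)] \<mu>(2,3) N(2) by auto
  from choice[OF this] obtain d where d: "\<And>i. d i \<in> borel_measurable \<mu>" "\<And>i t. 0 \<le> d i t"
    "\<And>i. N i = density \<mu> (\<lambda>t. ennreal (d i t))" by blast
  have dens: "densities \<mu> d"
    by (rule densities.intro[OF \<mu>(1,2)]) (use d(1) measurable_cong_sets[OF \<mu>(2) refl] in blast)
  interpret densities \<mu> d by (rule dens)
  have dint: "integrable \<mu> (d i)" for i
  proof -
    note [measurable] = d(1)[of i]
    interpret Ni: finite_measure "N i" by (rule N(1))
    have "(\<integral>\<^sup>+t. ennreal (d i t) \<partial>\<mu>) = emeasure (N i) (space (N i))"
      unfolding d(3)[of i] by (subst emeasure_density) (auto simp: d(1) intro!: nn_integral_cong)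
    then have "(\<integral>\<^sup>+t. ennreal (d i t) \<partial>\<mu>) < \<infinity>" by (simp add: less_top[symmetric])
    then show ?thesis using d(1,2) by (intro integrableI_nonneg) auto
  qed
  \<comment> \<open>For negative exponents both sides are conjugated: \<open>cay t\<close> has
    modulus 1, and \<open>cpow m L n\<close> has adjoint \<open>cpow m L (- n)\<close>.\<close>
  have mom: "(\<integral>t. cay t powi n * complex_of_real (d i t) \<partial>\<mu>) = ip m (g i) (cpow m L n (g i))" for i n
  proof -
    have nat: "(\<integral>t. cay t ^ k * complex_of_real (d i t) \<partial>\<mu>) = ip m (g i) (cpow m L (int k) (g i))" for k
    proof -
      have "(\<lambda>t. cay t ^ k) \<in> borel_measurable \<mu>"
        using measurable_cay by (simp cong: measurable_cong_sets add: \<mu>(2))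
      then have "(\<integral>t. cay t ^ k \<partial>N i) = (\<integral>t. d i t *\<^sub>R cay t ^ k \<partial>\<mu>)"
        unfolding d(3)[of i] by (intro integral_density d) (auto simp: d)
      then show ?thesis unfolding N(3) by (simp add: scaleR_conv_of_real mult.commute)
    qed
    show ?thesis
    proof (cases "n \<ge> 0")
      case True
      then show ?thesis using nat[of "nat n"] by (simp add: power_int_def)
    next
      case False
      have "cay t powi n * complex_of_real (d i t) = cnj (cay t ^ nat (- n) * complex_of_real (d i t))" for t
        using False cnj_cay_powi[of t "- n"] by (simp add: power_int_def)
      then have "(\<integral>t. cay t powi n * complex_of_real (d i t) \<partial>\<mu>) = cnj (\<integral>t. cay t ^ nat (- n) * complex_of_real (d i t) \<partial>\<mu>)"
        by (simp only: Bochner_Integration.integral_cnj)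
      also have "\<dots> = ip m (cpow m L (- n) (g i)) (g i)" unfolding nat ip_cnj using False by simp
      also have "\<dots> = ip m (g i) (cpow m L n (g i))" using cpow_adjoint[OF sa gL gL] by simp
      finally show ?thesis .
    qed
  qed
  define a where "a p = (case p of (i, k) \<Rightarrow> cpow m L k (g i))" for p :: "nat \<times> int"
  define b where "b p = (case p of (i, k) \<Rightarrow> slot_vec i k)" for p
  have ab: "a (i, k) = cpow m L k (g i)" "b (i, k) = slot_vec i k" for i k by (simp_all add: a_def b_def)
  have aL: "a p \<in> L2 m" for p by (cases p) (simp add: ab cpow_L2[OF sa gL])
  have bL: "b p \<in> L2 \<nu>" for p by (cases p) (simp add: ab slot_vec_L2[OF dint])
  have gram: "ip m (a p) (a q) = ip \<nu> (b p) (b q)" for p q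
  proof -
    obtain i k j l where pq: "p = (i, k)" "q = (j, l)" by (cases p, cases q)
    show ?thesis
    proof (cases "i = j")
      case True
      have "max 0 (d i t) = d i t" for t using d(2)[of i t] by simp
      then show ?thesis unfolding pq ab slot_vec_gram[OF dint] using True
        by (simp add: cpow_ip[OF sa gL gL] mom)
    next
      case False
      then show ?thesis unfolding pq ab slot_vec_gram[OF dint] by (simp add: gorth)
    qed
  qed
  have rab: "range a = range (\<lambda>(i, k). cpow m L k (g i))" "range b = range (\<lambda>(i, n). slot_vec i n)"
    by (intro arg_cong[where f=range] ext, simp add: a_def b_def)+
  have tot: "total_L2 m (range a)" "total_L2 \<nu> (range b)"
    unfolding rab by (fact gtot, rule slot_vec_total[OF dint])
  obtain V where V: "unitary_L2 m \<nu> V" "\<And>f p. f \<in> L2 m \<Longrightarrow> ip \<nu> (b p) (V f) = ip m (a p) f"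
    using unitary_ext[OF aL bL gram tot] by blast
  note VL = unitary_L2D(1)[OF V(1)]
  have snd_m: "(snd :: nat \<times> real \<Rightarrow> real) \<in> borel_measurable \<nu>"
    unfolding slotm_measurable_iff[OF \<mu>(2)] by simp
  then have cay_m: "(\<lambda>y. cay (snd y)) \<in> borel_measurable \<nu>" by simp
  have cayL: "(\<lambda>y. cay (snd y) * k y) \<in> L2 \<nu>" if k: "k \<in> L2 \<nu>" for k
    by (rule L2_bound[OF k, of _ 1]) (use cay_m L2_measurable[OF k] in \<open>auto simp: norm_mult\<close>)
  \<comment> \<open>Tested against the total family of slot vectors: moving the transform to the
    other side lowers the exponent k by one, which is the same as a factor \<open>cay\<close> on the
    right.\<close>
  have VW: "aeq \<nu> (V (cayley m L \<i> f)) (\<lambda>y. cay (snd y) * V f y)" if f: "f \<in> L2 m" for f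
  proof (rule total_eqI[OF tot(2) bL VL[OF cayley_L2[OF sa imag_unit_i(1)[OF sa] f]] cayL[OF VL[OF f]]])
    fix p :: "nat \<times> int"
    obtain i k where p: "p = (i, k)" by (cases p)
    have W1: "cayley m L \<i> f = cpow m L (0 + 1) f" by (simp add: cpow_def)
    have "ip \<nu> (b p) (V (cayley m L \<i> f)) = ip m (cpow m L ((k - 1) + 1) (g i)) (cpow m L (0 + 1) f)"
      using V(2)[OF cayley_L2[OF sa imag_unit_i(1)[OF sa] f], of "(i, k)"] by (simp add: p ab W1)
    also have "\<dots> = ip \<nu> (slot_vec i (k - 1)) (V f)"
      unfolding cpow_shift1[OF sa gL f] using V(2)[OF f, of "(i, k - 1)"] by (simp add: ab)
    also have "\<dots> = ip \<nu> (slot_vec i k) (\<lambda>y. cay (snd y) * V f y)"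
      unfolding ip_def
    proof (intro Bochner_Integration.integral_cong refl)
      fix y :: "nat \<times> real"
      obtain j t where y: "y = (j, t)" by (cases y)
      have "cay t powi (- (k - 1)) = cay t powi (- k) * cay t"
        using power_int_add[of "cay t" "- k" 1] by (simp add: algebra_simps)
      then show "cnj (slot_vec i (k - 1) y) * V f y = cnj (slot_vec i k y) * (cay (snd y) * V f y)"
        by (simp add: y slot_vec_def cnj_cay_powi)
    qed
    finally show "ip \<nu> (b p) (V (cayley m L \<i> f)) = ip \<nu> (b p) (\<lambda>y. cay (snd y) * V f y)"
      by (simp add: p ab)
  qed
  have Vpm: "aeq \<nu> (V (\<lambda>x. v x - \<i> * u x)) (\<lambda>y. V v y - \<i> * V u y)"
    "aeq \<nu> (V (\<lambda>x. v x + \<i> * u x)) (\<lambda>y. V v y + \<i> * V u y)" if "u \<in> L2 m" "v \<in> L2 m" for u v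
    using unitary_L2D(2)[OF V(1) that(2,1), of "- \<i>"] unitary_L2D(2)[OF V(1) that(2,1), of \<i>] by simp_all
  have "L = {(f,g). f \<in> L2 m \<and> g \<in> L2 m \<and> (\<lambda>y. complex_of_real (snd y) * V f y) \<in> L2 \<nu> \<and>
                 aeq \<nu> (V g) (\<lambda>y. complex_of_real (snd y) * V f y)}" (is "L = ?R")
  proof (intro subset_antisym subrelI)
    fix u v assume uv: "(u, v) \<in> L"
    then have L: "u \<in> L2 m" "v \<in> L2 m" using sa_L2[OF sa] by auto
    define f where "f = (\<lambda>x. v x - \<i> * u x)"
    have fL: "f \<in> L2 m" unfolding f_def by (intro L2_diff L2_scale L)
    have "aeq m (cayley m L \<i> f) (\<lambda>x. v x + \<i> * u x)"
      by (rule cayley_eq[OF sa imag_unit_i(1)[OF sa] fL uv]) (simp add: f_def aeq_def)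
    then have "aeq \<nu> (V (cayley m L \<i> f)) (V (\<lambda>x. v x + \<i> * u x))"
      by (intro unitary_L2D(3)[OF V(1)] cayley_L2[OF sa imag_unit_i(1)[OF sa] fL] L2_lin L)
    with VW[OF fL] Vpm[OF L] have eq: "aeq \<nu> (V v) (\<lambda>y. complex_of_real (snd y) * V u y)"
      unfolding aeq_def f_def
    proof eventually_elim
      case (elim y)
      then have "V v y + \<i> * V u y = cay (snd y) * (V v y - \<i> * V u y)" by simp
      then show ?case unfolding cay_eq_iff .
    qed
    have "(\<lambda>y. complex_of_real (snd y) * V u y) \<in> L2 \<nu>"
      by (rule L2_cong_AE[OF VL[OF L(2)] _ eq]) (use snd_m L2_measurable[OF VL[OF L(1)]] in auto)
    with eq L show "(u, v) \<in> ?R" by simp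
  next
    fix f g assume "(f, g) \<in> ?R"
    then have L: "f \<in> L2 m" "g \<in> L2 m" and eq: "aeq \<nu> (V g) (\<lambda>y. complex_of_real (snd y) * V f y)" by auto
    define F where "F = (\<lambda>x. g x - \<i> * f x)"
    have FL: "F \<in> L2 m" unfolding F_def by (intro L2_diff L2_scale L)
    have GL: "(\<lambda>x. g x + \<i> * f x) \<in> L2 m" by (intro L2_lin L)
    have "aeq \<nu> (V (cayley m L \<i> F)) (V (\<lambda>x. g x + \<i> * f x))"
      using VW[OF FL] Vpm[OF L] eq unfolding aeq_def F_def
    proof eventually_elim
      case (elim y)
      have "V g y + \<i> * V f y = cay (snd y) * (V g y - \<i> * V f y)" using elim(4) by (simp only: cay_eq_iff)
      then show ?case using elim by simp
    qed
    then have WF: "aeq m (cayley m L \<i> F) (\<lambda>x. g x + \<i> * f x)"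
      by (rule unitary_inj[OF V(1) cayley_L2[OF sa imag_unit_i(1)[OF sa] FL] GL])
    \<comment> \<open>A pair of L with the same difference \<open>v - \<i> * u\<close> as F and, by
      \<open>WF\<close>, also the same sum; adding and subtracting shows that it is the pair (f, g)
      up to null sets.\<close>
    obtain u v where uv: "(u, v) \<in> L" "aeq m F (\<lambda>x. v x - \<i> * u x)" "cayley m L \<i> F = (\<lambda>x. v x + \<i> * u x)"
      using cayley_ex[OF sa imag_unit_i(1)[OF sa] FL] by blast
    note pm = WF[unfolded uv(3), unfolded aeq_def] uv(2)[unfolded aeq_def F_def]
    have "AE x in m. v x = g x \<and> u x = f x"
      using pm
    proof eventually_elim
      case (elim x)
      then have "2 * v x = 2 * g x" "2 * \<i> * u x = 2 * \<i> * f x" by (simp_all add: complex_eq_iff)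
      then show ?case by simp
    qed
    then have e1: "aeq m v g" and e2: "aeq m u f" by (auto simp: aeq_def)
    show "(f, g) \<in> L" by (rule sa_cong[OF sa uv(1) L e2 e1])
  qed
  then have "spec_rep m L \<nu> V snd" unfolding spec_rep_iff using snd_m V(1) by blast
  \<comment> \<open>Off \<open>Mset d 1\<close> every density vanishes, so the complement is null
    for each \<open>N i\<close> and therefore for the measure \<mu> dominated by them in the sense
    of null sets.\<close>
  moreover have "AE t in \<mu>. t \<in> Mset d 1"
  proof -
    have Ms: "- Mset d 1 \<in> sets borel" using Mset_sets by auto
    have "emeasure (N i) (- Mset d 1) = 0" for i
    proof -
      have "emeasure (N i) (- Mset d 1) = (\<integral>\<^sup>+t. ennreal (d i t) * indicator (- Mset d 1) t \<partial>\<mu>)"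
        unfolding d(3)[of i] by (rule emeasure_density) (use d(1) Ms \<mu>(2) in auto)
      also have "\<dots> = (\<integral>\<^sup>+t. 0 \<partial>\<mu>)"
      proof (intro nn_integral_cong)
        fix t show "ennreal (d i t) * indicator (- Mset d 1) t = 0"
        proof (cases "d i t > 0")
          case True
          then have "t \<in> Mset d 1" by (rule Mset_1)
          then show ?thesis by simp
        next
          case False
          then show ?thesis using d(2)[of i t] by simp
        qed
      qed
      finally show ?thesis by simp
    qed
    then have "emeasure \<mu> (- Mset d 1) = 0" using \<mu>(3)[OF Ms] by simp
    then show ?thesis by (intro AE_I[of _ _ "- Mset d 1"]) (use Ms \<mu>(2) in auto)
  qed
  ultimately show ?thesis using dens by blast
qed

section \<open>Independence of the functional calculus from the representation\<close>

lemma spec_rep_cayley: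
  assumes sa: "selfadjoint m L" and sr: "spec_rep m L \<nu> V h" and f: "f \<in> L2 m"
  shows "aeq \<nu> (V (cayley m L \<i> f)) (\<lambda>y. cay (h y) * V f y)"
proof -
  have V: "unitary_L2 m \<nu> V" using sr by (simp add: spec_rep_iff)
  obtain u v where uv: "(u, v) \<in> L" "aeq m f (\<lambda>x. v x - \<i> * u x)" "cayley m L \<i> f = (\<lambda>x. v x + \<i> * u x)"
    using cayley_ex[OF sa imag_unit_i(1)[OF sa] f] by blast
  then have L: "u \<in> L2 m" "v \<in> L2 m" using sa_L2[OF sa] by auto
  have Vv: "aeq \<nu> (V v) (\<lambda>y. complex_of_real (h y) * V u y)"
    using sr uv(1) unfolding spec_rep_iff by blast
  have "aeq \<nu> (V f) (V (\<lambda>x. v x - \<i> * u x))"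
    by (rule unitary_L2D(3)[OF V f _ uv(2)]) (intro L2_diff L2_scale L)
  with Vv unitary_L2D(2)[OF V L(2,1), of "- \<i>"] unitary_L2D(2)[OF V L(2,1), of \<i>] show ?thesis
    unfolding uv(3) aeq_def
  proof eventually_elim
    case (elim y)
    have "V v y + \<i> * V u y = cay (h y) * (V v y - \<i> * V u y)" using elim(1) by (simp only: cay_eq_iff)
    then show ?case using elim by simp
  qed
qed

text \<open>The right side does not mention the representation; this is the only link between two
  unrelated choices of one.\<close>

lemma spec_rep_moments:
  assumes sa: "selfadjoint m L" and sr: "spec_rep m L \<nu> V h" and f: "f \<in> L2 m"
  shows "(\<integral>y. cay (h y) ^ n * complex_of_real ((cmod (V f y))\<^sup>2) \<partial>\<nu>) = ip m f (cpow m L (int n) f)"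
proof -
  have V: "unitary_L2 m \<nu> V" and hm: "h \<in> borel_measurable \<nu>" using sr by (simp_all add: spec_rep_iff)
  have XL: "cpow m L (int n) f \<in> L2 m" for n by (rule cpow_L2[OF sa f])
  have "aeq \<nu> (V (cpow m L (int n) f)) (\<lambda>y. cay (h y) ^ n * V f y)"
  proof (induction n)
    case 0 then show ?case by (simp add: aeq_def)
  next
    case (Suc n)
    have e: "cpow m L (int (Suc n)) f = cayley m L \<i> (cpow m L (int n) f)"
      by (simp add: cpow_def nat_add_distrib)
    show ?case unfolding e using spec_rep_cayley[OF sa sr XL[of n]] Suc unfolding aeq_def by eventually_elim simp
  qed
  then have "ip m f (cpow m L (int n) f) = ip \<nu> (V f) (\<lambda>y. cay (h y) ^ n * V f y)"
    unfolding unitary_ip[OF V f XL, symmetric]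
    by (intro ip_cong) (use hm L2_measurable[OF unitary_L2D(1)[OF V f]] L2_measurable[OF unitary_L2D(1)[OF V XL]] in \<open>auto simp: aeq_def\<close>)
  also have "\<dots> = (\<integral>y. cay (h y) ^ n * complex_of_real ((cmod (V f y))\<^sup>2) \<partial>\<nu>)"
    unfolding ip_def complex_norm_square by (intro Bochner_Integration.integral_cong) (auto simp: mult_ac)
  finally show ?thesis by simp
qed

text \<open>Both image measures live on the line and have the moments of f under the powers of the
  Cayley transform, so they coincide although the underlying spaces differ.\<close>

lemma spec_rep_distr_eq:
  assumes sa: "selfadjoint m L" and sr: "spec_rep m L \<nu>1 V1 h1" "spec_rep m L \<nu>2 V2 h2" and f: "f \<in> L2 m"
  shows "distr (density \<nu>1 (\<lambda>y. ennreal ((cmod (V1 f y))\<^sup>2))) borel h1 = distr (density \<nu>2 (\<lambda>y. ennreal ((cmod (V2 f y))\<^sup>2))) borel h2"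
proof (rule cayley_moments_unique)
  fix n :: nat
  have *: "(\<integral>t. cay t ^ n \<partial>distr (density \<nu> (\<lambda>y. ennreal ((cmod (V f y))\<^sup>2))) borel h) = ip m f (cpow m L (int n) f)"
    if sr: "spec_rep m L \<nu> V h" for \<nu> V h
  proof -
    have V: "unitary_L2 m \<nu> V" and hm: "h \<in> borel_measurable \<nu>" using sr by (simp_all add: spec_rep_iff)
    note [measurable] = hm L2_measurable[OF unitary_L2D(1)[OF V f]]
    have "(\<integral>t. cay t ^ n \<partial>distr (density \<nu> (\<lambda>y. ennreal ((cmod (V f y))\<^sup>2))) borel h)
       = (\<integral>y. cay (h y) ^ n \<partial>density \<nu> (\<lambda>y. ennreal ((cmod (V f y))\<^sup>2)))"
      by (rule integral_distr) auto
    also have "\<dots> = (\<integral>y. (cmod (V f y))\<^sup>2 *\<^sub>R cay (h y) ^ n \<partial>\<nu>)" by (rule integral_density) auto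
    also have "\<dots> = ip m f (cpow m L (int n) f)"
      unfolding spec_rep_moments[OF sa sr f, symmetric] by (simp add: scaleR_conv_of_real mult.commute)
    finally show ?thesis .
  qed
  show "(\<integral>t. cay t ^ n \<partial>distr (density \<nu>1 (\<lambda>y. ennreal ((cmod (V1 f y))\<^sup>2))) borel h1)
     = (\<integral>t. cay t ^ n \<partial>distr (density \<nu>2 (\<lambda>y. ennreal ((cmod (V2 f y))\<^sup>2))) borel h2)"
    unfolding *[OF sr(1)] *[OF sr(2)] ..
next
  have *: "finite_measure (distr (density \<nu> (\<lambda>y. ennreal ((cmod (V f y))\<^sup>2))) borel h)"
    if sr: "spec_rep m L \<nu> V h" for \<nu> :: "(nat \<times> real) measure" and V h
  proof -
    have V: "unitary_L2 m \<nu> V" and hm: "h \<in> borel_measurable \<nu>" using sr by (simp_all add: spec_rep_iff)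
    note [measurable] = hm L2_measurable[OF unitary_L2D(1)[OF V f]]
    have "finite_measure (density \<nu> (\<lambda>y. ennreal ((cmod (V f y))\<^sup>2)))"
    proof (rule finite_measureI)
      have "emeasure (density \<nu> (\<lambda>y. ennreal ((cmod (V f y))\<^sup>2))) (space \<nu>) = (\<integral>\<^sup>+y. ennreal ((cmod (V f y))\<^sup>2) \<partial>\<nu>)"
        by (subst emeasure_density) (auto intro!: nn_integral_cong)
      then show "emeasure (density \<nu> (\<lambda>y. ennreal ((cmod (V f y))\<^sup>2))) (space (density \<nu> (\<lambda>y. ennreal ((cmod (V f y))\<^sup>2)))) \<noteq> \<infinity>"
        using nn_integral_L2[OF unitary_L2D(1)[OF V f]] by simp
    qed
    then interpret finite_measure "density \<nu> (\<lambda>y. ennreal ((cmod (V f y))\<^sup>2))" .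
    show ?thesis by (rule finite_measure_distr) (use hm in simp)
  qed
  show "finite_measure (distr (density \<nu>1 (\<lambda>y. ennreal ((cmod (V1 f y))\<^sup>2))) borel h1)" by (rule *[OF sr(1)])
  show "finite_measure (distr (density \<nu>2 (\<lambda>y. ennreal ((cmod (V2 f y))\<^sup>2))) borel h2)" by (rule *[OF sr(2)])
qed simp_all

lemma polarization_complex:
  "4 * (x * cnj y) = complex_of_real ((cmod (x + y))\<^sup>2) - complex_of_real ((cmod (x + (- 1) * y))\<^sup>2)
     + \<i> * complex_of_real ((cmod (x + \<i> * y))\<^sup>2) - \<i> * complex_of_real ((cmod (x + (- \<i>) * y))\<^sup>2)"
  unfolding complex_norm_square by (simp add: algebra_simps)

text \<open>Polarization of \<open>spec_rep_distr_eq\<close>; the bound on \<Psi> makes each of the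
  four integrals converge separately.\<close>

lemma spec_rep_weighted_ip_eq:
  assumes sa: "selfadjoint m L" and sr: "spec_rep m L \<nu>1 V1 h1" "spec_rep m L \<nu>2 V2 h2"
    and f: "f \<in> L2 m" and g: "g \<in> L2 m"
    and \<Psi>: "\<Psi> \<in> borel_measurable borel" "\<And>t. cmod (\<Psi> t) \<le> C"
  shows "(\<integral>y. \<Psi> (h1 y) * (V1 f y * cnj (V1 g y)) \<partial>\<nu>1) = (\<integral>y. \<Psi> (h2 y) * (V2 f y * cnj (V2 g y)) \<partial>\<nu>2)"
proof -
  define \<rho> where "\<rho> \<nu> V h f = distr (density \<nu> (\<lambda>y. ennreal ((cmod (V f y))\<^sup>2))) borel h"
    for \<nu> :: "(nat \<times> real) measure" and V :: "'a fn \<Rightarrow> (nat \<times> real) fn" and h :: "nat \<times> real \<Rightarrow> real" and f :: "'a fn"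
  have key: "4 * (\<integral>y. \<Psi> (h y) * (V f y * cnj (V g y)) \<partial>\<nu>) =
      (\<integral>t. \<Psi> t \<partial>\<rho> \<nu> V h (\<lambda>x. f x + 1 * g x)) - (\<integral>t. \<Psi> t \<partial>\<rho> \<nu> V h (\<lambda>x. f x + (- 1) * g x))
      + \<i> * (\<integral>t. \<Psi> t \<partial>\<rho> \<nu> V h (\<lambda>x. f x + \<i> * g x)) - \<i> * (\<integral>t. \<Psi> t \<partial>\<rho> \<nu> V h (\<lambda>x. f x + (- \<i>) * g x))"
    if sr: "spec_rep m L \<nu> V h" for \<nu> V h
  proof -
    have V: "unitary_L2 m \<nu> V" and hm[measurable]: "h \<in> borel_measurable \<nu>" using sr by (simp_all add: spec_rep_iff)
    note [measurable] = L2_measurable[OF unitary_L2D(1)[OF V f]] L2_measurable[OF unitary_L2D(1)[OF V g]] \<Psi>(1)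
    have 1: "(\<integral>t. \<Psi> t \<partial>\<rho> \<nu> V h (\<lambda>x. f x + a * g x)) = (\<integral>y. \<Psi> (h y) * complex_of_real ((cmod (V f y + a * V g y))\<^sup>2) \<partial>\<nu>)"
      and 2: "integrable \<nu> (\<lambda>y. \<Psi> (h y) * complex_of_real ((cmod (V f y + a * V g y))\<^sup>2))" for a
    proof -
      have FL: "(\<lambda>x. f x + a * g x) \<in> L2 m" by (rule L2_lin[OF f g])
      note [measurable] = L2_measurable[OF unitary_L2D(1)[OF V FL]]
      have "(\<integral>t. \<Psi> t \<partial>\<rho> \<nu> V h (\<lambda>x. f x + a * g x)) = (\<integral>y. \<Psi> (h y) \<partial>density \<nu> (\<lambda>y. ennreal ((cmod (V (\<lambda>x. f x + a * g x) y))\<^sup>2)))"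
        unfolding \<rho>_def by (rule integral_distr) auto
      also have "\<dots> = (\<integral>y. (cmod (V (\<lambda>x. f x + a * g x) y))\<^sup>2 *\<^sub>R \<Psi> (h y) \<partial>\<nu>)" by (rule integral_density) auto
      also have "\<dots> = (\<integral>y. \<Psi> (h y) * complex_of_real ((cmod (V f y + a * V g y))\<^sup>2) \<partial>\<nu>)"
      proof (rule integral_cong_AE)
        show "AE y in \<nu>. (cmod (V (\<lambda>x. f x + a * g x) y))\<^sup>2 *\<^sub>R \<Psi> (h y) = \<Psi> (h y) * complex_of_real ((cmod (V f y + a * V g y))\<^sup>2)"
          using unitary_L2D(2)[OF V f g, of a] unfolding aeq_def
          by eventually_elim (simp add: scaleR_conv_of_real mult.commute)
      qed measurable
      finally show "(\<integral>t. \<Psi> t \<partial>\<rho> \<nu> V h (\<lambda>x. f x + a * g x)) = (\<integral>y. \<Psi> (h y) * complex_of_real ((cmod (V f y + a * V g y))\<^sup>2) \<partial>\<nu>)" .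
      have C: "0 \<le> C" using \<Psi>(2)[of 0] norm_ge_zero order_trans by blast
      have "integrable \<nu> (\<lambda>y. C * (cmod (V f y + a * V g y))\<^sup>2)"
        by (intro integrable_mult_right L2_integrable L2_lin unitary_L2D(1)[OF V] f g)
      then show "integrable \<nu> (\<lambda>y. \<Psi> (h y) * complex_of_real ((cmod (V f y + a * V g y))\<^sup>2))"
      proof (rule Bochner_Integration.integrable_bound)
        show "AE y in \<nu>. norm (\<Psi> (h y) * complex_of_real ((cmod (V f y + a * V g y))\<^sup>2)) \<le> norm (C * (cmod (V f y + a * V g y))\<^sup>2)"
          using \<Psi>(2) C by (intro AE_I2) (simp add: norm_mult norm_power mult_right_mono)
      qed measurable
    qed
    have eq: "4 * (\<Psi> (h y) * (V f y * cnj (V g y))) =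
      \<Psi> (h y) * complex_of_real ((cmod (V f y + 1 * V g y))\<^sup>2) - \<Psi> (h y) * complex_of_real ((cmod (V f y + (- 1) * V g y))\<^sup>2)
     + \<i> * (\<Psi> (h y) * complex_of_real ((cmod (V f y + \<i> * V g y))\<^sup>2)) - \<i> * (\<Psi> (h y) * complex_of_real ((cmod (V f y + (- \<i>) * V g y))\<^sup>2))" for y
    proof -
      have "4 * (\<Psi> (h y) * (V f y * cnj (V g y))) = \<Psi> (h y) * (4 * (V f y * cnj (V g y)))" by simp
      then show ?thesis unfolding polarization_complex by (simp only: mult_1 right_diff_distrib distrib_left mult.left_commute)
    qed
    have "4 * (\<integral>y. \<Psi> (h y) * (V f y * cnj (V g y)) \<partial>\<nu>) = (\<integral>y. 4 * (\<Psi> (h y) * (V f y * cnj (V g y))) \<partial>\<nu>)"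
      by simp
    also have "\<dots> = (\<integral>t. \<Psi> t \<partial>\<rho> \<nu> V h (\<lambda>x. f x + 1 * g x)) - (\<integral>t. \<Psi> t \<partial>\<rho> \<nu> V h (\<lambda>x. f x + (- 1) * g x))
      + \<i> * (\<integral>t. \<Psi> t \<partial>\<rho> \<nu> V h (\<lambda>x. f x + \<i> * g x)) - \<i> * (\<integral>t. \<Psi> t \<partial>\<rho> \<nu> V h (\<lambda>x. f x + (- \<i>) * g x))"
      unfolding eq 1 integral_mult_right_zero[symmetric]
      by (simp only: Bochner_Integration.integral_diff Bochner_Integration.integral_add Bochner_Integration.integrable_diff
          Bochner_Integration.integrable_add integrable_mult_right 2)
    finally show ?thesis .
  qed
  have "\<rho> \<nu>1 V1 h1 (\<lambda>x. f x + a * g x) = \<rho> \<nu>2 V2 h2 (\<lambda>x. f x + a * g x)" for a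
    unfolding \<rho>_def by (rule spec_rep_distr_eq[OF sa sr]) (rule L2_lin[OF f g])
  then have "4 * (\<integral>y. \<Psi> (h1 y) * (V1 f y * cnj (V1 g y)) \<partial>\<nu>1) = 4 * (\<integral>y. \<Psi> (h2 y) * (V2 f y * cnj (V2 g y)) \<partial>\<nu>2)"
    unfolding key[OF sr(1)] key[OF sr(2)] by (simp only:)
  then show ?thesis by simp
qed

definition rep_calc :: "'a measure \<Rightarrow> (real \<Rightarrow> complex) \<Rightarrow> (nat \<times> real) measure \<Rightarrow> ('a fn \<Rightarrow> (nat \<times> real) fn) \<Rightarrow> (nat \<times> real \<Rightarrow> real) \<Rightarrow> 'a op" where
  "rep_calc m \<Phi> \<nu> V h = {(f,g). f \<in> L2 m \<and> g \<in> L2 m \<and> (\<lambda>y. \<Phi> (h y) * V f y) \<in> L2 \<nu> \<and>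
                 aeq \<nu> (V g) (\<lambda>y. \<Phi> (h y) * V f y)}"

text \<open>Membership has to be expressed by quantities common to all representations. The domain
  condition is an integral against the distribution of f, and the equation for g says that a squared
  distance vanishes, which expands into weighted inner products.\<close>

lemma rep_calc_subset:
  assumes sa: "selfadjoint m L" and sr: "spec_rep m L \<nu>1 V1 h1" "spec_rep m L \<nu>2 V2 h2"
    and \<Phi>[measurable]: "\<Phi> \<in> borel_measurable borel"
  shows "rep_calc m \<Phi> \<nu>1 V1 h1 \<subseteq> rep_calc m \<Phi> \<nu>2 V2 h2"
proof (rule subrelI)
  fix f g assume fg: "(f, g) \<in> rep_calc m \<Phi> \<nu>1 V1 h1"
  then have f: "f \<in> L2 m" and g: "g \<in> L2 m" and P1: "(\<lambda>y. \<Phi> (h1 y) * V1 f y) \<in> L2 \<nu>1"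
    and e1: "aeq \<nu>1 (V1 g) (\<lambda>y. \<Phi> (h1 y) * V1 f y)" by (auto simp: rep_calc_def)
  have V: "unitary_L2 m \<nu>1 V1" "unitary_L2 m \<nu>2 V2"
    and hm[measurable]: "h1 \<in> borel_measurable \<nu>1" "h2 \<in> borel_measurable \<nu>2" using sr by (simp_all add: spec_rep_iff)
  note [measurable] = L2_measurable[OF unitary_L2D(1)[OF V(1) f]] L2_measurable[OF unitary_L2D(1)[OF V(1) g]]
    L2_measurable[OF unitary_L2D(1)[OF V(2) f]] L2_measurable[OF unitary_L2D(1)[OF V(2) g]]
  have nn: "(\<integral>\<^sup>+y. ennreal ((cmod (\<Phi> (h y) * V f y))\<^sup>2) \<partial>\<nu>) =
      (\<integral>\<^sup>+t. ennreal ((cmod (\<Phi> t))\<^sup>2) \<partial>distr (density \<nu> (\<lambda>y. ennreal ((cmod (V f y))\<^sup>2))) borel h)"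
    if [measurable]: "h \<in> borel_measurable \<nu>" "V f \<in> borel_measurable \<nu>" for \<nu> :: "(nat \<times> real) measure" and V h
    by (subst nn_integral_distr, measurable, subst nn_integral_density, measurable)
       (intro nn_integral_cong, simp add: norm_mult power_mult_distrib ennreal_mult mult.commute)
  \<comment> \<open>Square integrability depends on f only through the distribution shared by both
    representations.\<close>
  have P2: "(\<lambda>y. \<Phi> (h2 y) * V2 f y) \<in> L2 \<nu>2"
  proof (subst L2_nn_integral_iff)
    show "(\<lambda>y. \<Phi> (h2 y) * V2 f y) \<in> borel_measurable \<nu>2" by measurable
    have "(\<integral>\<^sup>+y. ennreal ((cmod (\<Phi> (h2 y) * V2 f y))\<^sup>2) \<partial>\<nu>2) = (\<integral>\<^sup>+y. ennreal ((cmod (\<Phi> (h1 y) * V1 f y))\<^sup>2) \<partial>\<nu>1)"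
      by (subst (1 2) nn) (auto simp: spec_rep_distr_eq[OF sa sr f])
    also have "\<dots> < \<infinity>" using nn_integral_L2[OF P1] by simp
    finally show "(\<integral>\<^sup>+y. ennreal ((cmod (\<Phi> (h2 y) * V2 f y))\<^sup>2) \<partial>\<nu>2) < \<infinity>" .
  qed
  \<comment> \<open>\<Phi> may be unbounded; restricting to the points where its modulus is at most
    n makes all the weights bounded, and every point is reached by some n.\<close>
  define cut :: "nat \<Rightarrow> real \<Rightarrow> complex" where "cut n t = (if cmod (\<Phi> t) \<le> real n then 1 else 0)" for n t
  have [measurable]: "cut n \<in> borel_measurable borel" for n unfolding cut_def by measurable
  \<comment> \<open>The four terms of the expanded square of
    \<open>cut n (h y) * (V g y - \<Phi> (h y) * V f y)\<close>; each has a bounded weight and is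
    therefore the same in both representations.\<close>
  define Q where "Q n \<nu> V h = (\<integral>y. cut n (h y) * (V g y * cnj (V g y)) \<partial>\<nu>) - (\<integral>y. (cut n (h y) * \<Phi> (h y)) * (V f y * cnj (V g y)) \<partial>\<nu>)
     - (\<integral>y. (cut n (h y) * cnj (\<Phi> (h y))) * (V g y * cnj (V f y)) \<partial>\<nu>) + (\<integral>y. (cut n (h y) * (\<Phi> (h y) * cnj (\<Phi> (h y)))) * (V f y * cnj (V f y)) \<partial>\<nu>)"
    for n and \<nu> :: "(nat \<times> real) measure" and V h
  have bd: "cmod (cut n t) \<le> 1" "cmod (cut n t * \<Phi> t) \<le> real n" "cmod (cut n t * cnj (\<Phi> t)) \<le> real n"
    "cmod (cut n t * (\<Phi> t * cnj (\<Phi> t))) \<le> real n * real n" for n t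
    by (auto simp: cut_def norm_mult mult_mono)
  have QQ: "Q n \<nu>1 V1 h1 = Q n \<nu>2 V2 h2" for n
    unfolding Q_def
    by (intro arg_cong2[where f="(+)"] arg_cong2[where f="(-)"]
        spec_rep_weighted_ip_eq[OF sa sr g g _ bd(1)] spec_rep_weighted_ip_eq[OF sa sr f g _ bd(2)]
        spec_rep_weighted_ip_eq[OF sa sr g f _ bd(3)] spec_rep_weighted_ip_eq[OF sa sr f f _ bd(4)]) measurable
  have Qeq: "Q n \<nu> V h = complex_of_real (\<integral>y. (cmod (cut n (h y) * (V g y - \<Phi> (h y) * V f y)))\<^sup>2 \<partial>\<nu>)"
    and Qint: "integrable \<nu> (\<lambda>y. (cmod (cut n (h y) * (V g y - \<Phi> (h y) * V f y)))\<^sup>2)"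
    if hm[measurable]: "h \<in> borel_measurable \<nu>" and Vf: "V f \<in> L2 \<nu>" and Vg: "V g \<in> L2 \<nu>"
    for \<nu> :: "(nat \<times> real) measure" and V h n
  proof -
    note [measurable] = L2_measurable[OF Vf] L2_measurable[OF Vg]
    have wL: "integrable \<nu> (\<lambda>y. \<Psi> (h y) * (k y * cnj (l y)))"
      if k: "k \<in> L2 \<nu>" and l: "l \<in> L2 \<nu>" and [measurable]: "\<Psi> \<in> borel_measurable borel" and b: "\<And>t. cmod (\<Psi> t) \<le> C"
      for k l \<Psi> and C :: real
    proof -
      note [measurable] = L2_measurable[OF k] L2_measurable[OF l]
      have "(\<lambda>y. \<Psi> (h y) * k y) \<in> L2 \<nu>"
        by (rule L2_bound[OF k, of _ C]) (measurable, auto simp: norm_mult intro!: mult_right_mono b)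
      from L2_prod_integrable[OF l this] show ?thesis by (simp add: mult_ac)
    qed
    have i1: "integrable \<nu> (\<lambda>y. cut n (h y) * (V g y * cnj (V g y)))"
      by (rule wL[OF Vg Vg _ bd(1)]) measurable
    have i2: "integrable \<nu> (\<lambda>y. (cut n (h y) * \<Phi> (h y)) * (V f y * cnj (V g y)))"
      by (rule wL[OF Vf Vg _ bd(2)]) measurable
    have i3: "integrable \<nu> (\<lambda>y. (cut n (h y) * cnj (\<Phi> (h y))) * (V g y * cnj (V f y)))"
      by (rule wL[OF Vg Vf _ bd(3)]) measurable
    have i4: "integrable \<nu> (\<lambda>y. (cut n (h y) * (\<Phi> (h y) * cnj (\<Phi> (h y)))) * (V f y * cnj (V f y)))"
      by (rule wL[OF Vf Vf _ bd(4)]) measurable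
    have pt: "complex_of_real ((cmod (cut n (h y) * (V g y - \<Phi> (h y) * V f y)))\<^sup>2) =
       cut n (h y) * (V g y * cnj (V g y)) - (cut n (h y) * \<Phi> (h y)) * (V f y * cnj (V g y))
       - (cut n (h y) * cnj (\<Phi> (h y))) * (V g y * cnj (V f y)) + (cut n (h y) * (\<Phi> (h y) * cnj (\<Phi> (h y)))) * (V f y * cnj (V f y))" for y
      unfolding complex_norm_square by (simp add: cut_def algebra_simps)
    have c: "integrable \<nu> (\<lambda>y. complex_of_real ((cmod (cut n (h y) * (V g y - \<Phi> (h y) * V f y)))\<^sup>2))"
      unfolding pt by (intro Bochner_Integration.integrable_add Bochner_Integration.integrable_diff i1 i2 i3 i4)
    then show "integrable \<nu> (\<lambda>y. (cmod (cut n (h y) * (V g y - \<Phi> (h y) * V f y)))\<^sup>2)"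
      using integrable_Re[OF c] by simp
    have "complex_of_real (\<integral>y. (cmod (cut n (h y) * (V g y - \<Phi> (h y) * V f y)))\<^sup>2 \<partial>\<nu>)
        = (\<integral>y. complex_of_real ((cmod (cut n (h y) * (V g y - \<Phi> (h y) * V f y)))\<^sup>2) \<partial>\<nu>)"
      by (rule integral_complex_of_real[symmetric])
    also have "\<dots> = Q n \<nu> V h" unfolding pt Q_def
      by (simp only: Bochner_Integration.integral_diff Bochner_Integration.integral_add
          Bochner_Integration.integrable_diff i1 i2 i3 i4)
    finally show "Q n \<nu> V h = complex_of_real (\<integral>y. (cmod (cut n (h y) * (V g y - \<Phi> (h y) * V f y)))\<^sup>2 \<partial>\<nu>)" ..
  qed
  have "AE y in \<nu>2. cut n (h2 y) * (V2 g y - \<Phi> (h2 y) * V2 f y) = 0" for n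
  proof -
    have "AE y in \<nu>1. (cmod (cut n (h1 y) * (V1 g y - \<Phi> (h1 y) * V1 f y)))\<^sup>2 = 0"
      using e1 unfolding aeq_def by eventually_elim simp
    then have "(\<integral>y. (cmod (cut n (h1 y) * (V1 g y - \<Phi> (h1 y) * V1 f y)))\<^sup>2 \<partial>\<nu>1) = 0"
      by (rule integral_eq_zero_AE)
    then have "Q n \<nu>1 V1 h1 = 0"
      using Qeq[OF hm(1) unitary_L2D(1)[OF V(1) f] unitary_L2D(1)[OF V(1) g], of n] by simp
    then have "(\<integral>y. (cmod (cut n (h2 y) * (V2 g y - \<Phi> (h2 y) * V2 f y)))\<^sup>2 \<partial>\<nu>2) = 0"
      using Qeq[OF hm(2) unitary_L2D(1)[OF V(2) f] unitary_L2D(1)[OF V(2) g], of n] unfolding QQ by simp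
    then have "AE y in \<nu>2. (cmod (cut n (h2 y) * (V2 g y - \<Phi> (h2 y) * V2 f y)))\<^sup>2 = 0"
      by (subst (asm) integral_nonneg_eq_0_iff_AE[OF Qint[OF hm(2) unitary_L2D(1)[OF V(2) f] unitary_L2D(1)[OF V(2) g]]]) auto
    then show ?thesis by eventually_elim simp
  qed
  then have "AE y in \<nu>2. \<forall>n. cut n (h2 y) * (V2 g y - \<Phi> (h2 y) * V2 f y) = 0"
    by (subst AE_all_countable) (rule allI)
  then have "aeq \<nu>2 (V2 g) (\<lambda>y. \<Phi> (h2 y) * V2 f y)"
    unfolding aeq_def
  proof eventually_elim
    case (elim y)
    obtain n where "cmod (\<Phi> (h2 y)) \<le> real n" using real_arch_simple by blast
    then have "cut n (h2 y) = 1" by (simp add: cut_def)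
    then show ?case using spec[OF elim, of n] by simp
  qed
  with f g P2 show "(f, g) \<in> rep_calc m \<Phi> \<nu>2 V2 h2" by (simp add: rep_calc_def)
qed

text \<open>Exhibiting one representation makes the one behind \<open>SOME\<close> genuine, and the
  inclusion in both directions identifies its calculus with the explicit one.\<close>

theorem fcalc_eq:
  assumes sa: "selfadjoint m L" and sr: "spec_rep m L \<nu> V h" and \<Phi>: "\<Phi> \<in> borel_measurable borel"
  shows "fcalc m L \<Phi> = rep_calc m \<Phi> \<nu> V h"
proof -
  define r where "r = (SOME r. spec_rep m L (fst r) (fst (snd r)) (snd (snd r)))"
  have "\<exists>r. spec_rep m L (fst r) (fst (snd r)) (snd (snd r))"
    using sr by (intro exI[of _ "(\<nu>, V, h)"]) simp
  then have r: "spec_rep m L (fst r) (fst (snd r)) (snd (snd r))" unfolding r_def by (rule someI_ex)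
  have "fcalc m L \<Phi> = rep_calc m \<Phi> (fst r) (fst (snd r)) (snd (snd r))"
    unfolding fcalc_def rep_calc_def Let_def r_def ..
  also have "\<dots> = rep_calc m \<Phi> \<nu> V h"
    by (intro subset_antisym rep_calc_subset[OF sa r sr \<Phi>] rep_calc_subset[OF sa sr r \<Phi>])
  finally show ?thesis .
qed

section \<open>The dual pairing and a Hilbert-Schmidt bound\<close>

lemma suminf_swap_ennreal: "(\<Sum>n. \<Sum>k. a n k :: ennreal) = (\<Sum>k. \<Sum>n. a n k)"
proof -
  have "(\<Sum>n. \<Sum>k. a n k) = (\<integral>\<^sup>+n. (\<Sum>k. a n k) \<partial>count_space UNIV)" by (simp add: nn_integral_count_space_nat)
  also have "\<dots> = (\<Sum>k. \<integral>\<^sup>+n. a n k \<partial>count_space UNIV)" by (rule nn_integral_suminf) simp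
  finally show ?thesis by (simp add: nn_integral_count_space_nat)
qed

lemma onb_parseval_ennreal:
  assumes "onb m e" "f \<in> L2 m"
  shows "(\<Sum>n. ennreal ((cmod (ip m (e n) f))\<^sup>2)) = ennreal ((l2norm m f)\<^sup>2)"
  using onb_expand(1)[OF assms] by (intro suminf_ennreal_eq) auto

locale weight =
  fixes m :: "'a measure" and w :: "'a \<Rightarrow> real"
  assumes w1: "\<forall>x\<in>space m. 1 \<le> w x"
    and winv: "(\<lambda>x. complex_of_real (1 / w x)) \<in> L2 m"
begin

text \<open>Only 1/w is given as measurable; w is recovered as its reciprocal.\<close>

lemma w_meas [measurable]: "w \<in> borel_measurable m"
proof -
  have "(\<lambda>x. Re (complex_of_real (1 / w x))) \<in> borel_measurable m"
    using L2_measurable[OF winv] by measurable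
  then have "(\<lambda>x. 1 / w x) \<in> borel_measurable m" by simp
  then have "(\<lambda>x. 1 / (1 / w x)) \<in> borel_measurable m" by (rule borel_measurable_divide[OF borel_measurable_const])
  then show ?thesis by simp
qed

lemma w_pos: "x \<in> space m \<Longrightarrow> w x > 0"
  using w1 by fastforce

lemma L2_div_w: "g \<in> L2 m \<Longrightarrow> (\<lambda>x. g x / complex_of_real (w x)) \<in> L2 m"
proof -
  assume g: "g \<in> L2 m"
  note [measurable] = L2_measurable[OF g]
  show ?thesis
  proof (rule L2_bound[OF g, of _ 1])
    show "AE x in m. cmod (g x / complex_of_real (w x)) \<le> 1 * cmod (g x)"
    proof (rule AE_I2)
      fix x assume "x \<in> space m"
      then have "1 \<le> w x" using w1 by blast
      then show "cmod (g x / complex_of_real (w x)) \<le> 1 * cmod (g x)"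
        by (simp add: norm_divide divide_le_eq mult_le_cancel_left1)
    qed
  qed measurable
qed

lemma Hplus_L2: "f \<in> Hplus m w \<Longrightarrow> f \<in> L2 m"
  unfolding Hplus_def using L2_div_w by auto

lemma HplusE:
  assumes "f \<in> Hplus m w"
  obtains g where "g \<in> L2 m" "f = (\<lambda>x. g x / complex_of_real (w x))"
  using assms unfolding Hplus_def by blast

lemma HplusI: "g \<in> L2 m \<Longrightarrow> (\<lambda>x. g x / complex_of_real (w x)) \<in> Hplus m w"
  unfolding Hplus_def by blast

lemma ip_div_w: "ip m h (\<lambda>x. g x / complex_of_real (w x)) = ip m (\<lambda>x. h x / complex_of_real (w x)) g"
  unfolding ip_def by (intro Bochner_Integration.integral_cong) auto

text \<open>Moving the weight from f to the approximants makes any admissible sequence converge to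
  the ordinary integral. For the description by \<open>THE\<close> to have just one solution, at
  least one admissible sequence must exist.\<close>

lemma dpair_eq:
  assumes h: "h \<in> Hminus m w" and f: "f \<in> Hplus m w"
  shows "dpair m w h f = ip m h f" and "integrable m (\<lambda>x. cnj (h x) * f x)"
proof -
  obtain g where g: "g \<in> L2 m" and fg: "f = (\<lambda>x. g x / complex_of_real (w x))" using f by (rule HplusE)
  have hm[measurable]: "h \<in> borel_measurable m" and hw: "(\<lambda>x. h x / complex_of_real (w x)) \<in> L2 m"
    using h by (auto simp: Hminus_def)
  have fp: "ip m k f = ip m (\<lambda>x. k x / complex_of_real (w x)) g" for k unfolding fg by (rule ip_div_w)
  show "integrable m (\<lambda>x. cnj (h x) * f x)"
    using L2_prod_integrable[OF hw g] unfolding fg by simp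
  have lim: "(\<lambda>n. ip m (hs n) f) \<longlonglongrightarrow> ip m h f"
    if hs: "\<And>n. hs n \<in> L2 m" "(\<lambda>n. l2norm m (\<lambda>x. (hs n x - h x) / complex_of_real (w x))) \<longlonglongrightarrow> 0" for hs
    unfolding fp
  proof (rule l2lim_ip(2)[OF L2_div_w[OF hs(1)] hw g])
    show "l2lim m (\<lambda>n x. hs n x / complex_of_real (w x)) (\<lambda>x. h x / complex_of_real (w x))"
      using hs(2) by (simp add: l2lim_def diff_divide_distrib)
  qed
  \<comment> \<open>Cutting h down to the points with w at most n makes it square integrable, since
    there it is at most n times h/w; dominated convergence gives the approximation.\<close>
  define hs where "hs n x = (if w x \<le> real n then h x else 0)" for n x
  have hs1: "hs n \<in> L2 m" for n
  proof (rule L2_bound[OF hw, of _ "real n"])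
    show "hs n \<in> borel_measurable m" unfolding hs_def by measurable
    show "AE x in m. cmod (hs n x) \<le> real n * cmod (h x / complex_of_real (w x))"
    proof (rule AE_I2)
      fix x assume "x \<in> space m"
      then have "w x > 0" by (rule w_pos)
      then show "cmod (hs n x) \<le> real n * cmod (h x / complex_of_real (w x))"
        by (simp add: hs_def norm_divide field_simps mult_right_mono)
    qed
  qed
  have hs2: "(\<lambda>n. l2norm m (\<lambda>x. (hs n x - h x) / complex_of_real (w x))) \<longlonglongrightarrow> 0"
  proof -
    have "(\<lambda>n. \<integral>x. (cmod ((hs n x - h x) / complex_of_real (w x)))\<^sup>2 \<partial>m) \<longlonglongrightarrow> (\<integral>x. 0 \<partial>m)"
    proof (rule integral_dominated_convergence[where w="\<lambda>x. (cmod (h x / complex_of_real (w x)))\<^sup>2"])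
      show "AE x in m. (\<lambda>n. (cmod ((hs n x - h x) / complex_of_real (w x)))\<^sup>2) \<longlonglongrightarrow> 0"
      proof (rule AE_I2)
        fix x
        obtain n0 where "w x \<le> real n0" using real_arch_simple by blast
        then show "(\<lambda>n. (cmod ((hs n x - h x) / complex_of_real (w x)))\<^sup>2) \<longlonglongrightarrow> 0"
          by (intro tendsto_eventually eventually_sequentiallyI[of n0]) (auto simp: hs_def)
      qed
      show "AE x in m. norm ((cmod ((hs n x - h x) / complex_of_real (w x)))\<^sup>2) \<le> (cmod (h x / complex_of_real (w x)))\<^sup>2" for n
        by (rule AE_I2) (auto simp: hs_def norm_divide)
      show "integrable m (\<lambda>x. (cmod (h x / complex_of_real (w x)))\<^sup>2)" by (rule L2_integrable[OF hw])
      show "(\<lambda>x. (cmod ((hs n x - h x) / complex_of_real (w x)))\<^sup>2) \<in> borel_measurable m" for n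
        using hs1[of n, THEN L2_measurable] by measurable
    qed simp
    from tendsto_real_sqrt[OF this] show ?thesis unfolding l2norm_def by simp
  qed
  show "dpair m w h f = ip m h f"
    unfolding dpair_def
  proof (rule the_equality)
    show "\<forall>hs. (\<forall>n. hs n \<in> L2 m) \<and> (\<lambda>n. l2norm m (\<lambda>x. (hs n x - h x) / complex_of_real (w x))) \<longlonglongrightarrow> 0 \<longrightarrow> (\<lambda>n. ip m (hs n) f) \<longlonglongrightarrow> ip m h f"
      using lim by blast
    fix c assume "\<forall>hs. (\<forall>n. hs n \<in> L2 m) \<and> (\<lambda>n. l2norm m (\<lambda>x. (hs n x - h x) / complex_of_real (w x))) \<longlonglongrightarrow> 0 \<longrightarrow> (\<lambda>n. ip m (hs n) f) \<longlonglongrightarrow> c"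
    then have "(\<lambda>n. ip m (hs n) f) \<longlonglongrightarrow> c" using hs1 hs2 by blast
    then show "c = ip m h f" using lim[OF hs1 hs2] by (rule LIMSEQ_unique)
  qed
qed

lemma L2_Hminus: "f \<in> L2 m \<Longrightarrow> f \<in> Hminus m w"
  unfolding Hminus_def using L2_measurable L2_div_w by auto

text \<open>The test element is the weighted difference divided once more by w, which turns the
  equality of the pairings into a vanishing norm.\<close>

lemma Hplus_separates:
  assumes h: "h \<in> Hminus m w" and k: "k \<in> Hminus m w" and eq: "\<And>u. u \<in> Hplus m w \<Longrightarrow> dpair m w h u = dpair m w k u"
  shows "aeq m h k"
proof -
  have hw: "(\<lambda>x. h x / complex_of_real (w x)) \<in> L2 m" and kw: "(\<lambda>x. k x / complex_of_real (w x)) \<in> L2 m"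
    using h k by (auto simp: Hminus_def)
  let ?d = "\<lambda>x. h x / complex_of_real (w x) - k x / complex_of_real (w x)"
  have d: "?d \<in> L2 m" by (rule L2_diff[OF hw kw])
  have "ip m ?d ?d = 0"
    using eq[OF HplusI[OF d]] unfolding dpair_eq(1)[OF h HplusI[OF d]] dpair_eq(1)[OF k HplusI[OF d]] ip_div_w
    by (simp add: ip_diff_left d hw kw)
  then have "aeq m ?d (\<lambda>x. 0)" by (rule ip_self_eq_0[OF d])
  then show ?thesis unfolding aeq_def
  proof (rule AE_mp)
    show "AE x in m. ?d x = 0 \<longrightarrow> h x = k x"
    proof (rule AE_I2, rule impI)
      fix x assume "x \<in> space m" "?d x = 0"
      then show "h x = k x" using w_pos[of x] by simp
    qed
  qed
qed

end

section \<open>Symmetric operators with bounded range functions\<close>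

locale bounded_range = weight +
  fixes K :: "'a fn \<Rightarrow> 'a fn" and e :: "nat \<Rightarrow> 'a fn"
  assumes KL: "\<And>f. f \<in> L2 m \<Longrightarrow> K f \<in> L2 m"
    and K_sym: "\<And>f g. f \<in> L2 m \<Longrightarrow> g \<in> L2 m \<Longrightarrow> ip m (K f) g = ip m f (K g)"
    and K_lin: "\<And>f g a. f \<in> L2 m \<Longrightarrow> g \<in> L2 m \<Longrightarrow> aeq m (K (\<lambda>x. f x + a * g x)) (\<lambda>x. K f x + a * K g x)"
    and K_bd: "\<And>f. f \<in> L2 m \<Longrightarrow> \<exists>C. AE x in m. cmod (K f x) \<le> C"
    and e: "onb m e"
begin

lemma ip_bound_ae:
  assumes a: "integrable m (\<lambda>x. cmod (a x))" "a \<in> borel_measurable m" and f: "f \<in> borel_measurable m"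
    and C: "AE x in m. cmod (f x) \<le> C"
  shows "cmod (ip m a f) \<le> C * (\<integral>x. cmod (a x) \<partial>m)"
proof -
  note [measurable] = a(2) f
  have "integrable m (\<lambda>x. C * cmod (a x))" using a by simp
  then have int: "integrable m (\<lambda>x. cnj (a x) * f x)"
  proof (rule Bochner_Integration.integrable_bound)
    show "AE x in m. norm (cnj (a x) * f x) \<le> norm (C * cmod (a x))"
      using C
    proof eventually_elim
      case (elim x)
      then have "0 \<le> C" using norm_ge_zero order_trans by blast
      then show ?case using mult_right_mono[OF elim, of "cmod (a x)"] by (simp add: norm_mult mult.commute)
    qed
  qed measurable
  have "cmod (ip m a f) \<le> (\<integral>x. norm (cnj (a x) * f x) \<partial>m)"
    unfolding ip_def by (rule integral_norm_bound)
  also have "\<dots> \<le> (\<integral>x. C * cmod (a x) \<partial>m)"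
  proof (rule integral_mono_AE)
    show "AE x in m. norm (cnj (a x) * f x) \<le> C * cmod (a x)"
      using C by eventually_elim (simp add: norm_mult mult.commute[of C] mult_left_mono)
  qed (use int a in auto)
  finally show ?thesis by simp
qed

text \<open>By symmetry the inner product of \<open>K a\<close> with f equals that of a with
  \<open>K f\<close>, which is bounded by the supremum of \<open>K f\<close> as long as a has
  integral norm at most 1. Uniform boundedness then gives the estimate dual to the wanted bound from
  square integrable to bounded functions.\<close>

lemma K_bounded_L1: "\<exists>C\<ge>0. \<forall>a\<in>L2 m. integrable m (\<lambda>x. cmod (a x)) \<longrightarrow> (\<integral>x. cmod (a x) \<partial>m) \<le> 1 \<longrightarrow> l2norm m (K a) \<le> C"
proof -
  define S where "S = {K a | a. a \<in> L2 m \<and> integrable m (\<lambda>x. cmod (a x)) \<and> (\<integral>x. cmod (a x) \<partial>m) \<le> 1}"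
  have "\<exists>C. \<forall>s\<in>S. l2norm m s \<le> C"
  proof (rule uniform_bounded_L2)
    show "S \<subseteq> L2 m" using KL by (auto simp: S_def)
    fix f assume f: "f \<in> L2 m"
    obtain C where C: "AE x in m. cmod (K f x) \<le> C" using K_bd[OF f] by blast
    have C': "AE x in m. cmod (K f x) \<le> \<bar>C\<bar>" using C by eventually_elim simp
    have "cmod (ip m s f) \<le> \<bar>C\<bar>" if "s \<in> S" for s
    proof -
      obtain a where a: "s = K a" "a \<in> L2 m" "integrable m (\<lambda>x. cmod (a x))" "(\<integral>x. cmod (a x) \<partial>m) \<le> 1"
        using \<open>s \<in> S\<close> by (auto simp: S_def)
      have "cmod (ip m s f) = cmod (ip m a (K f))" unfolding a(1) by (simp add: K_sym a f)
      also have "\<dots> \<le> \<bar>C\<bar> * (\<integral>x. cmod (a x) \<partial>m)"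
        by (rule ip_bound_ae[OF a(3) L2_measurable[OF a(2)] L2_measurable[OF KL[OF f]] C'])
      also have "\<dots> \<le> \<bar>C\<bar> * 1" by (rule mult_left_mono[OF a(4)]) simp
      finally show ?thesis by simp
    qed
    then show "\<exists>C. \<forall>s\<in>S. cmod (ip m s f) \<le> C" by blast
  qed
  then obtain C where C: "\<And>s. s \<in> S \<Longrightarrow> l2norm m s \<le> C" by blast
  have "l2norm m (K a) \<le> \<bar>C\<bar>" if "a \<in> L2 m" "integrable m (\<lambda>x. cmod (a x))" "(\<integral>x. cmod (a x) \<partial>m) \<le> 1" for a
    using C[of "K a"] that by (fastforce simp: S_def)
  then show ?thesis by (intro exI[of _ "\<bar>C\<bar>"]) auto
qed

lemma w_inverse_sq_integrable: "integrable m (\<lambda>x. (1 / w x)\<^sup>2)"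
  using L2_integrable[OF winv] by (simp only: norm_of_real power2_abs)

text \<open>This is the closed graph theorem for \<open>K\<close> as a map into \<open>L\<^sup>\<infinity>\<close>.\<close>
lemma K_bounded_sup: "\<exists>C\<ge>0. \<forall>f\<in>L2 m. AE x in m. cmod (K f x) \<le> C * l2norm m f"
proof -
  obtain C where C0: "C \<ge> 0" and C: "\<And>a. a \<in> L2 m \<Longrightarrow> integrable m (\<lambda>x. cmod (a x)) \<Longrightarrow> (\<integral>x. cmod (a x) \<partial>m) \<le> 1 \<Longrightarrow> l2norm m (K a) \<le> C"
    using K_bounded_L1 by blast
  have "AE x in m. cmod (K f x) \<le> C * l2norm m f" if f: "f \<in> L2 m" for f
  proof -
    define B where "B = C * l2norm m f"
    define F where "F = K f"
    have FL: "F \<in> L2 m" unfolding F_def by (rule KL[OF f])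
    note [measurable] = L2_measurable[OF FL]
    \<comment> \<open>An integrable weight that is positive exactly on the part of the space where
      the bound fails; the aim is that it vanishes almost everywhere.\<close>
    define q where "q x = (if B < cmod (F x) then (1 / w x)\<^sup>2 else 0)" for x
    have [measurable]: "q \<in> borel_measurable m" unfolding q_def by measurable
    have q0: "0 \<le> q x" for x by (simp add: q_def)
    have qi: "integrable m q"
      by (rule Bochner_Integration.integrable_bound[OF w_inverse_sq_integrable]) (auto simp: q_def)
    define I where "I = (\<integral>x. q x \<partial>m)"
    have I0: "I \<ge> 0" unfolding I_def by (rule integral_nonneg_AE) (simp add: q0)
    have concl: "AE x in m. cmod (F x) \<le> B" if z: "AE x in m. q x = 0 \<or> (cmod (F x) - B) * q x = 0"
    proof -
      have "AE x in m. x \<in> space m" by (rule AE_space)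
      with z show ?thesis
      proof eventually_elim
        case (elim x)
        show ?case
        proof (rule ccontr)
          assume "\<not> cmod (F x) \<le> B"
          moreover then have "q x > 0" using w_pos[OF elim(2)] by (simp add: q_def)
          ultimately show False using elim(1) by auto
        qed
      qed
    qed
    show ?thesis
    proof (cases "I = 0")
      case True
      then have "AE x in m. q x = 0"
        unfolding I_def by (subst (asm) integral_nonneg_eq_0_iff_AE[OF qi]) (auto simp: q0)
      then have "AE x in m. q x = 0 \<or> (cmod (F x) - B) * q x = 0" by eventually_elim simp
      from concl[OF this] show ?thesis by (simp add: F_def B_def)
    next
      case False
      then have I: "I > 0" using I0 by linarith
      \<comment> \<open>A test function of integral norm at most 1 carrying the phase of F, so that
        its inner product with F is the average of the modulus of F with respect to q.\<close>
      define a where "a x = complex_of_real (q x / I) * sgn (F x)" for x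
      have [measurable]: "a \<in> borel_measurable m" unfolding a_def sgn_div_norm by measurable
      have na: "cmod (a x) \<le> q x / I" for x
        using q0[of x] I unfolding a_def norm_mult norm_of_real norm_sgn by (auto simp: abs_of_nonneg)
      have a1: "integrable m (\<lambda>x. cmod (a x))"
      proof (rule Bochner_Integration.integrable_bound)
        show "integrable m (\<lambda>x. q x / I)" using qi by simp
        show "AE x in m. norm (cmod (a x)) \<le> norm (q x / I)" using na q0 I by (intro AE_I2) (simp add: abs_of_nonneg)
      qed measurable
      have a2: "(\<integral>x. cmod (a x) \<partial>m) \<le> 1"
      proof -
        have "(\<integral>x. cmod (a x) \<partial>m) \<le> (\<integral>x. q x / I \<partial>m)"
          by (rule integral_mono[OF a1 _ na]) (use qi in simp)
        also have "\<dots> = 1" using I by (simp add: I_def)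
        finally show ?thesis .
      qed
      have aL: "a \<in> L2 m"
      proof (rule L2_bound[OF winv, of _ "1 / I"])
        show "AE x in m. cmod (a x) \<le> 1 / I * cmod (complex_of_real (1 / w x))"
        proof (rule AE_I2)
          fix x assume x: "x \<in> space m"
          then have "1 \<le> w x" using w1 by blast
          then have "1 / w x \<le> 1" "0 \<le> 1 / w x" by auto
          then have "(1 / w x)\<^sup>2 \<le> 1 / w x"
            by (simp only: power2_eq_square mult_left_le)
          then have "q x \<le> 1 / w x" using \<open>0 \<le> 1 / w x\<close> by (simp add: q_def)
          then have "q x / I \<le> (1 / w x) / I" using I by (intro divide_right_mono) auto
          then show "cmod (a x) \<le> 1 / I * cmod (complex_of_real (1 / w x))"
            using na[of x] \<open>0 \<le> 1 / w x\<close> by (simp only: norm_of_real abs_of_nonneg) (simp add: mult.commute)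
        qed
      qed measurable
      have Fqi: "integrable m (\<lambda>x. cmod (F x) * q x)"
      proof (rule Bochner_Integration.integrable_bound)
        show "integrable m (\<lambda>x. cmod (cnj (F x) * complex_of_real (1 / w x)))"
          by (intro integrable_norm L2_prod_integrable FL winv)
        show "AE x in m. norm (cmod (F x) * q x) \<le> norm (cmod (cnj (F x) * complex_of_real (1 / w x)))"
        proof (rule AE_I2)
          fix x assume x: "x \<in> space m"
          then have "1 \<le> w x" using w1 by blast
          then have "1 / w x \<le> 1" "0 \<le> 1 / w x" by auto
          then have "(1 / w x)\<^sup>2 \<le> 1 / w x"
            by (simp only: power2_eq_square mult_left_le)
          then have "q x \<le> 1 / w x" using \<open>0 \<le> 1 / w x\<close> by (simp add: q_def)
          then have "cmod (F x) * q x \<le> cmod (F x) * (1 / w x)" by (intro mult_left_mono) auto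
          then show "norm (cmod (F x) * q x) \<le> norm (cmod (cnj (F x) * complex_of_real (1 / w x)))"
            using q0[of x] \<open>0 \<le> 1 / w x\<close> by (simp only: norm_mult norm_of_real abs_of_nonneg real_norm_def abs_norm_cancel abs_mult complex_mod_cnj)
        qed
      qed measurable
      have "ip m a F = complex_of_real ((\<integral>x. cmod (F x) * q x \<partial>m) / I)"
      proof -
        have "cnj (a x) * F x = complex_of_real (cmod (F x) * q x / I)" for x
        proof -
          have "cnj (sgn (F x)) * F x = complex_of_real (cmod (F x))"
          proof (cases "F x = 0")
            case False
            have "cnj (sgn (F x)) * F x = (F x * cnj (F x)) / complex_of_real (cmod (F x))"
              by (simp add: sgn_div_norm scaleR_conv_of_real divide_inverse mult_ac)
            also have "\<dots> = complex_of_real ((cmod (F x))\<^sup>2) / complex_of_real (cmod (F x))"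
              unfolding complex_norm_square ..
            finally show ?thesis using False by (simp add: power2_eq_square)
          qed simp
          then show ?thesis by (simp add: a_def mult_ac)
        qed
        then have "ip m a F = (\<integral>x. complex_of_real (cmod (F x) * q x / I) \<partial>m)" by (simp only: ip_def)
        then show ?thesis by (simp only: integral_complex_of_real integral_divide_zero)
      qed
      moreover have "cmod (ip m a F) \<le> B"
      proof -
        have "cmod (ip m a F) = cmod (ip m (K a) f)" unfolding F_def by (simp add: K_sym aL f)
        also have "\<dots> \<le> l2norm m (K a) * l2norm m f" by (rule Cauchy_Schwarz_L2[OF KL[OF aL] f])
        also have "\<dots> \<le> B" unfolding B_def by (intro mult_right_mono C aL a1 a2) simp
        finally show ?thesis .
      qed
      ultimately have "(\<integral>x. cmod (F x) * q x \<partial>m) / I \<le> B" by (simp only: norm_of_real)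
      then have "(\<integral>x. cmod (F x) * q x \<partial>m) \<le> B * I" using I by (simp add: divide_le_eq)
      moreover have d: "(\<integral>x. (cmod (F x) - B) * q x \<partial>m) = (\<integral>x. cmod (F x) * q x \<partial>m) - B * I"
        unfolding I_def left_diff_distrib using Fqi qi by simp
      moreover have pos: "0 \<le> (cmod (F x) - B) * q x" for x by (simp add: q_def)
      moreover have "0 \<le> (\<integral>x. (cmod (F x) - B) * q x \<partial>m)" by (rule integral_nonneg_AE) (simp add: pos)
      \<comment> \<open>The average of the modulus with respect to q is at most B, while on the
        support of q the modulus exceeds B; so the integral of the nonnegative excess is 0.\<close>
      ultimately have "(\<integral>x. (cmod (F x) - B) * q x \<partial>m) = 0" by linarith
      moreover have "integrable m (\<lambda>x. (cmod (F x) - B) * q x)"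
        unfolding left_diff_distrib using Fqi qi by simp
      ultimately have "AE x in m. (cmod (F x) - B) * q x = 0"
        using pos by (subst (asm) integral_nonneg_eq_0_iff_AE) auto
      then have "AE x in m. q x = 0 \<or> (cmod (F x) - B) * q x = 0" by eventually_elim simp
      from concl[OF this] show ?thesis by (simp add: F_def B_def)
    qed
  qed
  with C0 show ?thesis by blast
qed

lemma eL: "e n \<in> L2 m"
  using e by (simp add: onb_def)

lemma K_zero: "aeq m (K (\<lambda>x. 0)) (\<lambda>x. 0)"
  using K_lin[of "\<lambda>x. 0" "\<lambda>x. 0" "-1"] by (simp add: aeq_def)

lemma K_sum: "aeq m (K (\<lambda>x. \<Sum>n<N. c n * e n x)) (\<lambda>x. \<Sum>n<N. c n * K (e n) x)"
proof (induction N)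
  case 0 then show ?case using K_zero by simp
next
  case (Suc N)
  have sL: "(\<lambda>x. \<Sum>n<N. c n * e n x) \<in> L2 m" by (intro L2_sum L2_scale eL)
  show ?case using K_lin[OF sL eL, of "c N" N] Suc unfolding aeq_def by eventually_elim simp
qed

text \<open>At a fixed x the square function is governed by the linear combinations of the values
  \<open>K (e n) x\<close>. Each combination is bounded by the norm of its coefficients, but only
  off its own null set; coefficients from a countable dense set need just one null set.\<close>

lemma K_square_function: "\<exists>C\<ge>0. \<forall>N. AE x in m. (\<Sum>n<N. (cmod (K (e n) x))\<^sup>2) \<le> C"
proof -
  obtain C where C0: "C \<ge> 0" and C: "\<And>f. f \<in> L2 m \<Longrightarrow> AE x in m. cmod (K f x) \<le> C * l2norm m f"
    using K_bounded_sup by blast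
  obtain D :: "complex set" where D: "countable D" "\<And>X. open X \<Longrightarrow> X \<noteq> {} \<Longrightarrow> \<exists>d\<in>D. d \<in> X"
    by (rule countable_dense_setE) blast
  have "AE x in m. (\<Sum>n<N. (cmod (K (e n) x))\<^sup>2) \<le> C\<^sup>2" for N
  proof -
    define P where "P = PiE {..<N} (\<lambda>_. D)"
    have cP: "countable P" unfolding P_def by (rule countable_PiE) (auto simp: D)
    have "AE x in m. cmod (\<Sum>n<N. c n * K (e n) x) \<le> C * sqrt (\<Sum>n<N. (cmod (c n))\<^sup>2)" for c
    proof -
      have sL: "(\<lambda>x. \<Sum>n<N. c n * e n x) \<in> L2 m" by (intro L2_sum L2_scale eL)
      have "(l2norm m (\<lambda>x. \<Sum>n<N. c n * e n x))\<^sup>2 \<le> (\<Sum>n<N. (cmod (c n))\<^sup>2)"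
      proof (subst onb_sum_norm[OF e finite_lessThan], rule sum_mono)
        fix n
        have "l2norm m (e n) = 0 \<or> l2norm m (e n) = 1" using e by (simp add: onb_def)
        then show "(cmod (c n))\<^sup>2 * (l2norm m (e n))\<^sup>2 \<le> (cmod (c n))\<^sup>2" by auto
      qed
      then have "l2norm m (\<lambda>x. \<Sum>n<N. c n * e n x) \<le> sqrt (\<Sum>n<N. (cmod (c n))\<^sup>2)" by (rule real_le_rsqrt)
      then have le: "C * l2norm m (\<lambda>x. \<Sum>n<N. c n * e n x) \<le> C * sqrt (\<Sum>n<N. (cmod (c n))\<^sup>2)"
        using C0 by (rule mult_left_mono)
      show ?thesis using C[OF sL] K_sum[of c N] unfolding aeq_def
        by eventually_elim (use le in auto)
    qed
    then have "AE x in m. \<forall>c\<in>P. cmod (\<Sum>n<N. c n * K (e n) x) \<le> C * sqrt (\<Sum>n<N. (cmod (c n))\<^sup>2)"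
      by (subst AE_ball_countable[OF cP]) blast
    then show ?thesis
    proof eventually_elim
      case (elim x)
      define F where "F n = K (e n) x" for n
      define S where "S = (\<Sum>n<N. (cmod (F n))\<^sup>2)"
      have S0: "S \<ge> 0" unfolding S_def by (intro sum_nonneg) auto
      \<comment> \<open>Coefficients from D approaching the conjugates of the values themselves: in
        the limit the bound reads S at most C times the square root of S.\<close>
      have "\<forall>k n. \<exists>d\<in>D. d \<in> ball (cnj (F n)) (1 / real (Suc k))"
        using D(2)[OF open_ball] by fastforce
      then obtain c where c: "\<And>k n. c k n \<in> D" "\<And>k n. c k n \<in> ball (cnj (F n)) (1 / real (Suc k))" by metis
      have clim: "(\<lambda>k. c k n) \<longlonglongrightarrow> cnj (F n)" for n
      proof -
        have "(\<lambda>k. c k n - cnj (F n)) \<longlonglongrightarrow> 0"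
          by (rule Lim_null_comparison[OF _ LIMSEQ_inverse_real_of_nat])
             (use c(2)[of _ n] in \<open>auto simp: dist_norm norm_minus_commute divide_inverse intro!: always_eventually less_imp_le\<close>)
        then show ?thesis by (simp add: LIM_zero_iff)
      qed
      have le: "cmod (\<Sum>n<N. c k n * F n) \<le> C * sqrt (\<Sum>n<N. (cmod (c k n))\<^sup>2)" for k
      proof -
        have "restrict (c k) {..<N} \<in> P" unfolding P_def using c(1) by auto
        from bspec[OF elim this] show ?thesis by (simp add: F_def)
      qed
      have "cmod (\<Sum>n<N. cnj (F n) * F n) \<le> C * sqrt (\<Sum>n<N. (cmod (cnj (F n)))\<^sup>2)"
        by (rule LIMSEQ_le[OF _ _ exI[of _ 0]], rule tendsto_norm, rule tendsto_sum, rule tendsto_mult[OF clim tendsto_const],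
            rule tendsto_mult[OF tendsto_const], rule tendsto_real_sqrt, rule tendsto_sum, rule tendsto_power, rule tendsto_norm, rule clim)
           (use le in blast)
      moreover have "(\<Sum>n<N. cnj (F n) * F n) = complex_of_real S"
        unfolding S_def of_real_sum complex_norm_square by (simp add: mult.commute)
      ultimately have "cmod (complex_of_real S) \<le> C * sqrt S" by (simp only: complex_mod_cnj S_def[symmetric])
      then have "S \<le> C * sqrt S" using S0 by simp
      then have s: "sqrt S * sqrt S \<le> C * sqrt S" using S0 by simp
      have "sqrt S \<le> C"
      proof (cases "S = 0")
        case False
        then have "sqrt S > 0" using S0 by simp
        with s show ?thesis by (rule mult_right_le_imp_le)
      qed (use C0 in simp)
      then have "S \<le> C\<^sup>2" by (rule sqrt_le_D)
      then show ?case by (simp add: S_def F_def)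
    qed
  qed
  then show ?thesis using zero_le_power2 by blast
qed

text \<open>\<open>K \<circ> w\<^sup>-\<^sup>1\<close> is Hilbert-Schmidt, because its adjoint \<open>w\<^sup>-\<^sup>1 \<circ> K\<close> is.\<close>
theorem hilbert_schmidt: "(\<Sum>n. ennreal ((l2norm m (K (\<lambda>x. e n x / complex_of_real (w x))))\<^sup>2)) < \<infinity>"
proof -
  let ?ew = "\<lambda>n x. e n x / complex_of_real (w x)"
  let ?Kw = "\<lambda>k x. K (e k) x / complex_of_real (w x)"
  have ewL: "?ew n \<in> L2 m" for n by (rule L2_div_w[OF eL])
  have KwL: "?Kw k \<in> L2 m" for k by (rule L2_div_w[OF KL[OF eL]])
  note [measurable] = L2_measurable[OF KL[OF eL]]
  have "cmod (ip m (e k) (K (?ew n))) = cmod (ip m (e n) (?Kw k))" for k n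
  proof -
    have "ip m (e k) (K (?ew n)) = ip m (?Kw k) (e n)"
      using K_sym[OF eL ewL, of k n] ip_div_w[of "K (e k)" "e n"] by simp
    then have "cmod (ip m (e k) (K (?ew n))) = cmod (cnj (ip m (?Kw k) (e n)))" by (simp only: complex_mod_cnj)
    then show ?thesis by (simp only: ip_cnj)
  qed
  then have "(\<Sum>n. ennreal ((l2norm m (K (?ew n)))\<^sup>2)) = (\<Sum>n. \<Sum>k. ennreal ((cmod (ip m (e n) (?Kw k)))\<^sup>2))"
    by (simp only: onb_parseval_ennreal[OF e KL[OF ewL], symmetric])
  also have "\<dots> = (\<Sum>k. ennreal ((l2norm m (?Kw k))\<^sup>2))"
    by (subst suminf_swap_ennreal) (simp only: onb_parseval_ennreal[OF e KwL])
  also have "\<dots> < \<infinity>"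
  proof -
    obtain C where C: "C \<ge> 0" "\<And>N. AE x in m. (\<Sum>n<N. (cmod (K (e n) x))\<^sup>2) \<le> C" using K_square_function by blast
    let ?I = "\<integral>x. (1 / w x)\<^sup>2 \<partial>m"
    \<comment> \<open>The pointwise bound on the square function is integrated against
      \<open>(1 / w x)\<^sup>2\<close>, which gives an estimate independent of N.\<close>
    have bd: "(\<Sum>k<N. (l2norm m (?Kw k))\<^sup>2) \<le> C * ?I" for N
    proof -
      have ii: "integrable m (\<lambda>x. (cmod (?Kw k x))\<^sup>2)" for k by (rule L2_integrable[OF KwL])
      have "(\<Sum>k<N. (l2norm m (?Kw k))\<^sup>2) = (\<integral>x. (\<Sum>k<N. (cmod (?Kw k x))\<^sup>2) \<partial>m)"
        unfolding l2norm_sq by (rule Bochner_Integration.integral_sum[symmetric]) (rule ii)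
      also have "\<dots> \<le> (\<integral>x. C * (1 / w x)\<^sup>2 \<partial>m)"
      proof (rule integral_mono_AE)
        show "AE x in m. (\<Sum>k<N. (cmod (?Kw k x))\<^sup>2) \<le> C * (1 / w x)\<^sup>2"
          using C(2)[of N]
        proof eventually_elim
          case (elim x)
          have "(\<Sum>k<N. (cmod (?Kw k x))\<^sup>2) = (\<Sum>k<N. (cmod (K (e k) x))\<^sup>2) * (1 / w x)\<^sup>2"
            by (simp add: norm_divide power_divide sum_distrib_right sum_divide_distrib)
          then show ?case using elim by (simp only:) (rule mult_right_mono, auto)
        qed
      qed (use ii w_inverse_sq_integrable in \<open>auto intro!: Bochner_Integration.integrable_sum\<close>)
      finally show ?thesis by simp
    qed
    have s: "summable (\<lambda>k. (l2norm m (?Kw k))\<^sup>2)" by (rule summableI_nonneg_bounded[OF _ bd]) simp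
    show ?thesis by (subst suminf_ennreal2[OF _ s]) auto
  qed
  finally show ?thesis .
qed

end

section \<open>Generalized eigenfunctions\<close>

lemma l2norm_mono:
  assumes "f \<in> L2 m" "g \<in> L2 m" "AE x in m. cmod (f x) \<le> cmod (g x)"
  shows "l2norm m f \<le> l2norm m g"
  unfolding l2norm_def
proof (intro real_sqrt_le_mono integral_mono_AE L2_integrable assms)
  show "AE x in m. (cmod (f x))\<^sup>2 \<le> (cmod (g x))\<^sup>2"
    using assms(3) by eventually_elim (rule power_mono, auto)
qed

lemma Jset_infinity: "Jset \<infinity> = {j. 1 \<le> j}"
  by (simp add: Jset_def)

section \<open>Families of functions as functions on the slot space\<close>

context densities
begin

text \<open>\<open>Jset\<close> starts at 1, so nothing is known about the member with index 0; slot
  0 is null and receives the value 0 to keep the function measurable.\<close>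

definition slot_fun :: "(nat \<Rightarrow> real \<Rightarrow> complex) \<Rightarrow> nat \<times> real \<Rightarrow> complex" where
  "slot_fun g = (\<lambda>(j, t). if j = 0 then 0 else g j t)"

lemma slot_fun_measurable:
  assumes "\<And>j. j \<in> Jset \<infinity> \<Longrightarrow> g j \<in> borel_measurable \<mu>"
  shows "slot_fun g \<in> borel_measurable \<nu>"
proof -
  have "g j \<in> borel_measurable borel" if "1 \<le> j" for j
    using assms[of j] that measurable_cong_sets[OF sets_\<mu> refl] by (auto simp: Jset_infinity)
  then have "(\<lambda>t. if j = 0 then 0 else g j t) \<in> borel_measurable borel" for j by (cases "j = 0") auto
  then show ?thesis unfolding slotm_measurable_iff[OF sets_\<mu>] slot_fun_def by simp
qed

lemma dsnorm2_slot_fun: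
  assumes "\<And>j. j \<in> Jset \<infinity> \<Longrightarrow> g j \<in> borel_measurable \<mu>"
  shows "dsnorm2 \<mu> (Jset \<infinity>) (Mset d) g = (\<integral>\<^sup>+y. ennreal ((cmod (slot_fun g y))\<^sup>2) \<partial>\<nu>)"
proof -
  note [measurable] = slot_fun_measurable[OF assms]
  have "(\<integral>\<^sup>+y. ennreal ((cmod (slot_fun g y))\<^sup>2) \<partial>\<nu>)
      = (\<Sum>j. \<integral>\<^sup>+t. indicator (Mset d j) t * ennreal ((cmod (slot_fun g (j, t)))\<^sup>2) \<partial>\<mu>)"
    by (rule slot_nn_integral) measurable
  also have "\<dots> = dsnorm2 \<mu> (Jset \<infinity>) (Mset d) g"
    unfolding dsnorm2_def
  proof (intro suminf_cong)
    fix j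
    show "(\<integral>\<^sup>+t. indicator (Mset d j) t * ennreal ((cmod (slot_fun g (j, t)))\<^sup>2) \<partial>\<mu>) =
      (if j \<in> Jset \<infinity> then (\<integral>\<^sup>+t. indicator (Mset d j) t * ennreal ((cmod (g j t))\<^sup>2) \<partial>\<mu>) else 0)"
      by (cases "j = 0") (simp_all add: slot_fun_def Jset_infinity)
  qed
  finally show ?thesis by simp
qed

lemma in_dsum_slot_fun: "in_dsum \<mu> (Jset \<infinity>) (Mset d) g \<Longrightarrow> slot_fun g \<in> L2 \<nu>"
  unfolding in_dsum_def
  using slot_fun_measurable[of g] dsnorm2_slot_fun[of g] by (subst L2_nn_integral_iff) auto

lemma slot_AE_J:
  "(\<forall>j\<in>Jset \<infinity>. AE t in \<mu>. t \<in> Mset d j \<longrightarrow> P j t) \<longleftrightarrow> (AE y in \<nu>. P (fst y) (snd y))"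
  unfolding slot_AE
proof (intro iffI allI ballI)
  fix j assume *: "\<forall>j\<in>Jset \<infinity>. AE t in \<mu>. t \<in> Mset d j \<longrightarrow> P j t"
  show "AE t in \<mu>. t \<in> Mset d j \<longrightarrow> P (fst (j, t)) (snd (j, t))"
  proof (cases "j = 0")
    case False
    then have "j \<in> Jset \<infinity>" by (simp add: Jset_infinity)
    from bspec[OF * this] show ?thesis by simp
  qed (simp add: Mset_0)
next
  fix j assume "\<forall>j. AE t in \<mu>. t \<in> Mset d j \<longrightarrow> P (fst (j, t)) (snd (j, t))"
  then show "AE t in \<mu>. t \<in> Mset d j \<longrightarrow> P j t" by simp
qed

lemma slot_fun_AE:
  assumes "AE y in \<nu>. F y = g (fst y) (snd y)" shows "AE y in \<nu>. F y = slot_fun g y"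
proof -
  have "AE t in \<mu>. t \<in> Mset d j \<longrightarrow> fst (j, t) \<noteq> 0" for j by (cases "j = 0") (simp_all add: Mset_0)
  then have "AE y in \<nu>. fst y \<noteq> 0" unfolding slot_AE by blast
  with assms show ?thesis by eventually_elim (auto simp: slot_fun_def split: prod.splits)
qed

lemma slice_measurable:
  assumes "F \<in> borel_measurable \<nu>" shows "(\<lambda>t. F (j, t)) \<in> borel_measurable \<mu>"
  using assms measurable_cong_sets[OF sets_\<mu> refl] unfolding slotm_measurable_iff[OF sets_\<mu>] by blast

lemma slot_integrable_slice:
  assumes F: "integrable \<nu> F"
  shows "integrable \<mu> (\<lambda>t. indicator (Mset d j) t * (F (j, t) :: complex))"
proof -
  note [measurable] = borel_measurable_integrable[OF F] slice_measurable[OF borel_measurable_integrable[OF F], of j]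
  have "(\<integral>\<^sup>+t. ennreal (norm (indicator (Mset d j) t * F (j, t))) \<partial>\<mu>)
      = (\<integral>\<^sup>+t. indicator (Mset d j) t * ennreal (norm (F (j, t))) \<partial>\<mu>)"
    by (intro nn_integral_cong) (simp add: indicator_def)
  also have "\<dots> \<le> (\<Sum>j. \<integral>\<^sup>+t. indicator (Mset d j) t * ennreal (norm (F (j, t))) \<partial>\<mu>)"
    by (rule ennreal_le_suminf)
  also have "\<dots> = (\<integral>\<^sup>+y. ennreal (norm (F y)) \<partial>\<nu>)" by (rule slot_nn_integral[symmetric]) measurable
  also have "\<dots> < \<infinity>" using F by (simp add: integrable_iff_bounded)
  finally show ?thesis by (intro integrableI_bounded) measurable
qed

text \<open>The support condition leaves finitely many slots, and slot 0 drops out because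
  \<open>Mset d 0\<close> is empty.\<close>

lemma slot_integral_finite:
  assumes F: "integrable \<nu> F" and supp: "\<And>j t. n < j \<Longrightarrow> F (j, t) = (0::complex)"
  shows "(\<integral>y. F y \<partial>\<nu>) = (\<Sum>j\<in>{j\<in>Jset \<infinity>. j \<le> n}. \<integral>t. indicator (Mset d j) t * F (j, t) \<partial>\<mu>)"
proof -
  let ?I = "\<lambda>y. case y of (j, t) \<Rightarrow> indicator (Mset d j) t"
  have Fm: "F \<in> borel_measurable (count_space UNIV \<Otimes>\<^sub>M \<mu>)"
    by (rule meas_slot[OF borel_measurable_integrable[OF F]])
  have conv: "slotm \<mu> (Mset d) = density (count_space UNIV \<Otimes>\<^sub>M \<mu>) (\<lambda>y. ennreal (?I y))"
    unfolding slotm_def by (intro arg_cong2[where f=density] refl ext) (auto simp: indicator_def split: prod.splits)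
  have I0: "AE y in count_space UNIV \<Otimes>\<^sub>M \<mu>. 0 \<le> (?I y :: real)" by (rule AE_I2) (auto split: prod.splits)
  have int: "integrable (count_space UNIV \<Otimes>\<^sub>M \<mu>) (\<lambda>y. (?I y :: real) *\<^sub>R F y)"
    using F unfolding conv by (subst (asm) integrable_density[OF Fm M_ind I0])
  have eq: "(\<lambda>y. (?I y :: real) *\<^sub>R F y) = (\<lambda>(j, t). indicator (Mset d j) t * F (j, t))"
    by (rule ext) (auto simp: scaleR_conv_of_real indicator_def split: prod.splits)
  have nz: "j \<noteq> 0 \<and> j \<le> n" if j: "(\<integral>t. indicator (Mset d j) t * F (j, t) \<partial>\<mu>) \<noteq> 0" for j
  proof -
    have "j \<noteq> 0"
    proof
      assume "j = 0"
      with j show False by (simp add: Mset_0)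
    qed
    moreover have "j \<le> n"
    proof (rule ccontr)
      assume "\<not> j \<le> n"
      then have "F (j, t) = 0" for t by (intro supp) simp
      with j show False by simp
    qed
    ultimately show ?thesis ..
  qed
  have "(\<integral>y. F y \<partial>\<nu>) = (\<integral>y. (?I y :: real) *\<^sub>R F y \<partial>(count_space UNIV \<Otimes>\<^sub>M \<mu>))"
    unfolding conv by (rule integral_density[OF Fm M_ind I0])
  also have "\<dots> = (\<integral>j. \<integral>t. indicator (Mset d j) t * F (j, t) \<partial>\<mu> \<partial>count_space UNIV)"
    using P.integral_fst[OF int[unfolded eq]] unfolding eq by simp
  also have "\<dots> = (\<Sum>j | j \<in> UNIV \<and> (\<integral>t. indicator (Mset d j) t * F (j, t) \<partial>\<mu>) \<noteq> 0. \<integral>t. indicator (Mset d j) t * F (j, t) \<partial>\<mu>)"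
    by (rule lebesgue_integral_count_space_finite_support, rule finite_subset[of _ "{..n}"]) (use nz in auto)
  also have "\<dots> = (\<Sum>j\<in>{j\<in>Jset \<infinity>. j \<le> n}. \<integral>t. indicator (Mset d j) t * F (j, t) \<partial>\<mu>)"
    by (rule sum.mono_neutral_left) (use nz in \<open>auto simp: Jset_infinity Suc_le_eq\<close>)
  finally show ?thesis .
qed

end

text \<open>The assumption \<open>HS\<close> is what remains of the Hilbert-Schmidt bound once
  \<gamma> has been divided out: at almost every point the transforms of the weighted basis vectors
  have square summable values.\<close>

locale eigen = weight m w + densities \<mu> d
  for m :: "'a measure" and w :: "'a \<Rightarrow> real" and \<mu> :: "real measure" and d :: "nat \<Rightarrow> real \<Rightarrow> real" +
  fixes V :: "'a fn \<Rightarrow> (nat \<times> real) fn" and e :: "nat \<Rightarrow> 'a fn"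
  assumes V: "unitary_L2 m (slotm \<mu> (Mset d)) V" and e: "onb m e"
    and HS: "AE y in slotm \<mu> (Mset d). (\<Sum>n. ennreal ((cmod (V (\<lambda>x. e n x / complex_of_real (w x)) y))\<^sup>2)) < \<infinity>"
begin

lemmas VL = unitary_L2D(1)[OF V]

lemma eL: "e n \<in> L2 m"
  using e by (simp add: onb_def)

definition E :: "nat \<Rightarrow> nat \<times> real \<Rightarrow> complex" where
  "E n = V (\<lambda>x. e n x / complex_of_real (w x))"

definition good :: "nat \<times> real \<Rightarrow> bool" where
  "good y \<longleftrightarrow> (\<Sum>n. ennreal ((cmod (E n y))\<^sup>2)) < \<infinity>"

text \<open>The Riesz representative of the functional g \<mapsto> V (g / w) y, with the value at
  the single point y defined through the basis expansion, since V itself gives functions only up to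
  null sets.\<close>

definition psi :: "nat \<times> real \<Rightarrow> 'a fn" where
  "psi y = (SOME p. p \<in> L2 m \<and> (\<forall>g\<in>L2 m. (\<lambda>n. E n y * ip m (e n) g) sums ip m p g))"

text \<open>Multiplication by w undoes the weight in \<open>psi\<close>. The value 0 at the
  exceptional points keeps \<open>phi j t\<close> in the space \<open>Hminus\<close> for every t,
  not only for almost every one.\<close>

definition phi :: "nat \<Rightarrow> real \<Rightarrow> 'a fn" where
  "phi j t = (if t \<in> Mset d j \<and> good (j, t) then (\<lambda>x. complex_of_real (w x) * psi (j, t) x) else (\<lambda>x. 0))"

lemma E_L2: "E n \<in> L2 \<nu>"
  unfolding E_def by (intro VL L2_div_w eL)

lemma psi: assumes "good y"
  shows "psi y \<in> L2 m" and "g \<in> L2 m \<Longrightarrow> (\<lambda>n. E n y * ip m (e n) g) sums ip m (psi y) g"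
proof -
  define c where "c n = cnj (E n y)" for n
  have "summable (\<lambda>n. (cmod (c n))\<^sup>2)"
    unfolding c_def complex_mod_cnj by (rule summable_suminf_not_top) (use assms in \<open>auto simp: good_def\<close>)
  from riesz_fischer[OF e this] obtain p where p: "p \<in> L2 m" "l2lim m (\<lambda>N x. \<Sum>n<N. c n * e n x) p" by blast
  have "\<forall>g\<in>L2 m. (\<lambda>n. E n y * ip m (e n) g) sums ip m p g"
    using riesz_fischer_ip[OF e p] by (simp add: c_def)
  with p(1) have "\<exists>p. p \<in> L2 m \<and> (\<forall>g\<in>L2 m. (\<lambda>n. E n y * ip m (e n) g) sums ip m p g)" by blast
  from someI_ex[OF this] have *: "psi y \<in> L2 m \<and> (\<forall>g\<in>L2 m. (\<lambda>n. E n y * ip m (e n) g) sums ip m (psi y) g)"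
    unfolding psi_def .
  then show "psi y \<in> L2 m" ..
  show "g \<in> L2 m \<Longrightarrow> (\<lambda>n. E n y * ip m (e n) g) sums ip m (psi y) g" using * by blast
qed

lemma phi_Hminus: "phi j t \<in> Hminus m w"
proof (cases "t \<in> Mset d j \<and> good (j, t)")
  case True
  then have p: "psi (j, t) \<in> L2 m" by (intro psi) simp
  note [measurable] = L2_measurable[OF p]
  have "(\<lambda>x. complex_of_real (w x) * psi (j, t) x / complex_of_real (w x)) \<in> L2 m"
  proof (rule L2_cong_AE[OF p])
    show "aeq m (psi (j, t)) (\<lambda>x. complex_of_real (w x) * psi (j, t) x / complex_of_real (w x))"
      unfolding aeq_def
    proof (rule AE_I2)
      fix x assume "x \<in> space m"
      then show "psi (j, t) x = complex_of_real (w x) * psi (j, t) x / complex_of_real (w x)"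
        using w_pos[of x] by simp
    qed
  qed measurable
  then show ?thesis using True by (simp add: phi_def Hminus_def)
next
  case False
  then show ?thesis by (simp only: phi_def Hminus_def if_False) simp
qed

lemma dpair_zero: "f \<in> Hplus m w \<Longrightarrow> dpair m w (\<lambda>x. 0) f = 0"
  using dpair_eq(1)[of "\<lambda>x. 0" f] by (simp add: Hminus_def)

lemma dpair_phi:
  assumes g: "g \<in> L2 m"
  shows "dpair m w (phi j t) (\<lambda>x. g x / complex_of_real (w x)) =
    (if t \<in> Mset d j \<and> good (j, t) then (\<Sum>n. E n (j, t) * ip m (e n) g) else 0)"
proof (cases "t \<in> Mset d j \<and> good (j, t)")
  case True
  then have gd: "good (j, t)" by simp
  have "dpair m w (phi j t) (\<lambda>x. g x / complex_of_real (w x)) = ip m (phi j t) (\<lambda>x. g x / complex_of_real (w x))"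
    by (rule dpair_eq(1)[OF phi_Hminus HplusI[OF g]])
  also have "\<dots> = ip m (psi (j, t)) g"
    unfolding ip_def
  proof (intro Bochner_Integration.integral_cong refl)
    fix x assume "x \<in> space m"
    then show "cnj (phi j t x) * (g x / complex_of_real (w x)) = cnj (psi (j, t) x) * g x"
      using w_pos[of x] True by (simp add: phi_def)
  qed
  also have "\<dots> = (\<Sum>n. E n (j, t) * ip m (e n) g)" using psi(2)[OF gd g] by (simp add: sums_iff)
  finally show ?thesis using True by simp
next
  case False
  then have "phi j t = (\<lambda>x. 0)" by (simp only: phi_def if_False)
  then show ?thesis using False dpair_zero[OF HplusI[OF g]] by (simp only: if_False)
qed

lemma good_measurable: "Measurable.pred borel (\<lambda>t. good (j, t))"
proof -
  have [measurable]: "(\<lambda>t. E n (j, t)) \<in> borel_measurable borel" for n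
    using L2_measurable[OF E_L2[of n]] unfolding slotm_measurable_iff[OF sets_\<mu>] by blast
  have [measurable]: "(\<lambda>t. \<Sum>n. ennreal ((cmod (E n (j, t)))\<^sup>2)) \<in> borel_measurable borel" by measurable
  show ?thesis unfolding good_def by measurable
qed

lemma dpair_phi_measurable:
  assumes "u \<in> Hplus m w"
  shows "(\<lambda>t. dpair m w (phi j t) u) \<in> borel_measurable \<mu>"
proof -
  obtain g where g: "g \<in> L2 m" and u: "u = (\<lambda>x. g x / complex_of_real (w x))" using assms by (rule HplusE)
  have [measurable]: "(\<lambda>t. E n (j, t)) \<in> borel_measurable borel" for n
    using L2_measurable[OF E_L2[of n]] unfolding slotm_measurable_iff[OF sets_\<mu>] by blast
  note [measurable] = good_measurable Mset_sets
  have "(\<lambda>t. if t \<in> Mset d j \<and> good (j, t) then (\<Sum>n. E n (j, t) * ip m (e n) g) else 0) \<in> borel_measurable borel"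
    by measurable
  then have "(\<lambda>t. dpair m w (phi j t) u) \<in> borel_measurable borel" unfolding u dpair_phi[OF g] .
  then show ?thesis using measurable_cong_sets[OF sets_\<mu> refl] by blast
qed

lemma V_sum:
  assumes "\<And>n. a n \<in> L2 m"
  shows "aeq \<nu> (V (\<lambda>x. \<Sum>n<N. c n * a n x)) (\<lambda>y. \<Sum>n<(N::nat). c n * V (a n) y)"
proof (induction N)
  case 0
  show ?case using unitary_L2D(2)[OF V L2_zero L2_zero, of "- 1"] by (simp add: aeq_def)
next
  case (Suc N)
  have sL: "(\<lambda>x. \<Sum>n<N. c n * a n x) \<in> L2 m" by (intro L2_sum L2_scale assms)
  show ?case using unitary_L2D(2)[OF V sL assms, of "c N" N] Suc unfolding aeq_def by eventually_elim simp
qed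

lemma V_diff:
  assumes "f \<in> L2 m" "g \<in> L2 m"
  shows "l2norm \<nu> (\<lambda>y. V f y - V g y) = l2norm m (\<lambda>x. f x - g x)"
proof -
  have "aeq \<nu> (V (\<lambda>x. f x - g x)) (\<lambda>y. V f y - V g y)"
    using unitary_L2D(2)[OF V assms, of "- 1"] by simp
  then have "l2norm \<nu> (\<lambda>y. V f y - V g y) = l2norm \<nu> (V (\<lambda>x. f x - g x))"
    by (intro l2norm_cong[symmetric] L2_measurable VL L2_diff assms)
  then show ?thesis using unitary_L2D(4)[OF V L2_diff[OF assms]] by simp
qed

text \<open>The expansion of g gives partial sums that converge to \<open>V u\<close> in mean, hence
  almost everywhere along a subsequence; at every good point the full series converges to the
  pairing, so the two limits agree. The exceptional null set may depend on u, but \<open>phi\<close>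
  does not.\<close>

theorem V_eq_dpair:
  assumes u: "u \<in> Hplus m w"
  shows "AE y in \<nu>. V u y = dpair m w (phi (fst y) (snd y)) u"
proof -
  obtain g where g: "g \<in> L2 m" and ug: "u = (\<lambda>x. g x / complex_of_real (w x))" using u by (rule HplusE)
  have uL: "u \<in> L2 m" by (rule Hplus_L2[OF u])
  define c where "c n = ip m (e n) g" for n
  define s where "s N = (\<lambda>x. \<Sum>n<N. c n * e n x)" for N
  define T where "T N = (\<lambda>y. \<Sum>n<N. c n * E n y)" for N
  have sL: "s N \<in> L2 m" for N unfolding s_def by (intro L2_sum L2_scale eL)
  have swL: "(\<lambda>x. s N x / complex_of_real (w x)) \<in> L2 m" for N by (rule L2_div_w[OF sL])
  have TL: "T N \<in> L2 \<nu>" for N unfolding T_def by (intro L2_sum L2_scale E_L2)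
  have sw: "(\<lambda>x. s N x / complex_of_real (w x)) = (\<lambda>x. \<Sum>n<N. c n * (e n x / complex_of_real (w x)))" for N
    by (simp add: s_def sum_divide_distrib)
  have VT: "aeq \<nu> (V (\<lambda>x. s N x / complex_of_real (w x))) (T N)" for N
    unfolding sw T_def E_def by (rule V_sum) (rule L2_div_w[OF eL])
  \<comment> \<open>Division by w does not increase norms because w is at least 1, and V is
    isometric, so convergence of the expansion of g carries over.\<close>
  have "l2lim \<nu> T (V u)"
    unfolding l2lim_def
  proof (rule Lim_null_comparison)
    show "(\<lambda>N. l2norm m (\<lambda>x. s N x - g x)) \<longlonglongrightarrow> 0"
      using onb_expand(2)[OF e g] unfolding l2lim_def s_def c_def .
    have "l2norm \<nu> (\<lambda>y. T N y - V u y) \<le> l2norm m (\<lambda>x. s N x - g x)" for N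
    proof -
      have "l2norm \<nu> (\<lambda>y. T N y - V u y) = l2norm \<nu> (\<lambda>y. V (\<lambda>x. s N x / complex_of_real (w x)) y - V u y)"
        using VT[of N] by (intro l2norm_cong L2_measurable L2_diff TL VL swL uL) (auto simp: aeq_def)
      also have "\<dots> = l2norm m (\<lambda>x. s N x / complex_of_real (w x) - u x)" by (rule V_diff[OF swL uL])
      also have "\<dots> \<le> l2norm m (\<lambda>x. s N x - g x)"
      proof (rule l2norm_mono)
        show "AE x in m. cmod (s N x / complex_of_real (w x) - u x) \<le> cmod (s N x - g x)"
        proof (rule AE_I2)
          fix x assume "x \<in> space m"
          then have "1 \<le> w x" using w1 by blast
          then show "cmod (s N x / complex_of_real (w x) - u x) \<le> cmod (s N x - g x)"
            unfolding ug diff_divide_distrib[symmetric] norm_divide norm_of_real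
            by (simp add: divide_le_eq mult_le_cancel_left1)
        qed
      qed (intro L2_diff swL uL sL g)+
      finally show ?thesis .
    qed
    then show "\<forall>\<^sub>F N in sequentially. norm (l2norm \<nu> (\<lambda>y. T N y - V u y)) \<le> l2norm m (\<lambda>x. s N x - g x)"
      by simp
  qed
  from l2lim_AE_subseq[OF TL VL[OF uL] this] obtain r :: "nat \<Rightarrow> nat"
    where r: "strict_mono r" "AE y in \<nu>. (\<lambda>n. T (r n) y) \<longlonglongrightarrow> V u y" by blast
  have inM: "AE y in \<nu>. snd y \<in> Mset d (fst y)" unfolding slot_AE by simp
  have gd: "AE y in \<nu>. good y" using HS by (simp add: good_def E_def)
  from r(2) inM gd show ?thesis
  proof eventually_elim
    case (elim y)
    have "(\<lambda>n. E n y * ip m (e n) g) sums (\<Sum>n. E n y * ip m (e n) g)"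
      using psi(2)[OF elim(3) g] by (simp add: sums_iff)
    then have "(\<lambda>N. T N y) \<longlonglongrightarrow> (\<Sum>n. E n y * ip m (e n) g)"
      by (simp add: sums_def T_def c_def mult.commute)
    then have "(\<lambda>n. T (r n) y) \<longlonglongrightarrow> (\<Sum>n. E n y * ip m (e n) g)"
      using LIMSEQ_subseq_LIMSEQ[OF _ r(1)] by (auto simp: o_def)
    then have "V u y = (\<Sum>n. E n y * ip m (e n) g)" using elim(1) by (blast intro: LIMSEQ_unique)
    then show ?case unfolding ug dpair_phi[OF g] using elim by simp
  qed
qed

text \<open>The weak integral up to n and r is the vector whose transform is g cut off at slot n and
  outside the interval from -r to r; pairing with u and using \<open>V_eq_dpair\<close> confirms
  this. Unitarity of V reduces the limit to removing the cutoffs.\<close>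

theorem exp_limit_phi:
  assumes g: "in_dsum \<mu> (Jset \<infinity>) (Mset d) g" and f: "f \<in> L2 m"
    and Vf: "AE y in \<nu>. V f y = g (fst y) (snd y)"
  shows "exp_limit m w \<mu> (Jset \<infinity>) (Mset d) phi g f"
proof -
  define G where "G = slot_fun g"
  have GL: "G \<in> L2 \<nu>" unfolding G_def by (rule in_dsum_slot_fun[OF g])
  have VG: "aeq \<nu> (V f) G" unfolding aeq_def G_def by (rule slot_fun_AE[OF Vf])
  note [measurable] = L2_measurable[OF GL]
  define Gc where "Gc n r y = (if fst y \<le> n \<and> snd y \<in> {- r..r} then G y else 0)" for n :: nat and r y
  have Gc_meas: "Gc n r \<in> borel_measurable \<nu>" for n r
  proof -
    have [measurable]: "(\<lambda>t. G (j, t)) \<in> borel_measurable borel" for j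
      using L2_measurable[OF GL] unfolding slotm_measurable_iff[OF sets_\<mu>] by blast
    have "(\<lambda>t. if j \<le> n \<and> - r \<le> t \<and> t \<le> r then G (j, t) else 0) \<in> borel_measurable borel" for j
      by measurable
    then show ?thesis unfolding slotm_measurable_iff[OF sets_\<mu>] Gc_def by simp
  qed
  have GcL: "Gc n r \<in> L2 \<nu>" for n r
    by (rule L2_bound[OF GL Gc_meas, where C=1]) (auto simp: Gc_def)
  have ex: "\<exists>h. h \<in> L2 m \<and> aeq \<nu> (V h) (Gc n r)" for n r
    using unitary_L2D(5)[OF V GcL] by blast
  have ws: "wsum m w \<mu> (Jset \<infinity>) (Mset d) phi g n r h" if h: "h \<in> L2 m" "aeq \<nu> (V h) (Gc n r)" for n r h
    unfolding wsum_def
  proof (intro conjI ballI impI)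
    show "h \<in> Hminus m w" by (rule L2_Hminus[OF h(1)])
    fix u assume u: "u \<in> Hplus m w"
    have uL: "u \<in> L2 m" by (rule Hplus_L2[OF u])
    let ?F = "\<lambda>y. cnj (Gc n r y) * V u y"
    have Fint: "integrable \<nu> ?F" by (rule L2_prod_integrable[OF GcL VL[OF uL]])
    let ?D = "\<lambda>j t. (indicator (Mset d j \<inter> {- r..r}) t :: complex) * (cnj (g j t) * dpair m w (phi j t) u)"
    have aeD: "AE t in \<mu>. indicator (Mset d j) t * ?F (j, t) = ?D j t" if j: "j \<in> Jset \<infinity>" "j \<le> n" for j
    proof -
      have "AE t in \<mu>. t \<in> Mset d j \<longrightarrow> V u (j, t) = dpair m w (phi j t) u"
        using V_eq_dpair[OF u] unfolding slot_AE by simp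
      then show ?thesis
      proof eventually_elim
        case (elim t)
        have "j \<noteq> 0" using j by (simp add: Jset_infinity)
        then show ?case using elim j(2)
          by (cases "t \<in> Mset d j") (auto simp: Gc_def G_def slot_fun_def indicator_def)
      qed
    qed
    have Dm: "?D j \<in> borel_measurable \<mu>" if "j \<in> Jset \<infinity>" for j
    proof -
      have [measurable]: "g j \<in> borel_measurable \<mu>" using g that by (simp add: in_dsum_def)
      note [measurable] = dpair_phi_measurable[OF u, of j] Mset_sets
      show ?thesis by measurable
    qed
    have Sint: "integrable \<mu> (\<lambda>t. indicator (Mset d j) t * ?F (j, t))" for j
      by (rule slot_integrable_slice[OF Fint])
    fix j :: nat
    show "integrable \<mu> (?D j)" if j: "j \<in> Jset \<infinity>" "j \<le> n"
      using Sint[of j] by (rule integrable_cong_AE_imp[OF _ Dm[OF j(1)]]) (use aeD[OF j] in eventually_elim, simp)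
  next
    fix u assume u: "u \<in> Hplus m w"
    have uL: "u \<in> L2 m" by (rule Hplus_L2[OF u])
    let ?F = "\<lambda>y. cnj (Gc n r y) * V u y"
    have Fint: "integrable \<nu> ?F" by (rule L2_prod_integrable[OF GcL VL[OF uL]])
    have Sint: "integrable \<mu> (\<lambda>t. indicator (Mset d j) t * ?F (j, t))" for j
      by (rule slot_integrable_slice[OF Fint])
    have "dpair m w h u = ip \<nu> (V h) (V u)"
      unfolding dpair_eq(1)[OF L2_Hminus[OF h(1)] u] unitary_ip[OF V h(1) uL] ..
    also have "\<dots> = ip \<nu> (Gc n r) (V u)"
      by (rule ip_cong[OF h(2)]) (auto simp: aeq_def VL h uL GcL L2_measurable)
    also have "\<dots> = (\<Sum>j\<in>{j\<in>Jset \<infinity>. j \<le> n}. \<integral>t. indicator (Mset d j) t * ?F (j, t) \<partial>\<mu>)"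
      unfolding ip_def by (rule slot_integral_finite[OF Fint]) (simp add: Gc_def)
    also have "\<dots> = (\<Sum>j\<in>{j\<in>Jset \<infinity>. j \<le> n}.
            \<integral>t. (indicator (Mset d j \<inter> {- r..r}) t :: complex) * (cnj (g j t) * dpair m w (phi j t) u) \<partial>\<mu>)"
    proof (intro sum.cong refl)
      fix j assume "j \<in> {j\<in>Jset \<infinity>. j \<le> n}"
      then have j: "j \<in> Jset \<infinity>" "j \<le> n" by auto
      have [measurable]: "g j \<in> borel_measurable \<mu>" using g j by (simp add: in_dsum_def)
      note [measurable] = dpair_phi_measurable[OF u, of j] Mset_sets
      show "(\<integral>t. indicator (Mset d j) t * ?F (j, t) \<partial>\<mu>) =
        (\<integral>t. (indicator (Mset d j \<inter> {- r..r}) t :: complex) * (cnj (g j t) * dpair m w (phi j t) u) \<partial>\<mu>)"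
      proof (rule integral_cong_AE)
        show "(\<lambda>t. indicator (Mset d j) t * ?F (j, t)) \<in> borel_measurable \<mu>"
          by (rule borel_measurable_integrable[OF Sint])
        have "AE t in \<mu>. t \<in> Mset d j \<longrightarrow> V u (j, t) = dpair m w (phi j t) u"
          using V_eq_dpair[OF u] unfolding slot_AE by simp
        then show "AE t in \<mu>. indicator (Mset d j) t * ?F (j, t) =
            (indicator (Mset d j \<inter> {- r..r}) t :: complex) * (cnj (g j t) * dpair m w (phi j t) u)"
        proof eventually_elim
          case (elim t)
          have "j \<noteq> 0" using j by (simp add: Jset_infinity)
          then show ?case using elim j(2)
            by (cases "t \<in> Mset d j") (auto simp: Gc_def G_def slot_fun_def indicator_def)
        qed
      qed measurable
    qed
    finally show "dpair m w h u = (\<Sum>j\<in>{j\<in>Jset \<infinity>. j \<le> n}.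
            \<integral>t. (indicator (Mset d j \<inter> {- r..r}) t :: complex) * (cnj (g j t) * dpair m w (phi j t) u) \<partial>\<mu>)" .
  qed
  \<comment> \<open>The diagonal cutoffs suffice: raising n or r only makes the error smaller
    pointwise, so one good index controls all larger pairs.\<close>
  have lim: "(\<lambda>n. l2norm \<nu> (\<lambda>y. Gc n (real n) y - G y)) \<longlonglongrightarrow> 0"
  proof -
    have "(\<lambda>n. \<integral>y. (cmod (Gc n (real n) y - G y))\<^sup>2 \<partial>\<nu>) \<longlonglongrightarrow> (\<integral>y. 0 \<partial>\<nu>)"
    proof (rule integral_dominated_convergence[where w="\<lambda>y. (cmod (G y))\<^sup>2"])
      show "AE y in \<nu>. (\<lambda>n. (cmod (Gc n (real n) y - G y))\<^sup>2) \<longlonglongrightarrow> 0"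
      proof (rule AE_I2)
        fix y :: "nat \<times> real"
        obtain n0 where n0: "\<bar>snd y\<bar> \<le> real n0" using real_arch_simple by blast
        have "(cmod (Gc n (real n) y - G y))\<^sup>2 = 0" if "n \<ge> max n0 (fst y)" for n
        proof -
          have "real n0 \<le> real n" "fst y \<le> n" using that by auto
          then show ?thesis using n0 by (auto simp: Gc_def)
        qed
        then show "(\<lambda>n. (cmod (Gc n (real n) y - G y))\<^sup>2) \<longlonglongrightarrow> 0"
          by (intro tendsto_eventually eventually_sequentiallyI[of "max n0 (fst y)"]) auto
      qed
      show "AE y in \<nu>. norm ((cmod (Gc n (real n) y - G y))\<^sup>2) \<le> (cmod (G y))\<^sup>2" for n
        by (rule AE_I2) (auto simp: Gc_def)
      show "integrable \<nu> (\<lambda>y. (cmod (G y))\<^sup>2)" by (rule L2_integrable[OF GL])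
      show "(\<lambda>y. (cmod (Gc n (real n) y - G y))\<^sup>2) \<in> borel_measurable \<nu>" for n
        using Gc_meas[of n "real n"] by measurable
    qed simp
    from tendsto_real_sqrt[OF this] show ?thesis unfolding l2norm_def by simp
  qed
  show ?thesis unfolding exp_limit_def
  proof (intro conjI allI impI)
    show "\<exists>h. wsum m w \<mu> (Jset \<infinity>) (Mset d) phi g n r h" for n r using ex[of n r] ws by blast
    fix \<epsilon> :: real assume "\<epsilon> > 0"
    then have "\<forall>\<^sub>F n in sequentially. l2norm \<nu> (\<lambda>y. Gc n (real n) y - G y) < \<epsilon>"
      using lim by (intro order_tendstoD) auto
    then obtain n0 where n0: "l2norm \<nu> (\<lambda>y. Gc n0 (real n0) y - G y) < \<epsilon>"
      unfolding eventually_sequentially by blast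
    show "\<exists>n0 E0. \<forall>n\<ge>n0. \<forall>E\<ge>E0. \<forall>h. wsum m w \<mu> (Jset \<infinity>) (Mset d) phi g n E h \<longrightarrow>
          h \<in> L2 m \<and> l2norm m (\<lambda>x. h x - f x) < \<epsilon>"
    proof (intro exI[of _ n0] exI[of _ "real n0"] allI impI)
      fix n :: nat and r h assume n: "n0 \<le> n" and r: "real n0 \<le> r" and w: "wsum m w \<mu> (Jset \<infinity>) (Mset d) phi g n r h"
      obtain h0 where h0: "h0 \<in> L2 m" "aeq \<nu> (V h0) (Gc n r)" using ex by blast
      have hm: "h \<in> Hminus m w" using w by (simp add: wsum_def)
      \<comment> \<open>\<open>wsum\<close> describes h only through its pairings with
        \<open>Hplus\<close>; these separate \<open>Hminus\<close>, so h agrees with the square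
        integrable vector \<open>h0\<close>.\<close>
      have "aeq m h0 h"
      proof (rule Hplus_separates[OF L2_Hminus[OF h0(1)] hm])
        fix u assume "u \<in> Hplus m w"
        then show "dpair m w h0 u = dpair m w h u" using ws[OF h0] w unfolding wsum_def by simp
      qed
      then have hL: "h \<in> L2 m" and hn: "l2norm m (\<lambda>x. h x - f x) = l2norm m (\<lambda>x. h0 x - f x)"
      proof -
        assume ae: "aeq m h0 h"
        show hL: "h \<in> L2 m" by (rule L2_cong_AE[OF h0(1) _ ae]) (use hm in \<open>simp add: Hminus_def\<close>)
        show "l2norm m (\<lambda>x. h x - f x) = l2norm m (\<lambda>x. h0 x - f x)"
          using ae by (intro l2norm_cong L2_measurable L2_diff hL h0 f) (auto simp: aeq_def)
      qed
      have "l2norm m (\<lambda>x. h0 x - f x) = l2norm \<nu> (\<lambda>y. V h0 y - V f y)" by (rule V_diff[OF h0(1) f, symmetric])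
      also have "\<dots> = l2norm \<nu> (\<lambda>y. Gc n r y - G y)"
      proof (intro l2norm_cong L2_measurable L2_diff VL h0 f GcL GL)
        show "aeq \<nu> (\<lambda>y. V h0 y - V f y) (\<lambda>y. Gc n r y - G y)"
          using h0(2) VG unfolding aeq_def by eventually_elim simp
      qed
      also have "\<dots> \<le> l2norm \<nu> (\<lambda>y. Gc n0 (real n0) y - G y)"
        by (rule l2norm_mono[OF L2_diff[OF GcL GL] L2_diff[OF GcL GL]]) (use n r in \<open>auto simp: Gc_def\<close>)
      also have "\<dots> < \<epsilon>" by (rule n0)
      finally show "h \<in> L2 m \<and> l2norm m (\<lambda>x. h x - f x) < \<epsilon>" using hL hn by simp
    qed
  qed
qed

end

section \<open>The expansion theorem\<close>

context densities
begin

text \<open>A test vector for sets of \<mu>: when almost every t lies in \<open>Mset d 1\<close>,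
  the first slot alone detects whether B is null.\<close>

definition first_slot :: "real set \<Rightarrow> nat \<times> real \<Rightarrow> complex" where
  "first_slot B = (\<lambda>(j, t). if j = 1 \<and> t \<in> B then 1 else 0)"

lemma first_slot_L2:
  assumes B: "B \<in> sets borel" shows "first_slot B \<in> L2 \<nu>"
proof -
  have "(\<lambda>t. if j = 1 \<and> t \<in> B then 1 else 0 :: complex) \<in> borel_measurable borel" for j :: nat
  proof (cases "j = 1")
    case True
    have "(\<lambda>t. indicator B t :: complex) \<in> borel_measurable borel" using B by (rule borel_measurable_indicator)
    moreover have "(\<lambda>t. if j = 1 \<and> t \<in> B then 1 else 0 :: complex) = (\<lambda>t. indicator B t)"
      using True by (intro ext) (simp add: indicator_def)
    ultimately show ?thesis by (simp only:)
  qed simp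
  then have m[measurable]: "first_slot B \<in> borel_measurable \<nu>"
    unfolding slotm_measurable_iff[OF sets_\<mu>] first_slot_def prod.case by (rule allI)
  have "(\<integral>\<^sup>+y. ennreal ((cmod (first_slot B y))\<^sup>2) \<partial>\<nu>) =
      (\<Sum>j. \<integral>\<^sup>+t. indicator (Mset d j) t * ennreal ((cmod (first_slot B (j, t)))\<^sup>2) \<partial>\<mu>)"
    by (rule slot_nn_integral) measurable
  also have "\<dots> = (\<Sum>j\<in>{1}. \<integral>\<^sup>+t. indicator (Mset d j) t * ennreal ((cmod (first_slot B (j, t)))\<^sup>2) \<partial>\<mu>)"
  proof (rule suminf_finite)
    fix j :: nat assume "j \<notin> {1}"
    then have "first_slot B (j, t) = 0" for t by (simp add: first_slot_def)
    then show "(\<integral>\<^sup>+t. indicator (Mset d j) t * ennreal ((cmod (first_slot B (j, t)))\<^sup>2) \<partial>\<mu>) = 0" by simp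
  qed simp
  also have "\<dots> = (\<integral>\<^sup>+t. indicator (Mset d 1) t * ennreal ((cmod (first_slot B (1, t)))\<^sup>2) \<partial>\<mu>)" by simp
  also have "\<dots> \<le> (\<integral>\<^sup>+t. 1 \<partial>\<mu>)" by (intro nn_integral_mono) (simp add: first_slot_def indicator_def)
  also have "\<dots> < \<infinity>" using finite_emeasure_space by (simp add: less_top[symmetric])
  finally show ?thesis by (simp add: L2_nn_integral_iff[OF m])
qed

lemma first_slot_null:
  assumes M1: "AE t in \<mu>. t \<in> Mset d 1" and z: "AE y in \<nu>. first_slot B y = 0"
  shows "AE t in \<mu>. t \<notin> B"
proof -
  have "AE t in \<mu>. t \<in> Mset d 1 \<longrightarrow> first_slot B (1, t) = 0" using z unfolding slot_AE by blast
  with M1 show ?thesis by eventually_elim (auto simp: first_slot_def split: if_splits)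
qed

text \<open>Over a small ball around a point t0 off the spectrum, a vector in the first slot is
  moved by L - t0 to a much shorter one, which the bounded inverse forbids unless the vector is
  null. Hence each such point has a null neighborhood.\<close>

lemma AE_spectrum:
  assumes sr: "spec_rep m L \<nu> V snd" and M1: "AE t in \<mu>. t \<in> Mset d 1"
  shows "AE t in \<mu>. t \<in> spectrum_op m L"
proof -
  have V: "unitary_L2 m \<nu> V" using sr by (simp add: spec_rep_iff)
  have loc: "\<exists>\<delta>>0. AE t in \<mu>. t \<notin> ball t0 \<delta>" if t0: "t0 \<notin> spectrum_op m L" for t0
  proof -
    have "bdd_invertible m {(f, \<lambda>x. g x - complex_of_real t0 * f x) | f g. (f,g) \<in> L}"
      using t0 unfolding spectrum_op_def mem_Collect_eq not_not .
    then have "\<exists>C. \<forall>f g. (f,g) \<in> {(f, \<lambda>x. g x - complex_of_real t0 * f x) | f g. (f,g) \<in> L} \<longrightarrow> l2norm m f \<le> C * l2norm m g"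
      unfolding bdd_invertible_def by (rule conjunct2)
    then obtain C where C: "\<And>f g. (f, g) \<in> L \<Longrightarrow> l2norm m f \<le> C * l2norm m (\<lambda>x. g x - complex_of_real t0 * f x)"
      by blast
    \<comment> \<open>Chosen so that the bound C of the inverse times \<delta> is at most 1/2; the
      absolute value and the summand 1 cover a nonpositive C.\<close>
    define \<delta> where "\<delta> = 1 / (2 * (\<bar>C\<bar> + 1))"
    have \<delta>: "\<delta> > 0" "\<bar>C\<bar> * \<delta> \<le> 1 / 2" unfolding \<delta>_def by (auto simp: divide_simps)
    define k where "k = first_slot (ball t0 \<delta>)"
    have kL: "k \<in> L2 \<nu>" unfolding k_def by (rule first_slot_L2) simp
    have snd_m: "(snd :: nat \<times> real \<Rightarrow> real) \<in> borel_measurable \<nu>"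
      unfolding slotm_measurable_iff[OF sets_\<mu>] by simp
    note [measurable] = snd_m L2_measurable[OF kL]
    have kd: "cmod ((complex_of_real (snd y) - complex_of_real t0) * k y) \<le> \<delta> * cmod (k y)" for y
    proof (cases "k y = 0")
      case False
      then have "snd y \<in> ball t0 \<delta>" by (cases y) (auto simp: k_def first_slot_def split: if_splits)
      then have "cmod (complex_of_real (snd y) - complex_of_real t0) \<le> \<delta>"
        by (simp add: dist_real_def flip: of_real_diff)
      then show ?thesis unfolding norm_mult by (rule mult_right_mono) simp
    qed simp
    have dL: "(\<lambda>y. (complex_of_real (snd y) - complex_of_real t0) * k y) \<in> L2 \<nu>"
      by (rule L2_bound[OF kL, where C=\<delta>]) (measurable, use kd in simp)
    from L2_lin[OF this kL, of "complex_of_real t0"]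
    have hk: "(\<lambda>y. complex_of_real (snd y) * k y) \<in> L2 \<nu>" by (simp add: algebra_simps)
    obtain f where f: "f \<in> L2 m" "aeq \<nu> (V f) k" using unitary_L2D(5)[OF V kL] by blast
    obtain g where g: "g \<in> L2 m" "aeq \<nu> (V g) (\<lambda>y. complex_of_real (snd y) * k y)" using unitary_L2D(5)[OF V hk] by blast
    note [measurable] = L2_measurable[OF unitary_L2D(1)[OF V f(1)]]
    have "(\<lambda>y. complex_of_real (snd y) * V f y) \<in> L2 \<nu>"
      by (rule L2_cong_AE[OF hk]) (measurable, use f(2) in \<open>auto simp: aeq_def\<close>)
    moreover have "aeq \<nu> (V g) (\<lambda>y. complex_of_real (snd y) * V f y)"
      using f(2) g(2) unfolding aeq_def by eventually_elim simp
    ultimately have "(f, g) \<in> L" using f(1) g(1) sr unfolding spec_rep_iff by blast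
    from C[OF this] have le: "l2norm m f \<le> C * l2norm m (\<lambda>x. g x + (- complex_of_real t0) * f x)" by simp
    have GL: "(\<lambda>x. g x + (- complex_of_real t0) * f x) \<in> L2 m" by (rule L2_lin[OF g(1) f(1)])
    have "aeq \<nu> (V (\<lambda>x. g x + (- complex_of_real t0) * f x)) (\<lambda>y. (complex_of_real (snd y) - complex_of_real t0) * k y)"
      using f(2) g(2) unitary_L2D(2)[OF V g(1) f(1), of "- complex_of_real t0"]
      unfolding aeq_def by eventually_elim (simp add: algebra_simps)
    then have "l2norm m (\<lambda>x. g x + (- complex_of_real t0) * f x) = l2norm \<nu> (\<lambda>y. (complex_of_real (snd y) - complex_of_real t0) * k y)"
      unfolding unitary_L2D(4)[OF V GL, symmetric]
      by (intro l2norm_cong L2_measurable unitary_L2D(1)[OF V GL] dL)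
    also have "\<dots> \<le> l2norm \<nu> (\<lambda>y. complex_of_real \<delta> * k y)"
      by (rule l2norm_mono[OF dL L2_scale[OF kL]]) (use kd \<delta> in \<open>simp add: norm_mult\<close>)
    also have "\<dots> = \<delta> * l2norm \<nu> k" unfolding l2norm_scale using \<delta> by simp
    finally have le2: "l2norm m (\<lambda>x. g x + (- complex_of_real t0) * f x) \<le> \<delta> * l2norm \<nu> k" .
    have fk: "l2norm m f = l2norm \<nu> k"
      unfolding unitary_L2D(4)[OF V f(1), symmetric] by (intro l2norm_cong f L2_measurable unitary_L2D(1)[OF V f(1)] kL)
    have "l2norm \<nu> k \<le> \<bar>C\<bar> * l2norm m (\<lambda>x. g x + (- complex_of_real t0) * f x)"
      using le fk mult_right_mono[OF abs_ge_self[of C], of "l2norm m (\<lambda>x. g x + (- complex_of_real t0) * f x)"] by simp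
    also have "\<dots> \<le> \<bar>C\<bar> * (\<delta> * l2norm \<nu> k)" using le2 by (rule mult_left_mono) simp
    also have "\<dots> \<le> 1 / 2 * l2norm \<nu> k" using mult_right_mono[OF \<delta>(2), of "l2norm \<nu> k"] by (simp add: mult.assoc)
    finally have "l2norm \<nu> k = 0" using l2norm_nonneg[of \<nu> k] by linarith
    then have "AE y in \<nu>. first_slot (ball t0 \<delta>) y = 0"
      using l2norm_eq_0_iff[OF kL] by (simp add: aeq_def k_def)
    from first_slot_null[OF M1 this] \<delta>(1) show ?thesis by blast
  qed
  then obtain \<delta> where \<delta>: "\<And>t. t \<notin> spectrum_op m L \<Longrightarrow> \<delta> t > 0"
    "\<And>t0. t0 \<notin> spectrum_op m L \<Longrightarrow> AE t in \<mu>. t \<notin> ball t0 (\<delta> t0)" by metis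
  \<comment> \<open>The null balls may be uncountably many; Lindelof's theorem leaves countably many
    with the same union.\<close>
  define F where "F = (\<lambda>t. ball t (\<delta> t)) ` (- spectrum_op m L)"
  obtain F' where F': "F' \<subseteq> F" "countable F'" "\<Union>F' = \<Union>F"
    by (rule Lindelof[of F]) (auto simp: F_def)
  have "AE t in \<mu>. \<forall>S\<in>F'. t \<notin> S"
    by (subst AE_ball_countable[OF F'(2)]) (use F'(1) \<delta>(2) in \<open>auto simp: F_def\<close>)
  then show ?thesis
  proof eventually_elim
    case (elim t)
    show ?case
    proof (rule ccontr)
      assume t: "t \<notin> spectrum_op m L"
      then have "t \<in> \<Union>F" using \<delta>(1)[OF t] by (auto simp: F_def intro!: bexI[of _ t])
      then show False using elim F'(3) by blast
    qed
  qed
qed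

text \<open>A null set A has a null cylinder in the slot space, so the indicator kills everything.
  Conversely, the vector with transform \<open>first_slot A\<close> is fixed by the spectral
  projection of A and must be null if that projection vanishes.\<close>

lemma spectral_measure_slots:
  assumes sa: "selfadjoint m L" and sr: "spec_rep m L \<nu> V snd" and M1: "AE t in \<mu>. t \<in> Mset d 1"
  shows "spectral_measure m L \<mu>"
  unfolding spectral_measure_def
proof (intro conjI ballI)
  show "sets \<mu> = sets borel" by (rule sets_\<mu>)
  have V: "unitary_L2 m \<nu> V" using sr by (simp add: spec_rep_iff)
  fix A :: "real set" assume A: "A \<in> sets borel"
  have fc: "fcalc m L (indicator A) = rep_calc m (indicator A) \<nu> V snd"
    by (rule fcalc_eq[OF sa sr]) (use A in measurable)
  have nullA: "emeasure \<mu> A = 0 \<longleftrightarrow> (AE t in \<mu>. t \<notin> A)"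
    using A by (subst AE_iff_measurable[of A]) (auto simp: space_\<mu> sets_\<mu>)
  show "emeasure \<mu> A = 0 \<longleftrightarrow> op_zero m (fcalc m L (indicator A))"
    unfolding nullA
  proof
    assume "AE t in \<mu>. t \<notin> A"
    then have "AE t in \<mu>. t \<in> Mset d j \<longrightarrow> snd (j, t) \<notin> A" for j by eventually_elim simp
    then have nA: "AE y in \<nu>. snd y \<notin> A" unfolding slot_AE by blast
    show "op_zero m (fcalc m L (indicator A))"
      unfolding op_zero_def fc
    proof (intro ballI, clarify)
      fix f g assume "(f, g) \<in> rep_calc m (indicator A) \<nu> V snd"
      then have g: "g \<in> L2 m" and eq: "aeq \<nu> (V g) (\<lambda>y. indicator A (snd y) * V f y)" by (auto simp: rep_calc_def)
      have "aeq \<nu> (V g) (\<lambda>y. 0)" using eq nA unfolding aeq_def by eventually_elim simp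
      then have "l2norm \<nu> (V g) = 0" by (simp add: l2norm_eq_0_iff unitary_L2D(1)[OF V g])
      then show "aeq m g (\<lambda>x. 0)" using unitary_L2D(4)[OF V g] l2norm_eq_0_iff[OF g] by simp
    qed
  next
    assume z: "op_zero m (fcalc m L (indicator A))"
    have kL: "first_slot A \<in> L2 \<nu>" by (rule first_slot_L2[OF A])
    obtain f where f: "f \<in> L2 m" "aeq \<nu> (V f) (first_slot A)" using unitary_L2D(5)[OF V kL] by blast
    have eq: "aeq \<nu> (V f) (\<lambda>y. indicator A (snd y) * V f y)"
      using f(2) unfolding aeq_def
      by eventually_elim (auto simp: first_slot_def indicator_def split: prod.splits if_splits)
    have "(\<lambda>t. indicator A t * V f (j, t)) \<in> borel_measurable borel" for j
    proof -
      have [measurable]: "(\<lambda>t. V f (j, t)) \<in> borel_measurable borel"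
        using L2_measurable[OF unitary_L2D(1)[OF V f(1)]] unfolding slotm_measurable_iff[OF sets_\<mu>] by blast
      show ?thesis using A by measurable
    qed
    then have "(\<lambda>y. indicator A (snd y) * V f y) \<in> borel_measurable \<nu>" unfolding slotm_measurable_iff[OF sets_\<mu>] by simp
    from L2_cong_AE[OF unitary_L2D(1)[OF V f(1)] this eq]
    have "(f, f) \<in> rep_calc m (indicator A) \<nu> V snd" unfolding rep_calc_def using f(1) eq by simp
    then have "aeq m f (\<lambda>x. 0)" using z unfolding op_zero_def fc by blast
    then have "l2norm \<nu> (V f) = 0" using unitary_L2D(4)[OF V f(1)] l2norm_eq_0_iff[OF f(1)] by simp
    then have "aeq \<nu> (V f) (\<lambda>y. 0)" by (simp add: l2norm_eq_0_iff unitary_L2D(1)[OF V f(1)])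
    with f(2) have "AE y in \<nu>. first_slot A y = 0" unfolding aeq_def by eventually_elim simp
    from first_slot_null[OF M1 this] show "AE t in \<mu>. t \<notin> A" .
  qed
qed

end

section \<open>Verification of the expansion\<close>

context eigen
begin

lemma slice_V: "f \<in> L2 m \<Longrightarrow> (\<lambda>t. V f (j, t)) \<in> borel_measurable \<mu>"
  by (rule slice_measurable[OF L2_measurable[OF VL]])

lemma dsnorm2_weighted:
  assumes f: "f \<in> L2 m" and \<Phi>[measurable]: "\<Phi> \<in> borel_measurable borel"
  shows "dsnorm2 \<mu> (Jset \<infinity>) (Mset d) (\<lambda>j t. \<Phi> t * V f (j, t)) = (\<integral>\<^sup>+y. ennreal ((cmod (\<Phi> (snd y) * V f y))\<^sup>2) \<partial>\<nu>)"
proof -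
  note [measurable] = slice_V[OF f]
  have "AE y in \<nu>. \<Phi> (snd y) * V f y = slot_fun (\<lambda>j t. \<Phi> t * V f (j, t)) y"
    by (rule slot_fun_AE) simp
  then have "AE y in \<nu>. ennreal ((cmod (slot_fun (\<lambda>j t. \<Phi> t * V f (j, t)) y))\<^sup>2) = ennreal ((cmod (\<Phi> (snd y) * V f y))\<^sup>2)"
    by eventually_elim simp
  then show ?thesis by (subst dsnorm2_slot_fun) (measurable, rule nn_integral_cong_AE)
qed

lemma dsnorm2_V: "f \<in> L2 m \<Longrightarrow> dsnorm2 \<mu> (Jset \<infinity>) (Mset d) (\<lambda>j t. V f (j, t)) = ennreal ((l2norm m f)\<^sup>2)"
  using dsnorm2_weighted[of f "\<lambda>_. 1"] nn_integral_L2[OF VL] unitary_L2D(4)[OF V] by simp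

lemma in_dsum_V: "f \<in> L2 m \<Longrightarrow> in_dsum \<mu> (Jset \<infinity>) (Mset d) (\<lambda>j t. V f (j, t))"
  unfolding in_dsum_def by (simp add: dsnorm2_V slice_V)

lemma dpair_phi_outside:
  assumes "f \<in> Hplus m w" "t \<notin> Mset d j" shows "dpair m w (phi j t) f = 0"
proof -
  have "phi j t = (\<lambda>x. 0)" using assms(2) by (simp add: phi_def)
  then show ?thesis using dpair_zero[OF assms(1)] by simp
qed

lemma AE_V_dpair:
  assumes "f \<in> Hplus m w"
  shows "AE t in \<mu>. t \<in> Mset d j \<longrightarrow> V f (j, t) = dpair m w (phi j t) f"
proof -
  have "\<forall>j. AE t in \<mu>. t \<in> Mset d j \<longrightarrow> V f (j, t) = dpair m w (phi (fst (j, t)) (snd (j, t))) f"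
    using V_eq_dpair[OF assms] unfolding slot_AE .
  then show ?thesis by simp
qed

lemma rep_calc_Domain:
  assumes f: "f \<in> L2 m" and \<Phi>[measurable]: "\<Phi> \<in> borel_measurable borel"
  shows "f \<in> Domain (rep_calc m \<Phi> \<nu> V snd) \<longleftrightarrow> dsnorm2 \<mu> (Jset \<infinity>) (Mset d) (\<lambda>j t. \<Phi> t * V f (j, t)) < \<infinity>"
proof -
  have "(\<lambda>t. \<Phi> t * V f (j, t)) \<in> borel_measurable borel" for j
  proof -
    have [measurable]: "(\<lambda>t. V f (j, t)) \<in> borel_measurable borel"
      using L2_measurable[OF VL[OF f]] unfolding slotm_measurable_iff[OF sets_\<mu>] by blast
    show ?thesis by measurable
  qed
  then have m: "(\<lambda>y. \<Phi> (snd y) * V f y) \<in> borel_measurable \<nu>" unfolding slotm_measurable_iff[OF sets_\<mu>] by simp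
  have "f \<in> Domain (rep_calc m \<Phi> \<nu> V snd) \<longleftrightarrow> (\<lambda>y. \<Phi> (snd y) * V f y) \<in> L2 \<nu>"
  proof
    assume k: "(\<lambda>y. \<Phi> (snd y) * V f y) \<in> L2 \<nu>"
    then obtain g where "g \<in> L2 m" "aeq \<nu> (V g) (\<lambda>y. \<Phi> (snd y) * V f y)" using unitary_L2D(5)[OF V k] by blast
    with k f show "f \<in> Domain (rep_calc m \<Phi> \<nu> V snd)" by (auto simp: rep_calc_def)
  qed (auto simp: rep_calc_def)
  then show ?thesis unfolding dsnorm2_weighted[OF f \<Phi>] L2_nn_integral_iff[OF m] .
qed

text \<open>The index set is always infinite; a finite multiplicity at t shows only in t missing
  from the later sets \<open>Mset d j\<close>. The lemma \<open>slot_AE\<close> turns the clauses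
  for all slots into one statement on the slot space, where V acts.\<close>

theorem gen_eig_expansion_phi:
  assumes sa: "selfadjoint m L" and sr: "spec_rep m L \<nu> V snd" and M1: "AE t in \<mu>. t \<in> Mset d 1"
  shows "gen_eig_expansion m L w \<mu> \<infinity> (Mset d) (\<lambda>j f t. V f (j, t)) phi"
  unfolding gen_eig_expansion_def
proof (intro conjI)
  show "spectral_measure m L \<mu>" by (rule spectral_measure_slots[OF sa sr M1])
  show "\<forall>j\<in>Jset \<infinity>. Mset d j \<in> sets borel" by (simp add: Mset_sets)
  show "\<forall>j. j \<in> Jset \<infinity> \<longrightarrow> Suc j \<in> Jset \<infinity> \<longrightarrow> Mset d (Suc j) \<subseteq> Mset d j"
    using Mset_antimono by (simp add: Jset_infinity)
  show "\<forall>f\<in>L2 m. in_dsum \<mu> (Jset \<infinity>) (Mset d) (\<lambda>j t. V f (j, t))" by (simp add: in_dsum_V)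
  show "\<forall>f\<in>L2 m. \<forall>g\<in>L2 m. \<forall>a::complex. \<forall>j\<in>Jset \<infinity>.
        AE t in \<mu>. t \<in> Mset d j \<longrightarrow> V (\<lambda>x. f x + a * g x) (j, t) = V f (j, t) + a * V g (j, t)"
    using unitary_L2D(2)[OF V] unfolding aeq_def slot_AE by blast
  show "\<forall>f\<in>L2 m. \<forall>g\<in>L2 m. aeq m f g \<longrightarrow> (\<forall>j\<in>Jset \<infinity>. AE t in \<mu>. t \<in> Mset d j \<longrightarrow> V f (j, t) = V g (j, t))"
    using unitary_L2D(3)[OF V] unfolding aeq_def[of \<nu>] slot_AE by blast
  show "\<forall>f\<in>L2 m. dsnorm2 \<mu> (Jset \<infinity>) (Mset d) (\<lambda>j t. V f (j, t)) = ennreal ((l2norm m f)\<^sup>2)"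
    by (simp add: dsnorm2_V)
  show "\<forall>g. in_dsum \<mu> (Jset \<infinity>) (Mset d) g \<longrightarrow>
        (\<exists>f\<in>L2 m. \<forall>j\<in>Jset \<infinity>. AE t in \<mu>. t \<in> Mset d j \<longrightarrow> V f (j, t) = g j t)"
  proof (intro allI impI)
    fix g assume "in_dsum \<mu> (Jset \<infinity>) (Mset d) g"
    then obtain f where f: "f \<in> L2 m" "AE y in \<nu>. V f y = slot_fun g y"
      using unitary_L2D(5)[OF V in_dsum_slot_fun] unfolding aeq_def by blast
    have "AE t in \<mu>. t \<in> Mset d j \<longrightarrow> V f (j, t) = g j t" if "j \<in> Jset \<infinity>" for j
    proof -
      have "AE t in \<mu>. t \<in> Mset d j \<longrightarrow> V f (j, t) = slot_fun g (j, t)" using f(2) unfolding slot_AE by blast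
      moreover have "slot_fun g (j, t) = g j t" for t using that by (simp add: slot_fun_def Jset_infinity)
      ultimately show ?thesis by simp
    qed
    with f(1) show "\<exists>f\<in>L2 m. \<forall>j\<in>Jset \<infinity>. AE t in \<mu>. t \<in> Mset d j \<longrightarrow> V f (j, t) = g j t" by blast
  qed
  show "\<forall>\<Phi>::real \<Rightarrow> complex. \<Phi> \<in> borel_measurable borel \<longrightarrow>
        (\<forall>f\<in>L2 m.
           (f \<in> Domain (fcalc m L \<Phi>) \<longleftrightarrow> dsnorm2 \<mu> (Jset \<infinity>) (Mset d) (\<lambda>j t. \<Phi> t * V f (j, t)) < \<infinity>) \<and>
           (\<forall>g. (f,g) \<in> fcalc m L \<Phi> \<longrightarrow>
              (\<forall>j\<in>Jset \<infinity>. AE t in \<mu>. t \<in> Mset d j \<longrightarrow> V g (j, t) = \<Phi> t * V f (j, t))))"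
  proof (intro allI impI ballI conjI)
    fix \<Phi> :: "real \<Rightarrow> complex" and f assume \<Phi>: "\<Phi> \<in> borel_measurable borel" and f: "f \<in> L2 m"
    show "f \<in> Domain (fcalc m L \<Phi>) \<longleftrightarrow> dsnorm2 \<mu> (Jset \<infinity>) (Mset d) (\<lambda>j t. \<Phi> t * V f (j, t)) < \<infinity>"
      unfolding fcalc_eq[OF sa sr \<Phi>] by (rule rep_calc_Domain[OF f \<Phi>])
    fix g j assume "(f, g) \<in> fcalc m L \<Phi>"
    then have "aeq \<nu> (V g) (\<lambda>y. \<Phi> (snd y) * V f y)" unfolding fcalc_eq[OF sa sr \<Phi>] by (simp add: rep_calc_def)
    then show "AE t in \<mu>. t \<in> Mset d j \<longrightarrow> V g (j, t) = \<Phi> t * V f (j, t)" unfolding aeq_def slot_AE by simp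
  qed
  show "\<forall>j\<in>Jset \<infinity>. \<forall>t. t \<in> Mset d j \<longrightarrow> phi j t \<in> Hminus m w" by (simp add: phi_Hminus)
  show "\<forall>j\<in>Jset \<infinity>. \<forall>t. t \<notin> Mset d j \<longrightarrow> phi j t = (\<lambda>x. 0)" by (simp add: phi_def)
  show "\<forall>j\<in>Jset \<infinity>. \<forall>u\<in>Hplus m w. (\<lambda>t. dpair m w (phi j t) u) \<in> borel_measurable \<mu>"
    by (simp add: dpair_phi_measurable)
  show "\<forall>f\<in>Hplus m w. \<forall>j\<in>Jset \<infinity>. AE t in \<mu>. t \<in> Mset d j \<longrightarrow> V f (j, t) = dpair m w (phi j t) f"
    by (intro ballI AE_V_dpair)
  show "\<forall>g f. in_dsum \<mu> (Jset \<infinity>) (Mset d) g \<longrightarrow> f \<in> L2 m \<longrightarrow>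
        (\<forall>j\<in>Jset \<infinity>. AE t in \<mu>. t \<in> Mset d j \<longrightarrow> V f (j, t) = g j t) \<longrightarrow>
        exp_limit m w \<mu> (Jset \<infinity>) (Mset d) phi g f"
  proof (intro allI impI)
    fix g f assume *: "in_dsum \<mu> (Jset \<infinity>) (Mset d) g" "f \<in> L2 m"
      "\<forall>j\<in>Jset \<infinity>. AE t in \<mu>. t \<in> Mset d j \<longrightarrow> V f (j, t) = g j t"
    show "exp_limit m w \<mu> (Jset \<infinity>) (Mset d) phi g f"
      by (rule exp_limit_phi[OF *(1,2)]) (use *(3) slot_AE_J[of "\<lambda>j t. V f (j, t) = g j t"] in simp)
  qed
  show "\<forall>f\<in>L2 m. exp_limit m w \<mu> (Jset \<infinity>) (Mset d) phi (\<lambda>j t. V f (j, t)) f"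
    by (intro ballI exp_limit_phi in_dsum_V) auto
  \<comment> \<open>On \<open>Mset d j\<close> the transform turns L into multiplication by t; off
    that set \<open>phi j t\<close> is 0 and both pairings vanish.\<close>
  show "\<forall>f g. (f,g) \<in> L \<longrightarrow> f \<in> Hplus m w \<longrightarrow> g \<in> Hplus m w \<longrightarrow>
        (\<forall>j\<in>Jset \<infinity>. AE t in \<mu>. dpair m w (phi j t) g = complex_of_real t * dpair m w (phi j t) f)"
  proof (intro allI impI ballI)
    fix f g j assume fg: "(f, g) \<in> L" and f: "f \<in> Hplus m w" and g: "g \<in> Hplus m w"
    have "aeq \<nu> (V g) (\<lambda>y. complex_of_real (snd y) * V f y)" using sr fg unfolding spec_rep_iff by blast
    then have "AE t in \<mu>. t \<in> Mset d j \<longrightarrow> V g (j, t) = complex_of_real t * V f (j, t)"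
      unfolding aeq_def slot_AE by simp
    with AE_V_dpair[OF f, of j] AE_V_dpair[OF g, of j]
    show "AE t in \<mu>. dpair m w (phi j t) g = complex_of_real t * dpair m w (phi j t) f"
    proof eventually_elim
      case (elim t)
      then show ?case using dpair_phi_outside[OF f, of t j] dpair_phi_outside[OF g, of t j]
        by (cases "t \<in> Mset d j") auto
    qed
  qed
qed

text \<open>S is any set of full measure: the spectrum for the theorem, and all of the line for the
  summability needed in \<open>exp_limit_dpair\<close>.\<close>

lemma parseval_phi:
  assumes f: "f \<in> Hplus m w" and S: "AE t in \<mu>. t \<in> S"
  shows "(\<integral>\<^sup>+t. indicator S t * (\<Sum>j. if j \<in> Jset \<infinity> then ennreal ((cmod (dpair m w (phi j t) f))\<^sup>2) else 0) \<partial>\<mu>)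
     = ennreal ((l2norm m f)\<^sup>2)"
proof -
  have fL: "f \<in> L2 m" by (rule Hplus_L2[OF f])
  note [measurable] = dpair_phi_measurable[OF f] L2_measurable[OF VL[OF fL]]
  let ?a = "\<lambda>j t. if j \<in> Jset \<infinity> then ennreal ((cmod (dpair m w (phi j t) f))\<^sup>2) else 0"
  have "(\<integral>\<^sup>+t. indicator S t * (\<Sum>j. ?a j t) \<partial>\<mu>) = (\<integral>\<^sup>+t. (\<Sum>j. ?a j t) \<partial>\<mu>)"
    by (rule nn_integral_cong_AE) (use S in eventually_elim, simp)
  also have "\<dots> = (\<Sum>j. \<integral>\<^sup>+t. ?a j t \<partial>\<mu>)" by (rule nn_integral_suminf) measurable
  also have "\<dots> = (\<Sum>j. \<integral>\<^sup>+t. indicator (Mset d j) t * ennreal ((cmod (V f (j, t)))\<^sup>2) \<partial>\<mu>)"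
  proof (intro suminf_cong nn_integral_cong_AE)
    fix j
    show "AE t in \<mu>. ?a j t = indicator (Mset d j) t * ennreal ((cmod (V f (j, t)))\<^sup>2)"
      using AE_V_dpair[OF f, of j]
    proof eventually_elim
      case (elim t)
      show ?case
      proof (cases "t \<in> Mset d j")
        case True
        then have "j \<noteq> 0" by (metis Mset_0 empty_iff)
        then show ?thesis using True elim by (simp add: Jset_infinity)
      next
        case False
        then show ?thesis by (simp add: dpair_phi_outside[OF f])
      qed
    qed
  qed
  also have "\<dots> = (\<integral>\<^sup>+y. ennreal ((cmod (V f y))\<^sup>2) \<partial>\<nu>)" by (rule slot_nn_integral[symmetric]) measurable
  also have "\<dots> = ennreal ((l2norm m f)\<^sup>2)" using nn_integral_L2[OF VL[OF fL]] unitary_L2D(4)[OF V fL] by simp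
  finally show ?thesis .
qed

lemma exp_limit_dpair:
  assumes f: "f \<in> Hplus m w"
  shows "exp_limit m w \<mu> (Jset \<infinity>) (Mset d) phi (\<lambda>j t. dpair m w (phi j t) f) f"
proof (rule exp_limit_phi[OF _ Hplus_L2[OF f]])
  have "AE t in \<mu>. t \<in> UNIV" by simp
  from parseval_phi[OF f this]
  have fin: "(\<integral>\<^sup>+t. (\<Sum>j. if j \<in> Jset \<infinity> then ennreal ((cmod (dpair m w (phi j t) f))\<^sup>2) else 0) \<partial>\<mu>) < \<infinity>" by simp
  note [measurable] = dpair_phi_measurable[OF f] Mset_sets
  have "dsnorm2 \<mu> (Jset \<infinity>) (Mset d) (\<lambda>j t. dpair m w (phi j t) f)
      \<le> (\<Sum>j. \<integral>\<^sup>+t. (if j \<in> Jset \<infinity> then ennreal ((cmod (dpair m w (phi j t) f))\<^sup>2) else 0) \<partial>\<mu>)"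
    unfolding dsnorm2_def by (intro suminf_le) (auto intro!: nn_integral_mono simp: indicator_def)
  also have "\<dots> = (\<integral>\<^sup>+t. (\<Sum>j. if j \<in> Jset \<infinity> then ennreal ((cmod (dpair m w (phi j t) f))\<^sup>2) else 0) \<partial>\<mu>)"
    by (rule nn_integral_suminf[symmetric]) measurable
  also note fin
  finally show "in_dsum \<mu> (Jset \<infinity>) (Mset d) (\<lambda>j t. dpair m w (phi j t) f)"
    unfolding in_dsum_def by (simp add: dpair_phi_measurable[OF f])
  show "AE y in \<nu>. V f y = dpair m w (phi (fst y) (snd y)) f" by (rule V_eq_dpair[OF f])
qed

end

theorem theorem3:
  fixes m :: "'a measure" and L :: "'a op" and \<gamma> :: "real \<Rightarrow> real" and w :: "'a \<Rightarrow> real"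
  assumes "separable_L2 m"
    and "selfadjoint m L"
    and "continuous_on UNIV \<gamma>" and "bounded (range \<gamma>)"
    and "\<forall>t\<in>spectrum_op m L. \<bar>\<gamma> t\<bar> > 0"
    and "\<forall>f g. (f,g) \<in> fcalc m L (\<lambda>t. complex_of_real (\<gamma> t)) \<longrightarrow> (\<exists>C. AE x in m. cmod (g x) \<le> C)"
    and "\<forall>x\<in>space m. 1 \<le> w x"
    and "(\<lambda>x. complex_of_real (1 / w x)) \<in> L2 m"
  shows "\<exists>\<mu> N M U \<phi>. gen_eig_expansion m L w \<mu> N M U \<phi> \<and>
     (AE t in \<mu>. \<forall>j\<in>Jset N. \<phi> j t \<in> borel_measurable m \<and>
                   (\<lambda>x. \<phi> j t x / complex_of_real (w x)) \<in> L2 m) \<and>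
     (\<forall>f\<in>Hplus m w.
        (\<forall>j\<in>Jset N. AE t in \<mu>. integrable m (\<lambda>x. cnj (\<phi> j t x) * f x) \<and>
                  dpair m w (\<phi> j t) f = (\<integral>x. cnj (\<phi> j t x) * f x \<partial>m)) \<and>
        exp_limit m w \<mu> (Jset N) M \<phi> (\<lambda>j t. dpair m w (\<phi> j t) f) f \<and>
        (\<integral>\<^sup>+t. indicator (spectrum_op m L) t *
             (\<Sum>j. if j \<in> Jset N then ennreal ((cmod (dpair m w (\<phi> j t) f))^2) else 0) \<partial>\<mu>)
          = ennreal ((l2norm m f)^2))"
proof -
  note sa = assms(2)
  obtain \<mu> d V where dens: "densities \<mu> d" and M1: "AE t in \<mu>. t \<in> Mset d 1"
    and sr: "spec_rep m L (slotm \<mu> (Mset d)) V snd"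
    using spectral_theorem[OF assms(1) sa] by blast
  interpret densities \<mu> d by (rule dens)
  interpret weight m w by (rule weight.intro[OF assms(7,8)])
  have V: "unitary_L2 m \<nu> V" and snd_m: "(snd :: nat \<times> real \<Rightarrow> real) \<in> borel_measurable \<nu>"
    using sr by (simp_all add: spec_rep_iff)
  note VL = unitary_L2D(1)[OF V]
  have spec: "AE t in \<mu>. t \<in> spectrum_op m L" by (rule AE_spectrum[OF sr M1])
  obtain e where e: "onb m e" using onb_exists[OF assms(1)] by blast
  have eL: "e n \<in> L2 m" for n using e by (simp add: onb_def)
  let ?\<Gamma> = "\<lambda>t. complex_of_real (\<gamma> t)"
  have [measurable]: "\<gamma> \<in> borel_measurable borel" by (rule borel_measurable_continuous_onI[OF assms(3)])
  then have \<Gamma>m: "?\<Gamma> \<in> borel_measurable borel" by measurable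
  have fc: "fcalc m L ?\<Gamma> = rep_calc m ?\<Gamma> \<nu> V snd" by (rule fcalc_eq[OF sa sr \<Gamma>m])
  obtain B where B: "\<And>t. \<bar>\<gamma> t\<bar> \<le> B" using assms(4) unfolding bounded_iff by auto
  have \<Gamma>snd: "(\<lambda>y. ?\<Gamma> (snd y)) \<in> borel_measurable \<nu>" using measurable_compose[OF snd_m \<Gamma>m] .
  have \<Gamma>L: "(\<lambda>y. ?\<Gamma> (snd y) * k y) \<in> L2 \<nu>" if k: "k \<in> L2 \<nu>" for k
    by (rule L2_bound[OF k, where C=B])
       (use \<Gamma>snd L2_measurable[OF k] B in \<open>auto simp: norm_mult intro!: mult_right_mono\<close>)
  \<comment> \<open>\<gamma> is bounded, so \<gamma>(L) is defined on every vector and a function K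
    selecting its values exists.\<close>
  have "\<forall>f. \<exists>g. f \<in> L2 m \<longrightarrow> (f, g) \<in> fcalc m L ?\<Gamma>"
    using unitary_L2D(5)[OF V \<Gamma>L[OF VL]] \<Gamma>L[OF VL] unfolding fc rep_calc_def by blast
  then obtain K where K: "\<And>f. f \<in> L2 m \<Longrightarrow> (f, K f) \<in> fcalc m L ?\<Gamma>" by metis
  then have KL: "K f \<in> L2 m" and VK: "aeq \<nu> (V (K f)) (\<lambda>y. ?\<Gamma> (snd y) * V f y)" if "f \<in> L2 m" for f
    using that unfolding fc by (auto simp: rep_calc_def)
  \<comment> \<open>Symmetry of K holds because \<gamma> is real, and linearity up to null sets
    because V is injective up to null sets.\<close>
  interpret bounded_range m w K e
  proof unfold_locales
    show "onb m e" by (rule e)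
    fix f g :: "'a fn" and a assume f: "f \<in> L2 m"
    show "K f \<in> L2 m" by (rule KL[OF f])
    show "\<exists>C. AE x in m. cmod (K f x) \<le> C" using assms(6) K[OF f] by blast
    assume g: "g \<in> L2 m"
    have "ip m (K f) g = ip \<nu> (\<lambda>y. ?\<Gamma> (snd y) * V f y) (V g)"
      unfolding unitary_ip[OF V KL[OF f] g, symmetric]
      by (rule ip_cong[OF VK[OF f]]) (auto simp: aeq_def L2_measurable VL KL f g \<Gamma>L)
    also have "\<dots> = ip \<nu> (V f) (\<lambda>y. ?\<Gamma> (snd y) * V g y)"
      unfolding ip_def by (intro Bochner_Integration.integral_cong) auto
    also have "\<dots> = ip m f (K g)"
      unfolding unitary_ip[OF V f KL[OF g], symmetric]
      by (rule ip_cong[symmetric, OF _ VK[OF g]]) (auto simp: aeq_def L2_measurable VL KL f g \<Gamma>L)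
    finally show "ip m (K f) g = ip m f (K g)" .
    have fg: "(\<lambda>x. f x + a * g x) \<in> L2 m" by (rule L2_lin[OF f g])
    show "aeq m (K (\<lambda>x. f x + a * g x)) (\<lambda>x. K f x + a * K g x)"
    proof (rule unitary_inj[OF V KL[OF fg] L2_lin[OF KL[OF f] KL[OF g]]])
      show "aeq \<nu> (V (K (\<lambda>x. f x + a * g x))) (V (\<lambda>x. K f x + a * K g x))"
        using VK[OF fg] VK[OF f] VK[OF g] unitary_L2D(2)[OF V f g, of a] unitary_L2D(2)[OF V KL[OF f] KL[OF g], of a]
        unfolding aeq_def by eventually_elim (simp add: algebra_simps)
    qed
  qed
  \<comment> \<open>V turns K of the weighted basis vectors into \<gamma> times \<open>E n\<close>;
    the Hilbert-Schmidt sum thereby becomes an integral over the slot space, so its integrand is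
    finite almost everywhere.\<close>
  define E where "E n = V (\<lambda>x. e n x / complex_of_real (w x))" for n
  have ewL: "(\<lambda>x. e n x / complex_of_real (w x)) \<in> L2 m" for n by (rule L2_div_w[OF eL])
  have EL: "E n \<in> L2 \<nu>" for n unfolding E_def by (rule VL[OF ewL])
  note [measurable] = \<Gamma>snd L2_measurable[OF EL]
  have "(\<integral>\<^sup>+y. (\<Sum>n. ennreal ((cmod (?\<Gamma> (snd y) * E n y))\<^sup>2)) \<partial>\<nu>) = (\<Sum>n. ennreal ((l2norm m (K (\<lambda>x. e n x / complex_of_real (w x))))\<^sup>2))"
  proof (subst nn_integral_suminf)
    show "(\<lambda>y. ennreal ((cmod (?\<Gamma> (snd y) * E n y))\<^sup>2)) \<in> borel_measurable \<nu>" for n by measurable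
    show "(\<Sum>n. \<integral>\<^sup>+y. ennreal ((cmod (?\<Gamma> (snd y) * E n y))\<^sup>2) \<partial>\<nu>) = (\<Sum>n. ennreal ((l2norm m (K (\<lambda>x. e n x / complex_of_real (w x))))\<^sup>2))"
    proof (intro suminf_cong)
      fix n
      have "l2norm \<nu> (\<lambda>y. ?\<Gamma> (snd y) * E n y) = l2norm m (K (\<lambda>x. e n x / complex_of_real (w x)))"
        unfolding unitary_L2D(4)[OF V KL[OF ewL], symmetric] E_def
        by (rule l2norm_cong[symmetric, OF VK[OF ewL]]) (intro L2_measurable VL KL ewL \<Gamma>L)+
      then show "(\<integral>\<^sup>+y. ennreal ((cmod (?\<Gamma> (snd y) * E n y))\<^sup>2) \<partial>\<nu>) = ennreal ((l2norm m (K (\<lambda>x. e n x / complex_of_real (w x))))\<^sup>2)"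
        using nn_integral_L2[OF \<Gamma>L[OF EL]] by simp
    qed
  qed
  then have "(\<integral>\<^sup>+y. (\<Sum>n. ennreal ((cmod (?\<Gamma> (snd y) * E n y))\<^sup>2)) \<partial>\<nu>) \<noteq> \<infinity>" using hilbert_schmidt by simp
  then have fin: "AE y in \<nu>. (\<Sum>n. ennreal ((cmod (?\<Gamma> (snd y) * E n y))\<^sup>2)) \<noteq> \<infinity>"
    by (rule nn_integral_PInf_AE[rotated]) measurable
  \<comment> \<open>The spectrum has full measure, so \<gamma> is nonzero almost everywhere and its
    square, constant in n at each point, can be divided out of the sum.\<close>
  have "AE t in \<mu>. t \<in> Mset d j \<longrightarrow> \<gamma> (snd (j, t)) \<noteq> 0" for j
    using spec by eventually_elim (use assms(5) in auto)
  then have nz: "AE y in \<nu>. \<gamma> (snd y) \<noteq> 0" unfolding slot_AE by blast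
  have HS: "AE y in \<nu>. (\<Sum>n. ennreal ((cmod (V (\<lambda>x. e n x / complex_of_real (w x)) y))\<^sup>2)) < \<infinity>"
    using fin nz
  proof eventually_elim
    case (elim y)
    have "(\<Sum>n. ennreal ((cmod (?\<Gamma> (snd y) * E n y))\<^sup>2)) = ennreal ((\<gamma> (snd y))\<^sup>2) * (\<Sum>n. ennreal ((cmod (E n y))\<^sup>2))"
      unfolding ennreal_suminf_cmult[symmetric]
      by (intro suminf_cong) (simp add: norm_mult power_mult_distrib ennreal_mult)
    then have "(\<Sum>n. ennreal ((cmod (E n y))\<^sup>2)) \<noteq> \<infinity>"
      using elim by (auto simp: ennreal_mult_eq_top_iff)
    then show ?case by (simp add: E_def less_top)
  qed
  interpret eigen m w \<mu> d V e
    by (intro eigen.intro eigen_axioms.intro weight_axioms densities_axioms V e HS)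
  have phiH: "phi j t \<in> borel_measurable m \<and> (\<lambda>x. phi j t x / complex_of_real (w x)) \<in> L2 m" for j t
    using phi_Hminus[of j t] by (simp add: Hminus_def)
  have pair: "integrable m (\<lambda>x. cnj (phi j t x) * f x) \<and> dpair m w (phi j t) f = (\<integral>x. cnj (phi j t x) * f x \<partial>m)"
    if "f \<in> Hplus m w" for f j t
    using dpair_eq[OF phi_Hminus that] by (simp add: ip_def)
  show ?thesis
  proof (intro exI conjI ballI)
    show "gen_eig_expansion m L w \<mu> \<infinity> (Mset d) (\<lambda>j f t. V f (j, t)) phi"
      by (rule gen_eig_expansion_phi[OF sa sr M1])
    show "AE t in \<mu>. \<forall>j\<in>Jset \<infinity>. phi j t \<in> borel_measurable m \<and> (\<lambda>x. phi j t x / complex_of_real (w x)) \<in> L2 m"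
      by (intro AE_I2 ballI phiH)
  next
    fix f assume f: "f \<in> Hplus m w"
    show "AE t in \<mu>. integrable m (\<lambda>x. cnj (phi j t x) * f x) \<and> dpair m w (phi j t) f = (\<integral>x. cnj (phi j t x) * f x \<partial>m)" for j
      by (intro AE_I2 pair f)
    show "exp_limit m w \<mu> (Jset \<infinity>) (Mset d) phi (\<lambda>j t. dpair m w (phi j t) f) f"
      by (rule exp_limit_dpair[OF f])
    show "(\<integral>\<^sup>+t. indicator (spectrum_op m L) t *
             (\<Sum>j. if j \<in> Jset \<infinity> then ennreal ((cmod (dpair m w (phi j t) f))^2) else 0) \<partial>\<mu>)
          = ennreal ((l2norm m f)^2)"
      by (rule parseval_phi[OF f spec])
  qed
qed

end
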